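(* Let $\theta\in\{-1,1\}$, $\varrho>1$, and let $f_1,f_2,f_3$ and $g$ be smooth functions of $v\in\mathbb{R}^3$. Then, with implicit constants independent of $f_1,f_2,f_3,g$, and with $\sum_{a\ne b}$ denoting the sum over ordered pairs of distinct elements $a,b\in\{1,2,3\}$: (1) $$\begin{aligned} \Big|\int_{\mathbb{R}^3}\Gamma[f_1,f_2;f_3]\,g\,dv\Big|\lesssim\ &\|g\|_{L^2_v}\|f_1\|_{L^2_v}\|f_2\|_{L^2_v}\|f_3\|_{L^2_v}+\|g\|_{L^\nu_v}\sum_{a\neq b}\|f_a\|_{L^2_v}\|f_b\|_{L^\nu_v}\\ &+\|g\|_{L^\nu_v}\min\Big\{\big(\|f_1\|_{L^\nu_v}\|f_2\|_{L^2_v}+\|f_1\|_{L^2_v}\|f_2\|_{L^\nu_v}\big)\sup_v|f_3|,\ \sup_v|f_1|\,\sup_v|f_2|\,\|f_3\|_{L^\nu_v}\Big\}\\ &+\|g\|_{L^\nu_v}\min\Big\{\big(\|f_1\|_{L^\nu_v}\|f_2\|_{L^2_v}+\|f_1\|_{L^2_v}\|f_2\|_{L^\nu_v}\big)\sup_v|f_3|,\ \big(\sup_v|\nu^{1/2}f_1|\,\|f_2\|_{L^2_v}+\|f_1\|_{L^2_v}\sup_v|\nu^{1/2}f_2|\big)\|f_3\|_{L^2_v}\Big\}\\ &+\|g\|_{L^\nu_v}\min\Big\{\|f_1\|_{L^\nu_v}\sup_v|f_3|,\ \sup_v|\nu^{1/2}f_1|\,\|f_3\|_{L^2_v}\Big\}\\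 &+\|g\|_{L^\nu_v}\min\Big\{\|f_2\|_{L^\nu_v}\sup_v|f_3|,\ \sup_v|\nu^{1/2}f_2|\,\|f_3\|_{L^2_v}\Big\}; \end{aligned}$$ (2) $$\Big|\int_{\mathbb{R}^3}\Gamma[f_1,f_2;f_3]\,g\,dv\Big|\lesssim \sup_v|\nu^3g|\sum_{a\neq b}\|f_a\|_{L^2_v}\|f_b\|_{L^2_v}+\Big(\|g\|_{L^\nu_v}+\sup_v|\nu g|\Big)\|f_1\|_{L^2_v}\|f_2\|_{L^2_v}\|f_3\|_{L^2_v};$$ (3) $$\begin{aligned} \big\|\Gamma[f_1,f_2;f_3]\,g\big\|_{L^2_v}\lesssim\ \sup_v|\nu g|\,\bigg(&\|f_1\|_{L^2_v}\|f_2\|_{L^2_v}\|f_3\|_{L^2_v}+\sum_{a\neq b}\|f_a\|_{L^2_v}\|f_b\|_{L^2_v}\\ &+\min\Big\{\sup_v|f_3|\,\|f_1\|_{L^2_v}\|f_2\|_{L^2_v},\ \sup_v|f_1|\,\sup_v|f_2|\,\|f_3\|_{L^2_v}\Big\}\\ &+\min\Big\{\sup_v|f_3|\,\|f_1\|_{L^2_v}\|f_2\|_{L^2_v},\ \sup_v|f_2|\,\|f_1\|_{L^2_v}\|f_3\|_{L^2_v}\Big\}\\ &+\min\Big\{\sup_v|f_3|\,\|f_1\|_{L^2_v}\|f_2\|_{L^2_v},\ \sup_v|f_1|\,\|f_2\|_{L^2_v}\|f_3\|_{L^2_v}\Big\}\bigg). \end{aligned}$$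
   Context: Notation: $u'=u+\omega(\omega\cdot(v-u))$, $v'=v-\omega(\omega\cdot(v-u))$ for $u,v\in\mathbb{R}^3$, $\omega\in\mathbb{S}^2$; $$\mu(v)=\frac{1}{\varrho e^{|v|^2}-\theta},\qquad \mathcal{M}(v)=\mu(1+\theta\mu)=\frac{\varrho e^{|v|^2}}{(\varrho e^{|v|^2}-\theta)^2}.$$ Symmetrized collision operators: $$\mathcal{Q}_1[F,G]=\frac12\int_{\mathbb{R}^3}\int_{\mathbb{S}^2}|\omega\cdot(v-u)|\Big[F(u')G(v')+G(u')F(v')-F(u)G(v)-G(u)F(v)\Big]d\omega\,du,$$ $$\mathcal{Q}_2[F,G;H]=\frac12\int_{\mathbb{R}^3}\int_{\mathbb{S}^2}|\omega\cdot(v-u)|\Big[\big(F(u')G(v')+G(u')F(v')\big)\big(H(u)+H(v)\big)-\big(F(u)G(v)+G(u)F(v)\big)\big(H(u')+H(v')\big)\Big]d\omega\,du.$$ The nonlinear operator is $$\begin{aligned}\Gamma[f_1,f_2;f_3]=\ &\mathcal{M}^{-1/2}\mathcal{Q}_1[\mathcal{M}^{1/2}f_1,\mathcal{M}^{1/2}f_2]+\theta\mathcal{M}^{-1/2}\mathcal{Q}_2[\mathcal{M}^{1/2}f_1,\mathcal{M}^{1/2}f_2;\mu]+\theta\mathcal{M}^{-1/2}\mathcal{Q}_2[\mathcal{M}^{1/2}f_1,\mu;\mathcal{M}^{1/2}f_3]\\&+\theta\mathcal{M}^{-1/2}\mathcal{Q}_2[\mu,\mathcal{M}^{1/2}f_2;\mathcal{M}^{1/2}f_3]+\theta\mathcal{M}^{-1/2}\mathcal{Q}_2[\mathcal{M}^{1/2}f_1,\mathcal{M}^{1/2}f_2;\mathcal{M}^{1/2}f_3].\end{aligned}$$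 $$\nu(v)=\int_{\mathbb{R}^3}\int_{\mathbb{S}^2}|\omega\cdot(v-u)|\,\mu(u)\mu(v)\mu(u')\mu(v')\varrho^2e^{|u|^2+|v|^2}\mathcal{M}^{-1}(v)\,d\omega\,du,\qquad \|f\|_{L^\nu_v}=\Big(\int_{\mathbb{R}^3}\nu(v)|f(v)|^2\,dv\Big)^{1/2}.$$ $A\lesssim B$ means $A\le CB$ with a universal constant $C$. *)

theory Defs
  imports "HOL-Analysis.Analysis"
begin

type_synonym vec3 = "real ^ 3"

primrec Ck :: "nat \<Rightarrow> (vec3 \<Rightarrow> real) \<Rightarrow> bool" where
  "Ck 0 f \<longleftrightarrow> continuous_on UNIV f"
| "Ck (Suc k) f \<longleftrightarrow> (\<forall>x. f differentiable (at x)) \<and>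
     (\<forall>i. Ck k (\<lambda>x. frechet_derivative f (at x) (axis i 1)))"

definition smooth :: "(vec3 \<Rightarrow> real) \<Rightarrow> bool" where
  "smooth f \<longleftrightarrow> (\<forall>k. Ck k f)"

(* Surface measure on the unit sphere, as the cone measure 3 * vol {x in the unit ball. x/|x| \<in> A}.
   It lives on the ambient space and is carried by the sphere; the origin, where sgn vanishes,
   is a null set. *)
definition sphere_measure :: "vec3 measure" where
  "sphere_measure = distr (density lborel (\<lambda>x. 3 * indicator (ball 0 1) x)) borel sgn"

lemma emeasure_sphere_measure_sphere: "emeasure sphere_measure (sphere 0 1) = ennreal (4 * pi)"
proof -
  have "emeasure sphere_measure (sphere 0 1)
      = emeasure (density lborel (\<lambda>x. 3 * indicator (ball 0 1) x)) (sgn -` sphere (0::vec3) 1)"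
    unfolding sphere_measure_def by (subst emeasure_distr) auto
  also have "sgn -` sphere (0::vec3) 1 = - {0}"
    by (auto simp: norm_sgn split: if_splits)
  also have "emeasure (density lborel (\<lambda>x. 3 * indicator (ball 0 1) x)) (- {0::vec3})
      = (\<integral>\<^sup>+x. 3 * indicator (ball 0 1) x * indicator (- {0::vec3}) x \<partial>lborel)"
    by (intro emeasure_density borel_measurable_times_ennreal borel_measurable_indicator) auto
  also have "\<dots> = (\<integral>\<^sup>+x. 3 * indicator (ball (0::vec3) 1) x \<partial>lborel)"
    by (rule nn_integral_cong_AE, use AE_lborel_singleton[of "0::vec3"] in eventually_elim)
       (auto simp: indicator_def)
  also have "\<dots> = 3 * emeasure lborel (ball (0::vec3) 1)"
    by (subst nn_integral_cmult_indicator) auto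
  also have "emeasure lborel (ball (0::vec3) 1) = ennreal (4 / 3 * pi)"
    by (subst emeasure_ball) (auto simp: unit_ball_vol_3)
  also have "3 * ennreal (4 / 3 * pi) = ennreal (3 * (4 / 3 * pi))"
    by (subst ennreal_mult) auto
  finally show ?thesis by simp
qed

definition post_u :: "vec3 \<Rightarrow> vec3 \<Rightarrow> vec3 \<Rightarrow> vec3" where
  "post_u u v \<omega> = u + (\<omega> \<bullet> (v - u)) *\<^sub>R \<omega>"

definition post_v :: "vec3 \<Rightarrow> vec3 \<Rightarrow> vec3 \<Rightarrow> vec3" where
  "post_v u v \<omega> = v - (\<omega> \<bullet> (v - u)) *\<^sub>R \<omega>"

definition mu :: "real \<Rightarrow> real \<Rightarrow> vec3 \<Rightarrow> real" where
  "mu \<theta> \<rho> v = 1 / (\<rho> * exp ((norm v)\<^sup>2) - \<theta>)"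

definition MM :: "real \<Rightarrow> real \<Rightarrow> vec3 \<Rightarrow> real" where
  "MM \<theta> \<rho> v = mu \<theta> \<rho> v * (1 + \<theta> * mu \<theta> \<rho> v)"

definition Q1_integrand ::
  "(vec3 \<Rightarrow> real) \<Rightarrow> (vec3 \<Rightarrow> real) \<Rightarrow> vec3 \<Rightarrow> vec3 \<times> vec3 \<Rightarrow> real" where
  "Q1_integrand F G v = (\<lambda>(u, \<omega>). let u' = post_u u v \<omega>; v' = post_v u v \<omega> in
     \<bar>\<omega> \<bullet> (v - u)\<bar> * (F u' * G v' + G u' * F v' - F u * G v - G u * F v))"

definition Q2_integrand ::
  "(vec3 \<Rightarrow> real) \<Rightarrow> (vec3 \<Rightarrow> real) \<Rightarrow> (vec3 \<Rightarrow> real) \<Rightarrow> vec3 \<Rightarrow> vec3 \<times> vec3 \<Rightarrow> real" where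
  "Q2_integrand F G H v = (\<lambda>(u, \<omega>). let u' = post_u u v \<omega>; v' = post_v u v \<omega> in
     \<bar>\<omega> \<bullet> (v - u)\<bar> * ((F u' * G v' + G u' * F v') * (H u + H v)
                     - (F u * G v + G u * F v) * (H u' + H v')))"

definition Q1 :: "(vec3 \<Rightarrow> real) \<Rightarrow> (vec3 \<Rightarrow> real) \<Rightarrow> vec3 \<Rightarrow> real" where
  "Q1 F G v = 1 / 2 * integral\<^sup>L (lborel \<Otimes>\<^sub>M sphere_measure) (Q1_integrand F G v)"

definition Q2 :: "(vec3 \<Rightarrow> real) \<Rightarrow> (vec3 \<Rightarrow> real) \<Rightarrow> (vec3 \<Rightarrow> real) \<Rightarrow> vec3 \<Rightarrow> real" where
  "Q2 F G H v = 1 / 2 * integral\<^sup>L (lborel \<Otimes>\<^sub>M sphere_measure) (Q2_integrand F G H v)"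

definition sqrtM_times :: "real \<Rightarrow> real \<Rightarrow> (vec3 \<Rightarrow> real) \<Rightarrow> vec3 \<Rightarrow> real" where
  "sqrtM_times \<theta> \<rho> f v = sqrt (MM \<theta> \<rho> v) * f v"

definition coll_Gamma :: "real \<Rightarrow> real \<Rightarrow>
    (vec3 \<Rightarrow> real) \<Rightarrow> (vec3 \<Rightarrow> real) \<Rightarrow> (vec3 \<Rightarrow> real) \<Rightarrow> vec3 \<Rightarrow> real" where
  "coll_Gamma \<theta> \<rho> f1 f2 f3 v =
    (let F1 = sqrtM_times \<theta> \<rho> f1; F2 = sqrtM_times \<theta> \<rho> f2; F3 = sqrtM_times \<theta> \<rho> f3;
         m = mu \<theta> \<rho>; w = 1 / sqrt (MM \<theta> \<rho> v)
     in w * Q1 F1 F2 v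
        + \<theta> * w * Q2 F1 F2 m v
        + \<theta> * w * Q2 F1 m F3 v
        + \<theta> * w * Q2 m F2 F3 v
        + \<theta> * w * Q2 F1 F2 F3 v)"

(* All collision integrals occurring in coll_Gamma at v converge absolutely, so that none of them
   takes the default value 0 of a non-convergent Bochner integral. *)
definition coll_Gamma_converges :: "real \<Rightarrow> real \<Rightarrow>
    (vec3 \<Rightarrow> real) \<Rightarrow> (vec3 \<Rightarrow> real) \<Rightarrow> (vec3 \<Rightarrow> real) \<Rightarrow> vec3 \<Rightarrow> bool" where
  "coll_Gamma_converges \<theta> \<rho> f1 f2 f3 v \<longleftrightarrow>
    (let F1 = sqrtM_times \<theta> \<rho> f1; F2 = sqrtM_times \<theta> \<rho> f2; F3 = sqrtM_times \<theta> \<rho> f3;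
         m = mu \<theta> \<rho>; P = lborel \<Otimes>\<^sub>M sphere_measure
     in integrable P (Q1_integrand F1 F2 v)
      \<and> integrable P (Q2_integrand F1 F2 m v)
      \<and> integrable P (Q2_integrand F1 m F3 v)
      \<and> integrable P (Q2_integrand m F2 F3 v)
      \<and> integrable P (Q2_integrand F1 F2 F3 v))"

definition nu :: "real \<Rightarrow> real \<Rightarrow> vec3 \<Rightarrow> real" where
  "nu \<theta> \<rho> v = integral\<^sup>L (lborel \<Otimes>\<^sub>M sphere_measure) (\<lambda>(u, \<omega>).
     \<bar>\<omega> \<bullet> (v - u)\<bar> * mu \<theta> \<rho> u * mu \<theta> \<rho> v
       * mu \<theta> \<rho> (post_u u v \<omega>) * mu \<theta> \<rho> (post_v u v \<omega>)
       * \<rho>\<^sup>2 * exp ((norm u)\<^sup>2 + (norm v)\<^sup>2) * inverse (MM \<theta> \<rho> v))"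

(* Norms and suprema take values in [0,\<infinity>], since smooth functions need not have finite norms. *)

definition ennsqrt :: "ennreal \<Rightarrow> ennreal" where
  "ennsqrt x = (if x = \<infinity> then \<infinity> else ennreal (sqrt (enn2real x)))"

definition L2norm :: "(vec3 \<Rightarrow> real) \<Rightarrow> ennreal" where
  "L2norm f = ennsqrt (\<integral>\<^sup>+v. ennreal (\<bar>f v\<bar>\<^sup>2) \<partial>lborel)"

definition Lnunorm :: "real \<Rightarrow> real \<Rightarrow> (vec3 \<Rightarrow> real) \<Rightarrow> ennreal" where
  "Lnunorm \<theta> \<rho> f = ennsqrt (\<integral>\<^sup>+v. ennreal (nu \<theta> \<rho> v * \<bar>f v\<bar>\<^sup>2) \<partial>lborel)"

definition supnorm :: "(vec3 \<Rightarrow> real) \<Rightarrow> ennreal" where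
  "supnorm f = (SUP v. ennreal \<bar>f v\<bar>)"

(* The next two are the left-hand sides |\<integral> \<Gamma>[f1,f2;f3] g dv| and ||\<Gamma>[f1,f2;f3] g||. They are set
   to \<infinity> if the integrals involved do not exist, so that an estimate by a finite bound includes
   their existence. Where g vanishes, the product \<Gamma> g is read as 0. *)

definition abs_integral_Gamma :: "real \<Rightarrow> real \<Rightarrow>
    (vec3 \<Rightarrow> real) \<Rightarrow> (vec3 \<Rightarrow> real) \<Rightarrow> (vec3 \<Rightarrow> real) \<Rightarrow> (vec3 \<Rightarrow> real) \<Rightarrow> ennreal" where
  "abs_integral_Gamma \<theta> \<rho> f1 f2 f3 g =
    (if (AE v in lborel. g v \<noteq> 0 \<longrightarrow> coll_Gamma_converges \<theta> \<rho> f1 f2 f3 v)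
        \<and> integrable lborel (\<lambda>v. coll_Gamma \<theta> \<rho> f1 f2 f3 v * g v)
     then ennreal \<bar>\<integral>v. coll_Gamma \<theta> \<rho> f1 f2 f3 v * g v \<partial>lborel\<bar>
     else \<infinity>)"

definition L2norm_Gamma :: "real \<Rightarrow> real \<Rightarrow>
    (vec3 \<Rightarrow> real) \<Rightarrow> (vec3 \<Rightarrow> real) \<Rightarrow> (vec3 \<Rightarrow> real) \<Rightarrow> (vec3 \<Rightarrow> real) \<Rightarrow> ennreal" where
  "L2norm_Gamma \<theta> \<rho> f1 f2 f3 g =
    (if AE v in lborel. g v \<noteq> 0 \<longrightarrow> coll_Gamma_converges \<theta> \<rho> f1 f2 f3 v
     then L2norm (\<lambda>v. coll_Gamma \<theta> \<rho> f1 f2 f3 v * g v)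
     else \<infinity>)"

definition distinct_pairs :: "(nat \<times> nat) set" where
  "distinct_pairs = {(a, b). a \<in> {1, 2, 3} \<and> b \<in> {1, 2, 3} \<and> a \<noteq> b}"

end

theory Submission
  imports Defs
begin

text \<open>After division by \<open>sqrt MM\<close>, conservation of energy bounds every gain and loss term by
  \<open>\<bar>\<omega> \<bullet> (v - u)\<bar>\<close> times Gaussian factors times the values of two or three of the \<open>f\<^sub>i\<close> at \<open>u, v, u', v'\<close>.
  Against \<open>g v\<close> these multilinear forms are estimated by Cauchy--Schwarz and the measure preserving involution
  \<open>(u, v) \<mapsto> (u', v')\<close>; the kernels that remain are bounded by polar coordinates and by Carleman-type
  changes of variables, which turn an average over \<open>\<omega>\<close> of the component of \<open>v - u\<close> along or orthogonal
  to \<open>\<omega>\<close> into an integral over \<open>vec3\<close>. Factors \<open>1 + \<bar>v\<bar>\<close> that are not absorbed by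
  the Gaussians are paid for by \<open>\<nu>\<close>, of which only the lower bound \<open>\<nu> \<ge> c (1 + \<bar>v\<bar>)\<close> is used. Estimate (3) is
  dual to an estimate against all \<open>L\<^sup>2\<close> functions.\<close>

text \<open>Energy conservation cancels \<open>1 / sqrt MM\<close> at v against the Gaussians of the
  two quadratic slots and leaves a single Gaussian at u. In a cubic term the only other Gaussian
  sits where the third argument sits. If that is u' or v', the two Gaussians give decay only in u' -
  u or v' - u, that is, in one component of the relative velocity; this is the obstacle behind the
  averages over the sphere and the changes of variables. An argument \<open>mu\<close> brings one
  more Gaussian, so its terms are cubic terms with \<open>gs\<close> in place of one function. The
  linear growth of |\<omega> \<bullet> (v - u)| costs up to one power of 1 + |v|. In (1) it is
  shared as a square root on g and a square root on one of the f; in (2) and (3) it falls on g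
  alone. Hence every quadratic kernel is bounded in two ways. All estimates concern
  [0, \<infinity>]-valued functions, where integrability is no issue. Absolute convergence of the
  collision integrals is read off afterwards from finiteness of the dominating integral.\<close>

type_synonym vfun = "vec3 \<Rightarrow> ennreal"

type_synonym ckernel = "vec3 \<Rightarrow> vec3 \<Rightarrow> vec3 \<Rightarrow> ennreal"

abbreviation meas :: "('a::topological_space \<Rightarrow> 'b::topological_space) \<Rightarrow> bool" where
  "meas f \<equiv> f \<in> borel_measurable borel"

section \<open>The sphere measure and the collision involution\<close>

lemma sets_sphere_measure [simp, measurable_cong]: "sets sphere_measure = sets borel"
  by (simp add: sphere_measure_def)

lemma space_sphere_measure [simp]: "space sphere_measure = UNIV"
  by (simp add: sphere_measure_def)

lemma nn_integral_sphere_measure: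
  assumes [measurable]: "meas h"
  shows "(\<integral>\<^sup>+\<omega>. h \<omega> \<partial>sphere_measure)
    = (\<integral>\<^sup>+x. 3 * indicator (ball 0 1) x * h (sgn x) \<partial>lborel)"
proof -
  have [measurable]: "(\<lambda>x::vec3. 3 * indicator (ball 0 1) x :: ennreal) \<in> borel_measurable borel"
    by (intro borel_measurable_times_ennreal borel_measurable_indicator) auto
  show ?thesis
    unfolding sphere_measure_def
    by (subst nn_integral_distr, simp, simp, subst nn_integral_density) (simp_all add: mult.assoc)
qed

lemma emeasure_sphere_measure_UNIV: "emeasure sphere_measure UNIV = ennreal (4 * pi)"
proof -
  have "emeasure sphere_measure UNIV = (\<integral>\<^sup>+\<omega>. 1 \<partial>sphere_measure)"
    by simp
  also have "\<dots> = (\<integral>\<^sup>+x. 3 * indicator (ball (0::vec3) 1) x \<partial>lborel)"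
    by (subst nn_integral_sphere_measure) auto
  also have "\<dots> = 3 * emeasure lborel (ball (0::vec3) 1)"
    by (subst nn_integral_cmult_indicator) auto
  also have "emeasure lborel (ball (0::vec3) 1) = ennreal (4 / 3 * pi)"
    by (subst emeasure_ball) (auto simp: unit_ball_vol_3)
  also have "3 * ennreal (4 / 3 * pi) = ennreal (3 * (4 / 3 * pi))"
    by (subst ennreal_mult) auto
  finally show ?thesis by simp
qed

interpretation sphere: finite_measure sphere_measure
  by standard (simp add: emeasure_sphere_measure_UNIV)

text \<open>The unit sphere and the whole space have the same finite measure 4 pi, so the complement
  of the sphere is null. This is what allows every later pointwise inequality to assume that
  \<omega> is a unit vector.\<close>

lemma AE_sphere_measure_norm: "AE \<omega> in sphere_measure. norm \<omega> = 1"
proof -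
  have "emeasure sphere_measure (- sphere 0 1) = emeasure sphere_measure UNIV - emeasure sphere_measure (sphere 0 1)"
    by (subst emeasure_Diff[symmetric])
       (auto simp: emeasure_sphere_measure_sphere Compl_eq_Diff_UNIV)
  then have "emeasure sphere_measure (- sphere 0 1) = 0"
    by (simp add: emeasure_sphere_measure_sphere emeasure_sphere_measure_UNIV)
  then show ?thesis
    by (intro AE_I[of _ _ "- sphere 0 1"]) auto
qed

lemma nn_integral_sphere_measure_mono:
  assumes "\<And>\<omega>. norm \<omega> = 1 \<Longrightarrow> f \<omega> \<le> g \<omega>"
  shows "(\<integral>\<^sup>+\<omega>. f \<omega> \<partial>sphere_measure) \<le> (\<integral>\<^sup>+\<omega>. g \<omega> \<partial>sphere_measure)"
  by (rule nn_integral_mono_AE, use AE_sphere_measure_norm in eventually_elim) (rule assms)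

lemma nn_integral_sphere_measure_cong:
  assumes "\<And>\<omega>. norm \<omega> = 1 \<Longrightarrow> f \<omega> = g \<omega>"
  shows "(\<integral>\<^sup>+\<omega>. f \<omega> \<partial>sphere_measure) = (\<integral>\<^sup>+\<omega>. g \<omega> \<partial>sphere_measure)"
  by (rule nn_integral_cong_AE, use AE_sphere_measure_norm in eventually_elim) (rule assms)

lemma measurable_post_u [measurable]:
  assumes [measurable]: "f \<in> borel_measurable M" "g \<in> borel_measurable M" "h \<in> borel_measurable M"
  shows "(\<lambda>x. post_u (f x) (g x) (h x)) \<in> borel_measurable M"
  unfolding post_u_def by measurable

lemma measurable_post_v [measurable]:
  assumes [measurable]: "f \<in> borel_measurable M" "g \<in> borel_measurable M" "h \<in> borel_measurable M"
  shows "(\<lambda>x. post_v (f x) (g x) (h x)) \<in> borel_measurable M"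
  unfolding post_v_def by measurable

section \<open>Measure preserving changes of variables\<close>

lemma nn_integral_lborel_translate:
  fixes f :: "'a::euclidean_space \<Rightarrow> ennreal"
  assumes [measurable]: "meas f"
  shows "(\<integral>\<^sup>+x. f (a + x) \<partial>lborel) = (\<integral>\<^sup>+x. f x \<partial>lborel)"
proof -
  have "(\<integral>\<^sup>+x. f x \<partial>lborel) = (\<integral>\<^sup>+x. f x \<partial>distr lborel borel ((+) a))"
    by (simp add: lborel_distr_plus)
  also have "\<dots> = (\<integral>\<^sup>+x. f (a + x) \<partial>lborel)"
    by (subst nn_integral_distr) auto
  finally show ?thesis by simp
qed

lemma nn_integral_lborel_scaleR:
  fixes f :: "'a::euclidean_space \<Rightarrow> ennreal"
  assumes [measurable]: "meas f" and "c \<noteq> 0"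
  shows "(\<integral>\<^sup>+x. f x \<partial>lborel) = ennreal (\<bar>c\<bar> ^ DIM('a)) * (\<integral>\<^sup>+x. f (c *\<^sub>R x) \<partial>lborel)"
  by (subst lborel_affine[of c 0]) (auto simp: assms nn_integral_density nn_integral_distr nn_integral_cmult)

lemma nn_integral_lborel_reflect:
  fixes f :: "'a::euclidean_space \<Rightarrow> ennreal"
  assumes [measurable]: "meas f"
  shows "(\<integral>\<^sup>+x. f (a - x) \<partial>lborel) = (\<integral>\<^sup>+x. f x \<partial>lborel)"
  using nn_integral_lborel_scaleR[of "\<lambda>x. f (a + x)" "-1"] nn_integral_lborel_translate[of f a] by simp

lemma lborel_Fubini:
  fixes f :: "'a::euclidean_space \<Rightarrow> 'b::euclidean_space \<Rightarrow> ennreal"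
  assumes [measurable]: "case_prod f \<in> borel_measurable (lborel \<Otimes>\<^sub>M lborel)"
  shows "(\<integral>\<^sup>+x. (\<integral>\<^sup>+y. f x y \<partial>lborel) \<partial>lborel) = (\<integral>\<^sup>+y. (\<integral>\<^sup>+x. f x y \<partial>lborel) \<partial>lborel)"
proof -
  have [measurable]: "(\<lambda>(x, y). f y x) \<in> borel_measurable (lborel \<Otimes>\<^sub>M lborel)"
    using measurable_pair_swap[OF assms] by (simp add: split_beta')
  show ?thesis
    by (rule lborel_pair.Fubini') measurable
qed

text \<open>Exchanges the component of \<open>X\<close> along \<open>\<omega>\<close> with an auxiliary variable \<open>s\<close>, as a composition of
  three shears.\<close>

lemma nn_integral_exchange:
  fixes \<Phi> :: "real \<Rightarrow> 'a::euclidean_space \<Rightarrow> ennreal"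
  assumes [measurable]: "case_prod \<Phi> \<in> borel_measurable borel" and ne: "\<omega> \<bullet> e \<noteq> 0"
  shows "(\<integral>\<^sup>+s. (\<integral>\<^sup>+X. \<Phi> (\<omega> \<bullet> X) (X - (\<omega> \<bullet> X) *\<^sub>R \<omega> + s *\<^sub>R e) \<partial>lborel) \<partial>lborel)
    = (\<integral>\<^sup>+s. (\<integral>\<^sup>+Z. \<Phi> (- (\<omega> \<bullet> e) * s) Z \<partial>lborel) \<partial>lborel)"
proof -
  have [measurable]: "case_prod \<Phi> \<in> borel_measurable (borel \<Otimes>\<^sub>M borel)"
    by (simp add: borel_prod)
  \<comment> \<open>The shears are Z = X + s c \<omega>, then a shift of s by -(\<omega> \<bullet>
    X) / c, then a shift of X by s e. Each translates one variable by an amount depending on the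
    other, so Fubini and translation invariance suffice.\<close>
  let ?c = "\<omega> \<bullet> e"
  have "(\<integral>\<^sup>+s. (\<integral>\<^sup>+Z. \<Phi> (- ?c * s) Z \<partial>lborel) \<partial>lborel)
      = (\<integral>\<^sup>+s. (\<integral>\<^sup>+X. \<Phi> (- ?c * s) ((s * ?c) *\<^sub>R \<omega> + X) \<partial>lborel) \<partial>lborel)"
    by (subst nn_integral_lborel_translate) auto
  also have "\<dots> = (\<integral>\<^sup>+X. (\<integral>\<^sup>+s. \<Phi> (- ?c * s) ((s * ?c) *\<^sub>R \<omega> + X) \<partial>lborel) \<partial>lborel)"
    by (rule lborel_Fubini) measurable
  also have "\<dots> = (\<integral>\<^sup>+X. (\<integral>\<^sup>+s. \<Phi> (- ?c * (- (\<omega> \<bullet> X) / ?c + s))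
      (((- (\<omega> \<bullet> X) / ?c + s) * ?c) *\<^sub>R \<omega> + X) \<partial>lborel) \<partial>lborel)"
    by (subst nn_integral_lborel_translate[where f = "\<lambda>s. \<Phi> (- ?c * s) ((s * ?c) *\<^sub>R \<omega> + X)" for X]) auto
  also have "\<dots> = (\<integral>\<^sup>+X. (\<integral>\<^sup>+s. \<Phi> (- ?c * s + \<omega> \<bullet> X) (X + (s * ?c) *\<^sub>R \<omega> - (\<omega> \<bullet> X) *\<^sub>R \<omega>) \<partial>lborel) \<partial>lborel)"
    by (intro nn_integral_cong arg_cong2[of _ _ _ _ \<Phi>]) (use ne in \<open>auto simp: algebra_simps\<close>)
  also have "\<dots> = (\<integral>\<^sup>+s. (\<integral>\<^sup>+X. \<Phi> (- ?c * s + \<omega> \<bullet> X) (X + (s * ?c) *\<^sub>R \<omega> - (\<omega> \<bullet> X) *\<^sub>R \<omega>) \<partial>lborel) \<partial>lborel)"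
    by (rule lborel_Fubini) measurable
  also have "\<dots> = (\<integral>\<^sup>+s. (\<integral>\<^sup>+X. \<Phi> (- ?c * s + \<omega> \<bullet> (s *\<^sub>R e + X))
      ((s *\<^sub>R e + X) + (s * ?c) *\<^sub>R \<omega> - (\<omega> \<bullet> (s *\<^sub>R e + X)) *\<^sub>R \<omega>) \<partial>lborel) \<partial>lborel)"
    by (subst nn_integral_lborel_translate[where f = "\<lambda>X. \<Phi> (- ?c * s + \<omega> \<bullet> X) (X + (s * ?c) *\<^sub>R \<omega> - (\<omega> \<bullet> X) *\<^sub>R \<omega>)" for s]) auto
  also have "\<dots> = (\<integral>\<^sup>+s. (\<integral>\<^sup>+X. \<Phi> (\<omega> \<bullet> X) (X - (\<omega> \<bullet> X) *\<^sub>R \<omega> + s *\<^sub>R e) \<partial>lborel) \<partial>lborel)"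
    by (intro nn_integral_cong arg_cong2[of _ _ _ _ \<Phi>]) (auto simp: algebra_simps)
  finally show ?thesis by simp
qed

text \<open>Rescaling s by -(\<omega> \<bullet> e) produces the Jacobian |\<omega> \<bullet> e|. In
  this form the component of X along \<omega> becomes an independent real variable t, while s e
  fills the gap left in X; with a weight of mass one in the variable s, integrals over the plane
  orthogonal to \<omega> become volume integrals.\<close>

lemma nn_integral_exchange':
  fixes \<Phi> :: "real \<Rightarrow> 'a::euclidean_space \<Rightarrow> ennreal"
  assumes [measurable]: "case_prod \<Phi> \<in> borel_measurable borel" and ne: "\<omega> \<bullet> e \<noteq> 0"
  shows "ennreal \<bar>\<omega> \<bullet> e\<bar> * (\<integral>\<^sup>+s. (\<integral>\<^sup>+X. \<Phi> (\<omega> \<bullet> X) (X - (\<omega> \<bullet> X) *\<^sub>R \<omega> + s *\<^sub>R e) \<partial>lborel) \<partial>lborel)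
    = (\<integral>\<^sup>+t. (\<integral>\<^sup>+Z. \<Phi> t Z \<partial>lborel) \<partial>lborel)"
proof -
  have [measurable]: "case_prod \<Phi> \<in> borel_measurable (borel \<Otimes>\<^sub>M borel)"
    by (simp add: borel_prod)
  show ?thesis
    using nn_integral_real_affine[of "\<lambda>t. \<integral>\<^sup>+Z. \<Phi> t Z \<partial>lborel" "- (\<omega> \<bullet> e)" 0] ne
    by (subst nn_integral_exchange) auto
qed

lemma scaleR_double: "(2 * c) *\<^sub>R x = c *\<^sub>R x + c *\<^sub>R (x :: 'a::real_vector)"
  unfolding mult_2 by (rule scaleR_add_left)

text \<open>With e = \<omega> and an auxiliary weight \<kappa> of mass one, the exchange frees the
  component along \<omega> as a real variable t; t is reflected to -t, and a second exchange puts it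
  back. No determinant has to be computed.\<close>

lemma nn_integral_Householder:
  fixes \<phi> :: "'a::euclidean_space \<Rightarrow> ennreal"
  assumes [measurable]: "meas \<phi>" and \<omega>: "norm \<omega> = 1"
  shows "(\<integral>\<^sup>+X. \<phi> (X - (2 * (\<omega> \<bullet> X)) *\<^sub>R \<omega>) \<partial>lborel) = (\<integral>\<^sup>+X. \<phi> X \<partial>lborel)"
proof -
  have 1: "\<omega> \<bullet> \<omega> = 1" using \<omega> by (simp add: norm_eq_1)
  define \<kappa> :: "real \<Rightarrow> ennreal" where "\<kappa> = indicator {0..1}"
  have [measurable]: "meas \<kappa>" by (simp add: \<kappa>_def)
  have \<kappa>1: "(\<integral>\<^sup>+s. \<kappa> s * c \<partial>lborel) = c" for c
    by (simp add: \<kappa>_def nn_integral_multc)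
  have "(\<integral>\<^sup>+s. (\<integral>\<^sup>+X. \<kappa> s * \<phi> (X - (2 * (\<omega> \<bullet> X)) *\<^sub>R \<omega>) \<partial>lborel) \<partial>lborel)
    = (\<integral>\<^sup>+s. (\<integral>\<^sup>+X. \<kappa> (\<omega> \<bullet> (X - (\<omega> \<bullet> X) *\<^sub>R \<omega> + s *\<^sub>R \<omega>)) * \<phi> ((X - (\<omega> \<bullet> X) *\<^sub>R \<omega> + s *\<^sub>R \<omega>)
       - (\<omega> \<bullet> (X - (\<omega> \<bullet> X) *\<^sub>R \<omega> + s *\<^sub>R \<omega>)) *\<^sub>R \<omega> - (\<omega> \<bullet> X) *\<^sub>R \<omega>) \<partial>lborel) \<partial>lborel)"
  proof -
    have "\<omega> \<bullet> (X - (\<omega> \<bullet> X) *\<^sub>R \<omega> + s *\<^sub>R \<omega>) = s" for s X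
      by (simp add: inner_add_right inner_diff_right 1)
    then show ?thesis
      by (simp add: scaleR_double diff_diff_eq)
  qed
  also have "\<dots> = (\<integral>\<^sup>+t. (\<integral>\<^sup>+Z. \<kappa> (\<omega> \<bullet> Z) * \<phi> (Z - (\<omega> \<bullet> Z) *\<^sub>R \<omega> - t *\<^sub>R \<omega>) \<partial>lborel) \<partial>lborel)"
    using nn_integral_exchange'[of "\<lambda>t Z. \<kappa> (\<omega> \<bullet> Z) * \<phi> (Z - (\<omega> \<bullet> Z) *\<^sub>R \<omega> - t *\<^sub>R \<omega>)" \<omega> \<omega>]
    by (simp add: 1 borel_prod[symmetric])
  also have "\<dots> = (\<integral>\<^sup>+t. (\<integral>\<^sup>+Z. \<kappa> (\<omega> \<bullet> Z) * \<phi> (Z - (\<omega> \<bullet> Z) *\<^sub>R \<omega> + t *\<^sub>R \<omega>) \<partial>lborel) \<partial>lborel)"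
    using nn_integral_lborel_reflect[of "\<lambda>t. (\<integral>\<^sup>+Z. \<kappa> (\<omega> \<bullet> Z) * \<phi> (Z - (\<omega> \<bullet> Z) *\<^sub>R \<omega> + t *\<^sub>R \<omega>) \<partial>lborel)" 0]
    by simp
  also have "\<dots> = (\<integral>\<^sup>+t. (\<integral>\<^sup>+Z. \<kappa> t * \<phi> Z \<partial>lborel) \<partial>lborel)"
    using nn_integral_exchange'[of "\<lambda>t Z. \<kappa> t * \<phi> Z" \<omega> \<omega>]
    by (simp add: 1 borel_prod[symmetric])
  finally show ?thesis
    by (simp add: nn_integral_cmult \<kappa>1)
qed

text \<open>In the variables u and X = v - u a collision shifts u by (\<omega> \<bullet> X) \<omega>
  and reflects X in the plane orthogonal to \<omega>. Both maps preserve Lebesgue measure.\<close>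

lemma nn_integral_collision:
  assumes [measurable]: "case_prod \<Phi> \<in> borel_measurable (borel \<Otimes>\<^sub>M borel)" and \<omega>: "norm \<omega> = 1"
  shows "(\<integral>\<^sup>+v. (\<integral>\<^sup>+u. \<Phi> (post_u u v \<omega>) (post_v u v \<omega>) \<partial>lborel) \<partial>lborel)
    = (\<integral>\<^sup>+v. (\<integral>\<^sup>+u. \<Phi> u v \<partial>lborel) \<partial>lborel)"
proof -
  have "(\<integral>\<^sup>+v. (\<integral>\<^sup>+u. \<Phi> (post_u u v \<omega>) (post_v u v \<omega>) \<partial>lborel) \<partial>lborel)
      = (\<integral>\<^sup>+u. (\<integral>\<^sup>+v. \<Phi> (post_u u v \<omega>) (post_v u v \<omega>) \<partial>lborel) \<partial>lborel)"
    by (rule lborel_Fubini) measurable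
  also have "\<dots> = (\<integral>\<^sup>+u. (\<integral>\<^sup>+X. \<Phi> (post_u u (u + X) \<omega>) (post_v u (u + X) \<omega>) \<partial>lborel) \<partial>lborel)"
    by (subst nn_integral_lborel_translate[where f = "\<lambda>v. \<Phi> (post_u u v \<omega>) (post_v u v \<omega>)" for u]) auto
  also have "\<dots> = (\<integral>\<^sup>+X. (\<integral>\<^sup>+u. \<Phi> (post_u u (u + X) \<omega>) (post_v u (u + X) \<omega>) \<partial>lborel) \<partial>lborel)"
    by (rule lborel_Fubini) measurable
  also have "\<dots> = (\<integral>\<^sup>+X. (\<integral>\<^sup>+u. \<Phi> ((\<omega> \<bullet> X) *\<^sub>R \<omega> + u) ((\<omega> \<bullet> X) *\<^sub>R \<omega> + u + (X - (2 * (\<omega> \<bullet> X)) *\<^sub>R \<omega>)) \<partial>lborel) \<partial>lborel)"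
    by (intro nn_integral_cong arg_cong2[of _ _ _ _ \<Phi>])
       (simp_all add: post_u_def post_v_def scaleR_double)
  also have "\<dots> = (\<integral>\<^sup>+X. (\<integral>\<^sup>+u. \<Phi> u (u + (X - (2 * (\<omega> \<bullet> X)) *\<^sub>R \<omega>)) \<partial>lborel) \<partial>lborel)"
    by (subst nn_integral_lborel_translate[where f = "\<lambda>u. \<Phi> u (u + (X - (2 * (\<omega> \<bullet> X)) *\<^sub>R \<omega>))" for X]) auto
  also have "\<dots> = (\<integral>\<^sup>+X. (\<integral>\<^sup>+u. \<Phi> u (u + X) \<partial>lborel) \<partial>lborel)"
    by (rule nn_integral_Householder[where \<phi> = "\<lambda>X. \<integral>\<^sup>+u. \<Phi> u (u + X) \<partial>lborel"]) (use \<omega> in auto)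
  also have "\<dots> = (\<integral>\<^sup>+u. (\<integral>\<^sup>+X. \<Phi> u (u + X) \<partial>lborel) \<partial>lborel)"
    by (rule lborel_Fubini) measurable
  also have "\<dots> = (\<integral>\<^sup>+u. (\<integral>\<^sup>+v. \<Phi> u v \<partial>lborel) \<partial>lborel)"
    by (subst nn_integral_lborel_translate) auto
  also have "\<dots> = (\<integral>\<^sup>+v. (\<integral>\<^sup>+u. \<Phi> u v \<partial>lborel) \<partial>lborel)"
    by (rule lborel_Fubini) measurable
  finally show ?thesis .
qed

section \<open>Polar coordinates for the cone measure\<close>

lemma nn_integral_cube_tail:
  assumes "a > 0"
  shows "(\<integral>\<^sup>+t. ennreal (3 / t ^ 4) * indicator {a..} t \<partial>lborel) = ennreal (1 / a ^ 3)"
proof -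
  have "(\<integral>\<^sup>+t. ennreal (3 / t ^ 4) * indicator {a..} t \<partial>lborel) = ennreal (0 - (- 1 / a ^ 3))"
  proof (rule nn_integral_FTC_atLeast)
    show "((\<lambda>x. - 1 / x ^ 3) has_real_derivative 3 / x ^ 4) (at x)" if "a \<le> x" for x :: real
      using that assms
      by (auto intro!: derivative_eq_intros simp: field_simps power4_eq_xxxx power2_eq_square eval_nat_numeral)
    show "((\<lambda>x::real. - 1 / x ^ 3) \<longlongrightarrow> 0) at_top"
      by (intro tendsto_divide_0[OF tendsto_const] filterlim_at_top_imp_at_infinity filterlim_pow_at_top filterlim_ident) auto
  qed (use assms in auto)
  then show ?thesis by simp
qed

lemma measurable_pred_ball [measurable]:
  assumes [measurable]: "f \<in> borel_measurable M"
  shows "Measurable.pred M (\<lambda>x. f x \<in> ball (a::'a::euclidean_space) r)"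
  unfolding mem_ball by measurable

text \<open>The cone measure averages over x in the unit ball. With r = |x| t the left-hand side is
  the integral of 3 |x|^3 t^2 h(t x) over the ball and t > 0. Substituting y = t x for fixed t gives
  (3 / t^4) |y|^3 h(y) on t > |y|, and the tail integral of 3 / t^4 from |y| on is 1 /
  |y|^3.\<close>

lemma nn_integral_polar:
  fixes h :: vfun
  assumes [measurable]: "meas h"
  shows "(\<integral>\<^sup>+\<omega>. (\<integral>\<^sup>+r. ennreal (r\<^sup>2) * h (r *\<^sub>R \<omega>) * indicator {0<..} r \<partial>lborel) \<partial>sphere_measure)
    = (\<integral>\<^sup>+y. h y \<partial>lborel)"
proof -
  have meas [measurable]: "(\<lambda>x::vec3. 3 * indicator (ball 0 1) x :: ennreal) \<in> borel_measurable borel"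
    by (intro borel_measurable_times_ennreal borel_measurable_indicator) auto
  have "(\<integral>\<^sup>+\<omega>. (\<integral>\<^sup>+r. ennreal (r\<^sup>2) * h (r *\<^sub>R \<omega>) * indicator {0<..} r \<partial>lborel) \<partial>sphere_measure)
      = (\<integral>\<^sup>+x. 3 * indicator (ball 0 1) x * (\<integral>\<^sup>+r. ennreal (r\<^sup>2) * h (r *\<^sub>R sgn x) * indicator {0<..} r \<partial>lborel) \<partial>lborel)"
    by (subst nn_integral_sphere_measure) measurable
  also have "\<dots> = (\<integral>\<^sup>+x. (\<integral>\<^sup>+t. 3 * indicator (ball 0 1) x * ennreal (norm x ^ 3 * t\<^sup>2) * h (t *\<^sub>R x) * indicator {0<..} t \<partial>lborel) \<partial>lborel)"
  proof (rule nn_integral_cong_AE, use AE_lborel_singleton[of "0::vec3"] in eventually_elim)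
    fix x :: vec3 assume x: "x \<noteq> 0"
    have "(\<integral>\<^sup>+r. ennreal (r\<^sup>2) * h (r *\<^sub>R sgn x) * indicator {0<..} r \<partial>lborel)
      = ennreal (norm x) * (\<integral>\<^sup>+t. ennreal ((norm x * t)\<^sup>2) * h ((norm x * t) *\<^sub>R sgn x) * indicator {0<..} (norm x * t) \<partial>lborel)"
      using x by (subst nn_integral_real_affine[where c = "norm x" and t = 0]) auto
    also have "\<dots> = (\<integral>\<^sup>+t. ennreal (norm x) * (ennreal ((norm x * t)\<^sup>2) * h ((norm x * t) *\<^sub>R sgn x) * indicator {0<..} (norm x * t)) \<partial>lborel)"
      by (subst nn_integral_cmult) auto
    also have "\<dots> = (\<integral>\<^sup>+t. ennreal (norm x ^ 3 * t\<^sup>2) * h (t *\<^sub>R x) * indicator {0<..} t \<partial>lborel)"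
    proof (intro nn_integral_cong)
      fix t :: real
      have "(norm x * t) *\<^sub>R sgn x = t *\<^sub>R x"
        using x by (simp add: sgn_div_norm)
      moreover have "indicator {0<..} (norm x * t) = (indicator {0<..} t :: ennreal)"
        using x by (simp add: indicator_def zero_less_mult_iff)
      moreover have "ennreal (norm x) * ennreal ((norm x * t)\<^sup>2) = ennreal (norm x ^ 3 * t\<^sup>2)"
        by (subst ennreal_mult[symmetric], simp, simp) (simp add: power2_eq_square power3_eq_cube mult_ac)
      ultimately show "ennreal (norm x) * (ennreal ((norm x * t)\<^sup>2) * h ((norm x * t) *\<^sub>R sgn x) * indicator {0<..} (norm x * t))
        = ennreal (norm x ^ 3 * t\<^sup>2) * h (t *\<^sub>R x) * indicator {0<..} t"
        by (simp only: mult.assoc[symmetric])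
    qed
    finally have eq: "(\<integral>\<^sup>+r. ennreal (r\<^sup>2) * h (r *\<^sub>R sgn x) * indicator {0<..} r \<partial>lborel)
      = (\<integral>\<^sup>+t. ennreal (norm x ^ 3 * t\<^sup>2) * h (t *\<^sub>R x) * indicator {0<..} t \<partial>lborel)" .
    show "3 * indicator (ball 0 1) x * (\<integral>\<^sup>+r. ennreal (r\<^sup>2) * h (r *\<^sub>R sgn x) * indicator {0<..} r \<partial>lborel)
      = (\<integral>\<^sup>+t. 3 * indicator (ball 0 1) x * ennreal (norm x ^ 3 * t\<^sup>2) * h (t *\<^sub>R x) * indicator {0<..} t \<partial>lborel)"
      unfolding eq by (subst nn_integral_cmult[symmetric]) (auto simp: mult.assoc)
  qed
  also have "\<dots> = (\<integral>\<^sup>+t. (\<integral>\<^sup>+x. 3 * indicator (ball 0 1) x * ennreal (norm x ^ 3 * t\<^sup>2) * h (t *\<^sub>R x) * indicator {0<..} t \<partial>lborel) \<partial>lborel)"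
    by (rule lborel_Fubini) measurable
  also have "\<dots> = (\<integral>\<^sup>+t. (\<integral>\<^sup>+y. ennreal (3 / t ^ 4) * indicator {norm y<..} t * (ennreal (norm y ^ 3) * h y) \<partial>lborel) \<partial>lborel)"
  proof (rule nn_integral_cong)
    fix t :: real
    show "(\<integral>\<^sup>+x. 3 * indicator (ball 0 1) x * ennreal (norm x ^ 3 * t\<^sup>2) * h (t *\<^sub>R x) * indicator {0<..} t \<partial>lborel)
      = (\<integral>\<^sup>+y. ennreal (3 / t ^ 4) * indicator {norm y<..} t * (ennreal (norm y ^ 3) * h y) \<partial>lborel)"
    proof (cases "t > 0")
      case True
      have [measurable]: "Measurable.pred borel (\<lambda>y::vec3. norm y < t)" by measurable
      have [measurable]: "(\<lambda>y::vec3. indicator {norm y<..} t :: ennreal) \<in> borel_measurable borel"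
        "(\<lambda>y::vec3. indicator {norm (t *\<^sub>R y)<..} t :: ennreal) \<in> borel_measurable borel"
        unfolding indicator_def greaterThan_iff by measurable
      have "(\<integral>\<^sup>+y. ennreal (3 / t ^ 4) * indicator {norm y<..} t * (ennreal (norm y ^ 3) * h y) \<partial>lborel)
        = ennreal (t ^ 3) * (\<integral>\<^sup>+x. ennreal (3 / t ^ 4) * indicator {norm (t *\<^sub>R x)<..} t * (ennreal (norm (t *\<^sub>R x) ^ 3) * h (t *\<^sub>R x)) \<partial>lborel)"
        using True by (subst nn_integral_lborel_scaleR[of _ t]) (auto simp: power3_eq_cube)
      also have "\<dots> = (\<integral>\<^sup>+x. ennreal (t ^ 3) * (ennreal (3 / t ^ 4) * indicator {norm (t *\<^sub>R x)<..} t * (ennreal (norm (t *\<^sub>R x) ^ 3) * h (t *\<^sub>R x))) \<partial>lborel)"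
        by (rule nn_integral_cmult[symmetric]) measurable
      also have "\<dots> = (\<integral>\<^sup>+x. 3 * indicator (ball 0 1) x * ennreal (norm x ^ 3 * t\<^sup>2) * h (t *\<^sub>R x) * indicator {0<..} t \<partial>lborel)"
      proof (intro nn_integral_cong)
        fix x :: vec3
        have ind: "indicator {norm (t *\<^sub>R x)<..} t = (indicator (ball 0 1) x :: ennreal)"
          using True by (auto simp: indicator_def)
        have "ennreal (t ^ 3) * (ennreal (3 / t ^ 4) * ennreal (norm (t *\<^sub>R x) ^ 3))
            = ennreal (3 * (norm x ^ 3 * t\<^sup>2))"
          using True by (simp add: ennreal_mult[symmetric] field_simps power3_eq_cube power4_eq_xxxx power2_eq_square)
        also have "\<dots> = 3 * ennreal (norm x ^ 3 * t\<^sup>2)"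
          by (simp add: ennreal_mult)
        finally show "ennreal (t ^ 3) * (ennreal (3 / t ^ 4) * indicator {norm (t *\<^sub>R x)<..} t * (ennreal (norm (t *\<^sub>R x) ^ 3) * h (t *\<^sub>R x)))
          = 3 * indicator (ball 0 1) x * ennreal (norm x ^ 3 * t\<^sup>2) * h (t *\<^sub>R x) * indicator {0<..} t"
          unfolding ind using True by (simp add: mult_ac)
      qed
      finally show ?thesis by (rule sym)
    next
      case False
      then have "indicator {norm y<..} t = (0::ennreal)" for y :: vec3
        by (auto simp: indicator_def intro: order.strict_trans1[OF norm_ge_zero])
      with False show ?thesis by simp
    qed
  qed
  also have "\<dots> = (\<integral>\<^sup>+y. (\<integral>\<^sup>+t. ennreal (3 / t ^ 4) * indicator {norm y<..} t * (ennreal (norm y ^ 3) * h y) \<partial>lborel) \<partial>lborel)"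
  proof (rule lborel_Fubini)
    have [measurable]: "(\<lambda>x. indicator {norm (snd x)<..} (fst x) :: ennreal) \<in> borel_measurable (lborel \<Otimes>\<^sub>M (lborel :: vec3 measure))"
      unfolding indicator_def greaterThan_iff by measurable
    show "(\<lambda>(t, y). ennreal (3 / t ^ 4) * indicator {norm y<..} t * (ennreal (norm y ^ 3) * h y))
        \<in> borel_measurable (lborel \<Otimes>\<^sub>M lborel)"
      unfolding split_beta' by measurable
  qed
  also have "\<dots> = (\<integral>\<^sup>+y. h y \<partial>lborel)"
  proof (rule nn_integral_cong_AE, use AE_lborel_singleton[of "0::vec3"] in eventually_elim)
    fix y :: vec3 assume y: "y \<noteq> 0"
    have "(\<integral>\<^sup>+t. ennreal (3 / t ^ 4) * indicator {norm y<..} t \<partial>lborel)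
      = (\<integral>\<^sup>+t. ennreal (3 / t ^ 4) * indicator {norm y..} t \<partial>lborel)"
      by (rule nn_integral_cong_AE, use AE_lborel_singleton[of "norm y"] in eventually_elim)
         (auto simp: indicator_def)
    also have "\<dots> = ennreal (1 / norm y ^ 3)"
      using y by (intro nn_integral_cube_tail) auto
    finally have "(\<integral>\<^sup>+t. ennreal (3 / t ^ 4) * indicator {norm y<..} t * (ennreal (norm y ^ 3) * h y) \<partial>lborel)
      = ennreal (1 / norm y ^ 3) * (ennreal (norm y ^ 3) * h y)"
      by (subst nn_integral_multc) auto
    also have "\<dots> = h y"
      using y by (simp add: mult.assoc[symmetric] ennreal_mult[symmetric])
    finally show "(\<integral>\<^sup>+t. ennreal (3 / t ^ 4) * indicator {norm y<..} t * (ennreal (norm y ^ 3) * h y) \<partial>lborel) = h y" .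
  qed
  finally show ?thesis .
qed

text \<open>Every line through the origin is traversed for \<omega> and for -\<omega>, hence the
  factor 2. Whole lines are the natural domain because the component \<omega> \<bullet> X takes both
  signs.\<close>

lemma nn_integral_polar_line:
  fixes h :: vfun
  assumes [measurable]: "meas h"
  shows "(\<integral>\<^sup>+\<omega>. (\<integral>\<^sup>+r. ennreal (r\<^sup>2) * h (r *\<^sub>R \<omega>) \<partial>lborel) \<partial>sphere_measure)
    = 2 * (\<integral>\<^sup>+y. h y \<partial>lborel)"
proof -
  have "(\<integral>\<^sup>+r. ennreal (r\<^sup>2) * h (r *\<^sub>R \<omega>) \<partial>lborel)
      = (\<integral>\<^sup>+r. ennreal (r\<^sup>2) * h (r *\<^sub>R \<omega>) * indicator {0<..} r \<partial>lborel)
      + (\<integral>\<^sup>+r. ennreal (r\<^sup>2) * h (- (r *\<^sub>R \<omega>)) * indicator {0<..} r \<partial>lborel)" for \<omega> :: vec3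
  proof -
    have eq: "(\<integral>\<^sup>+r. ennreal (r\<^sup>2) * h (- (r *\<^sub>R \<omega>)) * indicator {0<..} r \<partial>lborel)
        = (\<integral>\<^sup>+r. ennreal (r\<^sup>2) * h (r *\<^sub>R \<omega>) * indicator {..<0} r \<partial>lborel)"
      using nn_integral_lborel_reflect[of "\<lambda>r. ennreal (r\<^sup>2) * h (r *\<^sub>R \<omega>) * indicator {..<0} r" 0]
      by (simp add: indicator_def)
    show ?thesis
      unfolding eq
      by (subst nn_integral_add[symmetric])
         (auto intro!: nn_integral_cong simp: indicator_def split: if_splits)
  qed
  then have "(\<integral>\<^sup>+\<omega>. (\<integral>\<^sup>+r. ennreal (r\<^sup>2) * h (r *\<^sub>R \<omega>) \<partial>lborel) \<partial>sphere_measure)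
      = (\<integral>\<^sup>+\<omega>. (\<integral>\<^sup>+r. ennreal (r\<^sup>2) * h (r *\<^sub>R \<omega>) * indicator {0<..} r \<partial>lborel) \<partial>sphere_measure)
      + (\<integral>\<^sup>+\<omega>. (\<integral>\<^sup>+r. ennreal (r\<^sup>2) * h (- (r *\<^sub>R \<omega>)) * indicator {0<..} r \<partial>lborel) \<partial>sphere_measure)"
    by (simp add: nn_integral_add)
  also have "\<dots> = (\<integral>\<^sup>+y. h y \<partial>lborel) + (\<integral>\<^sup>+y. h (- y) \<partial>lborel)"
    by (subst nn_integral_polar, simp, subst nn_integral_polar[of "\<lambda>y. h (- y)"]) auto
  also have "(\<integral>\<^sup>+y. h (- y) \<partial>lborel) = (\<integral>\<^sup>+y. h y \<partial>lborel)"
    using nn_integral_lborel_reflect[of h 0] by simp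
  finally show ?thesis by (simp add: mult_2)
qed

section \<open>Averages of Gaussians over the sphere\<close>

lemma nn_integral_square_tail:
  "(\<integral>\<^sup>+t. ennreal (1 / (1 + t)\<^sup>2) * indicator {0..} t \<partial>lborel) = 1"
proof -
  have "(\<integral>\<^sup>+t. ennreal (1 / (1 + t)\<^sup>2) * indicator {0..} t \<partial>lborel) = ennreal (0 - (- 1 / (1 + 0)))"
  proof (rule nn_integral_FTC_atLeast)
    show "((\<lambda>x. - 1 / (1 + x)) has_real_derivative 1 / (1 + x)\<^sup>2) (at x)" if "0 \<le> x" for x :: real
      using that by (auto intro!: derivative_eq_intros simp: field_simps power2_eq_square)
    show "((\<lambda>x::real. - 1 / (1 + x)) \<longlongrightarrow> 0) at_top"
      by (intro tendsto_divide_0[OF tendsto_const] filterlim_at_top_imp_at_infinity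
          filterlim_tendsto_add_at_top[OF tendsto_const] filterlim_ident)
  qed auto
  then show ?thesis by simp
qed

text \<open>The hypothesis is the bound on the radial integrand including the Jacobian r^2; K / (1 +
  r)^2 integrates to K over the half line, and the sphere contributes 4 pi.\<close>

lemma nn_integral_radial_bound:
  fixes h :: "vec3 \<Rightarrow> real"
  assumes [measurable]: "meas h"
    and h: "\<And>x. x \<noteq> 0 \<Longrightarrow> (norm x)\<^sup>2 * h x \<le> K / (1 + norm x)\<^sup>2" and K: "K \<ge> 0"
  shows "(\<integral>\<^sup>+x. ennreal (h x) \<partial>lborel) \<le> ennreal (4 * pi * K)"
proof -
  have "(\<integral>\<^sup>+x. ennreal (h x) \<partial>lborel)
    = (\<integral>\<^sup>+\<omega>. (\<integral>\<^sup>+r. ennreal (r\<^sup>2) * ennreal (h (r *\<^sub>R \<omega>)) * indicator {0<..} r \<partial>lborel) \<partial>sphere_measure)"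
    by (subst nn_integral_polar) auto
  also have "\<dots> \<le> (\<integral>\<^sup>+(\<omega>::vec3). (\<integral>\<^sup>+r. ennreal K * (ennreal (1 / (1 + r)\<^sup>2) * indicator {0..} r) \<partial>lborel) \<partial>sphere_measure)"
  proof (intro nn_integral_sphere_measure_mono nn_integral_mono)
    fix \<omega> :: vec3 and r :: real assume "norm \<omega> = 1"
    moreover from this have "\<omega> \<noteq> 0" by auto
    ultimately show "ennreal (r\<^sup>2) * ennreal (h (r *\<^sub>R \<omega>)) * indicator {0<..} r \<le> ennreal K * (ennreal (1 / (1 + r)\<^sup>2) * indicator {0..} r)"
      using h[of "r *\<^sub>R \<omega>"] K
      by (cases "r > 0") (auto simp: indicator_def ennreal_mult''[symmetric] ennreal_mult'[symmetric] intro!: ennreal_leI)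
  qed
  also have "\<dots> = (\<integral>\<^sup>+(\<omega>::vec3). ennreal K \<partial>sphere_measure)"
    by (subst nn_integral_cmult) (auto simp: nn_integral_square_tail)
  also have "\<dots> = ennreal (4 * pi * K)"
    using K by (simp add: emeasure_sphere_measure_UNIV ennreal_mult'[symmetric] mult_ac)
  finally show ?thesis .
qed

text \<open>From (1 + t)^n \<le> exp (n t), completing the square in n t - c t^2 leaves the maximum
  n^2 / (4 c).\<close>

lemma poly_gaussian_bound:
  fixes t c :: real
  assumes "t \<ge> 0" "c > 0"
  shows "(1 + t) ^ n * exp (- c * t\<^sup>2) \<le> exp ((real n)\<^sup>2 / (4 * c))"
proof -
  have "(1 + t) ^ n \<le> exp t ^ n"
    using assms by (intro power_mono) (auto simp: exp_ge_add_one_self)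
  also have "\<dots> = exp (real n * t)"
    by (simp add: exp_of_nat_mult)
  finally have "(1 + t) ^ n * exp (- c * t\<^sup>2) \<le> exp (real n * t - c * t\<^sup>2)"
    by (simp add: exp_diff exp_minus field_simps)
  also have "real n * t - c * t\<^sup>2 \<le> (real n)\<^sup>2 / (4 * c)"
  proof -
    have "0 \<le> (real n - 2 * c * t)\<^sup>2 / (4 * c)"
      using assms by simp
    also have "\<dots> = (real n)\<^sup>2 / (4 * c) - real n * t + c * t\<^sup>2"
      using assms by (simp add: field_simps power2_eq_square)
    finally show ?thesis by simp
  qed
  finally show ?thesis by simp
qed

lemma gaussian_le_bracket:
  assumes "t \<ge> 0" "c > 0"
  shows "exp (- c * t\<^sup>2) \<le> exp ((real n)\<^sup>2 / (4 * c)) / (1 + t) ^ n"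
  using poly_gaussian_bound[OF assms, of n] assms by (simp add: field_simps)

lemma nn_integral_bracket4_bound:
  "(\<integral>\<^sup>+(x::vec3). ennreal (1 / (1 + norm x) ^ 4) \<partial>lborel) \<le> ennreal (4 * pi)"
proof -
  have "(norm x)\<^sup>2 * (1 / (1 + norm x) ^ 4) \<le> 1 / (1 + norm x)\<^sup>2" for x :: vec3
  proof -
    have "(norm x)\<^sup>2 \<le> (1 + norm x)\<^sup>2" by (intro power_mono) auto
    then have "(norm x)\<^sup>2 / (1 + norm x) ^ 4 \<le> (1 + norm x)\<^sup>2 / (1 + norm x) ^ 4"
      by (intro divide_right_mono) auto
    also have "\<dots> = 1 / (1 + norm x)\<^sup>2"
      using norm_ge_zero[of x] by (simp add: divide_simps power4_eq_xxxx power2_eq_square)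
    finally show ?thesis by simp
  qed
  then show ?thesis
    using nn_integral_radial_bound[of "\<lambda>x. 1 / (1 + norm x) ^ 4" 1] by simp
qed

lemma nn_integral_gaussian_finite:
  assumes "c > 0"
  obtains C where "C \<ge> 0" "(\<integral>\<^sup>+(x::vec3). ennreal (exp (- c * (norm x)\<^sup>2)) \<partial>lborel) = ennreal C"
proof -
  have "(\<integral>\<^sup>+(x::vec3). ennreal (exp (- c * (norm x)\<^sup>2)) \<partial>lborel)
    \<le> (\<integral>\<^sup>+(x::vec3). ennreal (exp ((real 4)\<^sup>2 / (4 * c))) * ennreal (1 / (1 + norm x) ^ 4) \<partial>lborel)"
  proof (intro nn_integral_mono)
    fix x :: vec3
    show "ennreal (exp (- c * (norm x)\<^sup>2)) \<le> ennreal (exp ((real 4)\<^sup>2 / (4 * c))) * ennreal (1 / (1 + norm x) ^ 4)"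
      using gaussian_le_bracket[of "norm x" c 4] assms
      by (subst ennreal_mult[symmetric]) (auto intro!: ennreal_leI)
  qed
  also have "\<dots> = ennreal (exp ((real 4)\<^sup>2 / (4 * c))) * (\<integral>\<^sup>+(x::vec3). ennreal (1 / (1 + norm x) ^ 4) \<partial>lborel)"
    by (subst nn_integral_cmult) auto
  also have "\<dots> \<le> ennreal (exp ((real 4)\<^sup>2 / (4 * c))) * ennreal (4 * pi)"
    by (intro mult_left_mono nn_integral_bracket4_bound) auto
  also have "\<dots> < \<infinity>" by (simp add: ennreal_mult_less_top)
  finally show ?thesis
    using that by (cases "\<integral>\<^sup>+(x::vec3). ennreal (exp (- c * (norm x)\<^sup>2)) \<partial>lborel") auto
qed

lemma nn_integral_gaussian_line_finite:
  assumes c: "c > 0"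
  obtains C where "C \<ge> 0" "(\<integral>\<^sup>+(t::real). ennreal (exp (- c * t\<^sup>2)) \<partial>lborel) = ennreal C"
proof -
  let ?K = "exp ((real 2)\<^sup>2 / (4 * c))"
  have half: "(\<integral>\<^sup>+(t::real). ennreal (exp (- c * t\<^sup>2)) * indicator {0..} t \<partial>lborel) \<le> ennreal ?K"
  proof -
    have "(\<integral>\<^sup>+(t::real). ennreal (exp (- c * t\<^sup>2)) * indicator {0..} t \<partial>lborel)
      \<le> (\<integral>\<^sup>+(t::real). ennreal ?K * (ennreal (1 / (1 + t)\<^sup>2) * indicator {0..} t) \<partial>lborel)"
    proof (intro nn_integral_mono)
      fix t :: real
      show "ennreal (exp (- c * t\<^sup>2)) * indicator {0..} t \<le> ennreal ?K * (ennreal (1 / (1 + t)\<^sup>2) * indicator {0..} t)"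
        using gaussian_le_bracket[of t c 2] c
        by (auto simp: indicator_def ennreal_mult[symmetric] intro!: ennreal_leI)
    qed
    also have "\<dots> = ennreal ?K"
      by (subst nn_integral_cmult) (auto simp: nn_integral_square_tail)
    finally show ?thesis .
  qed
  have "(\<integral>\<^sup>+(t::real). ennreal (exp (- c * t\<^sup>2)) \<partial>lborel)
    \<le> (\<integral>\<^sup>+(t::real). ennreal (exp (- c * t\<^sup>2)) * indicator {0..} t + ennreal (exp (- c * t\<^sup>2)) * indicator {..0} t \<partial>lborel)"
    by (intro nn_integral_mono) (auto simp: indicator_def)
  also have "\<dots> = (\<integral>\<^sup>+(t::real). ennreal (exp (- c * t\<^sup>2)) * indicator {0..} t \<partial>lborel)
      + (\<integral>\<^sup>+(t::real). ennreal (exp (- c * t\<^sup>2)) * indicator {..0} t \<partial>lborel)"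
    by (subst nn_integral_add) auto
  also have "(\<integral>\<^sup>+(t::real). ennreal (exp (- c * t\<^sup>2)) * indicator {..0} t \<partial>lborel)
      = (\<integral>\<^sup>+(t::real). ennreal (exp (- c * t\<^sup>2)) * indicator {0..} t \<partial>lborel)"
    using nn_integral_lborel_reflect[of "\<lambda>t. ennreal (exp (- c * t\<^sup>2)) * indicator {..0} t" 0]
    by (simp add: indicator_def)
  also have "(\<integral>\<^sup>+(t::real). ennreal (exp (- c * t\<^sup>2)) * indicator {0..} t \<partial>lborel)
      + (\<integral>\<^sup>+(t::real). ennreal (exp (- c * t\<^sup>2)) * indicator {0..} t \<partial>lborel) \<le> ennreal ?K + ennreal ?K"
    by (intro add_mono half)
  also have "\<dots> < \<infinity>" by simp
  finally show ?thesis
    using that by (cases "\<integral>\<^sup>+(t::real). ennreal (exp (- c * t\<^sup>2)) \<partial>lborel") auto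
qed

text \<open>The map \<open>\<omega> \<mapsto> (\<omega> \<bullet> X) *\<^sub>R \<omega>\<close> traces the sphere with diameter \<open>X\<close>. Averaging the Gaussian over a
  unit interval in the radial variable turns this surface integral into a volume integral.\<close>

lemma sphere_trace_gaussian_bound:
  assumes c: "c > 0"
  obtains C where "C \<ge> 0"
    "\<And>a X. (\<integral>\<^sup>+\<omega>. ennreal ((\<omega> \<bullet> X)\<^sup>2 * exp (- c * (norm (a + (\<omega> \<bullet> X) *\<^sub>R \<omega>))\<^sup>2)) \<partial>sphere_measure) \<le> ennreal C"
proof -
  obtain G where G: "G \<ge> 0" "(\<integral>\<^sup>+(x::vec3). ennreal (exp (- (c / 2) * (norm x)\<^sup>2)) \<partial>lborel) = ennreal G"
    using nn_integral_gaussian_finite[of "c / 2"] c by auto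
  have "(\<integral>\<^sup>+\<omega>. ennreal ((\<omega> \<bullet> X)\<^sup>2 * exp (- c * (norm (a + (\<omega> \<bullet> X) *\<^sub>R \<omega>))\<^sup>2)) \<partial>sphere_measure) \<le> ennreal (exp c * (2 * G))"
    for a X :: vec3
  proof -
    define h where "h y = ennreal (exp (- (c / 2) * (norm (a + y))\<^sup>2))" for y
    have [measurable]: "meas h" unfolding h_def[abs_def] by measurable
    have "(\<integral>\<^sup>+\<omega>. ennreal ((\<omega> \<bullet> X)\<^sup>2 * exp (- c * (norm (a + (\<omega> \<bullet> X) *\<^sub>R \<omega>))\<^sup>2)) \<partial>sphere_measure)
      \<le> (\<integral>\<^sup>+\<omega>. ennreal (exp c) * (\<integral>\<^sup>+r. ennreal (r\<^sup>2) * h (r *\<^sub>R \<omega>) \<partial>lborel) \<partial>sphere_measure)"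
    proof (intro nn_integral_sphere_measure_mono)
      fix \<omega> :: vec3 assume \<omega>: "norm \<omega> = 1"
      define t where "t = \<omega> \<bullet> X"
      \<comment> \<open>The unit interval runs away from the origin, so that t^2 \<le> r^2 on it.
        Moving the point by at most 1 is paid for by halving the exponent and by the factor exp
        c.\<close>
      define J where "J = (if t \<ge> 0 then {t..t + 1} else {t - 1..t})"
      have J [measurable]: "J \<in> sets borel" by (simp add: J_def)
      let ?m = "t\<^sup>2 * exp (- c * (norm (a + t *\<^sub>R \<omega>))\<^sup>2 - c)"
      have "?m \<le> r\<^sup>2 * exp (- (c / 2) * (norm (a + r *\<^sub>R \<omega>))\<^sup>2)" if "r \<in> J" for r
      proof -
        have "t\<^sup>2 \<le> r\<^sup>2" and d: "\<bar>r - t\<bar> \<le> 1"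
          using that by (auto simp: J_def abs_le_square_iff[symmetric] split: if_splits)
        have "norm (a + r *\<^sub>R \<omega>) = norm ((a + t *\<^sub>R \<omega>) + (r - t) *\<^sub>R \<omega>)"
          by (simp add: algebra_simps)
        also have "\<dots> \<le> norm (a + t *\<^sub>R \<omega>) + \<bar>r - t\<bar>"
          using norm_triangle_ineq[of "a + t *\<^sub>R \<omega>" "(r - t) *\<^sub>R \<omega>"] \<omega> by simp
        also have "\<dots> \<le> norm (a + t *\<^sub>R \<omega>) + 1" using d by simp
        finally have "(norm (a + r *\<^sub>R \<omega>))\<^sup>2 \<le> (norm (a + t *\<^sub>R \<omega>) + 1)\<^sup>2"
          by (intro power_mono) auto
        also have "\<dots> \<le> 2 * (norm (a + t *\<^sub>R \<omega>))\<^sup>2 + 2"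
          using sum_squares_bound[of "norm (a + t *\<^sub>R \<omega>)" 1] by (simp add: power2_sum)
        finally have "c / 2 * (norm (a + r *\<^sub>R \<omega>))\<^sup>2 \<le> c / 2 * (2 * (norm (a + t *\<^sub>R \<omega>))\<^sup>2 + 2)"
          using c by (intro mult_left_mono) auto
        then have "- c * (norm (a + t *\<^sub>R \<omega>))\<^sup>2 - c \<le> - (c / 2) * (norm (a + r *\<^sub>R \<omega>))\<^sup>2"
          by (simp add: algebra_simps)
        with \<open>t\<^sup>2 \<le> r\<^sup>2\<close> show ?thesis
          by (intro mult_mono) auto
      qed
      then have "(\<integral>\<^sup>+r. ennreal ?m * indicator J r \<partial>lborel) \<le> (\<integral>\<^sup>+r. ennreal (r\<^sup>2) * h (r *\<^sub>R \<omega>) \<partial>lborel)"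
        by (intro nn_integral_mono) (auto simp: indicator_def h_def ennreal_mult[symmetric] intro!: ennreal_leI)
      moreover have "(\<integral>\<^sup>+r. ennreal ?m * indicator J r \<partial>lborel) = ennreal ?m"
        by (subst nn_integral_cmult_indicator) (auto simp: J_def)
      ultimately have "ennreal (exp c) * ennreal ?m \<le> ennreal (exp c) * (\<integral>\<^sup>+r. ennreal (r\<^sup>2) * h (r *\<^sub>R \<omega>) \<partial>lborel)"
        by (intro mult_left_mono) auto
      moreover have "ennreal (exp c) * ennreal ?m = ennreal (t\<^sup>2 * exp (- c * (norm (a + t *\<^sub>R \<omega>))\<^sup>2))"
        by (simp add: ennreal_mult[symmetric] exp_diff)
      ultimately show "ennreal ((\<omega> \<bullet> X)\<^sup>2 * exp (- c * (norm (a + (\<omega> \<bullet> X) *\<^sub>R \<omega>))\<^sup>2))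
        \<le> ennreal (exp c) * (\<integral>\<^sup>+r. ennreal (r\<^sup>2) * h (r *\<^sub>R \<omega>) \<partial>lborel)"
        by (simp add: t_def)
    qed
    also have "\<dots> = ennreal (exp c) * (2 * (\<integral>\<^sup>+y. h y \<partial>lborel))"
      by (subst nn_integral_cmult) (auto simp: nn_integral_polar_line)
    also have "(\<integral>\<^sup>+y. h y \<partial>lborel) = ennreal G"
      unfolding h_def G(2)[symmetric]
      by (rule nn_integral_lborel_translate[where f = "\<lambda>x. ennreal (exp (- (c / 2) * (norm x)\<^sup>2))"]) simp
    finally show ?thesis
      using G by (simp add: ennreal_mult)
  qed
  with that[of "exp c * (2 * G)"] G show thesis by simp
qed

lemma norm_perp_square:
  fixes \<omega> X :: "'a::real_inner"
  assumes "norm \<omega> = 1"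
  shows "(norm X)\<^sup>2 = (\<omega> \<bullet> X)\<^sup>2 + (norm (X - (\<omega> \<bullet> X) *\<^sub>R \<omega>))\<^sup>2"
proof -
  have "\<omega> \<bullet> \<omega> = 1" using assms by (simp add: norm_eq_1)
  then show ?thesis
    unfolding power2_norm_eq_inner
    by (simp add: inner_diff_left inner_diff_right inner_commute[of X \<omega>] power2_eq_square)
qed

text \<open>Decompose |X|^2 into its parts along and orthogonal to \<omega>. The orthogonal square
  is absorbed by the Gaussian; the parallel square is the trace average with base point a = -X,
  since (\<omega> \<bullet> X) \<omega> - X is the orthogonal part up to sign.\<close>

lemma sphere_perp_gaussian_bound:
  assumes c: "c > 0"
  obtains C where "C \<ge> 0"
    "\<And>X. (\<integral>\<^sup>+\<omega>. ennreal ((1 + norm X)\<^sup>2 * exp (- c * (norm (X - (\<omega> \<bullet> X) *\<^sub>R \<omega>))\<^sup>2)) \<partial>sphere_measure) \<le> ennreal C"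
proof -
  obtain C where C: "C \<ge> 0"
    "\<And>a X. (\<integral>\<^sup>+\<omega>. ennreal ((\<omega> \<bullet> X)\<^sup>2 * exp (- c * (norm (a + (\<omega> \<bullet> X) *\<^sub>R \<omega>))\<^sup>2)) \<partial>sphere_measure) \<le> ennreal C"
    by (rule sphere_trace_gaussian_bound[OF c]) (rule that)
  \<comment> \<open>The 2 comes from (1 + x)^2 \<le> 2 + 2 x^2, the 2 / c from y^2 exp (-c y^2)
    \<le> 1 / c.\<close>
  let ?D = "2 + 2 / c"
  have "(\<integral>\<^sup>+\<omega>. ennreal ((1 + norm X)\<^sup>2 * exp (- c * (norm (X - (\<omega> \<bullet> X) *\<^sub>R \<omega>))\<^sup>2)) \<partial>sphere_measure)
    \<le> ennreal (?D * (4 * pi) + 2 * C)" for X :: vec3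
  proof -
    have "(\<integral>\<^sup>+\<omega>. ennreal ((1 + norm X)\<^sup>2 * exp (- c * (norm (X - (\<omega> \<bullet> X) *\<^sub>R \<omega>))\<^sup>2)) \<partial>sphere_measure)
      \<le> (\<integral>\<^sup>+\<omega>. ennreal ?D + 2 * ennreal ((\<omega> \<bullet> X)\<^sup>2 * exp (- c * (norm (- X + (\<omega> \<bullet> X) *\<^sub>R \<omega>))\<^sup>2)) \<partial>sphere_measure)"
    proof (intro nn_integral_sphere_measure_mono)
      fix \<omega> :: vec3 assume \<omega>: "norm \<omega> = 1"
      define y where "y = norm (X - (\<omega> \<bullet> X) *\<^sub>R \<omega>)"
      have y': "norm (- X + (\<omega> \<bullet> X) *\<^sub>R \<omega>) = y"
        unfolding y_def by (subst norm_minus_cancel[symmetric]) (simp add: algebra_simps)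
      have "(1 + norm X)\<^sup>2 \<le> 2 + 2 * (norm X)\<^sup>2"
        using sum_squares_bound[of 1 "norm X"] by (simp add: power2_sum)
      also have "\<dots> = 2 + 2 * y\<^sup>2 + 2 * (\<omega> \<bullet> X)\<^sup>2"
        using norm_perp_square[OF \<omega>, of X] by (simp add: y_def)
      finally have 1: "(1 + norm X)\<^sup>2 * exp (- c * y\<^sup>2) \<le> (2 + 2 * y\<^sup>2 + 2 * (\<omega> \<bullet> X)\<^sup>2) * exp (- c * y\<^sup>2)"
        by (intro mult_right_mono) auto
      have "c * y\<^sup>2 \<le> exp (c * y\<^sup>2)"
        using exp_ge_add_one_self[of "c * y\<^sup>2"] by linarith
      then have 2: "y\<^sup>2 * exp (- c * y\<^sup>2) \<le> 1 / c"
        using c by (simp add: exp_minus field_simps)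
      have 3: "exp (- c * y\<^sup>2) \<le> 1" using c by simp
      have "(2 + 2 * y\<^sup>2 + 2 * (\<omega> \<bullet> X)\<^sup>2) * exp (- c * y\<^sup>2)
        = 2 * exp (- c * y\<^sup>2) + 2 * (y\<^sup>2 * exp (- c * y\<^sup>2)) + 2 * ((\<omega> \<bullet> X)\<^sup>2 * exp (- c * y\<^sup>2))"
        by (simp only: distrib_right mult.assoc)
      with 1 2 3 have "(1 + norm X)\<^sup>2 * exp (- c * y\<^sup>2) \<le> ?D + 2 * ((\<omega> \<bullet> X)\<^sup>2 * exp (- c * y\<^sup>2))"
        by linarith
      then have "ennreal ((1 + norm X)\<^sup>2 * exp (- c * y\<^sup>2)) \<le> ennreal (?D + 2 * ((\<omega> \<bullet> X)\<^sup>2 * exp (- c * y\<^sup>2)))"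
        by (rule ennreal_leI)
      also have "\<dots> = ennreal ?D + 2 * ennreal ((\<omega> \<bullet> X)\<^sup>2 * exp (- c * y\<^sup>2))"
        using c by (subst ennreal_plus) (auto simp: ennreal_mult)
      finally show "ennreal ((1 + norm X)\<^sup>2 * exp (- c * (norm (X - (\<omega> \<bullet> X) *\<^sub>R \<omega>))\<^sup>2))
         \<le> ennreal ?D + 2 * ennreal ((\<omega> \<bullet> X)\<^sup>2 * exp (- c * (norm (- X + (\<omega> \<bullet> X) *\<^sub>R \<omega>))\<^sup>2))"
        unfolding y' y_def[symmetric] .
    qed
    also have "\<dots> = ennreal ?D * ennreal (4 * pi)
       + 2 * (\<integral>\<^sup>+\<omega>. ennreal ((\<omega> \<bullet> X)\<^sup>2 * exp (- c * (norm (- X + (\<omega> \<bullet> X) *\<^sub>R \<omega>))\<^sup>2)) \<partial>sphere_measure)"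
      by (subst nn_integral_add) (auto simp: nn_integral_cmult emeasure_sphere_measure_UNIV)
    also have "\<dots> \<le> ennreal ?D * ennreal (4 * pi) + 2 * ennreal C"
      by (intro add_left_mono mult_left_mono C) auto
    also have "\<dots> = ennreal (?D * (4 * pi) + 2 * C)"
      using c C by (subst ennreal_plus) (auto simp: ennreal_mult intro!: mult_nonneg_nonneg add_nonneg_nonneg)
    finally show ?thesis .
  qed
  with that[of "?D * (4 * pi) + 2 * C"] C c show thesis by simp
qed

text \<open>Averaging over translations of \<open>x\<close> in the direction \<open>b\<close>.\<close>

lemma nn_integral_ball_slab:
  fixes b :: vec3 and H :: "real \<Rightarrow> ennreal" and d :: "vec3 \<Rightarrow> real"
  assumes [measurable]: "meas H" "meas d"
    and d: "\<And>x t. d (t *\<^sub>R b + x) = d x" "\<And>x. norm x < 2 \<Longrightarrow> \<bar>d x\<bar> \<le> 2"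
  shows "ennreal (norm b) * (\<integral>\<^sup>+x. indicator (ball 0 1) x * indicator {x. d x \<noteq> 0} x * H ((x \<bullet> b) / d x) \<partial>lborel)
    \<le> ennreal (2 * measure lborel (ball (0::vec3) 2)) * (\<integral>\<^sup>+s. H s \<partial>lborel)"
proof (cases "b = 0")
  case False
  let ?n = "norm b"
  \<comment> \<open>Translation by t e with t in [0, 1] leaves d unchanged, has the unit ball
    contained in a ball of radius 2 after shifting, and changes the numerator x \<bullet> b into t
    |b| + x \<bullet> b.\<close>
  define e where "e = (1 / ?n) *\<^sub>R b"
  have e: "norm e = 1" "e \<bullet> b = ?n" "\<And>x t. d (t *\<^sub>R e + x) = d x"
    using False d(1)[of "t / ?n" x for t x] by (auto simp: e_def dot_square_norm power2_eq_square)
  let ?I = "\<integral>\<^sup>+x. indicator (ball 0 1) x * indicator {x. d x \<noteq> 0} x * H ((x \<bullet> b) / d x) \<partial>lborel"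
  have "?I = (\<integral>\<^sup>+t. indicator {0..1::real} t * ?I \<partial>lborel)"
    by (subst nn_integral_multc) auto
  also have "\<dots> = (\<integral>\<^sup>+t. indicator {0..1::real} t * (\<integral>\<^sup>+x. indicator (ball 0 1) (t *\<^sub>R e + x) * indicator {x. d x \<noteq> 0} x * H (((t *\<^sub>R e + x) \<bullet> b) / d x) \<partial>lborel) \<partial>lborel)"
  proof (rule nn_integral_cong, rule arg_cong2[where f = times], rule refl)
    fix t :: real
    have ind: "indicator {x. d x \<noteq> 0} (t *\<^sub>R e + x) = (indicator {x. d x \<noteq> 0} x :: ennreal)" for x
      by (simp add: indicator_def e)
    let ?f = "\<lambda>x. indicator (ball 0 1) x * indicator {x. d x \<noteq> 0} x * H ((x \<bullet> b) / d x)"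
    have "?I = (\<integral>\<^sup>+x. ?f (t *\<^sub>R e + x) \<partial>lborel)"
      by (rule nn_integral_lborel_translate[symmetric]) measurable
    then show "?I = (\<integral>\<^sup>+x. indicator (ball 0 1) (t *\<^sub>R e + x) * indicator {x. d x \<noteq> 0} x * H (((t *\<^sub>R e + x) \<bullet> b) / d x) \<partial>lborel)"
      by (simp only: e(3) ind)
  qed
  also have "\<dots> \<le> (\<integral>\<^sup>+(t::real). (\<integral>\<^sup>+x. indicator (ball 0 2) x * indicator {x. d x \<noteq> 0} x * H ((t * ?n + x \<bullet> b) / d x) \<partial>lborel) \<partial>lborel)"
  proof (intro nn_integral_mono)
    fix t :: real
    show "indicator {0..1::real} t * (\<integral>\<^sup>+x. indicator (ball 0 1) (t *\<^sub>R e + x) * indicator {x. d x \<noteq> 0} x * H (((t *\<^sub>R e + x) \<bullet> b) / d x) \<partial>lborel)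
      \<le> (\<integral>\<^sup>+x. indicator (ball 0 2) x * indicator {x. d x \<noteq> 0} x * H ((t * ?n + x \<bullet> b) / d x) \<partial>lborel)"
    proof (cases "t \<in> {0..1}")
      case True
      have "indicator (ball 0 1) (t *\<^sub>R e + x) \<le> (indicator (ball 0 2) x :: ennreal)" for x
      proof -
        have "norm x \<le> norm (t *\<^sub>R e + x) + norm (t *\<^sub>R e)"
          using norm_triangle_ineq4[of "t *\<^sub>R e + x" "t *\<^sub>R e"] by simp
        also have "norm (t *\<^sub>R e) \<le> 1" using True e by simp
        finally show ?thesis by (simp add: indicator_def)
      qed
      with True show ?thesis
        by (auto intro!: nn_integral_mono mult_right_mono simp: inner_add_left e(2))
    qed simp
  qed
  also have "\<dots> = (\<integral>\<^sup>+x. (\<integral>\<^sup>+(t::real). indicator (ball 0 2) x * indicator {x. d x \<noteq> 0} x * H ((t * ?n + x \<bullet> b) / d x) \<partial>lborel) \<partial>lborel)"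
    by (rule lborel_Fubini) measurable
  \<comment> \<open>For fixed x the argument of H is affine in t with slope |b| / d x. As |d x|
    \<le> 2 on the larger ball, the integral over t is at most (2 / |b|) times that of H, and the
    prefactor |b| cancels.\<close>
  also have "\<dots> \<le> (\<integral>\<^sup>+x. indicator (ball (0::vec3) 2) x * (ennreal (2 / ?n) * (\<integral>\<^sup>+s. H s \<partial>lborel)) \<partial>lborel)"
  proof (intro nn_integral_mono)
    fix x :: vec3
    show "(\<integral>\<^sup>+(t::real). indicator (ball 0 2) x * indicator {x. d x \<noteq> 0} x * H ((t * ?n + x \<bullet> b) / d x) \<partial>lborel)
      \<le> indicator (ball (0::vec3) 2) x * (ennreal (2 / ?n) * (\<integral>\<^sup>+s. H s \<partial>lborel))"
    proof (cases "norm x < 2 \<and> d x \<noteq> 0")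
      case True
      have "(\<integral>\<^sup>+s. H s \<partial>lborel) = ennreal \<bar>?n / d x\<bar> * (\<integral>\<^sup>+t. H ((x \<bullet> b) / d x + ?n / d x * t) \<partial>lborel)"
        using True False by (intro nn_integral_real_affine) auto
      then have "ennreal (\<bar>d x\<bar> / ?n) * (\<integral>\<^sup>+s. H s \<partial>lborel) = (\<integral>\<^sup>+t. H ((x \<bullet> b) / d x + ?n / d x * t) \<partial>lborel)"
        using True False by (simp add: mult.assoc[symmetric] ennreal_mult[symmetric])
      then have "(\<integral>\<^sup>+t. H ((t * ?n + x \<bullet> b) / d x) \<partial>lborel) = ennreal (\<bar>d x\<bar> / ?n) * (\<integral>\<^sup>+s. H s \<partial>lborel)"
        by (simp add: add_divide_distrib mult_ac add_ac)
      also have "\<dots> \<le> ennreal (2 / ?n) * (\<integral>\<^sup>+s. H s \<partial>lborel)"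
        using d(2)[of x] True by (intro mult_right_mono ennreal_leI divide_right_mono) auto
      finally show ?thesis using True by simp
    qed (auto simp: indicator_def)
  qed
  also have "\<dots> = ennreal (measure lborel (ball (0::vec3) 2)) * (ennreal (2 / ?n) * (\<integral>\<^sup>+s. H s \<partial>lborel))"
  proof -
    have "emeasure lborel (ball (0::vec3) 2) = ennreal (measure lborel (ball (0::vec3) 2))"
      by (rule emeasure_eq_ennreal_measure) (simp add: emeasure_ball)
    then show ?thesis
      by (subst nn_integral_multc) auto
  qed
  finally have "ennreal ?n * ?I \<le> ennreal ?n * \<dots>" by (rule mult_left_mono) simp
  also have "\<dots> = ennreal (2 * measure lborel (ball (0::vec3) 2)) * (\<integral>\<^sup>+s. H s \<partial>lborel)"
    using False by (simp add: mult.assoc[symmetric] ennreal_mult[symmetric]) (simp add: mult.commute)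
  finally show ?thesis .
qed simp

text \<open>In the cone measure |x \<bullet> X| \<le> |sgn x \<bullet> X| for |x| < 1, so the
  Gaussian may be evaluated at x \<bullet> X instead. The slab estimate with d = 1 then shows that
  the average decays like 1 / |X|, and the total mass 4 pi covers the summand 1 of 1 + |X|.\<close>

lemma sphere_inner_gaussian_bound:
  assumes c: "c > 0"
  obtains C where "C \<ge> 0"
    "\<And>X. (\<integral>\<^sup>+\<omega>. ennreal ((1 + norm X) * exp (- c * (\<omega> \<bullet> X)\<^sup>2)) \<partial>sphere_measure) \<le> ennreal C"
proof -
  obtain G where G: "G \<ge> 0" "(\<integral>\<^sup>+(t::real). ennreal (exp (- c * t\<^sup>2)) \<partial>lborel) = ennreal G"
    using nn_integral_gaussian_line_finite[OF c] by auto
  let ?V = "2 * measure lborel (ball (0::vec3) 2)"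
  have "(\<integral>\<^sup>+\<omega>. ennreal ((1 + norm X) * exp (- c * (\<omega> \<bullet> X)\<^sup>2)) \<partial>sphere_measure) \<le> ennreal (4 * pi + 3 * (?V * G))"
    for X :: vec3
  proof -
    have "(\<integral>\<^sup>+\<omega>. ennreal (exp (- c * (\<omega> \<bullet> X)\<^sup>2)) \<partial>sphere_measure) \<le> (\<integral>\<^sup>+(\<omega>::vec3). 1 \<partial>sphere_measure)"
      using c by (intro nn_integral_mono) auto
    then have 1: "(\<integral>\<^sup>+\<omega>. ennreal (exp (- c * (\<omega> \<bullet> X)\<^sup>2)) \<partial>sphere_measure) \<le> ennreal (4 * pi)"
      by (simp add: emeasure_sphere_measure_UNIV)
    have "(\<integral>\<^sup>+\<omega>. ennreal (exp (- c * (\<omega> \<bullet> X)\<^sup>2)) \<partial>sphere_measure)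
      = (\<integral>\<^sup>+x. 3 * indicator (ball 0 1) x * ennreal (exp (- c * (sgn x \<bullet> X)\<^sup>2)) \<partial>lborel)"
      by (subst nn_integral_sphere_measure) auto
    also have "\<dots> \<le> (\<integral>\<^sup>+x. 3 * (indicator (ball 0 1) x * indicator {x. 1 \<noteq> (0::real)} x * ennreal (exp (- c * ((x \<bullet> X) / 1)\<^sup>2))) \<partial>lborel)"
    proof (intro nn_integral_mono)
      fix x :: vec3
      have "(x \<bullet> X)\<^sup>2 \<le> (sgn x \<bullet> X)\<^sup>2" if "norm x < 1"
      proof (cases "x = 0")
        case False
        have "x \<bullet> X = norm x * (sgn x \<bullet> X)"
          using False by (simp add: sgn_div_norm)
        then have "(x \<bullet> X)\<^sup>2 = (norm x)\<^sup>2 * (sgn x \<bullet> X)\<^sup>2"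
          by (simp add: power_mult_distrib)
        also have "\<dots> \<le> 1 * (sgn x \<bullet> X)\<^sup>2"
          using that by (intro mult_right_mono power_le_one) auto
        finally show ?thesis by simp
      qed simp
      then show "3 * indicator (ball 0 1) x * ennreal (exp (- c * (sgn x \<bullet> X)\<^sup>2))
        \<le> 3 * (indicator (ball 0 1) x * indicator {x. 1 \<noteq> (0::real)} x * ennreal (exp (- c * ((x \<bullet> X) / 1)\<^sup>2)))"
        using c by (cases "norm x < 1") (auto intro!: mult_left_mono ennreal_leI)
    qed
    also have "\<dots> = 3 * (\<integral>\<^sup>+x. (indicator (ball 0 1) x * indicator {x. 1 \<noteq> (0::real)} x * ennreal (exp (- c * ((x \<bullet> X) / 1)\<^sup>2))) \<partial>lborel)"
      by (rule nn_integral_cmult) measurable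
    finally have "ennreal (norm X) * (\<integral>\<^sup>+\<omega>. ennreal (exp (- c * (\<omega> \<bullet> X)\<^sup>2)) \<partial>sphere_measure)
      \<le> 3 * (ennreal (norm X) * (\<integral>\<^sup>+x. (indicator (ball 0 1) x * indicator {x. 1 \<noteq> (0::real)} x * ennreal (exp (- c * ((x \<bullet> X) / 1)\<^sup>2))) \<partial>lborel))"
      by (subst mult.left_commute) (rule mult_left_mono, auto)
    also have "\<dots> \<le> 3 * (ennreal ?V * (\<integral>\<^sup>+s. ennreal (exp (- c * s\<^sup>2)) \<partial>lborel))"
      by (rule mult_left_mono, rule nn_integral_ball_slab[where d = "\<lambda>_. 1" and H = "\<lambda>s. ennreal (exp (- c * s\<^sup>2))"]) auto
    also have "\<dots> = ennreal (3 * (?V * G))"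
      unfolding G using G(1) by (simp add: ennreal_mult mult.assoc[symmetric])
    finally have 2: "ennreal (norm X) * (\<integral>\<^sup>+\<omega>. ennreal (exp (- c * (\<omega> \<bullet> X)\<^sup>2)) \<partial>sphere_measure) \<le> ennreal (3 * (?V * G))" .
    have "(\<integral>\<^sup>+\<omega>. ennreal ((1 + norm X) * exp (- c * (\<omega> \<bullet> X)\<^sup>2)) \<partial>sphere_measure)
      = (\<integral>\<^sup>+\<omega>. ennreal (exp (- c * (\<omega> \<bullet> X)\<^sup>2)) \<partial>sphere_measure)
       + ennreal (norm X) * (\<integral>\<^sup>+\<omega>. ennreal (exp (- c * (\<omega> \<bullet> X)\<^sup>2)) \<partial>sphere_measure)"
      by (subst nn_integral_cmult[symmetric], simp, subst nn_integral_add[symmetric])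
         (auto simp: ennreal_mult[symmetric] ennreal_plus[symmetric] distrib_right simp del: ennreal_plus)
    also have "\<dots> \<le> ennreal (4 * pi) + ennreal (3 * (?V * G))"
      by (intro add_mono 1 2)
    also have "\<dots> = ennreal (4 * pi + 3 * (?V * G))"
      using G(1) by (subst ennreal_plus) auto
    finally show ?thesis .
  qed
  with that[of "4 * pi + 3 * (?V * G)"] G show thesis by simp
qed

section \<open>Carleman-type changes of variables\<close>

definition perp :: "vec3 \<Rightarrow> vec3 \<Rightarrow> vec3" where
  "perp \<omega> X = X - (\<omega> \<bullet> X) *\<^sub>R \<omega>"

lemma measurable_perp [measurable]:
  assumes [measurable]: "f \<in> borel_measurable M" "g \<in> borel_measurable M"
  shows "(\<lambda>x. perp (f x) (g x)) \<in> borel_measurable M"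
  unfolding perp_def by measurable

text \<open>For fixed \<omega>, \<Psi> depends on X only through t = \<omega> \<bullet> X, and the
  Gaussian only on the orthogonal part. The exchange spreads the orthogonal plane over the slab 0
  \<le> \<omega> \<bullet> Z \<le> 1, where the orthogonal Gaussian is at most exp c times the full
  one. The remaining integral of t^2 \<Psi>(t \<omega>) is polar coordinates along lines.\<close>

lemma carleman_parallel:
  assumes c: "c > 0"
  obtains C where "C \<ge> 0"
    "\<And>\<Psi>. meas \<Psi> \<Longrightarrow>
      (\<integral>\<^sup>+\<omega>. (\<integral>\<^sup>+X. ennreal ((\<omega> \<bullet> X)\<^sup>2 * exp (- c * (norm (perp \<omega> X))\<^sup>2)) * \<Psi> ((\<omega> \<bullet> X) *\<^sub>R \<omega>) \<partial>lborel) \<partial>sphere_measure)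
      \<le> ennreal C * (\<integral>\<^sup>+y. \<Psi> y \<partial>lborel)"
proof -
  obtain G where G: "G \<ge> 0" "(\<integral>\<^sup>+(x::vec3). ennreal (exp (- c * (norm x)\<^sup>2)) \<partial>lborel) = ennreal G"
    using nn_integral_gaussian_finite[OF c] by auto
  define \<kappa> :: "real \<Rightarrow> ennreal" where "\<kappa> = indicator {0..1}"
  have [measurable]: "meas \<kappa>" by (simp add: \<kappa>_def)
  have main: "(\<integral>\<^sup>+\<omega>. (\<integral>\<^sup>+X. ennreal ((\<omega> \<bullet> X)\<^sup>2 * exp (- c * (norm (perp \<omega> X))\<^sup>2)) * \<Psi> ((\<omega> \<bullet> X) *\<^sub>R \<omega>) \<partial>lborel) \<partial>sphere_measure)
      \<le> ennreal (exp c * G * 2) * (\<integral>\<^sup>+y. \<Psi> y \<partial>lborel)"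
    if [measurable]: "meas \<Psi>" for \<Psi> :: vfun
  proof -
    have "(\<integral>\<^sup>+\<omega>. (\<integral>\<^sup>+X. ennreal ((\<omega> \<bullet> X)\<^sup>2 * exp (- c * (norm (perp \<omega> X))\<^sup>2)) * \<Psi> ((\<omega> \<bullet> X) *\<^sub>R \<omega>) \<partial>lborel) \<partial>sphere_measure)
      \<le> (\<integral>\<^sup>+\<omega>. ennreal (exp c * G) * (\<integral>\<^sup>+t. ennreal (t\<^sup>2) * \<Psi> (t *\<^sub>R \<omega>) \<partial>lborel) \<partial>sphere_measure)"
    proof (rule nn_integral_sphere_measure_mono)
      fix \<omega> :: vec3 assume \<omega>: "norm \<omega> = 1"
      then have 1: "\<omega> \<bullet> \<omega> = 1" by (simp add: norm_eq_1)
      define \<Phi> where "\<Phi> t Z = ennreal (t\<^sup>2) * \<Psi> (t *\<^sub>R \<omega>) * (ennreal (exp (- c * (norm (perp \<omega> Z))\<^sup>2)) * \<kappa> (\<omega> \<bullet> Z))" for t Z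
      have [measurable]: "case_prod \<Phi> \<in> borel_measurable (borel \<Otimes>\<^sub>M borel)"
        unfolding \<Phi>_def by measurable
      define g where "g X = ennreal ((\<omega> \<bullet> X)\<^sup>2 * exp (- c * (norm (perp \<omega> X))\<^sup>2)) * \<Psi> ((\<omega> \<bullet> X) *\<^sub>R \<omega>)" for X
      have [measurable]: "meas g" unfolding g_def[abs_def] by measurable
      have \<Phi>g: "\<Phi> (\<omega> \<bullet> X) (X - (\<omega> \<bullet> X) *\<^sub>R \<omega> + s *\<^sub>R \<omega>) = \<kappa> s * g X" for s X
      proof -
        have "\<omega> \<bullet> (X - (\<omega> \<bullet> X) *\<^sub>R \<omega> + s *\<^sub>R \<omega>) = s"
          by (simp add: inner_add_right inner_diff_right 1)
        then have "perp \<omega> (X - (\<omega> \<bullet> X) *\<^sub>R \<omega> + s *\<^sub>R \<omega>) = perp \<omega> X"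
          "\<omega> \<bullet> (X - (\<omega> \<bullet> X) *\<^sub>R \<omega> + s *\<^sub>R \<omega>) = s"
          by (simp_all add: perp_def)
        then show ?thesis by (simp add: \<Phi>_def g_def ennreal_mult mult_ac)
      qed
      have "(\<integral>\<^sup>+X. g X \<partial>lborel) = (\<integral>\<^sup>+s. (\<integral>\<^sup>+X. \<kappa> s * g X \<partial>lborel) \<partial>lborel)"
        by (simp add: nn_integral_cmult nn_integral_multc \<kappa>_def)
      also have "\<dots> = (\<integral>\<^sup>+t. (\<integral>\<^sup>+Z. \<Phi> t Z \<partial>lborel) \<partial>lborel)"
        using nn_integral_exchange'[of \<Phi> \<omega> \<omega>] by (simp add: \<Phi>g 1 borel_prod[symmetric])
      also have "\<dots> \<le> (\<integral>\<^sup>+t. ennreal (t\<^sup>2) * \<Psi> (t *\<^sub>R \<omega>) * ennreal (exp c * G) \<partial>lborel)"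
      proof (rule nn_integral_mono)
        fix t :: real
        have "(\<integral>\<^sup>+Z. ennreal (exp (- c * (norm (perp \<omega> Z))\<^sup>2)) * \<kappa> (\<omega> \<bullet> Z) \<partial>lborel)
          \<le> (\<integral>\<^sup>+(Z::vec3). ennreal (exp c) * ennreal (exp (- c * (norm Z)\<^sup>2)) \<partial>lborel)"
        proof (rule nn_integral_mono)
          fix Z :: vec3
          show "ennreal (exp (- c * (norm (perp \<omega> Z))\<^sup>2)) * \<kappa> (\<omega> \<bullet> Z) \<le> ennreal (exp c) * ennreal (exp (- c * (norm Z)\<^sup>2))"
          proof (cases "\<omega> \<bullet> Z \<in> {0..1}")
            case True
            then have "c * (\<omega> \<bullet> Z)\<^sup>2 \<le> c * 1"
              using c by (intro mult_left_mono power_le_one) auto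
            then have "- c * (norm (perp \<omega> Z))\<^sup>2 \<le> c + - c * (norm Z)\<^sup>2"
              using norm_perp_square[OF \<omega>, of Z] by (simp add: perp_def algebra_simps)
            then have "exp (- c * (norm (perp \<omega> Z))\<^sup>2) \<le> exp c * exp (- c * (norm Z)\<^sup>2)"
              by (simp add: exp_add[symmetric])
            then show ?thesis
              using True by (simp add: \<kappa>_def ennreal_mult[symmetric] ennreal_leI)
          qed (simp add: \<kappa>_def)
        qed
        also have "\<dots> = ennreal (exp c * G)"
          using G by (simp add: nn_integral_cmult ennreal_mult)
        finally show "(\<integral>\<^sup>+Z. \<Phi> t Z \<partial>lborel) \<le> ennreal (t\<^sup>2) * \<Psi> (t *\<^sub>R \<omega>) * ennreal (exp c * G)"
          unfolding \<Phi>_def by (subst nn_integral_cmult) (auto intro!: mult_left_mono)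
      qed
      also have "\<dots> = ennreal (exp c * G) * (\<integral>\<^sup>+t. ennreal (t\<^sup>2) * \<Psi> (t *\<^sub>R \<omega>) \<partial>lborel)"
        by (subst nn_integral_multc) (auto simp: mult.commute)
      finally show "(\<integral>\<^sup>+X. ennreal ((\<omega> \<bullet> X)\<^sup>2 * exp (- c * (norm (perp \<omega> X))\<^sup>2)) * \<Psi> ((\<omega> \<bullet> X) *\<^sub>R \<omega>) \<partial>lborel)
        \<le> ennreal (exp c * G) * (\<integral>\<^sup>+t. ennreal (t\<^sup>2) * \<Psi> (t *\<^sub>R \<omega>) \<partial>lborel)"
        unfolding g_def .
    qed
    also have "\<dots> = ennreal (exp c * G) * (2 * (\<integral>\<^sup>+y. \<Psi> y \<partial>lborel))"
      by (subst nn_integral_cmult) (auto simp: nn_integral_polar_line)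
    also have "\<dots> = ennreal (exp c * G * 2) * (\<integral>\<^sup>+y. \<Psi> y \<partial>lborel)"
      using G by (simp add: ennreal_mult mult.assoc)
    finally show ?thesis .
  qed
  show thesis
    by (rule that[OF _ main]) (use G in auto)
qed

lemma exists_Basis_component:
  fixes \<omega> :: vec3
  assumes "norm \<omega> = 1"
  obtains e where "e \<in> Basis" "1 / 2 \<le> \<bar>\<omega> \<bullet> e\<bar>"
proof (rule ccontr)
  assume "\<not> thesis"
  then have lt: "\<forall>e\<in>Basis. \<bar>\<omega> \<bullet> e\<bar> < 1 / 2"
    using that by force
  have "1 = (\<Sum>e\<in>Basis. (\<omega> \<bullet> e)\<^sup>2)"
    using assms euclidean_inner[of \<omega> \<omega>] by (simp add: norm_eq_1 power2_eq_square)
  also have "\<dots> \<le> (\<Sum>e\<in>(Basis :: vec3 set). (1 / 2)\<^sup>2)"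
    using lt by (intro sum_mono) (simp add: abs_le_square_iff[symmetric] less_imp_le)
  also have "\<dots> = 3 / 4" by (simp add: power2_eq_square)
  finally show False by simp
qed

text \<open>The plane orthogonal to \<open>\<omega>\<close> is parametrized by skew projection along a coordinate vector \<open>e\<close> with
  \<open>\<bar>\<omega> \<bullet> e\<bar> \<ge> 1 / 2\<close>; then varying \<open>\<omega>\<close> moves the projected point along the line spanned by \<open>e\<close>.\<close>

lemma carleman_perp:
  assumes c: "c > 0"
  obtains C where "C \<ge> 0"
    "\<And>\<Psi>. meas \<Psi> \<Longrightarrow>
      (\<integral>\<^sup>+\<omega>. (\<integral>\<^sup>+X. ennreal (exp (- c * (\<omega> \<bullet> X)\<^sup>2)) * (ennreal (norm (perp \<omega> X)) * \<Psi> (perp \<omega> X)) \<partial>lborel) \<partial>sphere_measure)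
      \<le> ennreal C * (\<integral>\<^sup>+y. \<Psi> y \<partial>lborel)"
proof -
  obtain G where G: "G \<ge> 0" "(\<integral>\<^sup>+(t::real). ennreal (exp (- c * t\<^sup>2)) \<partial>lborel) = ennreal G"
    using nn_integral_gaussian_line_finite[OF c] by auto
  define V where "V = 2 * measure lborel (ball (0::vec3) 2)"
  have V: "V \<ge> 0" by (simp add: V_def)
  define \<kappa> :: "real \<Rightarrow> ennreal" where "\<kappa> = indicator {0..1}"
  have [measurable]: "meas \<kappa>" by (simp add: \<kappa>_def)
  have \<kappa>1: "(\<integral>\<^sup>+s. \<kappa> (a + s) \<partial>lborel) = 1" for a
    using nn_integral_lborel_translate[of \<kappa> a] by (simp add: \<kappa>_def)
  have main: "(\<integral>\<^sup>+\<omega>. (\<integral>\<^sup>+X. ennreal (exp (- c * (\<omega> \<bullet> X)\<^sup>2)) * (ennreal (norm (perp \<omega> X)) * \<Psi> (perp \<omega> X)) \<partial>lborel) \<partial>sphere_measure)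
      \<le> ennreal (3 * (2 * G * (9 * V))) * (\<integral>\<^sup>+y. \<Psi> y \<partial>lborel)"
    if [measurable]: "meas \<Psi>" for \<Psi> :: vfun
  proof -
    define \<Psi>' where "\<Psi>' y = ennreal (norm y) * \<Psi> y" for y
    have [measurable]: "meas \<Psi>'" unfolding \<Psi>'_def[abs_def] by measurable
    define J where "J \<omega> = (\<integral>\<^sup>+X. ennreal (exp (- c * (\<omega> \<bullet> X)\<^sup>2)) * \<Psi>' (perp \<omega> X) \<partial>lborel)" for \<omega>
    \<comment> \<open>\<open>A e\<close> integrates over the slab 0 \<le> e \<bullet> Z \<le> 1 the
      value of \<Psi>' at the skew projection of Z along e onto the plane orthogonal to
      \<omega>.\<close>
    define A where "A e \<omega> = (\<integral>\<^sup>+Z. \<kappa> (e \<bullet> Z) * \<Psi>' (Z - ((\<omega> \<bullet> Z) / (\<omega> \<bullet> e)) *\<^sub>R e) \<partial>lborel)" for e \<omega>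
    have A_meas [measurable]: "A e \<in> borel_measurable borel" for e
      unfolding A_def[abs_def] by measurable
    \<comment> \<open>The exchange trades the component along \<omega>, which carries the Gaussian
      and contributes G, for a coordinate along e. Its Jacobian |\<omega> \<bullet> e| is at least
      1/2, hence the factor 2.\<close>
    have step1: "J \<omega> \<le> ennreal (2 * G) * A e \<omega>"
      if \<omega>: "norm \<omega> = 1" and e: "e \<in> Basis" and h: "1 / 2 \<le> \<bar>\<omega> \<bullet> e\<bar>" for \<omega> e
    proof -
      have 1: "\<omega> \<bullet> \<omega> = 1" "e \<bullet> e = 1" using \<omega> e by (auto simp: norm_eq_1)
      have ne: "\<omega> \<bullet> e \<noteq> 0" using h by auto
      define \<Phi> where "\<Phi> t Z = ennreal (exp (- c * t\<^sup>2)) * (\<kappa> (e \<bullet> Z) * \<Psi>' (Z - ((\<omega> \<bullet> Z) / (\<omega> \<bullet> e)) *\<^sub>R e))" for t Z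
      have [measurable]: "case_prod \<Phi> \<in> borel_measurable (borel \<Otimes>\<^sub>M borel)"
        unfolding \<Phi>_def by measurable
      have \<Phi>: "\<Phi> (\<omega> \<bullet> X) (X - (\<omega> \<bullet> X) *\<^sub>R \<omega> + s *\<^sub>R e)
          = ennreal (exp (- c * (\<omega> \<bullet> X)\<^sup>2)) * \<Psi>' (perp \<omega> X) * \<kappa> (e \<bullet> perp \<omega> X + s)" for X s
      proof -
        have "\<omega> \<bullet> (X - (\<omega> \<bullet> X) *\<^sub>R \<omega> + s *\<^sub>R e) = s * (\<omega> \<bullet> e)"
          by (simp add: inner_add_right inner_diff_right 1)
        then show ?thesis
          using ne by (simp add: \<Phi>_def perp_def inner_add_right 1 mult_ac)
      qed
      have "(\<integral>\<^sup>+s. (\<integral>\<^sup>+X. \<Phi> (\<omega> \<bullet> X) (X - (\<omega> \<bullet> X) *\<^sub>R \<omega> + s *\<^sub>R e) \<partial>lborel) \<partial>lborel)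
        = (\<integral>\<^sup>+X. (\<integral>\<^sup>+s. ennreal (exp (- c * (\<omega> \<bullet> X)\<^sup>2)) * \<Psi>' (perp \<omega> X) * \<kappa> (e \<bullet> perp \<omega> X + s) \<partial>lborel) \<partial>lborel)"
        unfolding \<Phi> by (rule lborel_Fubini) measurable
      also have "\<dots> = J \<omega>"
        unfolding J_def by (subst nn_integral_cmult) (auto simp: \<kappa>1)
      finally have "ennreal \<bar>\<omega> \<bullet> e\<bar> * J \<omega> = (\<integral>\<^sup>+t. (\<integral>\<^sup>+Z. \<Phi> t Z \<partial>lborel) \<partial>lborel)"
        using nn_integral_exchange'[of \<Phi> \<omega> e] ne by (simp add: borel_prod[symmetric])
      also have "\<dots> = (\<integral>\<^sup>+t. ennreal (exp (- c * t\<^sup>2)) * A e \<omega> \<partial>lborel)"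
        unfolding \<Phi>_def A_def by (subst nn_integral_cmult) auto
      also have "\<dots> = ennreal G * A e \<omega>"
        by (subst nn_integral_multc, simp) (simp only: G)
      finally have eq: "ennreal \<bar>\<omega> \<bullet> e\<bar> * J \<omega> = ennreal G * A e \<omega>" .
      have "2 * ennreal (1 / 2) = 1"
        using ennreal_mult[of 2 "1 / 2"] by simp
      then have "J \<omega> = 2 * (ennreal (1 / 2) * J \<omega>)"
        by (simp only: mult.assoc[symmetric] mult_1)
      also have "\<dots> \<le> 2 * (ennreal \<bar>\<omega> \<bullet> e\<bar> * J \<omega>)"
        using h by (intro mult_left_mono mult_right_mono ennreal_leI) auto
      also have "\<dots> = ennreal (2 * G) * A e \<omega>"
        unfolding eq using G by (simp add: ennreal_mult mult.assoc)
      finally show ?thesis .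
    qed
    have step2: "J \<omega> \<le> (\<Sum>e\<in>Basis. indicator {\<omega>. 1 / 2 \<le> \<bar>\<omega> \<bullet> e\<bar>} \<omega> * (ennreal (2 * G) * A e \<omega>))"
      if \<omega>: "norm \<omega> = 1" for \<omega>
    proof -
      obtain e where e: "e \<in> Basis" "1 / 2 \<le> \<bar>\<omega> \<bullet> e\<bar>"
        using exists_Basis_component[OF \<omega>] .
      have "J \<omega> \<le> indicator {\<omega>. 1 / 2 \<le> \<bar>\<omega> \<bullet> e\<bar>} \<omega> * (ennreal (2 * G) * A e \<omega>)"
        using step1[OF \<omega> e] e by simp
      also have "\<dots> \<le> (\<Sum>e\<in>Basis. indicator {\<omega>. 1 / 2 \<le> \<bar>\<omega> \<bullet> e\<bar>} \<omega> * (ennreal (2 * G) * A e \<omega>))"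
        using e by (intro member_le_sum) auto
      finally show ?thesis .
    qed
    have step4: "(\<integral>\<^sup>+\<omega>. indicator {\<omega>. 1 / 2 \<le> \<bar>\<omega> \<bullet> e\<bar>} \<omega> * \<Psi>' (Z - ((\<omega> \<bullet> Z) / (\<omega> \<bullet> e)) *\<^sub>R e) \<partial>sphere_measure)
        \<le> ennreal (9 * V) * (\<integral>\<^sup>+s. \<Psi> (Z - (e \<bullet> Z) *\<^sub>R e + s *\<^sub>R e) \<partial>lborel)" if e: "e \<in> Basis" for Z e
    proof -
      have 1: "norm e = 1" "e \<bullet> e = 1" using e by (auto simp: norm_eq_1)
      \<comment> \<open>Only the part b of Z orthogonal to e matters: the projected point is b - s e
        with s = (x \<bullet> b) / (x \<bullet> e) and |s| \<le> 2 |b|. So the factor |y| hidden in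
        \<Psi>' is at most 3 |b|, exactly the factor that the slab estimate asks for; with the
        density 3 of the cone measure this makes 9. Orthogonality of b and e is the invariance of d
        = x \<bullet> e required there.\<close>
      define b where "b = Z - (e \<bullet> Z) *\<^sub>R e"
      have be: "b \<bullet> e = 0" by (simp add: b_def inner_diff_left 1 inner_commute[of e Z])
      have "(\<integral>\<^sup>+\<omega>. indicator {\<omega>. 1 / 2 \<le> \<bar>\<omega> \<bullet> e\<bar>} \<omega> * \<Psi>' (Z - ((\<omega> \<bullet> Z) / (\<omega> \<bullet> e)) *\<^sub>R e) \<partial>sphere_measure)
        = (\<integral>\<^sup>+x. 3 * indicator (ball 0 1) x * (indicator {\<omega>. 1 / 2 \<le> \<bar>\<omega> \<bullet> e\<bar>} (sgn x) * \<Psi>' (Z - ((sgn x \<bullet> Z) / (sgn x \<bullet> e)) *\<^sub>R e)) \<partial>lborel)"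
        by (subst nn_integral_sphere_measure) measurable
      also have "\<dots> \<le> (\<integral>\<^sup>+x. ennreal (9 * norm b) * (indicator (ball 0 1) x * indicator {x. x \<bullet> e \<noteq> 0} x * \<Psi> (b - ((x \<bullet> b) / (x \<bullet> e)) *\<^sub>R e)) \<partial>lborel)"
      proof (rule nn_integral_mono)
        fix x :: vec3
        show "3 * indicator (ball 0 1) x * (indicator {\<omega>. 1 / 2 \<le> \<bar>\<omega> \<bullet> e\<bar>} (sgn x) * \<Psi>' (Z - ((sgn x \<bullet> Z) / (sgn x \<bullet> e)) *\<^sub>R e))
          \<le> ennreal (9 * norm b) * (indicator (ball 0 1) x * indicator {x. x \<bullet> e \<noteq> 0} x * \<Psi> (b - ((x \<bullet> b) / (x \<bullet> e)) *\<^sub>R e))"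
        proof (cases "1 / 2 \<le> \<bar>sgn x \<bullet> e\<bar>")
          case True
          then have x: "x \<noteq> 0" by auto
          have xe: "x \<bullet> e = norm x * (sgn x \<bullet> e)" "x \<bullet> Z = norm x * (sgn x \<bullet> Z)"
            using x by (simp_all add: sgn_div_norm)
          have "norm x * (1 / 2) \<le> norm x * \<bar>sgn x \<bullet> e\<bar>"
            using True by (intro mult_left_mono) auto
          then have xe2: "norm x / 2 \<le> \<bar>x \<bullet> e\<bar>" by (simp add: xe abs_mult)
          then have ne: "x \<bullet> e \<noteq> 0" using x by auto
          define \<rho> where "\<rho> = (x \<bullet> b) / (x \<bullet> e)"
          have "(sgn x \<bullet> Z) / (sgn x \<bullet> e) = (x \<bullet> Z) / (x \<bullet> e)"
            unfolding xe using x by simp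
          also have "x \<bullet> Z = x \<bullet> b + (e \<bullet> Z) * (x \<bullet> e)"
            by (simp add: b_def inner_diff_right)
          finally have "(sgn x \<bullet> Z) / (sgn x \<bullet> e) = \<rho> + e \<bullet> Z"
            using ne by (simp add: \<rho>_def add_divide_distrib)
          then have arg: "Z - ((sgn x \<bullet> Z) / (sgn x \<bullet> e)) *\<^sub>R e = b - \<rho> *\<^sub>R e"
            by (simp add: b_def algebra_simps)
          have "\<bar>\<rho>\<bar> \<le> (norm x * norm b) / (norm x / 2)"
            unfolding \<rho>_def abs_divide using xe2 x
            by (intro frac_le Cauchy_Schwarz_ineq2) auto
          also have "\<dots> = 2 * norm b" using x by simp
          finally have "norm (b - \<rho> *\<^sub>R e) \<le> 3 * norm b"
            using norm_triangle_ineq4[of b "\<rho> *\<^sub>R e"] 1 by simp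
          then have "3 * \<Psi>' (b - \<rho> *\<^sub>R e) \<le> 3 * (ennreal (3 * norm b) * \<Psi> (b - \<rho> *\<^sub>R e))"
            unfolding \<Psi>'_def by (intro mult_left_mono mult_right_mono ennreal_leI) auto
          also have "\<dots> = ennreal (9 * norm b) * \<Psi> (b - \<rho> *\<^sub>R e)"
            by (simp add: ennreal_mult mult.assoc[symmetric])
          finally show ?thesis
            using True ne unfolding arg by (auto simp: indicator_def \<rho>_def)
        qed simp
      qed
      also have "\<dots> = 9 * (ennreal (norm b) * (\<integral>\<^sup>+x. indicator (ball 0 1) x * indicator {x. x \<bullet> e \<noteq> 0} x * \<Psi> (b - ((x \<bullet> b) / (x \<bullet> e)) *\<^sub>R e) \<partial>lborel))"
        by (subst nn_integral_cmult) (auto simp: ennreal_mult mult.assoc)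
      also have "\<dots> \<le> 9 * (ennreal V * (\<integral>\<^sup>+s. \<Psi> (b - s *\<^sub>R e) \<partial>lborel))"
        unfolding V_def
      proof (rule mult_left_mono, rule nn_integral_ball_slab[where d = "\<lambda>x. x \<bullet> e" and H = "\<lambda>s. \<Psi> (b - s *\<^sub>R e)"])
        show "\<bar>x \<bullet> e\<bar> \<le> 2" if "norm x < 2" for x :: vec3
          using Cauchy_Schwarz_ineq2[of x e] that 1 by simp
      qed (auto simp: inner_add_left be)
      also have "(\<integral>\<^sup>+s. \<Psi> (b - s *\<^sub>R e) \<partial>lborel) = (\<integral>\<^sup>+s. \<Psi> (b + s *\<^sub>R e) \<partial>lborel)"
        using nn_integral_lborel_reflect[of "\<lambda>s. \<Psi> (b + s *\<^sub>R e)" 0] by simp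
      finally show ?thesis
        using V by (simp add: b_def ennreal_mult mult.assoc)
    qed
    \<comment> \<open>Integrating over the slab in e \<bullet> Z and over the line variable s along
      e recovers the full volume integral, once more by the exchange.\<close>
    have step5: "(\<integral>\<^sup>+\<omega>. indicator {\<omega>. 1 / 2 \<le> \<bar>\<omega> \<bullet> e\<bar>} \<omega> * A e \<omega> \<partial>sphere_measure)
        \<le> ennreal (9 * V) * (\<integral>\<^sup>+y. \<Psi> y \<partial>lborel)" if e: "e \<in> Basis" for e
    proof -
      interpret pair_sigma_finite sphere_measure "lborel :: vec3 measure" ..
      have 1: "e \<bullet> e = 1" using e by (auto simp: norm_eq_1)
      have "(\<integral>\<^sup>+\<omega>. indicator {\<omega>. 1 / 2 \<le> \<bar>\<omega> \<bullet> e\<bar>} \<omega> * A e \<omega> \<partial>sphere_measure)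
        = (\<integral>\<^sup>+\<omega>. (\<integral>\<^sup>+Z. \<kappa> (e \<bullet> Z) * (indicator {\<omega>. 1 / 2 \<le> \<bar>\<omega> \<bullet> e\<bar>} \<omega> * \<Psi>' (Z - ((\<omega> \<bullet> Z) / (\<omega> \<bullet> e)) *\<^sub>R e)) \<partial>lborel) \<partial>sphere_measure)"
        unfolding A_def by (subst nn_integral_cmult[symmetric]) (auto simp: mult_ac)
      also have "\<dots> = (\<integral>\<^sup>+Z. (\<integral>\<^sup>+\<omega>. \<kappa> (e \<bullet> Z) * (indicator {\<omega>. 1 / 2 \<le> \<bar>\<omega> \<bullet> e\<bar>} \<omega> * \<Psi>' (Z - ((\<omega> \<bullet> Z) / (\<omega> \<bullet> e)) *\<^sub>R e)) \<partial>sphere_measure) \<partial>lborel)"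
        by (rule Fubini'[symmetric]) measurable
      also have "\<dots> \<le> (\<integral>\<^sup>+Z. \<kappa> (e \<bullet> Z) * (ennreal (9 * V) * (\<integral>\<^sup>+s. \<Psi> (Z - (e \<bullet> Z) *\<^sub>R e + s *\<^sub>R e) \<partial>lborel)) \<partial>lborel)"
        by (subst nn_integral_cmult, simp) (intro nn_integral_mono mult_left_mono step4 e zero_le)
      also have "\<dots> = ennreal (9 * V) * (\<integral>\<^sup>+Z. (\<integral>\<^sup>+s. \<kappa> (e \<bullet> Z) * \<Psi> (Z - (e \<bullet> Z) *\<^sub>R e + s *\<^sub>R e) \<partial>lborel) \<partial>lborel)"
        by (subst mult.left_commute, subst nn_integral_cmult) (auto simp: nn_integral_cmult)
      also have "(\<integral>\<^sup>+Z. (\<integral>\<^sup>+s. \<kappa> (e \<bullet> Z) * \<Psi> (Z - (e \<bullet> Z) *\<^sub>R e + s *\<^sub>R e) \<partial>lborel) \<partial>lborel)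
        = (\<integral>\<^sup>+s. (\<integral>\<^sup>+Z. \<kappa> (e \<bullet> Z) * \<Psi> (Z - (e \<bullet> Z) *\<^sub>R e + s *\<^sub>R e) \<partial>lborel) \<partial>lborel)"
        by (rule lborel_Fubini) measurable
      also have "\<dots> = (\<integral>\<^sup>+t. (\<integral>\<^sup>+Z. \<kappa> t * \<Psi> Z \<partial>lborel) \<partial>lborel)"
        using nn_integral_exchange'[of "\<lambda>t Z. \<kappa> t * \<Psi> Z" e e] by (simp add: 1 borel_prod[symmetric])
      also have "\<dots> = (\<integral>\<^sup>+y. \<Psi> y \<partial>lborel)"
        using \<kappa>1[of 0] by (simp add: nn_integral_cmult nn_integral_multc)
      finally show ?thesis .
    qed
    have "(\<integral>\<^sup>+\<omega>. J \<omega> \<partial>sphere_measure)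
      \<le> (\<integral>\<^sup>+\<omega>. (\<Sum>e\<in>Basis. ennreal (2 * G) * (indicator {\<omega>. 1 / 2 \<le> \<bar>\<omega> \<bullet> e\<bar>} \<omega> * A e \<omega>)) \<partial>sphere_measure)"
      by (rule nn_integral_sphere_measure_mono) (use step2 in \<open>simp add: mult_ac\<close>)
    also have "\<dots> = (\<Sum>e\<in>Basis. ennreal (2 * G) * (\<integral>\<^sup>+\<omega>. indicator {\<omega>. 1 / 2 \<le> \<bar>\<omega> \<bullet> e\<bar>} \<omega> * A e \<omega> \<partial>sphere_measure))"
      by (subst nn_integral_sum) (auto simp: nn_integral_cmult)
    also have "\<dots> \<le> (\<Sum>e\<in>(Basis :: vec3 set). ennreal (2 * G) * (ennreal (9 * V) * (\<integral>\<^sup>+y. \<Psi> y \<partial>lborel)))"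
      by (intro sum_mono mult_left_mono step5) auto
    also have "\<dots> = 3 * (ennreal (2 * G) * ennreal (9 * V)) * (\<integral>\<^sup>+y. \<Psi> y \<partial>lborel)"
      by (simp add: mult.assoc)
    also have "3 * (ennreal (2 * G) * ennreal (9 * V)) = ennreal (3 * (2 * G * (9 * V)))"
      using G V by (subst (3) ennreal_mult, simp, simp, subst (3) ennreal_mult) simp_all
    finally show ?thesis
      unfolding J_def \<Psi>'_def .
  qed
  show thesis
    by (rule that[OF _ main]) (use G V in auto)
qed

section \<open>Trilinear forms over pairs of velocities\<close>

lemma ennsqrt_ennreal [simp]: "x \<ge> 0 \<Longrightarrow> ennsqrt (ennreal x) = ennreal (sqrt x)"
  by (simp add: ennsqrt_def)

lemma ennsqrt_top [simp]: "ennsqrt top = top"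
  by (simp add: ennsqrt_def)

lemma ennsqrt_square: "(ennsqrt x)\<^sup>2 = x"
  by (cases x) (auto simp: ennreal_power power2_eq_square ennreal_mult[symmetric] ennreal_top_mult)

lemma ennsqrt_power2: "ennsqrt (x\<^sup>2) = x"
  by (cases x) (auto simp: ennreal_power power2_eq_square ennreal_mult[symmetric] ennreal_top_mult)

lemma ennsqrt_mono: "x \<le> y \<Longrightarrow> ennsqrt x \<le> ennsqrt y"
  by (cases x; cases y) (auto simp: top_unique intro!: ennreal_leI)

lemma ennsqrt_mult: "ennsqrt (x * y) = ennsqrt x * ennsqrt y"
proof -
  have "ennsqrt x * ennsqrt y = ennsqrt ((ennsqrt x * ennsqrt y)\<^sup>2)"
    by (simp add: ennsqrt_power2)
  also have "\<dots> = ennsqrt (x * y)"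
    by (simp add: power_mult_distrib ennsqrt_square)
  finally show ?thesis by simp
qed

lemma nn_integral_Cauchy_Schwarz:
  assumes [measurable]: "f \<in> borel_measurable M" "g \<in> borel_measurable M"
  shows "(\<integral>\<^sup>+x. f x * g x \<partial>M) \<le> ennsqrt (\<integral>\<^sup>+x. (f x)\<^sup>2 \<partial>M) * ennsqrt (\<integral>\<^sup>+x. (g x)\<^sup>2 \<partial>M)"
  using ennsqrt_mono[OF Cauchy_Schwarz_nn_integral[OF assms]]
  by (simp add: ennsqrt_power2 ennsqrt_mult)

definition enn_L2 :: "vfun \<Rightarrow> ennreal" where
  "enn_L2 p = ennsqrt (\<integral>\<^sup>+v. (p v)\<^sup>2 \<partial>lborel)"

lemma enn_L2_square: "(\<integral>\<^sup>+v. (p v)\<^sup>2 \<partial>lborel) = (enn_L2 p)\<^sup>2"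
  by (simp add: enn_L2_def ennsqrt_square)

lemma enn_L2_mono: "(\<And>v. p v \<le> q v) \<Longrightarrow> enn_L2 p \<le> enn_L2 q"
  unfolding enn_L2_def by (intro ennsqrt_mono nn_integral_mono power_mono) auto

lemma enn_L2_cmult:
  assumes [measurable]: "meas p"
  shows "enn_L2 (\<lambda>v. c * p v) = c * enn_L2 p"
  by (simp add: enn_L2_def power_mult_distrib nn_integral_cmult ennsqrt_mult ennsqrt_power2)

lemma nn_integral_mult_le_enn_L2:
  assumes [measurable]: "meas p" "meas q"
  shows "(\<integral>\<^sup>+v. p v * q v \<partial>lborel) \<le> enn_L2 p * enn_L2 q"
  unfolding enn_L2_def by (rule nn_integral_Cauchy_Schwarz) auto

section \<open>The integral over pairs of velocities and collision directions\<close>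

definition collI :: "ckernel \<Rightarrow> ennreal" where
  "collI \<Phi> = (\<integral>\<^sup>+v. (\<integral>\<^sup>+u. (\<integral>\<^sup>+\<omega>. \<Phi> u v \<omega> \<partial>sphere_measure) \<partial>lborel) \<partial>lborel)"

abbreviation coll_meas :: "ckernel \<Rightarrow> bool" where
  "coll_meas \<Phi> \<equiv> (\<lambda>(u, v, \<omega>). \<Phi> u v \<omega>) \<in> borel_measurable (borel \<Otimes>\<^sub>M borel \<Otimes>\<^sub>M borel)"

lemma coll_measD [measurable_dest]:
  assumes "coll_meas \<Phi>" and "f \<in> borel_measurable M" "g \<in> borel_measurable M" "h \<in> borel_measurable M"
  shows "(\<lambda>x. \<Phi> (f x) (g x) (h x)) \<in> borel_measurable M"
proof -
  note assms[measurable]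
  have "(\<lambda>x. case (f x, g x, h x) of (u, v, \<omega>) \<Rightarrow> \<Phi> u v \<omega>) \<in> borel_measurable M"
    by (rule measurable_compose[OF _ assms(1)]) measurable
  then show ?thesis by simp
qed

lemma collI_mono:
  assumes "\<And>u v \<omega>. norm \<omega> = 1 \<Longrightarrow> \<Phi> u v \<omega> \<le> \<Psi> u v \<omega>"
  shows "collI \<Phi> \<le> collI \<Psi>"
  unfolding collI_def by (rule nn_integral_mono, rule nn_integral_mono, rule nn_integral_sphere_measure_mono) (rule assms)

lemma collI_cong:
  assumes "\<And>u v \<omega>. norm \<omega> = 1 \<Longrightarrow> \<Phi> u v \<omega> = \<Psi> u v \<omega>"
  shows "collI \<Phi> = collI \<Psi>"
  by (intro antisym collI_mono) (auto simp: assms)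

lemma collI_cmult:
  assumes [measurable]: "coll_meas \<Phi>"
  shows "collI (\<lambda>u v \<omega>. c * \<Phi> u v \<omega>) = c * collI \<Phi>"
  unfolding collI_def by (simp add: nn_integral_cmult)

lemma collI_add:
  assumes [measurable]: "coll_meas \<Phi>" "coll_meas \<Psi>"
  shows "collI (\<lambda>u v \<omega>. \<Phi> u v \<omega> + \<Psi> u v \<omega>) = collI \<Phi> + collI \<Psi>"
  unfolding collI_def by (simp add: nn_integral_add)

lemma sphere_Fubini:
  fixes f :: "vec3 \<Rightarrow> vfun"
  assumes [measurable]: "case_prod f \<in> borel_measurable (borel \<Otimes>\<^sub>M borel)"
  shows "(\<integral>\<^sup>+v. (\<integral>\<^sup>+\<omega>. f v \<omega> \<partial>sphere_measure) \<partial>lborel) = (\<integral>\<^sup>+\<omega>. (\<integral>\<^sup>+v. f v \<omega> \<partial>lborel) \<partial>sphere_measure)"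
proof -
  interpret pair_sigma_finite sphere_measure "lborel :: vec3 measure" ..
  show ?thesis
    by (rule Fubini'[where f = "\<lambda>\<omega> v. f v \<omega>"]) measurable
qed

lemma collI_sphere_outer:
  assumes [measurable]: "coll_meas \<Phi>"
  shows "collI \<Phi> = (\<integral>\<^sup>+\<omega>. (\<integral>\<^sup>+v. (\<integral>\<^sup>+u. \<Phi> u v \<omega> \<partial>lborel) \<partial>lborel) \<partial>sphere_measure)"
proof -
  have "collI \<Phi> = (\<integral>\<^sup>+v. (\<integral>\<^sup>+\<omega>. (\<integral>\<^sup>+u. \<Phi> u v \<omega> \<partial>lborel) \<partial>sphere_measure) \<partial>lborel)"
    unfolding collI_def by (subst sphere_Fubini) auto
  also have "\<dots> = (\<integral>\<^sup>+\<omega>. (\<integral>\<^sup>+v. (\<integral>\<^sup>+u. \<Phi> u v \<omega> \<partial>lborel) \<partial>lborel) \<partial>sphere_measure)"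
    by (rule sphere_Fubini) measurable
  finally show ?thesis .
qed

lemma collI_swap:
  assumes [measurable]: "coll_meas \<Phi>"
  shows "collI \<Phi> = (\<integral>\<^sup>+u. (\<integral>\<^sup>+v. (\<integral>\<^sup>+\<omega>. \<Phi> u v \<omega> \<partial>sphere_measure) \<partial>lborel) \<partial>lborel)"
  unfolding collI_def by (rule lborel_Fubini) measurable

text \<open>With \<omega> outermost the collision acts on (u, v) for each fixed unit vector \<omega>
  and leaves \<omega> itself alone, so the measure preservation for fixed \<omega> carries
  over.\<close>

lemma collI_involution:
  assumes [measurable]: "coll_meas \<Phi>"
  shows "collI (\<lambda>u v \<omega>. \<Phi> (post_u u v \<omega>) (post_v u v \<omega>) \<omega>) = collI \<Phi>"
proof -
  have "collI (\<lambda>u v \<omega>. \<Phi> (post_u u v \<omega>) (post_v u v \<omega>) \<omega>)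
    = (\<integral>\<^sup>+\<omega>. (\<integral>\<^sup>+v. (\<integral>\<^sup>+u. \<Phi> (post_u u v \<omega>) (post_v u v \<omega>) \<omega> \<partial>lborel) \<partial>lborel) \<partial>sphere_measure)"
    by (rule collI_sphere_outer) measurable
  also have "\<dots> = (\<integral>\<^sup>+\<omega>. (\<integral>\<^sup>+v. (\<integral>\<^sup>+u. \<Phi> u v \<omega> \<partial>lborel) \<partial>lborel) \<partial>sphere_measure)"
    by (rule nn_integral_sphere_measure_cong, rule nn_integral_collision) auto
  also have "\<dots> = collI \<Phi>"
    by (rule collI_sphere_outer[symmetric]) measurable
  finally show ?thesis .
qed

text \<open>Reading the iterated integral as one integral over a product measure makes the
  Cauchy-Schwarz inequality for a single measure applicable.\<close>

lemma collI_eq_nn_integral: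
  assumes [measurable]: "coll_meas \<Phi>"
  shows "collI \<Phi> = (\<integral>\<^sup>+(v, u, \<omega>). \<Phi> u v \<omega> \<partial>(lborel \<Otimes>\<^sub>M (lborel \<Otimes>\<^sub>M sphere_measure)))"
proof -
  interpret P: pair_sigma_finite "lborel :: vec3 measure" sphere_measure ..
  have S: "sigma_finite_measure (lborel \<Otimes>\<^sub>M sphere_measure :: (vec3 \<times> vec3) measure)"
    by (rule sigma_finite_pair_measure) unfold_locales
  have "(\<integral>\<^sup>+(v, u, \<omega>). \<Phi> u v \<omega> \<partial>(lborel \<Otimes>\<^sub>M (lborel \<Otimes>\<^sub>M sphere_measure)))
      = (\<integral>\<^sup>+v. (\<integral>\<^sup>+(u, \<omega>). \<Phi> u v \<omega> \<partial>(lborel \<Otimes>\<^sub>M sphere_measure)) \<partial>lborel)"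
    by (subst sigma_finite_measure.nn_integral_fst[OF S, symmetric]) auto
  also have "\<dots> = collI \<Phi>"
    unfolding collI_def by (subst sphere.nn_integral_fst[symmetric]) auto
  finally show ?thesis by simp
qed

lemma collI_Cauchy_Schwarz:
  assumes [measurable]: "coll_meas \<Phi>" "coll_meas \<Psi>"
  shows "collI (\<lambda>u v \<omega>. \<Phi> u v \<omega> * \<Psi> u v \<omega>)
    \<le> ennsqrt (collI (\<lambda>u v \<omega>. (\<Phi> u v \<omega>)\<^sup>2)) * ennsqrt (collI (\<lambda>u v \<omega>. (\<Psi> u v \<omega>)\<^sup>2))"
proof -
  let ?T = "lborel \<Otimes>\<^sub>M (lborel \<Otimes>\<^sub>M sphere_measure)"
  have "(\<integral>\<^sup>+x. (case x of (v, u, \<omega>) \<Rightarrow> \<Phi> u v \<omega>) * (case x of (v, u, \<omega>) \<Rightarrow> \<Psi> u v \<omega>) \<partial>?T)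
    \<le> ennsqrt (\<integral>\<^sup>+x. (case x of (v, u, \<omega>) \<Rightarrow> \<Phi> u v \<omega>)\<^sup>2 \<partial>?T) * ennsqrt (\<integral>\<^sup>+x. (case x of (v, u, \<omega>) \<Rightarrow> \<Psi> u v \<omega>)\<^sup>2 \<partial>?T)"
    by (rule nn_integral_Cauchy_Schwarz) auto
  then show ?thesis
    by (simp add: collI_eq_nn_integral split_beta')
qed

lemma post_diff: "post_v u v \<omega> - post_u u v \<omega> = (v - u) - (2 * (\<omega> \<bullet> (v - u))) *\<^sub>R \<omega>"
  by (simp add: post_u_def post_v_def scaleR_double)

lemma post_inner:
  assumes "norm \<omega> = 1"
  shows "\<omega> \<bullet> (post_v u v \<omega> - post_u u v \<omega>) = - (\<omega> \<bullet> (v - u))"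
proof -
  have 1: "\<omega> \<bullet> \<omega> = 1" using assms by (simp add: norm_eq_1)
  show ?thesis
    unfolding post_diff inner_diff_right[of \<omega> "v - u"] inner_scaleR_right 1 by simp
qed

lemma post_u_post:
  assumes "norm \<omega> = 1"
  shows "post_u (post_u u v \<omega>) (post_v u v \<omega>) \<omega> = u" "post_v (post_u u v \<omega>) (post_v u v \<omega>) \<omega> = v"
  unfolding post_u_def[of "post_u u v \<omega>"] post_v_def[of "post_u u v \<omega>"] post_inner[OF assms]
  by (simp_all add: post_u_def post_v_def)

lemma post_perp:
  assumes "norm \<omega> = 1"
  shows "perp \<omega> (post_v u v \<omega> - post_u u v \<omega>) = perp \<omega> (v - u)"
  unfolding perp_def post_inner[OF assms] unfolding post_diff scaleR_double by simp

lemma norm_perp_square':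
  "norm \<omega> = 1 \<Longrightarrow> (norm X)\<^sup>2 = (\<omega> \<bullet> X)\<^sup>2 + (norm (perp \<omega> X))\<^sup>2"
  unfolding perp_def by (rule norm_perp_square)

lemma post_norm:
  assumes "norm \<omega> = 1"
  shows "norm (post_v u v \<omega> - post_u u v \<omega>) = norm (v - u)"
proof -
  have "(norm (post_v u v \<omega> - post_u u v \<omega>))\<^sup>2 = (norm (v - u))\<^sup>2"
    using norm_perp_square'[OF assms, of "v - u"] norm_perp_square'[OF assms, of "post_v u v \<omega> - post_u u v \<omega>"]
    by (simp only: post_perp[OF assms] post_inner[OF assms] power2_minus)
  then show ?thesis by simp
qed

lemma post_energy:
  assumes "norm \<omega> = 1"
  shows "(norm (post_u u v \<omega>))\<^sup>2 + (norm (post_v u v \<omega>))\<^sup>2 = (norm u)\<^sup>2 + (norm v)\<^sup>2"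
proof -
  have "\<omega> \<bullet> \<omega> = 1" using assms by (simp add: norm_eq_1)
  then show ?thesis
    unfolding power2_norm_eq_inner
    by (simp add: post_u_def post_v_def inner_diff_left inner_diff_right inner_add_left inner_add_right
        inner_commute[of u \<omega>] inner_commute[of v \<omega>] inner_commute[of v u] algebra_simps)
qed

lemma collI_product_bound:
  assumes [measurable]: "meas p" "meas q" "coll_meas k"
    and k: "\<And>u v. (\<integral>\<^sup>+\<omega>. (k u v \<omega>)\<^sup>2 \<partial>sphere_measure) \<le> A"
  shows "collI (\<lambda>u v \<omega>. (p u * q v * k u v \<omega>)\<^sup>2) \<le> A * (enn_L2 p)\<^sup>2 * (enn_L2 q)\<^sup>2"
proof -
  have "collI (\<lambda>u v \<omega>. (p u * q v * k u v \<omega>)\<^sup>2)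
    = (\<integral>\<^sup>+v. (\<integral>\<^sup>+u. (p u)\<^sup>2 * (q v)\<^sup>2 * (\<integral>\<^sup>+\<omega>. (k u v \<omega>)\<^sup>2 \<partial>sphere_measure) \<partial>lborel) \<partial>lborel)"
    unfolding collI_def power_mult_distrib by (subst nn_integral_cmult) auto
  also have "\<dots> \<le> (\<integral>\<^sup>+v. (\<integral>\<^sup>+u. (p u)\<^sup>2 * (q v)\<^sup>2 * A \<partial>lborel) \<partial>lborel)"
    by (intro nn_integral_mono mult_left_mono k) auto
  also have "\<dots> = A * (enn_L2 p)\<^sup>2 * (enn_L2 q)\<^sup>2"
    by (simp add: nn_integral_multc nn_integral_cmult enn_L2_square mult_ac)
  finally show ?thesis .
qed

text \<open>Schur tests: Cauchy--Schwarz with the kernel split into a factor paired with two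
  of the functions and a factor paired with the third, after the collision involution where needed.\<close>

lemma collI_Schur_u:
  assumes [measurable]: "meas p" "meas q" "meas r"
      "coll_meas k1" "coll_meas k2"
    and k1: "\<And>u v. (\<integral>\<^sup>+\<omega>. (k1 u v \<omega>)\<^sup>2 \<partial>sphere_measure) \<le> ennreal A"
    and k2: "\<And>u. (\<integral>\<^sup>+v. (\<integral>\<^sup>+\<omega>. (k2 u v \<omega>)\<^sup>2 \<partial>sphere_measure) \<partial>lborel) \<le> ennreal B"
    and AB: "A \<ge> 0" "B \<ge> 0"
  shows "collI (\<lambda>u v \<omega>. p u * q v * k1 u v \<omega> * (r (post_u u v \<omega>) * k2 (post_u u v \<omega>) (post_v u v \<omega>) \<omega>))
    \<le> ennreal (sqrt A * sqrt B) * (enn_L2 p * enn_L2 q * enn_L2 r)"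
proof -
  have "collI (\<lambda>u v \<omega>. (r (post_u u v \<omega>) * k2 (post_u u v \<omega>) (post_v u v \<omega>) \<omega>)\<^sup>2)
      = collI (\<lambda>u v \<omega>. (r u * k2 u v \<omega>)\<^sup>2)"
    by (rule collI_involution) measurable
  also have "\<dots> = (\<integral>\<^sup>+u. (\<integral>\<^sup>+v. (\<integral>\<^sup>+\<omega>. (r u * k2 u v \<omega>)\<^sup>2 \<partial>sphere_measure) \<partial>lborel) \<partial>lborel)"
    by (rule collI_swap) measurable
  also have "\<dots> = (\<integral>\<^sup>+u. (r u)\<^sup>2 * (\<integral>\<^sup>+v. (\<integral>\<^sup>+\<omega>. (k2 u v \<omega>)\<^sup>2 \<partial>sphere_measure) \<partial>lborel) \<partial>lborel)"
    by (simp add: power_mult_distrib nn_integral_cmult)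
  also have "\<dots> \<le> (\<integral>\<^sup>+u. (r u)\<^sup>2 * ennreal B \<partial>lborel)"
    by (intro nn_integral_mono mult_left_mono k2) auto
  also have "\<dots> = ennreal B * (enn_L2 r)\<^sup>2"
    by (simp add: nn_integral_cmult enn_L2_square mult_ac)
  finally have 2: "collI (\<lambda>u v \<omega>. (r (post_u u v \<omega>) * k2 (post_u u v \<omega>) (post_v u v \<omega>) \<omega>)\<^sup>2) \<le> ennreal B * (enn_L2 r)\<^sup>2" .
  have "collI (\<lambda>u v \<omega>. p u * q v * k1 u v \<omega> * (r (post_u u v \<omega>) * k2 (post_u u v \<omega>) (post_v u v \<omega>) \<omega>))
    \<le> ennsqrt (collI (\<lambda>u v \<omega>. (p u * q v * k1 u v \<omega>)\<^sup>2))
      * ennsqrt (collI (\<lambda>u v \<omega>. (r (post_u u v \<omega>) * k2 (post_u u v \<omega>) (post_v u v \<omega>) \<omega>)\<^sup>2))"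
    by (rule collI_Cauchy_Schwarz) measurable
  also have "\<dots> \<le> ennsqrt (ennreal A * (enn_L2 p)\<^sup>2 * (enn_L2 q)\<^sup>2) * ennsqrt (ennreal B * (enn_L2 r)\<^sup>2)"
    by (intro mult_mono ennsqrt_mono collI_product_bound k1 2) auto
  also have "\<dots> = ennreal (sqrt A * sqrt B) * (enn_L2 p * enn_L2 q * enn_L2 r)"
    using AB by (simp add: ennsqrt_mult ennsqrt_power2 ennreal_mult mult_ac)
  finally show ?thesis .
qed

lemma collI_Schur_v:
  assumes [measurable]: "meas p" "meas q" "meas r"
      "coll_meas k1" "coll_meas k2"
    and k1: "\<And>u v. (\<integral>\<^sup>+\<omega>. (k1 u v \<omega>)\<^sup>2 \<partial>sphere_measure) \<le> ennreal A"
    and k2: "\<And>v. (\<integral>\<^sup>+u. (\<integral>\<^sup>+\<omega>. (k2 u v \<omega>)\<^sup>2 \<partial>sphere_measure) \<partial>lborel) \<le> ennreal B"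
    and AB: "A \<ge> 0" "B \<ge> 0"
  shows "collI (\<lambda>u v \<omega>. p u * q v * k1 u v \<omega> * (r (post_v u v \<omega>) * k2 (post_u u v \<omega>) (post_v u v \<omega>) \<omega>))
    \<le> ennreal (sqrt A * sqrt B) * (enn_L2 p * enn_L2 q * enn_L2 r)"
proof -
  have "collI (\<lambda>u v \<omega>. (r (post_v u v \<omega>) * k2 (post_u u v \<omega>) (post_v u v \<omega>) \<omega>)\<^sup>2)
      = collI (\<lambda>u v \<omega>. (r v * k2 u v \<omega>)\<^sup>2)"
    by (rule collI_involution) measurable
  also have "\<dots> = (\<integral>\<^sup>+v. (r v)\<^sup>2 * (\<integral>\<^sup>+u. (\<integral>\<^sup>+\<omega>. (k2 u v \<omega>)\<^sup>2 \<partial>sphere_measure) \<partial>lborel) \<partial>lborel)"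
    unfolding collI_def by (simp add: power_mult_distrib nn_integral_cmult)
  also have "\<dots> \<le> (\<integral>\<^sup>+v. (r v)\<^sup>2 * ennreal B \<partial>lborel)"
    by (intro nn_integral_mono mult_left_mono k2) auto
  also have "\<dots> = ennreal B * (enn_L2 r)\<^sup>2"
    by (simp add: nn_integral_cmult enn_L2_square mult_ac)
  finally have 2: "collI (\<lambda>u v \<omega>. (r (post_v u v \<omega>) * k2 (post_u u v \<omega>) (post_v u v \<omega>) \<omega>)\<^sup>2) \<le> ennreal B * (enn_L2 r)\<^sup>2" .
  have "collI (\<lambda>u v \<omega>. p u * q v * k1 u v \<omega> * (r (post_v u v \<omega>) * k2 (post_u u v \<omega>) (post_v u v \<omega>) \<omega>))
    \<le> ennsqrt (collI (\<lambda>u v \<omega>. (p u * q v * k1 u v \<omega>)\<^sup>2))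
      * ennsqrt (collI (\<lambda>u v \<omega>. (r (post_v u v \<omega>) * k2 (post_u u v \<omega>) (post_v u v \<omega>) \<omega>)\<^sup>2))"
    by (rule collI_Cauchy_Schwarz) measurable
  also have "\<dots> \<le> ennsqrt (ennreal A * (enn_L2 p)\<^sup>2 * (enn_L2 q)\<^sup>2) * ennsqrt (ennreal B * (enn_L2 r)\<^sup>2)"
    by (intro mult_mono ennsqrt_mono collI_product_bound k1 2) auto
  also have "\<dots> = ennreal (sqrt A * sqrt B) * (enn_L2 p * enn_L2 q * enn_L2 r)"
    using AB by (simp add: ennsqrt_mult ennsqrt_power2 ennreal_mult mult_ac)
  finally show ?thesis .
qed

section \<open>Bounded trilinear and quadrilinear forms\<close>

lemma sq_exp: "(exp (x::real))\<^sup>2 = exp (2 * x)"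
  by (simp add: power2_eq_square exp_add[symmetric])

lemma sq_gauss: "(exp (- (c * t)))\<^sup>2 = exp (- (2 * c * t :: real))"
  by (simp add: sq_exp)

text \<open>The kernel factor paired with p and q is 1. In the other factor the involution moves r
  to u and the Gaussian to v, where it is integrated out.\<close>

lemma form_gauss_u_bound:
  assumes c: "c > 0"
  shows "\<exists>C. \<forall>p q r. meas p \<longrightarrow> meas q \<longrightarrow> meas r \<longrightarrow>
    collI (\<lambda>u v \<omega>. p u * q v * r (post_u u v \<omega>) * ennreal (exp (- c * (norm (post_v u v \<omega>))\<^sup>2)))
      \<le> ennreal C * (enn_L2 p * enn_L2 q * enn_L2 r)"
proof -
  obtain G where G: "G \<ge> 0" "(\<integral>\<^sup>+(x::vec3). ennreal (exp (- (2 * c) * (norm x)\<^sup>2)) \<partial>lborel) = ennreal G"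
    using nn_integral_gaussian_finite[of "2 * c"] c by auto
  define k where "k u v \<omega> = ennreal (exp (- c * (norm v)\<^sup>2))" for u v \<omega> :: vec3
  have [measurable]: "coll_meas k" unfolding k_def by measurable
  have k: "(\<integral>\<^sup>+v. (\<integral>\<^sup>+\<omega>. (k u v \<omega>)\<^sup>2 \<partial>sphere_measure) \<partial>lborel) \<le> ennreal (4 * pi * G)" for u
  proof -
    have "(\<integral>\<^sup>+v. (\<integral>\<^sup>+\<omega>. (k u v \<omega>)\<^sup>2 \<partial>sphere_measure) \<partial>lborel)
      = (\<integral>\<^sup>+(v::vec3). ennreal (4 * pi) * ennreal (exp (- (2 * c) * (norm v)\<^sup>2)) \<partial>lborel)"
      by (simp add: k_def ennreal_power sq_gauss emeasure_sphere_measure_UNIV mult.commute)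
    also have "\<dots> = ennreal (4 * pi) * ennreal G"
      unfolding G(2)[symmetric] by (rule nn_integral_cmult) measurable
    finally show ?thesis using G by (simp add: ennreal_mult)
  qed
  have "collI (\<lambda>u v \<omega>. p u * q v * r (post_u u v \<omega>) * ennreal (exp (- c * (norm (post_v u v \<omega>))\<^sup>2)))
      \<le> ennreal (sqrt (4 * pi) * sqrt (4 * pi * G)) * (enn_L2 p * enn_L2 q * enn_L2 r)"
    if [measurable]: "meas p" "meas q" "meas r" for p q r
    using collI_Schur_u[of p q r "\<lambda>_ _ _. 1" k "4 * pi" "4 * pi * G"] k G
    by (simp add: emeasure_sphere_measure_UNIV k_def mult.assoc)
  then show ?thesis by blast
qed

lemma form_gauss_v_bound:
  assumes c: "c > 0"
  shows "\<exists>C. \<forall>p q r. meas p \<longrightarrow> meas q \<longrightarrow> meas r \<longrightarrow>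
    collI (\<lambda>u v \<omega>. p u * q v * r (post_v u v \<omega>) * ennreal (exp (- c * (norm (post_u u v \<omega>))\<^sup>2)))
      \<le> ennreal C * (enn_L2 p * enn_L2 q * enn_L2 r)"
proof -
  obtain G where G: "G \<ge> 0" "(\<integral>\<^sup>+(x::vec3). ennreal (exp (- (2 * c) * (norm x)\<^sup>2)) \<partial>lborel) = ennreal G"
    using nn_integral_gaussian_finite[of "2 * c"] c by auto
  define k where "k u v \<omega> = ennreal (exp (- c * (norm u)\<^sup>2))" for u v \<omega> :: vec3
  have [measurable]: "coll_meas k" unfolding k_def by measurable
  have k: "(\<integral>\<^sup>+u. (\<integral>\<^sup>+\<omega>. (k u v \<omega>)\<^sup>2 \<partial>sphere_measure) \<partial>lborel) \<le> ennreal (4 * pi * G)" for v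
  proof -
    have "(\<integral>\<^sup>+u. (\<integral>\<^sup>+\<omega>. (k u v \<omega>)\<^sup>2 \<partial>sphere_measure) \<partial>lborel)
      = (\<integral>\<^sup>+(u::vec3). ennreal (4 * pi) * ennreal (exp (- (2 * c) * (norm u)\<^sup>2)) \<partial>lborel)"
      by (simp add: k_def ennreal_power sq_gauss emeasure_sphere_measure_UNIV mult.commute)
    also have "\<dots> = ennreal (4 * pi) * ennreal G"
      unfolding G(2)[symmetric] by (rule nn_integral_cmult) measurable
    finally show ?thesis using G by (simp add: ennreal_mult)
  qed
  have "collI (\<lambda>u v \<omega>. p u * q v * r (post_v u v \<omega>) * ennreal (exp (- c * (norm (post_u u v \<omega>))\<^sup>2)))
      \<le> ennreal (sqrt (4 * pi) * sqrt (4 * pi * G)) * (enn_L2 p * enn_L2 q * enn_L2 r)"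
    if [measurable]: "meas p" "meas q" "meas r" for p q r
    using collI_Schur_v[of p q r "\<lambda>_ _ _. 1" k "4 * pi" "4 * pi * G"] k G
    by (simp add: emeasure_sphere_measure_UNIV k_def mult.assoc)
  then show ?thesis by blast
qed

text \<open>This is the preceding form seen through the collision involution, which interchanges (u,
  v) with (u', v').\<close>

lemma form_gain_bound:
  assumes c: "c > 0"
  shows "\<exists>C. \<forall>p q r. meas p \<longrightarrow> meas q \<longrightarrow> meas r \<longrightarrow>
    collI (\<lambda>u v \<omega>. p (post_u u v \<omega>) * q (post_v u v \<omega>) * r v * ennreal (exp (- c * (norm u)\<^sup>2)))
      \<le> ennreal C * (enn_L2 p * enn_L2 q * enn_L2 r)"
proof -
  obtain C where C: "\<And>p q r. meas p \<Longrightarrow> meas q \<Longrightarrow> meas r \<Longrightarrow>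
    collI (\<lambda>u v \<omega>. p u * q v * r (post_v u v \<omega>) * ennreal (exp (- c * (norm (post_u u v \<omega>))\<^sup>2)))
      \<le> ennreal C * (enn_L2 p * enn_L2 q * enn_L2 r)"
    using form_gauss_v_bound[OF c] by blast
  have "collI (\<lambda>u v \<omega>. p (post_u u v \<omega>) * q (post_v u v \<omega>) * r v * ennreal (exp (- c * (norm u)\<^sup>2)))
      \<le> ennreal C * (enn_L2 p * enn_L2 q * enn_L2 r)"
    if [measurable]: "meas p" "meas q" "meas r" for p q r
  proof -
    have "collI (\<lambda>u v \<omega>. p (post_u u v \<omega>) * q (post_v u v \<omega>) * r v * ennreal (exp (- c * (norm u)\<^sup>2)))
      = collI (\<lambda>u v \<omega>. p (post_u u v \<omega>) * q (post_v u v \<omega>) * r (post_v (post_u u v \<omega>) (post_v u v \<omega>) \<omega>)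
          * ennreal (exp (- c * (norm (post_u (post_u u v \<omega>) (post_v u v \<omega>) \<omega>))\<^sup>2)))"
      by (rule collI_cong) (simp add: post_u_post)
    also have "\<dots> = collI (\<lambda>u v \<omega>. p u * q v * r (post_v u v \<omega>) * ennreal (exp (- c * (norm (post_u u v \<omega>))\<^sup>2)))"
      by (rule collI_involution) measurable
    also have "\<dots> \<le> ennreal C * (enn_L2 p * enn_L2 q * enn_L2 r)"
      by (rule C) measurable
    finally show ?thesis .
  qed
  then show ?thesis by blast
qed

text \<open>No velocity after the collision occurs, so the integral factorizes into 4 pi, the
  pairing of q with r, and the pairing of p with the Gaussian.\<close>

lemma form_loss_bound:
  assumes c: "c > 0"
  shows "\<exists>C. \<forall>p q r. meas p \<longrightarrow> meas q \<longrightarrow> meas r \<longrightarrow>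
    collI (\<lambda>u v \<omega>. p u * q v * r v * ennreal (exp (- c * (norm u)\<^sup>2)))
      \<le> ennreal C * (enn_L2 p * enn_L2 q * enn_L2 r)"
proof -
  obtain G where G: "G \<ge> 0" "(\<integral>\<^sup>+(x::vec3). ennreal (exp (- (2 * c) * (norm x)\<^sup>2)) \<partial>lborel) = ennreal G"
    using nn_integral_gaussian_finite[of "2 * c"] c by auto
  have "collI (\<lambda>u v \<omega>. p u * q v * r v * ennreal (exp (- c * (norm u)\<^sup>2)))
      \<le> ennreal (4 * pi * sqrt G) * (enn_L2 p * enn_L2 q * enn_L2 r)"
    if [measurable]: "meas p" "meas q" "meas r" for p q r
  proof -
    have "collI (\<lambda>u v \<omega>. p u * q v * r v * ennreal (exp (- c * (norm u)\<^sup>2)))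
      = (\<integral>\<^sup>+v. (\<integral>\<^sup>+u. (q v * r v * ennreal (4 * pi)) * (p u * ennreal (exp (- c * (norm u)\<^sup>2))) \<partial>lborel) \<partial>lborel)"
      unfolding collI_def by (simp add: emeasure_sphere_measure_UNIV mult_ac)
    also have "\<dots> = ennreal (4 * pi) * (\<integral>\<^sup>+v. q v * r v \<partial>lborel) * (\<integral>\<^sup>+u. p u * ennreal (exp (- c * (norm u)\<^sup>2)) \<partial>lborel)"
      by (subst nn_integral_cmult, simp, subst nn_integral_multc, simp, subst nn_integral_multc) (auto simp: mult_ac)
    also have "\<dots> \<le> ennreal (4 * pi) * (enn_L2 q * enn_L2 r) * (enn_L2 p * enn_L2 (\<lambda>u. ennreal (exp (- c * (norm u)\<^sup>2))))"
      by (intro mult_mono nn_integral_mult_le_enn_L2) auto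
    also have "enn_L2 (\<lambda>u. ennreal (exp (- c * (norm u)\<^sup>2))) = ennreal (sqrt G)"
      using G by (simp add: enn_L2_def ennreal_power sq_gauss)
    finally show ?thesis
      using G by (simp add: ennreal_mult mult_ac)
  qed
  then show ?thesis by blast
qed

text \<open>Cauchy-Schwarz separates (p, q) from (r, h). Moved by the involution, the square of the
  first factor carries the kernel (\<omega> \<bullet> X)^2 exp (-2 c |u + (\<omega> \<bullet> X)
  \<omega>|^2), whose average over the sphere is bounded. The growth of |\<omega> \<bullet> (v - u)|
  thus costs no weight and all four norms are plain L2 norms.\<close>

lemma form_quad_bound:
  assumes c: "c > 0"
  shows "\<exists>C. \<forall>p q r h. meas p \<longrightarrow> meas q \<longrightarrow> meas r \<longrightarrow> meas h \<longrightarrow>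
    collI (\<lambda>u v \<omega>. p (post_u u v \<omega>) * q (post_v u v \<omega>) * r u * h v * ennreal (\<bar>\<omega> \<bullet> (v - u)\<bar> * exp (- c * (norm u)\<^sup>2)))
      \<le> ennreal C * (enn_L2 p * enn_L2 q * enn_L2 r * enn_L2 h)"
proof -
  obtain A where A: "A \<ge> 0"
    "\<And>a X. (\<integral>\<^sup>+\<omega>. ennreal ((\<omega> \<bullet> X)\<^sup>2 * exp (- (2 * c) * (norm (a + (\<omega> \<bullet> X) *\<^sub>R \<omega>))\<^sup>2)) \<partial>sphere_measure) \<le> ennreal A"
    using c by (rule_tac sphere_trace_gaussian_bound[of "2 * c"]) (simp, rule that)
  define k where "k u v \<omega> = ennreal (\<bar>\<omega> \<bullet> (v - u)\<bar> * exp (- c * (norm (post_u u v \<omega>))\<^sup>2))" for u v \<omega> :: vec3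
  have [measurable]: "coll_meas k" unfolding k_def by measurable
  have k: "(\<integral>\<^sup>+\<omega>. (k u v \<omega>)\<^sup>2 \<partial>sphere_measure) \<le> ennreal A" for u v
    using A(2)[of "v - u" u] by (simp add: k_def ennreal_power power_mult_distrib sq_gauss post_u_def)
  have "collI (\<lambda>u v \<omega>. p (post_u u v \<omega>) * q (post_v u v \<omega>) * r u * h v * ennreal (\<bar>\<omega> \<bullet> (v - u)\<bar> * exp (- c * (norm u)\<^sup>2)))
      \<le> ennreal (sqrt A * sqrt (4 * pi)) * (enn_L2 p * enn_L2 q * enn_L2 r * enn_L2 h)"
    if [measurable]: "meas p" "meas q" "meas r" "meas h" for p q r h
  proof -
    have "collI (\<lambda>u v \<omega>. p (post_u u v \<omega>) * q (post_v u v \<omega>) * r u * h v * ennreal (\<bar>\<omega> \<bullet> (v - u)\<bar> * exp (- c * (norm u)\<^sup>2)))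
      = collI (\<lambda>u v \<omega>. (p (post_u u v \<omega>) * q (post_v u v \<omega>) * k (post_u u v \<omega>) (post_v u v \<omega>) \<omega>) * (r u * h v * 1))"
      by (rule collI_cong) (simp add: k_def post_u_post post_inner mult_ac)
    also have "\<dots> \<le> ennsqrt (collI (\<lambda>u v \<omega>. (p (post_u u v \<omega>) * q (post_v u v \<omega>) * k (post_u u v \<omega>) (post_v u v \<omega>) \<omega>)\<^sup>2))
       * ennsqrt (collI (\<lambda>u v \<omega>. (r u * h v * 1)\<^sup>2))"
      by (rule collI_Cauchy_Schwarz) measurable
    also have "collI (\<lambda>u v \<omega>. (p (post_u u v \<omega>) * q (post_v u v \<omega>) * k (post_u u v \<omega>) (post_v u v \<omega>) \<omega>)\<^sup>2)
      = collI (\<lambda>u v \<omega>. (p u * q v * k u v \<omega>)\<^sup>2)"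
      by (rule collI_involution) measurable
    also have "ennsqrt (collI (\<lambda>u v \<omega>. (p u * q v * k u v \<omega>)\<^sup>2)) * ennsqrt (collI (\<lambda>u v \<omega>. (r u * h v * 1)\<^sup>2))
      \<le> ennsqrt (ennreal A * (enn_L2 p)\<^sup>2 * (enn_L2 q)\<^sup>2) * ennsqrt (ennreal (4 * pi) * (enn_L2 r)\<^sup>2 * (enn_L2 h)\<^sup>2)"
      by (intro mult_mono ennsqrt_mono collI_product_bound k) (auto simp: emeasure_sphere_measure_UNIV)
    also have "\<dots> = ennreal (sqrt A) * ennreal (sqrt (4 * pi)) * (enn_L2 p * enn_L2 q * enn_L2 r * enn_L2 h)"
      by (simp only: ennsqrt_mult ennsqrt_power2 ennsqrt_ennreal[OF A(1)] ennsqrt_ennreal[of "4 * pi", simplified] mult_ac) simp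
    also have "\<dots> = ennreal (sqrt A * sqrt (4 * pi)) * (enn_L2 p * enn_L2 q * enn_L2 r * enn_L2 h)"
      using A by (subst ennreal_mult) simp_all
    finally show ?thesis .
  qed
  then show ?thesis by blast
qed

lemma nn_integral_bracket4_shift:
  "(\<integral>\<^sup>+(v::vec3). ennreal (1 / (1 + norm (v - u)) ^ 4) \<partial>lborel) \<le> ennreal (4 * pi)"
  "(\<integral>\<^sup>+(v::vec3). ennreal (1 / (1 + norm (u - v)) ^ 4) \<partial>lborel) \<le> ennreal (4 * pi)"
  using nn_integral_bracket4_bound
    nn_integral_lborel_translate[of "\<lambda>x::vec3. ennreal (1 / (1 + norm x) ^ 4)" "- u"]
  by (simp_all add: norm_minus_commute[of u])

text \<open>The Gaussian in \<omega> \<bullet> X has spherical average of order 1 / (1 + |X|). The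
  kernel is split as \<open>k1\<close> times \<open>k2\<close> so that the average of the square of
  \<open>k1\<close> is bounded and that of \<open>k2\<close> is of order (1 + |X|)^(-4), which is
  integrable in three dimensions. Since \<open>k2\<close> depends only on quantities conserved by
  the collision, it may be attached to (u', v') and hence to r.\<close>

lemma form_inner_bound:
  assumes c: "c > 0"
  shows "\<exists>C. \<forall>p q r. meas p \<longrightarrow> meas q \<longrightarrow> meas r \<longrightarrow>
    collI (\<lambda>u v \<omega>. p u * q v * r (post_u u v \<omega>) * ennreal (exp (- c * (\<omega> \<bullet> (v - u))\<^sup>2) / (1 + norm (v - u))))
      \<le> ennreal C * (enn_L2 p * enn_L2 q * enn_L2 r)"
proof -
  obtain A where A: "A \<ge> 0"
    "\<And>X. (\<integral>\<^sup>+\<omega>. ennreal ((1 + norm X) * exp (- c * (\<omega> \<bullet> X)\<^sup>2)) \<partial>sphere_measure) \<le> ennreal A"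
    by (rule sphere_inner_gaussian_bound[OF c]) (rule that)
  define k1 where "k1 u v \<omega> = ennreal (sqrt ((1 + norm (v - u)) * exp (- c * (\<omega> \<bullet> (v - u))\<^sup>2)))" for u v \<omega> :: vec3
  define k2 where "k2 u v \<omega> = ennreal (sqrt (exp (- c * (\<omega> \<bullet> (v - u))\<^sup>2) / (1 + norm (v - u)) ^ 3))" for u v \<omega> :: vec3
  have [measurable]: "coll_meas k1" "coll_meas k2" unfolding k1_def k2_def by measurable
  have k1: "(\<integral>\<^sup>+\<omega>. (k1 u v \<omega>)\<^sup>2 \<partial>sphere_measure) \<le> ennreal A" for u v
    using A(2)[of "v - u"] by (simp add: k1_def ennreal_power)
  have k2: "(\<integral>\<^sup>+v. (\<integral>\<^sup>+\<omega>. (k2 u v \<omega>)\<^sup>2 \<partial>sphere_measure) \<partial>lborel) \<le> ennreal (4 * pi * A)" for u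
  proof -
    have "(\<integral>\<^sup>+\<omega>. (k2 u v \<omega>)\<^sup>2 \<partial>sphere_measure) \<le> ennreal (1 / (1 + norm (v - u)) ^ 4) * ennreal A" for v
    proof -
      have "(k2 u v \<omega>)\<^sup>2 = ennreal (1 / (1 + norm (v - u)) ^ 4) * (k1 u v \<omega>)\<^sup>2" for \<omega>
      proof -
        have pos: "1 + norm (v - u) > 0" by (simp add: add_pos_nonneg)
        have "exp (- c * (\<omega> \<bullet> (v - u))\<^sup>2) / (1 + norm (v - u)) ^ 3
          = 1 / (1 + norm (v - u)) ^ 4 * ((1 + norm (v - u)) * exp (- c * (\<omega> \<bullet> (v - u))\<^sup>2))"
          using pos by (simp add: power3_eq_cube power4_eq_xxxx)
        then show ?thesis
          unfolding k1_def k2_def by (simp add: ennreal_power ennreal_mult[symmetric])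
      qed
      then have "(\<integral>\<^sup>+\<omega>. (k2 u v \<omega>)\<^sup>2 \<partial>sphere_measure)
          = ennreal (1 / (1 + norm (v - u)) ^ 4) * (\<integral>\<^sup>+\<omega>. (k1 u v \<omega>)\<^sup>2 \<partial>sphere_measure)"
        by (simp add: nn_integral_cmult)
      also have "\<dots> \<le> ennreal (1 / (1 + norm (v - u)) ^ 4) * ennreal A"
        by (intro mult_left_mono k1) auto
      finally show ?thesis .
    qed
    then have "(\<integral>\<^sup>+v. (\<integral>\<^sup>+\<omega>. (k2 u v \<omega>)\<^sup>2 \<partial>sphere_measure) \<partial>lborel)
      \<le> (\<integral>\<^sup>+v. ennreal (1 / (1 + norm (v - u)) ^ 4) * ennreal A \<partial>lborel)"
      by (intro nn_integral_mono)
    also have "\<dots> = (\<integral>\<^sup>+v. ennreal (1 / (1 + norm (v - u)) ^ 4) \<partial>lborel) * ennreal A"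
      by (rule nn_integral_multc) measurable
    also have "\<dots> \<le> ennreal (4 * pi) * ennreal A"
      by (intro mult_right_mono nn_integral_bracket4_shift) auto
    finally show ?thesis using A by (simp add: ennreal_mult)
  qed
  have kk: "k1 u v \<omega> * k2 u v \<omega> = ennreal (exp (- c * (\<omega> \<bullet> (v - u))\<^sup>2) / (1 + norm (v - u)))" for u v \<omega>
  proof -
    have pos: "1 + norm (v - u) > 0" by (simp add: add_pos_nonneg)
    have "sqrt ((1 + norm (v - u)) * exp (- c * (\<omega> \<bullet> (v - u))\<^sup>2)) * sqrt (exp (- c * (\<omega> \<bullet> (v - u))\<^sup>2) / (1 + norm (v - u)) ^ 3)
      = sqrt ((exp (- c * (\<omega> \<bullet> (v - u))\<^sup>2) / (1 + norm (v - u)))\<^sup>2)"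
      unfolding real_sqrt_mult[symmetric] using pos by (intro arg_cong[of _ _ sqrt]) (simp add: divide_simps power2_eq_square power3_eq_cube)
    also have "\<dots> = exp (- c * (\<omega> \<bullet> (v - u))\<^sup>2) / (1 + norm (v - u))"
      using pos by (subst real_sqrt_abs) simp
    finally show ?thesis
      unfolding k1_def k2_def by (simp add: ennreal_mult[symmetric])
  qed
  have k2': "k2 (post_u u v \<omega>) (post_v u v \<omega>) \<omega> = k2 u v \<omega>" if "norm \<omega> = 1" for u v \<omega>
    using that by (simp add: k2_def post_inner post_norm)
  have "collI (\<lambda>u v \<omega>. p u * q v * r (post_u u v \<omega>) * ennreal (exp (- c * (\<omega> \<bullet> (v - u))\<^sup>2) / (1 + norm (v - u))))
      \<le> ennreal (sqrt A * sqrt (4 * pi * A)) * (enn_L2 p * enn_L2 q * enn_L2 r)"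
    if [measurable]: "meas p" "meas q" "meas r" for p q r
  proof -
    have "collI (\<lambda>u v \<omega>. p u * q v * r (post_u u v \<omega>) * ennreal (exp (- c * (\<omega> \<bullet> (v - u))\<^sup>2) / (1 + norm (v - u))))
      = collI (\<lambda>u v \<omega>. p u * q v * k1 u v \<omega> * (r (post_u u v \<omega>) * k2 (post_u u v \<omega>) (post_v u v \<omega>) \<omega>))"
      unfolding kk[symmetric] by (rule collI_cong) (simp add: k2' mult_ac)
    also have "\<dots> \<le> ennreal (sqrt A * sqrt (4 * pi * A)) * (enn_L2 p * enn_L2 q * enn_L2 r)"
      by (rule collI_Schur_u) (use A k1 k2 in auto)
    finally show ?thesis .
  qed
  then show ?thesis by blast
qed

text \<open>The same splitting as for \<open>form_inner_bound\<close>; the Gaussian in the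
  orthogonal component has the better average (1 + |X|)^(-2), so the kernel needs no additional
  factor 1 / (1 + |X|).\<close>

lemma form_perp_bound:
  assumes c: "c > 0"
  shows "\<exists>C. \<forall>p q r. meas p \<longrightarrow> meas q \<longrightarrow> meas r \<longrightarrow>
    collI (\<lambda>u v \<omega>. p u * q v * r (post_v u v \<omega>) * ennreal (exp (- c * (norm (perp \<omega> (v - u)))\<^sup>2)))
      \<le> ennreal C * (enn_L2 p * enn_L2 q * enn_L2 r)"
proof -
  obtain A where A: "A \<ge> 0"
    "\<And>X. (\<integral>\<^sup>+\<omega>. ennreal ((1 + norm X)\<^sup>2 * exp (- c * (norm (X - (\<omega> \<bullet> X) *\<^sub>R \<omega>))\<^sup>2)) \<partial>sphere_measure) \<le> ennreal A"
    by (rule sphere_perp_gaussian_bound[OF c]) (rule that)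
  define k1 where "k1 u v \<omega> = ennreal ((1 + norm (v - u)) * exp (- (c / 2) * (norm (perp \<omega> (v - u)))\<^sup>2))" for u v \<omega> :: vec3
  define k2 where "k2 u v \<omega> = ennreal (exp (- (c / 2) * (norm (perp \<omega> (v - u)))\<^sup>2) / (1 + norm (v - u)))" for u v \<omega> :: vec3
  have [measurable]: "coll_meas k1" "coll_meas k2" unfolding k1_def k2_def by measurable
  have k1: "(\<integral>\<^sup>+\<omega>. (k1 u v \<omega>)\<^sup>2 \<partial>sphere_measure) \<le> ennreal A" for u v
    using A(2)[of "v - u"] by (simp add: k1_def perp_def ennreal_power power_mult_distrib sq_exp)
  have k2: "(\<integral>\<^sup>+u. (\<integral>\<^sup>+\<omega>. (k2 u v \<omega>)\<^sup>2 \<partial>sphere_measure) \<partial>lborel) \<le> ennreal (4 * pi * A)" for v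
  proof -
    have "(\<integral>\<^sup>+\<omega>. (k2 u v \<omega>)\<^sup>2 \<partial>sphere_measure) \<le> ennreal (1 / (1 + norm (v - u)) ^ 4) * ennreal A" for u
    proof -
      have "(k2 u v \<omega>)\<^sup>2 = ennreal (1 / (1 + norm (v - u)) ^ 4) * (k1 u v \<omega>)\<^sup>2" for \<omega>
      proof -
        have pos: "1 + norm (v - u) > 0" by (simp add: add_pos_nonneg)
        have "(exp (- (c / 2) * (norm (perp \<omega> (v - u)))\<^sup>2) / (1 + norm (v - u)))\<^sup>2
          = 1 / (1 + norm (v - u)) ^ 4 * ((1 + norm (v - u)) * exp (- (c / 2) * (norm (perp \<omega> (v - u)))\<^sup>2))\<^sup>2"
          using pos by (simp add: power2_eq_square power4_eq_xxxx)
        then show ?thesis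
          unfolding k1_def k2_def by (simp add: ennreal_power ennreal_mult[symmetric])
      qed
      then have "(\<integral>\<^sup>+\<omega>. (k2 u v \<omega>)\<^sup>2 \<partial>sphere_measure)
          = ennreal (1 / (1 + norm (v - u)) ^ 4) * (\<integral>\<^sup>+\<omega>. (k1 u v \<omega>)\<^sup>2 \<partial>sphere_measure)"
        by (simp add: nn_integral_cmult)
      also have "\<dots> \<le> ennreal (1 / (1 + norm (v - u)) ^ 4) * ennreal A"
        by (intro mult_left_mono k1) auto
      finally show ?thesis .
    qed
    then have "(\<integral>\<^sup>+u. (\<integral>\<^sup>+\<omega>. (k2 u v \<omega>)\<^sup>2 \<partial>sphere_measure) \<partial>lborel)
      \<le> (\<integral>\<^sup>+u. ennreal (1 / (1 + norm (v - u)) ^ 4) * ennreal A \<partial>lborel)"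
      by (intro nn_integral_mono)
    also have "\<dots> = (\<integral>\<^sup>+u. ennreal (1 / (1 + norm (v - u)) ^ 4) \<partial>lborel) * ennreal A"
      by (rule nn_integral_multc) measurable
    also have "\<dots> \<le> ennreal (4 * pi) * ennreal A"
      by (intro mult_right_mono nn_integral_bracket4_shift) auto
    finally show ?thesis using A by (simp add: ennreal_mult)
  qed
  have kk: "k1 u v \<omega> * k2 u v \<omega> = ennreal (exp (- c * (norm (perp \<omega> (v - u)))\<^sup>2))" for u v \<omega>
  proof -
    have "1 + norm (v - u) > 0" by (simp add: add_pos_nonneg)
    moreover have "exp (- c * (norm (perp \<omega> (v - u)))\<^sup>2) = (exp (- (c / 2) * (norm (perp \<omega> (v - u)))\<^sup>2))\<^sup>2"
      by (simp add: sq_exp)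
    ultimately show ?thesis
      unfolding k1_def k2_def by (simp add: ennreal_mult[symmetric] power2_eq_square)
  qed
  have k2': "k2 (post_u u v \<omega>) (post_v u v \<omega>) \<omega> = k2 u v \<omega>" if "norm \<omega> = 1" for u v \<omega>
    using that by (simp add: k2_def post_perp post_norm)
  have "collI (\<lambda>u v \<omega>. p u * q v * r (post_v u v \<omega>) * ennreal (exp (- c * (norm (perp \<omega> (v - u)))\<^sup>2)))
      \<le> ennreal (sqrt A * sqrt (4 * pi * A)) * (enn_L2 p * enn_L2 q * enn_L2 r)"
    if [measurable]: "meas p" "meas q" "meas r" for p q r
  proof -
    have "collI (\<lambda>u v \<omega>. p u * q v * r (post_v u v \<omega>) * ennreal (exp (- c * (norm (perp \<omega> (v - u)))\<^sup>2)))
      = collI (\<lambda>u v \<omega>. p u * q v * k1 u v \<omega> * (r (post_v u v \<omega>) * k2 (post_u u v \<omega>) (post_v u v \<omega>) \<omega>))"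
      unfolding kk[symmetric] by (rule collI_cong) (simp add: k2' mult_ac)
    also have "\<dots> \<le> ennreal (sqrt A * sqrt (4 * pi * A)) * (enn_L2 p * enn_L2 q * enn_L2 r)"
      by (rule collI_Schur_v) (use A k1 k2 in auto)
    finally show ?thesis .
  qed
  then show ?thesis by blast
qed

text \<open>The kernel \<open>1 / (\<bar>y\<bar> (1 + \<bar>y\<bar>))\<close> left over from the Carleman-type lemmas is square integrable.\<close>

lemma riesz_kernel_bound:
  assumes [measurable]: "meas p"
  shows "(\<integral>\<^sup>+y. p (v - y) * ennreal (1 / (norm y * (1 + norm y))) \<partial>lborel) \<le> ennreal (sqrt (4 * pi)) * enn_L2 p"
proof -
  have "(\<integral>\<^sup>+(y::vec3). (ennreal (1 / (norm y * (1 + norm y))))\<^sup>2 \<partial>lborel)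
    = (\<integral>\<^sup>+(y::vec3). ennreal ((1 / (norm y * (1 + norm y)))\<^sup>2) \<partial>lborel)"
    by (simp add: ennreal_power)
  also have "\<dots> \<le> ennreal (4 * pi * 1)"
    by (rule nn_integral_radial_bound) (auto simp: power_divide power_mult_distrib)
  finally have "enn_L2 (\<lambda>y. ennreal (1 / (norm y * (1 + norm y)))) \<le> ennsqrt (ennreal (4 * pi * 1))"
    unfolding enn_L2_def by (rule ennsqrt_mono)
  then have 1: "enn_L2 (\<lambda>y. ennreal (1 / (norm y * (1 + norm y)))) \<le> ennreal (sqrt (4 * pi))"
    by simp
  have 2: "enn_L2 (\<lambda>y. p (v - y)) = enn_L2 p"
    unfolding enn_L2_def using nn_integral_lborel_reflect[of "\<lambda>y. (p y)\<^sup>2" v] by simp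
  have "(\<integral>\<^sup>+y. p (v - y) * ennreal (1 / (norm y * (1 + norm y))) \<partial>lborel)
    \<le> enn_L2 (\<lambda>y. p (v - y)) * enn_L2 (\<lambda>y. ennreal (1 / (norm y * (1 + norm y))))"
    by (rule nn_integral_mult_le_enn_L2) auto
  also have "\<dots> \<le> enn_L2 p * ennreal (sqrt (4 * pi))"
    unfolding 2 by (intro mult_left_mono 1) auto
  finally show ?thesis by (simp add: mult.commute)
qed

text \<open>Two functions at v pair by Cauchy-Schwarz in v alone, so a bound of the inner integral
  that is uniform in v is enough. The third function is hidden in k and its norm in A.\<close>

lemma form_pointwise_bound:
  assumes [measurable]: "meas q" "meas r" "coll_meas k"
    and k: "\<And>v. (\<integral>\<^sup>+u. (\<integral>\<^sup>+\<omega>. k u v \<omega> \<partial>sphere_measure) \<partial>lborel) \<le> A"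
  shows "collI (\<lambda>u v \<omega>. q v * r v * k u v \<omega>) \<le> A * (enn_L2 q * enn_L2 r)"
proof -
  have "collI (\<lambda>u v \<omega>. q v * r v * k u v \<omega>)
    = (\<integral>\<^sup>+v. q v * r v * (\<integral>\<^sup>+u. (\<integral>\<^sup>+\<omega>. k u v \<omega> \<partial>sphere_measure) \<partial>lborel) \<partial>lborel)"
    unfolding collI_def by (simp add: nn_integral_cmult)
  also have "\<dots> \<le> (\<integral>\<^sup>+v. q v * r v * A \<partial>lborel)"
    by (intro nn_integral_mono mult_left_mono k) auto
  also have "\<dots> = A * (\<integral>\<^sup>+v. q v * r v \<partial>lborel)"
    by (subst nn_integral_multc) (auto simp: mult.commute)
  also have "\<dots> \<le> A * (enn_L2 q * enn_L2 r)"
    by (intro mult_left_mono nn_integral_mult_le_enn_L2) auto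
  finally show ?thesis .
qed

lemma nn_integral_relative_velocity:
  fixes f :: "vec3 \<Rightarrow> vfun"
  assumes [measurable]: "case_prod f \<in> borel_measurable (borel \<Otimes>\<^sub>M borel)"
  shows "(\<integral>\<^sup>+u. (\<integral>\<^sup>+\<omega>. f (v - u) \<omega> \<partial>sphere_measure) \<partial>lborel) = (\<integral>\<^sup>+\<omega>. (\<integral>\<^sup>+X. f X \<omega> \<partial>lborel) \<partial>sphere_measure)"
proof -
  have "(\<integral>\<^sup>+u. (\<integral>\<^sup>+\<omega>. f (v - u) \<omega> \<partial>sphere_measure) \<partial>lborel) = (\<integral>\<^sup>+X. (\<integral>\<^sup>+\<omega>. f X \<omega> \<partial>sphere_measure) \<partial>lborel)"
    by (rule nn_integral_lborel_reflect[where f = "\<lambda>X. \<integral>\<^sup>+\<omega>. f X \<omega> \<partial>sphere_measure"]) measurable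
  also have "\<dots> = (\<integral>\<^sup>+\<omega>. (\<integral>\<^sup>+X. f X \<omega> \<partial>lborel) \<partial>sphere_measure)"
    by (rule sphere_Fubini) measurable
  finally show ?thesis .
qed

text \<open>With X = v - u, v' = v - (\<omega> \<bullet> X) \<omega>. For fixed v,
  \<open>carleman_parallel\<close> with y = (\<omega> \<bullet> X) \<omega> bounds the inner
  integral by that of p (v - y) against 1 / (|y| (1 + |y|)), uniformly in v by
  Cauchy-Schwarz.\<close>

lemma form_parallel_bound:
  assumes c: "c > 0"
  shows "\<exists>C. \<forall>p q r. meas p \<longrightarrow> meas q \<longrightarrow> meas r \<longrightarrow>
    collI (\<lambda>u v \<omega>. p (post_v u v \<omega>) * q v * r v * ennreal (\<bar>\<omega> \<bullet> (v - u)\<bar> / (1 + norm (v - u)) * exp (- c * (norm (perp \<omega> (v - u)))\<^sup>2)))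
      \<le> ennreal C * (enn_L2 p * enn_L2 q * enn_L2 r)"
proof -
  obtain C where C: "C \<ge> 0"
    "\<And>\<Psi>. meas \<Psi> \<Longrightarrow>
      (\<integral>\<^sup>+\<omega>. (\<integral>\<^sup>+X. ennreal ((\<omega> \<bullet> X)\<^sup>2 * exp (- c * (norm (perp \<omega> X))\<^sup>2)) * \<Psi> ((\<omega> \<bullet> X) *\<^sub>R \<omega>) \<partial>lborel) \<partial>sphere_measure)
      \<le> ennreal C * (\<integral>\<^sup>+y. \<Psi> y \<partial>lborel)"
    by (rule carleman_parallel[OF c]) (rule that)
  have "collI (\<lambda>u v \<omega>. p (post_v u v \<omega>) * q v * r v * ennreal (\<bar>\<omega> \<bullet> (v - u)\<bar> / (1 + norm (v - u)) * exp (- c * (norm (perp \<omega> (v - u)))\<^sup>2)))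
      \<le> ennreal (C * sqrt (4 * pi)) * (enn_L2 p * enn_L2 q * enn_L2 r)"
    if [measurable]: "meas p" "meas q" "meas r" for p q r
  proof -
    let ?w = "\<lambda>X \<omega>. ennreal (\<bar>\<omega> \<bullet> X\<bar> / (1 + norm X) * exp (- c * (norm (perp \<omega> X))\<^sup>2))"
    have "(\<integral>\<^sup>+u. (\<integral>\<^sup>+\<omega>. p (post_v u v \<omega>) * ?w (v - u) \<omega> \<partial>sphere_measure) \<partial>lborel) \<le> ennreal (C * sqrt (4 * pi)) * enn_L2 p" for v
    proof -
      define \<Psi> where "\<Psi> y = p (v - y) * ennreal (1 / (norm y * (1 + norm y)))" for y
      have [measurable]: "meas \<Psi>" unfolding \<Psi>_def[abs_def] by measurable
      have "(\<integral>\<^sup>+u. (\<integral>\<^sup>+\<omega>. p (post_v u v \<omega>) * ?w (v - u) \<omega> \<partial>sphere_measure) \<partial>lborel)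
        = (\<integral>\<^sup>+u. (\<integral>\<^sup>+\<omega>. (\<lambda>X \<omega>. p (v - (\<omega> \<bullet> X) *\<^sub>R \<omega>) * ?w X \<omega>) (v - u) \<omega> \<partial>sphere_measure) \<partial>lborel)"
        by (simp add: post_v_def)
      also have "\<dots> = (\<integral>\<^sup>+\<omega>. (\<integral>\<^sup>+X. p (v - (\<omega> \<bullet> X) *\<^sub>R \<omega>) * ?w X \<omega> \<partial>lborel) \<partial>sphere_measure)"
        by (rule nn_integral_relative_velocity) measurable
      also have "\<dots> \<le> (\<integral>\<^sup>+\<omega>. (\<integral>\<^sup>+X. ennreal ((\<omega> \<bullet> X)\<^sup>2 * exp (- c * (norm (perp \<omega> X))\<^sup>2)) * \<Psi> ((\<omega> \<bullet> X) *\<^sub>R \<omega>) \<partial>lborel) \<partial>sphere_measure)"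
      proof (rule nn_integral_sphere_measure_mono, rule nn_integral_mono)
        fix \<omega> X :: vec3 assume \<omega>: "norm \<omega> = 1"
        define w where "w = \<bar>\<omega> \<bullet> X\<bar>"
        define E where "E = exp (- c * (norm (perp \<omega> X))\<^sup>2)"
        have w: "0 \<le> w" "w \<le> norm X"
          using Cauchy_Schwarz_ineq2[of \<omega> X] \<omega> by (auto simp: w_def)
        \<comment> \<open>This exposes the factor w^2 that \<open>carleman_parallel\<close>
          consumes. At w = 0 both sides of the rewriting vanish, the reciprocal of w (1 + w) being 0
          by convention.\<close>
        have "w / (1 + norm X) \<le> w / (1 + w)"
          using w by (intro divide_left_mono) (auto intro!: mult_pos_pos)
        also have "\<dots> = w\<^sup>2 * (1 / (w * (1 + w)))"
          using w by (cases "w = 0") (auto simp: power2_eq_square)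
        finally have "w / (1 + norm X) * E \<le> w\<^sup>2 * (1 / (w * (1 + w))) * E"
          by (intro mult_right_mono) (auto simp: E_def)
        then have "ennreal (w / (1 + norm X) * E) \<le> ennreal (w\<^sup>2 * E) * ennreal (1 / (w * (1 + w)))"
          using w by (subst ennreal_mult[symmetric]) (auto simp: E_def mult_ac intro!: ennreal_leI)
        then have "p (v - (\<omega> \<bullet> X) *\<^sub>R \<omega>) * ennreal (w / (1 + norm X) * E)
          \<le> p (v - (\<omega> \<bullet> X) *\<^sub>R \<omega>) * (ennreal (w\<^sup>2 * E) * ennreal (1 / (w * (1 + w))))"
          by (rule mult_left_mono) simp
        also have "\<dots> = ennreal (w\<^sup>2 * E) * (p (v - (\<omega> \<bullet> X) *\<^sub>R \<omega>) * ennreal (1 / (w * (1 + w))))"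
          by (rule mult.left_commute)
        finally show "p (v - (\<omega> \<bullet> X) *\<^sub>R \<omega>) * ?w X \<omega>
            \<le> ennreal ((\<omega> \<bullet> X)\<^sup>2 * exp (- c * (norm (perp \<omega> X))\<^sup>2)) * \<Psi> ((\<omega> \<bullet> X) *\<^sub>R \<omega>)"
          using \<omega> by (simp add: \<Psi>_def w_def E_def)
      qed
      also have "\<dots> \<le> ennreal C * (\<integral>\<^sup>+y. \<Psi> y \<partial>lborel)"
        by (rule C) measurable
      also have "\<dots> \<le> ennreal C * (ennreal (sqrt (4 * pi)) * enn_L2 p)"
        unfolding \<Psi>_def by (intro mult_left_mono riesz_kernel_bound) auto
      finally show ?thesis using C by (simp add: ennreal_mult mult.assoc)
    qed
    then have "collI (\<lambda>u v \<omega>. q v * r v * (p (post_v u v \<omega>) * ?w (v - u) \<omega>))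
      \<le> ennreal (C * sqrt (4 * pi)) * enn_L2 p * (enn_L2 q * enn_L2 r)"
      by (intro form_pointwise_bound) auto
    then show ?thesis by (simp add: mult_ac)
  qed
  then show ?thesis by blast
qed

text \<open>At the origin the kernel 1 / (|y| (1 + |y|)) takes the value 0 of a division by zero, so
  the pointwise comparison in the transversal form cannot be relied on where the orthogonal
  component vanishes. That set is a line, hence null.\<close>

lemma AE_perp_nonzero:
  assumes "norm \<omega> = 1"
  shows "AE X in lborel. perp \<omega> X \<noteq> 0"
proof -
  have "{X. perp \<omega> X = 0} \<subseteq> span {\<omega>}"
    unfolding perp_def by (auto simp: span_singleton)
  moreover have "dim (span {\<omega>}) < DIM(vec3)"
    using dim_le_card[of "span {\<omega>}" "{\<omega>}"] by simp
  then have "negligible (span {\<omega>})"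
    by (intro negligible_lowdim) simp
  ultimately have "negligible {X. perp \<omega> X = 0}"
    using negligible_subset by blast
  then have "{X. perp \<omega> X = 0} \<in> null_sets lebesgue"
    by (simp add: negligible_iff_null_sets)
  moreover have "{X. perp \<omega> X = 0} \<in> sets lborel" by measurable
  ultimately have "{X. perp \<omega> X = 0} \<in> null_sets lborel"
    by (simp add: null_sets_def)
  then show ?thesis
    by (rule AE_I') auto
qed

text \<open>The counterpart of \<open>form_parallel_bound\<close> for u' = v -
  \<open>perp \<omega> X\<close>: now y is the orthogonal component and \<open>carleman_perp\<close>
  consumes a factor |y|.\<close>

lemma form_transversal_bound:
  assumes c: "c > 0"
  shows "\<exists>C. \<forall>p q r. meas p \<longrightarrow> meas q \<longrightarrow> meas r \<longrightarrow>
    collI (\<lambda>u v \<omega>. p (post_u u v \<omega>) * q v * r v * ennreal (exp (- c * (\<omega> \<bullet> (v - u))\<^sup>2) / (1 + norm (v - u))))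
      \<le> ennreal C * (enn_L2 p * enn_L2 q * enn_L2 r)"
proof -
  obtain C where C: "C \<ge> 0"
    "\<And>\<Psi>. meas \<Psi> \<Longrightarrow>
      (\<integral>\<^sup>+\<omega>. (\<integral>\<^sup>+X. ennreal (exp (- c * (\<omega> \<bullet> X)\<^sup>2)) * (ennreal (norm (perp \<omega> X)) * \<Psi> (perp \<omega> X)) \<partial>lborel) \<partial>sphere_measure)
      \<le> ennreal C * (\<integral>\<^sup>+y. \<Psi> y \<partial>lborel)"
    by (rule carleman_perp[OF c]) (rule that)
  have "collI (\<lambda>u v \<omega>. p (post_u u v \<omega>) * q v * r v * ennreal (exp (- c * (\<omega> \<bullet> (v - u))\<^sup>2) / (1 + norm (v - u))))
      \<le> ennreal (C * sqrt (4 * pi)) * (enn_L2 p * enn_L2 q * enn_L2 r)"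
    if [measurable]: "meas p" "meas q" "meas r" for p q r
  proof -
    let ?w = "\<lambda>X \<omega>. ennreal (exp (- c * (\<omega> \<bullet> X)\<^sup>2) / (1 + norm X))"
    have "(\<integral>\<^sup>+u. (\<integral>\<^sup>+\<omega>. p (post_u u v \<omega>) * ?w (v - u) \<omega> \<partial>sphere_measure) \<partial>lborel) \<le> ennreal (C * sqrt (4 * pi)) * enn_L2 p" for v
    proof -
      define \<Psi> where "\<Psi> y = p (v - y) * ennreal (1 / (norm y * (1 + norm y)))" for y
      have [measurable]: "meas \<Psi>" unfolding \<Psi>_def[abs_def] by measurable
      have "(\<integral>\<^sup>+u. (\<integral>\<^sup>+\<omega>. p (post_u u v \<omega>) * ?w (v - u) \<omega> \<partial>sphere_measure) \<partial>lborel)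
        = (\<integral>\<^sup>+u. (\<integral>\<^sup>+\<omega>. (\<lambda>X \<omega>. p (v - perp \<omega> X) * ?w X \<omega>) (v - u) \<omega> \<partial>sphere_measure) \<partial>lborel)"
        by (simp add: post_u_def perp_def)
      also have "\<dots> = (\<integral>\<^sup>+\<omega>. (\<integral>\<^sup>+X. p (v - perp \<omega> X) * ?w X \<omega> \<partial>lborel) \<partial>sphere_measure)"
        by (rule nn_integral_relative_velocity) measurable
      also have "\<dots> \<le> (\<integral>\<^sup>+\<omega>. (\<integral>\<^sup>+X. ennreal (exp (- c * (\<omega> \<bullet> X)\<^sup>2)) * (ennreal (norm (perp \<omega> X)) * \<Psi> (perp \<omega> X)) \<partial>lborel) \<partial>sphere_measure)"
      proof (rule nn_integral_sphere_measure_mono, rule nn_integral_mono_AE)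
        fix \<omega> :: vec3 assume \<omega>: "norm \<omega> = 1"
        show "AE X in lborel. p (v - perp \<omega> X) * ?w X \<omega> \<le> ennreal (exp (- c * (\<omega> \<bullet> X)\<^sup>2)) * (ennreal (norm (perp \<omega> X)) * \<Psi> (perp \<omega> X))"
          using AE_perp_nonzero[OF \<omega>]
        proof eventually_elim
          fix X assume X: "perp \<omega> X \<noteq> 0"
          define n where "n = norm (perp \<omega> X)"
          define E where "E = exp (- c * (\<omega> \<bullet> X)\<^sup>2)"
          have "n\<^sup>2 \<le> (norm X)\<^sup>2"
            using norm_perp_square[OF \<omega>, of X] by (simp add: n_def perp_def)
          then have n: "0 < n" "n \<le> norm X"
            using X by (auto simp: n_def)
          then have "E / (1 + norm X) \<le> E / (1 + n)"
            by (intro divide_left_mono) (auto simp: E_def intro!: mult_pos_pos)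
          also have "\<dots> = E * (n * (1 / (n * (1 + n))))"
            using n by simp
          finally have "ennreal (E / (1 + norm X)) \<le> ennreal E * (ennreal n * ennreal (1 / (n * (1 + n))))"
            using n by (subst ennreal_mult[symmetric], simp, simp, subst ennreal_mult[symmetric]) (auto simp: E_def intro!: ennreal_leI)
          then have "p (v - perp \<omega> X) * ennreal (E / (1 + norm X)) \<le> p (v - perp \<omega> X) * (ennreal E * (ennreal n * ennreal (1 / (n * (1 + n)))))"
            by (rule mult_left_mono) simp
          also have "\<dots> = ennreal E * (ennreal n * \<Psi> (perp \<omega> X))"
            by (simp add: \<Psi>_def n_def mult_ac)
          finally show "p (v - perp \<omega> X) * ?w X \<omega> \<le> ennreal (exp (- c * (\<omega> \<bullet> X)\<^sup>2)) * (ennreal (norm (perp \<omega> X)) * \<Psi> (perp \<omega> X))"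
            by (simp add: n_def E_def)
        qed
      qed
      also have "\<dots> \<le> ennreal C * (\<integral>\<^sup>+y. \<Psi> y \<partial>lborel)"
        by (rule C) measurable
      also have "\<dots> \<le> ennreal C * (ennreal (sqrt (4 * pi)) * enn_L2 p)"
        unfolding \<Psi>_def by (intro mult_left_mono riesz_kernel_bound) auto
      finally show ?thesis using C by (simp add: ennreal_mult mult.assoc)
    qed
    then have "collI (\<lambda>u v \<omega>. q v * r v * (p (post_u u v \<omega>) * ?w (v - u) \<omega>))
      \<le> ennreal (C * sqrt (4 * pi)) * enn_L2 p * (enn_L2 q * enn_L2 r)"
      by (intro form_pointwise_bound) auto
    then show ?thesis by (simp add: mult_ac)
  qed
  then show ?thesis by blast
qed

section \<open>Gaussian kernel inequalities\<close>

text \<open>Up to constants, \<open>gs\<close> is the square root of both \<open>mu\<close> and \<open>MM\<close>. The exponent in \<open>gb\<close> leaves room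
  for absorbing powers of velocities into \<open>gs\<close> and for passing from \<open>u, u', v'\<close> to components of \<open>v - u\<close>.\<close>

definition gs :: "vec3 \<Rightarrow> real" where
  "gs x = exp (- ((norm x)\<^sup>2 / 2))"

definition gb :: "real \<Rightarrow> real" where
  "gb t = exp (- (1 / 16) * t\<^sup>2)"

lemma gs_pos [simp]: "gs x > 0" "gs x \<ge> 0" and gs_le_1 [simp]: "gs x \<le> 1"
  by (simp_all add: gs_def)

lemma gb_pos [simp]: "gb x > 0" "gb x \<ge> 0" and gb_le_1 [simp]: "gb x \<le> 1"
  by (simp_all add: gb_def)

lemma measurable_gs [measurable]: "meas gs"
  unfolding gs_def[abs_def] by measurable

lemma measurable_gb [measurable]: "meas gb"
  unfolding gb_def[abs_def] by measurable

text \<open>The constants are the exponents n^2 / (4 c) of \<open>poly_gaussian_bound\<close> for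
  (n, c) = (1, 1/4), (1, 1/16) and (2, 3/16); the last one, 16/3, is rounded up.\<close>

lemma bracket_gaussian:
  fixes t :: real
  assumes "t \<ge> 0"
  shows "(1 + t) * exp (- (t\<^sup>2 / 4)) \<le> exp 1" "t * exp (- (t\<^sup>2 / 16)) \<le> exp 4"
    "(1 + t)\<^sup>2 * exp (- (3 * t\<^sup>2 / 16)) \<le> exp 6"
proof -
  show "(1 + t) * exp (- (t\<^sup>2 / 4)) \<le> exp 1"
    using poly_gaussian_bound[of t "1 / 4" 1] assms by simp
  have "t * exp (- (t\<^sup>2 / 16)) \<le> (1 + t) * exp (- (t\<^sup>2 / 16))"
    by (intro mult_right_mono) auto
  then show "t * exp (- (t\<^sup>2 / 16)) \<le> exp 4"
    by (rule order_trans) (use poly_gaussian_bound[of t "1 / 16" 1] assms in simp)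
  have "(1 + t)\<^sup>2 * exp (- (3 * t\<^sup>2 / 16)) \<le> exp (16 / 3)"
    using poly_gaussian_bound[of t "3 / 16" 2] assms by simp
  also have "\<dots> \<le> exp 6" by simp
  finally show "(1 + t)\<^sup>2 * exp (- (3 * t\<^sup>2 / 16)) \<le> exp 6" .
qed

text \<open>The exponent 1/2 of \<open>gs\<close> is cut into two quarters, one of which absorbs the
  bracket.\<close>

lemma gs_bracket: "(1 + norm x) * gs x \<le> exp 1 * exp (- ((norm x)\<^sup>2 / 4))"
proof -
  have "(1 + norm x) * gs x = (1 + norm x) * exp (- ((norm x)\<^sup>2 / 4)) * exp (- ((norm x)\<^sup>2 / 4))"
    by (simp add: gs_def mult.assoc exp_add[symmetric])
  also have "\<dots> \<le> exp 1 * exp (- ((norm x)\<^sup>2 / 4))"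
    by (intro mult_right_mono bracket_gaussian) auto
  finally show ?thesis .
qed

lemma gs_quarter: "gs x \<le> exp (- ((norm x)\<^sup>2 / 4))"
  by (simp add: gs_def)

lemma gs_eighth: "gs x \<le> gb (norm x)"
  by (simp add: gs_def gb_def)

lemma gs_bracket_gb: "(1 + norm x) * gs x \<le> exp 1 * gb (norm x)"
proof -
  have "exp 1 * exp (- ((norm x)\<^sup>2 / 4)) \<le> exp 1 * gb (norm x)"
    by (simp add: gb_def)
  with gs_bracket[of x] show ?thesis by (rule order_trans)
qed

lemma gs_bracket_1: "(1 + norm x) * gs x \<le> exp 1"
  by (rule order_trans[OF gs_bracket_gb]) simp

section \<open>Velocities before and after a collision\<close>

lemma square_triangle:
  fixes x y z :: real
  assumes "0 \<le> x" "x \<le> y + z"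
  shows "x\<^sup>2 \<le> 2 * (y\<^sup>2 + z\<^sup>2)"
proof -
  have "x\<^sup>2 \<le> (y + z)\<^sup>2" using assms by (intro power_mono) auto
  also have "\<dots> \<le> 2 * (y\<^sup>2 + z\<^sup>2)"
    using sum_squares_bound[of y z] by (simp add: power2_sum)
  finally show ?thesis .
qed

lemma bracket_add_le:
  fixes x y z :: real
  assumes "x \<le> y + z" "0 \<le> y" "0 \<le> z"
  shows "1 + x \<le> (1 + y) * (1 + z)"
proof -
  have "(1 + y) * (1 + z) = 1 + y + z + y * z" by (simp add: algebra_simps)
  with assms(1) mult_nonneg_nonneg[OF assms(2,3)] show ?thesis by linarith
qed

lemma bracket_le_square: "t \<ge> 0 \<Longrightarrow> 1 + t \<le> (1 + t :: real)\<^sup>2"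
  by (simp add: power2_eq_square algebra_simps)

lemma sqrt_bracket_le: "t \<ge> 0 \<Longrightarrow> sqrt (1 + t) \<le> 1 + (t :: real)"
  using bracket_le_square[of t] by (intro real_le_lsqrt) auto

lemma relative_velocity_bounds:
  fixes u v :: "'a::real_normed_vector"
  shows "norm (v - u) \<le> norm u + norm v"
    and "(norm (v - u))\<^sup>2 \<le> 2 * ((norm u)\<^sup>2 + (norm v)\<^sup>2)"
    and "1 + norm (v - u) \<le> (1 + norm u) * (1 + norm v)"
proof -
  show 1: "norm (v - u) \<le> norm u + norm v"
    using norm_triangle_ineq4[of v u] by simp
  show "(norm (v - u))\<^sup>2 \<le> 2 * ((norm u)\<^sup>2 + (norm v)\<^sup>2)"
    by (intro square_triangle 1) simp
  show "1 + norm (v - u) \<le> (1 + norm u) * (1 + norm v)"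
    by (intro bracket_add_le 1) auto
qed

text \<open>The identities behind the third and fourth bound are u' - u = (\<omega> \<bullet> (v -
  u)) \<omega> and v' - u = \<open>perp \<omega> (v - u)\<close>: Gaussians at u and at one outgoing
  velocity control one component of v - u each.\<close>

lemma collision_geometry:
  assumes "norm \<omega> = 1"
  shows "\<bar>\<omega> \<bullet> (v - u)\<bar> \<le> norm (v - u)"
    and "norm (v - u) \<le> norm (post_u u v \<omega>) + norm (post_v u v \<omega>)"
    and "(\<omega> \<bullet> (v - u))\<^sup>2 \<le> 2 * ((norm u)\<^sup>2 + (norm (post_u u v \<omega>))\<^sup>2)"
    and "(norm (perp \<omega> (v - u)))\<^sup>2 \<le> 2 * ((norm u)\<^sup>2 + (norm (post_v u v \<omega>))\<^sup>2)"
    and "(\<omega> \<bullet> (v - u))\<^sup>2 \<le> (norm (v - u))\<^sup>2"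
    and "(norm (perp \<omega> (v - u)))\<^sup>2 \<le> (norm (v - u))\<^sup>2"
proof -
  show "\<bar>\<omega> \<bullet> (v - u)\<bar> \<le> norm (v - u)"
    using Cauchy_Schwarz_ineq2[of \<omega> "v - u"] assms by simp
  show "norm (v - u) \<le> norm (post_u u v \<omega>) + norm (post_v u v \<omega>)"
    using norm_triangle_ineq4[of "post_v u v \<omega>" "post_u u v \<omega>"] post_norm[OF assms, of u v] by simp
  have "\<bar>\<omega> \<bullet> (v - u)\<bar> = norm (post_u u v \<omega> - u)"
    using assms by (simp add: post_u_def)
  also have "\<dots> \<le> norm u + norm (post_u u v \<omega>)"
    using norm_triangle_ineq4[of "post_u u v \<omega>" u] by simp
  finally have "\<bar>\<omega> \<bullet> (v - u)\<bar>\<^sup>2 \<le> 2 * ((norm u)\<^sup>2 + (norm (post_u u v \<omega>))\<^sup>2)"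
    by (rule square_triangle[rotated]) simp
  then show "(\<omega> \<bullet> (v - u))\<^sup>2 \<le> 2 * ((norm u)\<^sup>2 + (norm (post_u u v \<omega>))\<^sup>2)" by simp
  have "norm (perp \<omega> (v - u)) = norm (post_v u v \<omega> - u)"
    by (simp add: perp_def post_v_def algebra_simps)
  also have "\<dots> \<le> norm u + norm (post_v u v \<omega>)"
    using norm_triangle_ineq4[of "post_v u v \<omega>" u] by simp
  finally show "(norm (perp \<omega> (v - u)))\<^sup>2 \<le> 2 * ((norm u)\<^sup>2 + (norm (post_v u v \<omega>))\<^sup>2)"
    by (rule square_triangle[rotated]) simp
  show "(\<omega> \<bullet> (v - u))\<^sup>2 \<le> (norm (v - u))\<^sup>2" "(norm (perp \<omega> (v - u)))\<^sup>2 \<le> (norm (v - u))\<^sup>2"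
    using norm_perp_square'[OF assms, of "v - u"] by auto
qed

section \<open>Pointwise kernel inequalities\<close>

lemma bracket_relative:
  assumes "norm \<omega> = 1"
  shows "1 + norm (v - u) \<le> (1 + norm u) * (1 + norm v)"
    "1 + norm (v - u) \<le> (1 + norm (post_u u v \<omega>)) * (1 + norm (post_v u v \<omega>))"
    "\<bar>\<omega> \<bullet> (v - u)\<bar> \<le> 1 + norm (v - u)"
  using relative_velocity_bounds(3)[of v u] bracket_add_le[OF collision_geometry(2)[OF assms]]
    collision_geometry(1)[OF assms, of v u] by auto

lemma bracket_gs_relative:
  "(1 + norm (v - u)) * gs u \<le> exp 1 * ((1 + norm v) * exp (- ((norm u)\<^sup>2 / 4)))"
proof -
  have "(1 + norm (v - u)) * gs u \<le> (1 + norm v) * ((1 + norm u) * gs u)"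
    using mult_right_mono[OF relative_velocity_bounds(3)[of v u], of "gs u"] by (simp add: mult_ac)
  also have "\<dots> \<le> (1 + norm v) * (exp 1 * exp (- ((norm u)\<^sup>2 / 4)))"
    by (intro mult_left_mono gs_bracket) auto
  finally show ?thesis by (simp add: mult_ac)
qed

lemma kernel_gauss:
  assumes "norm \<omega> = 1"
  shows "\<bar>\<omega> \<bullet> (v - u)\<bar> * gs u \<le> exp 1 * ((1 + norm v) * gb (norm u))"
proof -
  have "\<bar>\<omega> \<bullet> (v - u)\<bar> * gs u \<le> (1 + norm (v - u)) * gs u"
    by (intro mult_right_mono bracket_relative[OF assms]) auto
  also have "\<dots> \<le> exp 1 * ((1 + norm v) * exp (- ((norm u)\<^sup>2 / 4)))"
    by (rule bracket_gs_relative)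
  also have "\<dots> \<le> exp 1 * ((1 + norm v) * gb (norm u))"
    by (intro mult_left_mono) (auto simp: gb_def)
  finally show ?thesis .
qed

text \<open>|\<omega> \<bullet> (v - u)| is written as a product of two square roots. One is
  estimated before the collision and gives sqrt (1 + |v|), the bracket of u going into
  \<open>gs u\<close>; the other is estimated after it and gives a square root at u' or v'. So g and
  one of the two functions each receive half a weight.\<close>

lemma kernel_gauss_sqrt:
  assumes "norm \<omega> = 1"
  shows "\<bar>\<omega> \<bullet> (v - u)\<bar> * gs u
    \<le> exp 1 * (sqrt (1 + norm v) * (sqrt (1 + norm (post_u u v \<omega>)) + sqrt (1 + norm (post_v u v \<omega>))) * gb (norm u))"
proof -
  let ?w = "\<bar>\<omega> \<bullet> (v - u)\<bar>" and ?a = "norm (post_u u v \<omega>)" and ?b = "norm (post_v u v \<omega>)"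
  have "sqrt ?w \<le> sqrt ((1 + norm u) * (1 + norm v))"
    using bracket_relative[OF assms, of v u] by (intro real_sqrt_le_mono) linarith
  also have "\<dots> \<le> (1 + norm u) * sqrt (1 + norm v)"
    unfolding real_sqrt_mult by (intro mult_right_mono sqrt_bracket_le) auto
  finally have 1: "sqrt ?w \<le> (1 + norm u) * sqrt (1 + norm v)" .
  have "sqrt ?w \<le> sqrt ((1 + ?a) + (1 + ?b))"
    using collision_geometry(1,2)[OF assms, of v u] by (intro real_sqrt_le_mono) linarith
  also have "\<dots> \<le> sqrt (1 + ?a) + sqrt (1 + ?b)"
    by (intro sqrt_add_le_add_sqrt) auto
  finally have 2: "sqrt ?w \<le> sqrt (1 + ?a) + sqrt (1 + ?b)" .
  have "?w * gs u = sqrt ?w * sqrt ?w * gs u" by simp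
  also have "\<dots> \<le> ((1 + norm u) * sqrt (1 + norm v)) * (sqrt (1 + ?a) + sqrt (1 + ?b)) * gs u"
    by (intro mult_right_mono mult_mono 1 2) auto
  also have "\<dots> = (sqrt (1 + norm v) * (sqrt (1 + ?a) + sqrt (1 + ?b))) * ((1 + norm u) * gs u)"
    by (simp add: mult_ac)
  also have "\<dots> \<le> (sqrt (1 + norm v) * (sqrt (1 + ?a) + sqrt (1 + ?b))) * (exp 1 * gb (norm u))"
    by (intro mult_left_mono gs_bracket_gb) auto
  finally show ?thesis by (simp add: mult_ac)
qed

text \<open>Again one square root is measured before and one after the collision. The available
  outgoing Gaussian absorbs the bracket of its own velocity, so half powers remain only at v and at
  the other outgoing velocity.\<close>

lemma kernel_exchange_sqrt:
  assumes "norm \<omega> = 1"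
  shows "\<bar>\<omega> \<bullet> (v - u)\<bar> * ((gs u)\<^sup>2 * gs (post_v u v \<omega>))
      \<le> exp 2 * (sqrt (1 + norm v) * sqrt (1 + norm (post_u u v \<omega>)) * gb (norm (post_v u v \<omega>)))"
    and "\<bar>\<omega> \<bullet> (v - u)\<bar> * ((gs u)\<^sup>2 * gs (post_u u v \<omega>))
      \<le> exp 2 * (sqrt (1 + norm v) * sqrt (1 + norm (post_v u v \<omega>)) * gb (norm (post_u u v \<omega>)))"
proof -
  let ?w = "\<bar>\<omega> \<bullet> (v - u)\<bar>" and ?a = "norm (post_u u v \<omega>)" and ?b = "norm (post_v u v \<omega>)"
  have "sqrt ?w \<le> sqrt ((1 + norm u) * (1 + norm v))"
    using bracket_relative[OF assms, of v u] by (intro real_sqrt_le_mono) linarith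
  also have "\<dots> \<le> (1 + norm u) * sqrt (1 + norm v)"
    unfolding real_sqrt_mult by (intro mult_right_mono sqrt_bracket_le) auto
  finally have 1: "sqrt ?w \<le> (1 + norm u) * sqrt (1 + norm v)" .
  have 2: "sqrt ?w \<le> sqrt (1 + x) * (1 + y)" if "1 + norm (v - u) \<le> (1 + x) * (1 + y)" "0 \<le> x" "0 \<le> y" for x y
  proof -
    have "sqrt ?w \<le> sqrt ((1 + x) * (1 + y))"
      using bracket_relative(3)[OF assms, of v u] that by (intro real_sqrt_le_mono) linarith
    also have "\<dots> \<le> sqrt (1 + x) * (1 + y)"
      unfolding real_sqrt_mult using that by (intro mult_left_mono sqrt_bracket_le) auto
    finally show ?thesis .
  qed
  have main: "?w * ((gs u)\<^sup>2 * gs y) \<le> exp 2 * (sqrt (1 + norm v) * sqrt (1 + norm x) * gb (norm y))"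
    if "1 + norm (v - u) \<le> (1 + norm x) * (1 + norm y)" for x y :: vec3
  proof -
    have "?w * ((gs u)\<^sup>2 * gs y) = sqrt ?w * sqrt ?w * ((gs u)\<^sup>2 * gs y)" by simp
    also have "\<dots> \<le> ((1 + norm u) * sqrt (1 + norm v)) * (sqrt (1 + norm x) * (1 + norm y)) * ((gs u)\<^sup>2 * gs y)"
      using 2[OF that] by (intro mult_right_mono mult_mono 1) auto
    also have "\<dots> = sqrt (1 + norm v) * sqrt (1 + norm x) * (((1 + norm u) * gs u * gs u) * ((1 + norm y) * gs y))"
      by (simp add: mult_ac power2_eq_square)
    also have "\<dots> \<le> sqrt (1 + norm v) * sqrt (1 + norm x) * ((exp 1 * 1) * (exp 1 * gb (norm y)))"
      by (intro mult_left_mono mult_mono gs_bracket_gb gs_bracket_1) auto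
    also have "\<dots> = exp 2 * (sqrt (1 + norm v) * sqrt (1 + norm x) * gb (norm y))"
      using exp_add[of "1::real" 1] by (simp add: mult_ac)
    finally show ?thesis .
  qed
  show "?w * ((gs u)\<^sup>2 * gs (post_v u v \<omega>)) \<le> exp 2 * (sqrt (1 + norm v) * sqrt (1 + ?a) * gb ?b)"
    by (rule main, rule bracket_relative[OF assms])
  show "?w * ((gs u)\<^sup>2 * gs (post_u u v \<omega>)) \<le> exp 2 * (sqrt (1 + norm v) * sqrt (1 + ?b) * gb ?a)"
    by (rule main) (use bracket_relative(2)[OF assms, of v u] in \<open>simp add: mult.commute\<close>)
qed

lemma kernel_exchange:
  assumes "norm \<omega> = 1"
  shows "\<bar>\<omega> \<bullet> (v - u)\<bar> * ((gs u)\<^sup>2 * gs x) \<le> exp 1 * ((1 + norm v) * gb (norm x))"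
proof -
  have "\<bar>\<omega> \<bullet> (v - u)\<bar> * ((gs u)\<^sup>2 * gs x) = (\<bar>\<omega> \<bullet> (v - u)\<bar> * gs u) * (gs u * gs x)"
    by (simp add: power2_eq_square mult_ac)
  also have "\<dots> \<le> (exp 1 * ((1 + norm v) * gb (norm u))) * (1 * gb (norm x))"
    by (intro mult_mono kernel_gauss[OF assms] gs_eighth) auto
  also have "\<dots> \<le> exp 1 * ((1 + norm v) * 1) * (1 * gb (norm x))"
    by (intro mult_right_mono mult_left_mono) auto
  finally show ?thesis by (simp add: mult_ac)
qed

lemma gs_energy:
  assumes "norm \<omega> = 1"
  shows "gs (post_u u v \<omega>) * gs (post_v u v \<omega>) = gs u * gs v"
  using post_energy[OF assms, of u v] by (simp add: gs_def exp_add[symmetric] add_divide_distrib[symmetric])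

text \<open>By energy conservation \<open>gs u * gs v\<close> is also the product of the Gaussians
  after the collision. Each of them absorbs one outgoing bracket and keeps decay, so either outgoing
  velocity may be chosen for the final Gaussian.\<close>

lemma kernel_all_gauss:
  assumes "norm \<omega> = 1" "x \<in> {post_u u v \<omega>, post_v u v \<omega>}"
  shows "\<bar>\<omega> \<bullet> (v - u)\<bar> * (gs u * gs v) \<le> exp 2 * gb (norm x)"
proof -
  have "\<bar>\<omega> \<bullet> (v - u)\<bar> \<le> (1 + norm (post_u u v \<omega>)) * (1 + norm (post_v u v \<omega>))"
    using bracket_relative[OF assms(1), of v u] by linarith
  then have "\<bar>\<omega> \<bullet> (v - u)\<bar> * (gs u * gs v)
    \<le> (1 + norm (post_u u v \<omega>)) * (1 + norm (post_v u v \<omega>)) * (gs (post_u u v \<omega>) * gs (post_v u v \<omega>))"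
    unfolding gs_energy[OF assms(1)] by (intro mult_right_mono) auto
  also have "\<dots> = ((1 + norm (post_u u v \<omega>)) * gs (post_u u v \<omega>)) * ((1 + norm (post_v u v \<omega>)) * gs (post_v u v \<omega>))"
    by (simp add: mult_ac)
  also have "\<dots> \<le> (exp 1 * gb (norm (post_u u v \<omega>))) * (exp 1 * gb (norm (post_v u v \<omega>)))"
    by (intro mult_mono gs_bracket_gb) auto
  also have "\<dots> = exp 2 * (gb (norm (post_u u v \<omega>)) * gb (norm (post_v u v \<omega>)))"
    using exp_add[of "1::real" 1] by (simp add: mult_ac)
  also have "\<dots> \<le> exp 2 * gb (norm x)"
    using assms(2) mult_left_le[OF gb_le_1[of "norm (post_u u v \<omega>)"] gb_pos(2)[of "norm (post_v u v \<omega>)"]]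
      mult_left_le[OF gb_le_1[of "norm (post_v u v \<omega>)"] gb_pos(2)[of "norm (post_u u v \<omega>)"]]
    by (auto simp: mult.commute)
  finally show ?thesis .
qed

text \<open>Two factors \<open>gb\<close> are retained because the estimate with suprema of p and q
  needs a square integrable function at u in addition to the kernel of the loss form.\<close>

lemma kernel_pair_gauss:
  assumes "norm \<omega> = 1"
  shows "\<bar>\<omega> \<bullet> (v - u)\<bar> * (gs u * gs v) \<le> exp 2 * (gb (norm u) * gb (norm u))"
proof -
  have "\<bar>\<omega> \<bullet> (v - u)\<bar> \<le> (1 + norm u) * (1 + norm v)"
    using bracket_relative[OF assms(1), of v u] by linarith
  then have "\<bar>\<omega> \<bullet> (v - u)\<bar> * (gs u * gs v) \<le> (1 + norm u) * (1 + norm v) * (gs u * gs v)"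
    by (intro mult_right_mono) auto
  also have "\<dots> = ((1 + norm u) * gs u) * ((1 + norm v) * gs v)"
    by (simp add: mult_ac)
  also have "\<dots> \<le> (exp 1 * exp (- ((norm u)\<^sup>2 / 4))) * exp 1"
    by (intro mult_mono gs_bracket gs_bracket_1) auto
  also have "\<dots> = exp 2 * exp (- ((norm u)\<^sup>2 / 4))"
    using exp_add[of "1::real" 1] by (simp add: mult_ac)
  also have "\<dots> \<le> exp 2 * (gb (norm u) * gb (norm u))"
    by (simp add: gb_def exp_add[symmetric])
  finally show ?thesis .
qed

text \<open>From |v - u|^2 \<le> 2 (|u|^2 + |v|^2) the two Gaussians have joint exponent at least |v
  - u|^2 / 4, cut into 3/16 to absorb the squared bracket and 1/16 for \<open>gb\<close>.\<close>

lemma kernel_relative_gauss: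
  "(1 + norm (v - u))\<^sup>2 * (gs u * gs v) \<le> exp 6 * gb (norm (v - u))"
proof -
  have "gs u * gs v = exp (- (((norm u)\<^sup>2 + (norm v)\<^sup>2) / 2))"
    by (simp add: gs_def exp_add[symmetric] add_divide_distrib)
  also have "\<dots> \<le> exp (- (3 * (norm (v - u))\<^sup>2 / 16) + - (1 / 16) * (norm (v - u))\<^sup>2)"
    using relative_velocity_bounds(2)[of v u] by simp
  also have "\<dots> = exp (- (3 * (norm (v - u))\<^sup>2 / 16)) * gb (norm (v - u))"
    unfolding gb_def exp_add ..
  finally have "(1 + norm (v - u))\<^sup>2 * (gs u * gs v)
    \<le> (1 + norm (v - u))\<^sup>2 * (exp (- (3 * (norm (v - u))\<^sup>2 / 16)) * gb (norm (v - u)))"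
    by (intro mult_left_mono) auto
  also have "\<dots> = ((1 + norm (v - u))\<^sup>2 * exp (- (3 * (norm (v - u))\<^sup>2 / 16))) * gb (norm (v - u))"
    by (simp add: mult_ac)
  also have "\<dots> \<le> exp 6 * gb (norm (v - u))"
    by (intro mult_right_mono bracket_gaussian) auto
  finally show ?thesis .
qed

text \<open>Decay in all of v - u is available here; it is deliberately weakened to the kernel of
  the transversal form, so that no separate form has to be bounded. The next lemma does the same for
  the parallel form.\<close>

lemma kernel_transversal_gauss:
  assumes "norm \<omega> = 1"
  shows "\<bar>\<omega> \<bullet> (v - u)\<bar> * (gs u * gs v) \<le> exp 6 * (gb (\<omega> \<bullet> (v - u)) / (1 + norm (v - u)))"
proof -
  have pos: "1 + norm (v - u) > 0" by (simp add: add_pos_nonneg)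
  have "\<bar>\<omega> \<bullet> (v - u)\<bar> * (gs u * gs v) * (1 + norm (v - u)) \<le> (1 + norm (v - u)) * (gs u * gs v) * (1 + norm (v - u))"
    using bracket_relative(3)[OF assms, of v u] by (intro mult_right_mono) auto
  also have "\<dots> \<le> exp 6 * gb (norm (v - u))"
    using kernel_relative_gauss[of v u] by (simp add: power2_eq_square mult_ac)
  also have "\<dots> \<le> exp 6 * gb (\<omega> \<bullet> (v - u))"
    using collision_geometry(5)[OF assms, of v u] by (simp add: gb_def)
  finally show ?thesis using pos by (simp add: field_simps)
qed

lemma kernel_parallel_gauss:
  assumes "norm \<omega> = 1"
  shows "\<bar>\<omega> \<bullet> (v - u)\<bar> * (gs u * gs v) \<le> exp 6 * (\<bar>\<omega> \<bullet> (v - u)\<bar> / (1 + norm (v - u)) * gb (norm (perp \<omega> (v - u))))"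
proof -
  have pos: "1 + norm (v - u) > 0" by (simp add: add_pos_nonneg)
  have "1 + norm (v - u) \<le> (1 + norm (v - u))\<^sup>2"
    by (rule bracket_le_square) simp
  then have "(1 + norm (v - u)) * (gs u * gs v) \<le> (1 + norm (v - u))\<^sup>2 * (gs u * gs v)"
    by (intro mult_right_mono) auto
  also have "\<dots> \<le> exp 6 * gb (norm (v - u))"
    by (rule kernel_relative_gauss)
  also have "\<dots> \<le> exp 6 * gb (norm (perp \<omega> (v - u)))"
    using collision_geometry(6)[OF assms, of v u] by (simp add: gb_def)
  finally have "\<bar>\<omega> \<bullet> (v - u)\<bar> / (1 + norm (v - u)) * ((1 + norm (v - u)) * (gs u * gs v))
      \<le> \<bar>\<omega> \<bullet> (v - u)\<bar> / (1 + norm (v - u)) * (exp 6 * gb (norm (perp \<omega> (v - u))))"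
    using pos by (intro mult_left_mono) auto
  then show ?thesis using pos by (simp add: mult_ac)
qed

text \<open>The denominator 1 + |v - u| is bought from \<open>gs u\<close> at the price of 1 + |v|.
  The quarters left of the two exponents amount to at least (\<omega> \<bullet> (v - u))^2 / 8; one
  half of this absorbs |\<omega> \<bullet> (v - u)| with constant exp 4, the other half is
  \<open>gb\<close>.\<close>

lemma kernel_transversal:
  assumes "norm \<omega> = 1"
  shows "\<bar>\<omega> \<bullet> (v - u)\<bar> * (gs u * gs (post_u u v \<omega>))
    \<le> exp 5 * ((1 + norm v) * (gb (\<omega> \<bullet> (v - u)) / (1 + norm (v - u))))"
proof -
  let ?w = "\<bar>\<omega> \<bullet> (v - u)\<bar>"
  have pos: "1 + norm (v - u) > 0" by (simp add: add_pos_nonneg)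
  have "(1 + norm (v - u)) * (?w * (gs u * gs (post_u u v \<omega>))) = ?w * (((1 + norm (v - u)) * gs u) * gs (post_u u v \<omega>))"
    by (simp add: mult_ac)
  also have "\<dots> \<le> ?w * ((exp 1 * ((1 + norm v) * exp (- ((norm u)\<^sup>2 / 4)))) * exp (- ((norm (post_u u v \<omega>))\<^sup>2 / 4)))"
    by (intro mult_left_mono mult_mono bracket_gs_relative gs_quarter) auto
  also have "\<dots> = exp 1 * (1 + norm v) * (?w * exp (- ((norm u)\<^sup>2 / 4) + - ((norm (post_u u v \<omega>))\<^sup>2 / 4)))"
    by (simp only: exp_add mult_ac)
  also have "\<dots> \<le> exp 1 * (1 + norm v) * (?w * exp (- (?w\<^sup>2 / 16) + - (1 / 16) * (\<omega> \<bullet> (v - u))\<^sup>2))"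
    using collision_geometry(3)[OF assms, of v u] by (intro mult_left_mono) auto
  also have "\<dots> = exp 1 * (1 + norm v) * ((?w * exp (- (?w\<^sup>2 / 16))) * gb (\<omega> \<bullet> (v - u)))"
    unfolding gb_def exp_add by simp
  also have "\<dots> \<le> exp 1 * (1 + norm v) * (exp 4 * gb (\<omega> \<bullet> (v - u)))"
    by (intro mult_left_mono mult_right_mono bracket_gaussian) auto
  also have "\<dots> = exp 5 * ((1 + norm v) * gb (\<omega> \<bullet> (v - u)))"
    using exp_add[of "1::real" 4] by (simp add: mult_ac)
  finally show ?thesis using pos by (simp add: field_simps)
qed

lemma kernel_parallel_aux:
  assumes "norm \<omega> = 1"
  shows "(1 + norm (v - u)) * (gs u * gs (post_v u v \<omega>)) \<le> exp 1 * ((1 + norm v) * gb (norm (perp \<omega> (v - u))))"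
proof -
  have "(1 + norm (v - u)) * (gs u * gs (post_v u v \<omega>)) = ((1 + norm (v - u)) * gs u) * gs (post_v u v \<omega>)"
    by (simp add: mult_ac)
  also have "\<dots> \<le> (exp 1 * ((1 + norm v) * exp (- ((norm u)\<^sup>2 / 4)))) * exp (- ((norm (post_v u v \<omega>))\<^sup>2 / 4))"
    by (intro mult_mono bracket_gs_relative gs_quarter) auto
  also have "\<dots> = exp 1 * ((1 + norm v) * exp (- ((norm u)\<^sup>2 / 4) + - ((norm (post_v u v \<omega>))\<^sup>2 / 4)))"
    by (simp only: exp_add mult_ac)
  also have "\<dots> \<le> exp 1 * ((1 + norm v) * gb (norm (perp \<omega> (v - u))))"
  proof -
    have "- (y / 4) + - (z / 4) \<le> - (1 / 16) * x" if "x \<le> 2 * (y + z)" "0 \<le> x" for x y z :: real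
      using that by (simp add: field_simps)
    from this[OF collision_geometry(4)[OF assms, of v u]]
    have "- ((norm u)\<^sup>2 / 4) + - ((norm (post_v u v \<omega>))\<^sup>2 / 4) \<le> - (1 / 16) * (norm (perp \<omega> (v - u)))\<^sup>2"
      by simp
    then show ?thesis
      unfolding gb_def by (intro mult_left_mono) auto
  qed
  finally show ?thesis .
qed

lemma kernel_perp:
  assumes "norm \<omega> = 1"
  shows "\<bar>\<omega> \<bullet> (v - u)\<bar> * (gs u * gs (post_v u v \<omega>)) \<le> exp 1 * ((1 + norm v) * gb (norm (perp \<omega> (v - u))))"
proof -
  have "\<bar>\<omega> \<bullet> (v - u)\<bar> * (gs u * gs (post_v u v \<omega>)) \<le> (1 + norm (v - u)) * (gs u * gs (post_v u v \<omega>))"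
    using bracket_relative(3)[OF assms, of v u] by (intro mult_right_mono) auto
  with kernel_parallel_aux[OF assms, of v u] show ?thesis by linarith
qed

lemma kernel_parallel:
  assumes "norm \<omega> = 1"
  shows "\<bar>\<omega> \<bullet> (v - u)\<bar> * (gs u * gs (post_v u v \<omega>))
    \<le> exp 1 * ((1 + norm v) * (\<bar>\<omega> \<bullet> (v - u)\<bar> / (1 + norm (v - u)) * gb (norm (perp \<omega> (v - u)))))"
proof -
  have pos: "1 + norm (v - u) > 0" by (simp add: add_pos_nonneg)
  have "\<bar>\<omega> \<bullet> (v - u)\<bar> / (1 + norm (v - u)) * ((1 + norm (v - u)) * (gs u * gs (post_v u v \<omega>)))
      \<le> \<bar>\<omega> \<bullet> (v - u)\<bar> / (1 + norm (v - u)) * (exp 1 * ((1 + norm v) * gb (norm (perp \<omega> (v - u)))))"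
    using pos by (intro mult_left_mono kernel_parallel_aux[OF assms]) auto
  then show ?thesis using pos by (simp add: mult_ac)
qed

lemma triple_measurable [measurable_dest]:
  assumes "(\<lambda>(u, v, \<omega>). k u v \<omega>) \<in> borel_measurable (borel \<Otimes>\<^sub>M borel \<Otimes>\<^sub>M borel)"
    and "f \<in> borel_measurable M" "g \<in> borel_measurable M" "h \<in> borel_measurable M"
  shows "(\<lambda>x. k (f x) (g x) (h x)) \<in> borel_measurable M"
proof -
  note assms[measurable]
  have "(\<lambda>x. case (f x, g x, h x) of (u, v, \<omega>) \<Rightarrow> k u v \<omega>) \<in> borel_measurable M"
    by (rule measurable_compose[OF _ assms(1)]) measurable
  then show ?thesis by simp
qed

lemma collI_kernel_le:
  assumes [measurable]: "coll_meas G"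
    and "\<And>u v \<omega>. norm \<omega> = 1 \<Longrightarrow> F u v \<omega> \<le> c * G u v \<omega>"
  shows "collI F \<le> c * collI G"
proof -
  have "collI F \<le> collI (\<lambda>u v \<omega>. c * G u v \<omega>)"
    by (rule collI_mono) (rule assms)
  then show ?thesis by (simp add: collI_cmult)
qed

section \<open>Uniform notation for the trilinear bounds\<close>

definition form3 :: "(vfun \<Rightarrow> vfun \<Rightarrow> vfun \<Rightarrow> ckernel) \<Rightarrow> bool" where
  "form3 \<Psi> \<longleftrightarrow> (\<exists>C. \<forall>p q r. meas p \<longrightarrow> meas q \<longrightarrow> meas r \<longrightarrow>
    collI (\<Psi> p q r) \<le> ennreal C * (enn_L2 p * enn_L2 q * enn_L2 r))"

lemma form3D:
  assumes "form3 \<Psi>"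
  obtains C where "C \<ge> 0" "\<And>p q r. meas p \<Longrightarrow> meas q \<Longrightarrow> meas r \<Longrightarrow>
    collI (\<Psi> p q r) \<le> ennreal C * (enn_L2 p * enn_L2 q * enn_L2 r)"
proof -
  obtain C where C: "\<forall>p q r. meas p \<longrightarrow> meas q \<longrightarrow> meas r \<longrightarrow>
    collI (\<Psi> p q r) \<le> ennreal C * (enn_L2 p * enn_L2 q * enn_L2 r)"
    using assms unfolding form3_def by auto
  show thesis
    by (rule that[of "max 0 C"]) (use C in \<open>auto simp: ennreal_max_0\<close>)
qed

lemma form3_loss: "form3 (\<lambda>p q r u v \<omega>. p u * q v * r v * ennreal (gb (norm u)))"
  unfolding form3_def gb_def by (rule form_loss_bound) simp

lemma form3_gain: "form3 (\<lambda>p q r u v \<omega>. p (post_u u v \<omega>) * q (post_v u v \<omega>) * r v * ennreal (gb (norm u)))"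
  unfolding form3_def gb_def by (rule form_gain_bound) simp

lemma form3_inner: "form3 (\<lambda>p q r u v \<omega>. p u * q v * r (post_u u v \<omega>) * ennreal (gb (\<omega> \<bullet> (v - u)) / (1 + norm (v - u))))"
  unfolding form3_def gb_def by (rule form_inner_bound) simp

lemma form3_perp: "form3 (\<lambda>p q r u v \<omega>. p u * q v * r (post_v u v \<omega>) * ennreal (gb (norm (perp \<omega> (v - u)))))"
  unfolding form3_def gb_def by (rule form_perp_bound) simp

lemma form3_transversal: "form3 (\<lambda>p q r u v \<omega>. p (post_u u v \<omega>) * q v * r v * ennreal (gb (\<omega> \<bullet> (v - u)) / (1 + norm (v - u))))"
  unfolding form3_def gb_def by (rule form_transversal_bound) simp

lemma form3_parallel: "form3 (\<lambda>p q r u v \<omega>. p (post_v u v \<omega>) * q v * r v *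
    ennreal (\<bar>\<omega> \<bullet> (v - u)\<bar> / (1 + norm (v - u)) * gb (norm (perp \<omega> (v - u)))))"
  unfolding form3_def gb_def by (rule form_parallel_bound) simp

lemma form3_gauss_u: "form3 (\<lambda>p q r u v \<omega>. p (post_u u v \<omega>) * q u * r v * ennreal (gb (norm (post_v u v \<omega>))))"
proof -
  have "form3 (\<lambda>q r p u v \<omega>. q u * r v * p (post_u u v \<omega>) * ennreal (gb (norm (post_v u v \<omega>))))"
    unfolding form3_def gb_def by (rule form_gauss_u_bound) simp
  then show ?thesis
  proof (rule form3D, goal_cases)
    case (1 C)
    note bound = 1(2)
    show ?case
      unfolding form3_def
    proof (intro exI[of _ C] allI impI, goal_cases)
      case (1 p q r)
      then show ?case
        using bound[of q r p] by (simp add: mult_ac)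
    qed
  qed
qed

lemma form3_gauss_v: "form3 (\<lambda>p q r u v \<omega>. p (post_v u v \<omega>) * q u * r v * ennreal (gb (norm (post_u u v \<omega>))))"
proof -
  have "form3 (\<lambda>q r p u v \<omega>. q u * r v * p (post_v u v \<omega>) * ennreal (gb (norm (post_u u v \<omega>))))"
    unfolding form3_def gb_def by (rule form_gauss_v_bound) simp
  then show ?thesis
  proof (rule form3D, goal_cases)
    case (1 C)
    note bound = 1(2)
    show ?case
      unfolding form3_def
    proof (intro exI[of _ C] allI impI, goal_cases)
      case (1 p q r)
      then show ?case
        using bound[of q r p] by (simp add: mult_ac)
    qed
  qed
qed

text \<open>Since \<open>ennreal\<close> sends negative numbers to 0, constants of unknown sign are
  replaced by their positive parts before they are added.\<close>

lemma add_le_ennreal_const: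
  assumes "a \<le> ennreal C * x" "b \<le> ennreal D * x"
  shows "a + b \<le> ennreal (max 0 C + max 0 D) * x"
proof -
  have "a + b \<le> ennreal (max 0 C) * x + ennreal (max 0 D) * x"
    using assms by (intro add_mono) (auto simp: ennreal_max_0)
  then show ?thesis by (simp add: distrib_right)
qed

section \<open>Weighted estimates of the collision kernels\<close>

text \<open>\<open>\<beta>\<close> will be the collision frequency \<open>\<nu>\<close>.\<close>

locale velocity_weight =
  fixes \<beta> :: "vec3 \<Rightarrow> real" and A :: real
  assumes measurable_weight [measurable]: "meas \<beta>"
    and A_pos: "A > 0"
    and weight_ge: "1 + norm v \<le> A * \<beta> v"
begin

lemma weight_pos: "\<beta> v > 0"
proof -
  have "0 < A * \<beta> v"
    using weight_ge[of v] norm_ge_zero[of v] by linarith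
  then show ?thesis using A_pos by (simp add: zero_less_mult_iff)
qed

lemma weight_nonneg [simp]: "\<beta> v \<ge> 0"
  using weight_pos[of v] by simp

lemma sqrt_weight_ge: "sqrt (1 + norm v) \<le> sqrt A * sqrt (\<beta> v)"
  unfolding real_sqrt_mult[symmetric] by (intro real_sqrt_le_mono weight_ge)

definition wmul :: "vfun \<Rightarrow> vfun" where
  "wmul g v = ennreal (\<beta> v) * g v"

definition hmul :: "vfun \<Rightarrow> vfun" where
  "hmul g v = ennreal (sqrt (\<beta> v)) * g v"

lemma measurable_wmul [measurable]: "meas g \<Longrightarrow> wmul g \<in> borel_measurable borel"
  unfolding wmul_def[abs_def] by measurable

lemma measurable_hmul [measurable]: "meas g \<Longrightarrow> hmul g \<in> borel_measurable borel"
  unfolding hmul_def[abs_def] by measurable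

lemma hmul_hmul: "hmul f v * hmul g v = f v * g v * ennreal (\<beta> v)"
proof -
  have "ennreal (sqrt (\<beta> v)) * ennreal (sqrt (\<beta> v)) = ennreal (\<beta> v)"
    by (simp add: ennreal_mult[symmetric])
  moreover have "hmul f v * hmul g v = f v * g v * (ennreal (sqrt (\<beta> v)) * ennreal (sqrt (\<beta> v)))"
    unfolding hmul_def by (simp only: mult_ac)
  ultimately show ?thesis by simp
qed

lemma le_hmul: "f v \<le> ennreal (sqrt A) * hmul f v"
proof -
  have "1 \<le> sqrt (1 + norm v)" by simp
  also have "\<dots> \<le> sqrt A * sqrt (\<beta> v)" by (rule sqrt_weight_ge)
  finally have "1 \<le> ennreal (sqrt A) * ennreal (sqrt (\<beta> v))"
    using A_pos by (simp add: ennreal_mult[symmetric] del: ennreal_1 add: ennreal_1[symmetric])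
  from mult_right_mono[OF this, of "f v"] show ?thesis
    by (simp add: hmul_def mult.assoc)
qed

lemma enn_L2_le_hmul:
  assumes [measurable]: "meas f"
  shows "enn_L2 f \<le> ennreal (sqrt A) * enn_L2 (hmul f)"
  using enn_L2_mono[of f "\<lambda>v. ennreal (sqrt A) * hmul f v", OF le_hmul]
  by (simp add: enn_L2_cmult)

text \<open>The same kernel is bounded twice: with the full weight on g, as needed for (2) and (3),
  and with half a weight on g and half on one of the two functions, as needed for (1). Measurability
  is included so that such kernels can be added.\<close>

definition bil_bound :: "(vfun \<Rightarrow> vfun \<Rightarrow> ckernel) \<Rightarrow> bool" where
  "bil_bound \<Phi> \<longleftrightarrow>
    (\<forall>p r. meas p \<longrightarrow> meas r \<longrightarrow> coll_meas (\<Phi> p r)) \<and>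
    (\<exists>C. \<forall>p r g. meas p \<longrightarrow> meas r \<longrightarrow> meas g \<longrightarrow>
      collI (\<lambda>u v \<omega>. \<Phi> p r u v \<omega> * g v) \<le> ennreal C * (enn_L2 p * enn_L2 r * enn_L2 (wmul g))) \<and>
    (\<exists>C. \<forall>p r g. meas p \<longrightarrow> meas r \<longrightarrow> meas g \<longrightarrow>
      collI (\<lambda>u v \<omega>. \<Phi> p r u v \<omega> * g v)
        \<le> ennreal C * (enn_L2 (hmul g) * (enn_L2 p * enn_L2 (hmul r) + enn_L2 (hmul p) * enn_L2 r)))"

lemma bil_boundD:
  assumes "bil_bound \<Phi>"
  shows "meas p \<Longrightarrow> meas r \<Longrightarrow> coll_meas (\<Phi> p r)"
    and "\<exists>C. \<forall>p r g. meas p \<longrightarrow> meas r \<longrightarrow> meas g \<longrightarrow>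
      collI (\<lambda>u v \<omega>. \<Phi> p r u v \<omega> * g v) \<le> ennreal C * (enn_L2 p * enn_L2 r * enn_L2 (wmul g))"
    and "\<exists>C. \<forall>p r g. meas p \<longrightarrow> meas r \<longrightarrow> meas g \<longrightarrow>
      collI (\<lambda>u v \<omega>. \<Phi> p r u v \<omega> * g v)
        \<le> ennreal C * (enn_L2 (hmul g) * (enn_L2 p * enn_L2 (hmul r) + enn_L2 (hmul p) * enn_L2 r))"
  using assms unfolding bil_bound_def by auto

lemma bil_bound_add:
  assumes "bil_bound \<Phi>" "bil_bound \<Psi>"
  shows "bil_bound (\<lambda>p r u v \<omega>. \<Phi> p r u v \<omega> + \<Psi> p r u v \<omega>)"
proof -
  have 1: "\<exists>C. \<forall>p r g. meas p \<longrightarrow> meas r \<longrightarrow> meas g \<longrightarrow>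
      collI (\<lambda>u v \<omega>. (\<Phi> p r u v \<omega> + \<Psi> p r u v \<omega>) * g v) \<le> ennreal C * R p r g"
    if \<Phi>: "\<exists>C. \<forall>p r g. meas p \<longrightarrow> meas r \<longrightarrow> meas g \<longrightarrow>
      collI (\<lambda>u v \<omega>. \<Phi> p r u v \<omega> * g v) \<le> ennreal C * R p r g"
    and \<Psi>: "\<exists>C. \<forall>p r g. meas p \<longrightarrow> meas r \<longrightarrow> meas g \<longrightarrow>
      collI (\<lambda>u v \<omega>. \<Psi> p r u v \<omega> * g v) \<le> ennreal C * R p r g" for R
  proof -
    obtain C where C: "\<And>p r g. meas p \<Longrightarrow> meas r \<Longrightarrow> meas g \<Longrightarrow>
      collI (\<lambda>u v \<omega>. \<Phi> p r u v \<omega> * g v) \<le> ennreal C * R p r g" using \<Phi> by auto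
    obtain D where D: "\<And>p r g. meas p \<Longrightarrow> meas r \<Longrightarrow> meas g \<Longrightarrow>
      collI (\<lambda>u v \<omega>. \<Psi> p r u v \<omega> * g v) \<le> ennreal D * R p r g" using \<Psi> by auto
    have "collI (\<lambda>u v \<omega>. (\<Phi> p r u v \<omega> + \<Psi> p r u v \<omega>) * g v) \<le> ennreal (max 0 C + max 0 D) * R p r g"
      if [measurable]: "meas p" "meas r" "meas g" for p r g
    proof -
      have [measurable]: "coll_meas (\<Phi> p r)" "coll_meas (\<Psi> p r)"
        using assms that unfolding bil_bound_def by auto
      have "collI (\<lambda>u v \<omega>. (\<Phi> p r u v \<omega> + \<Psi> p r u v \<omega>) * g v)
        = collI (\<lambda>u v \<omega>. \<Phi> p r u v \<omega> * g v) + collI (\<lambda>u v \<omega>. \<Psi> p r u v \<omega> * g v)"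
        unfolding distrib_right by (rule collI_add) measurable
      also have "\<dots> \<le> ennreal (max 0 C + max 0 D) * R p r g"
        by (intro add_le_ennreal_const C D) fact+
      finally show ?thesis .
    qed
    then show ?thesis by blast
  qed
  have 2: "coll_meas (\<lambda>u v \<omega>. \<Phi> p r u v \<omega> + \<Psi> p r u v \<omega>)"
    if "meas p" "meas r" for p r
  proof -
    have [measurable]: "coll_meas (\<Phi> p r)" "coll_meas (\<Psi> p r)"
      using assms that unfolding bil_bound_def by auto
    show ?thesis by measurable
  qed
  show ?thesis
    unfolding bil_bound_def
    by (intro conjI allI impI 1 2) (use assms in \<open>auto simp: bil_bound_def\<close>)
qed

lemma bil_bound_swap:
  assumes "bil_bound \<Phi>"
  shows "bil_bound (\<lambda>p r. \<Phi> r p)"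
proof -
  obtain C where
    C: "\<forall>p r g. meas p \<longrightarrow> meas r \<longrightarrow> meas g \<longrightarrow>
      collI (\<lambda>u v \<omega>. \<Phi> p r u v \<omega> * g v) \<le> ennreal C * (enn_L2 p * enn_L2 r * enn_L2 (wmul g))"
    using bil_boundD(2)[OF assms] ..
  obtain D where
    D: "\<forall>p r g. meas p \<longrightarrow> meas r \<longrightarrow> meas g \<longrightarrow>
      collI (\<lambda>u v \<omega>. \<Phi> p r u v \<omega> * g v)
        \<le> ennreal D * (enn_L2 (hmul g) * (enn_L2 p * enn_L2 (hmul r) + enn_L2 (hmul p) * enn_L2 r))"
    using bil_boundD(3)[OF assms] ..
  show ?thesis
    unfolding bil_bound_def
  proof (intro conjI allI impI exI)
    fix p r :: vfun assume "meas p" "meas r"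
    then show "coll_meas (\<Phi> r p)" using assms unfolding bil_bound_def by auto
  next
    fix p r g :: vfun assume "meas p" "meas r" "meas g"
    then show "collI (\<lambda>u v \<omega>. \<Phi> r p u v \<omega> * g v) \<le> ennreal C * (enn_L2 p * enn_L2 r * enn_L2 (wmul g))"
      using C[rule_format, of r p g] by (simp add: mult_ac)
  next
    fix p r g :: vfun assume "meas p" "meas r" "meas g"
    then show "collI (\<lambda>u v \<omega>. \<Phi> r p u v \<omega> * g v)
        \<le> ennreal D * (enn_L2 (hmul g) * (enn_L2 p * enn_L2 (hmul r) + enn_L2 (hmul p) * enn_L2 r))"
      using D[rule_format, of r p g] by (simp add: mult_ac add_ac)
  qed
qed

lemma weight_kernel_le:
  assumes "k \<le> K * ((1 + norm v) * e)" "K \<ge> 0" "e \<ge> 0"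
  shows "ennreal k \<le> ennreal (K * A) * (ennreal (\<beta> v) * ennreal e)"
proof -
  have "k \<le> K * (A * \<beta> v * e)"
    using assms weight_ge[of v] by (elim order_trans) (intro mult_left_mono mult_right_mono)
  then have "ennreal k \<le> ennreal ((K * A) * (\<beta> v * e))"
    by (intro ennreal_leI) (simp add: mult_ac)
  also have "\<dots> = ennreal (K * A) * (ennreal (\<beta> v) * ennreal e)"
    using assms A_pos by (simp add: ennreal_mult)
  finally show ?thesis .
qed

text \<open>The form bound for the kernel e is applied to weighted functions. By \<open>k3\<close>
  the whole weight goes to g; by \<open>k1\<close> it is shared in square roots between g and the
  function at x or the function at y.\<close>

lemma bil_boundI_weighted:
  fixes k e :: "vec3 \<Rightarrow> vec3 \<Rightarrow> vec3 \<Rightarrow> real" and x y :: "vec3 \<Rightarrow> vec3 \<Rightarrow> vec3 \<Rightarrow> vec3"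
  assumes [measurable]: "(\<lambda>(u, v, \<omega>). k u v \<omega>) \<in> borel_measurable (borel \<Otimes>\<^sub>M borel \<Otimes>\<^sub>M borel)"
      "(\<lambda>(u, v, \<omega>). e u v \<omega>) \<in> borel_measurable (borel \<Otimes>\<^sub>M borel \<Otimes>\<^sub>M borel)"
      "(\<lambda>(u, v, \<omega>). x u v \<omega>) \<in> borel_measurable (borel \<Otimes>\<^sub>M borel \<Otimes>\<^sub>M borel)"
      "(\<lambda>(u, v, \<omega>). y u v \<omega>) \<in> borel_measurable (borel \<Otimes>\<^sub>M borel \<Otimes>\<^sub>M borel)"
    and form: "form3 (\<lambda>a b c u v \<omega>. a (x u v \<omega>) * b (y u v \<omega>) * c v * ennreal (e u v \<omega>))"
    and e: "\<And>u v \<omega>. 0 \<le> e u v \<omega>" and K: "0 \<le> K"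
    and k3: "\<And>u v \<omega>. norm \<omega> = 1 \<Longrightarrow> k u v \<omega> \<le> K * ((1 + norm v) * e u v \<omega>)"
    and k1: "\<And>u v \<omega>. norm \<omega> = 1 \<Longrightarrow>
      k u v \<omega> \<le> K * (sqrt (1 + norm v) * (sqrt (1 + norm (x u v \<omega>)) + sqrt (1 + norm (y u v \<omega>))) * e u v \<omega>)"
  shows "bil_bound (\<lambda>p r u v \<omega>. ennreal (k u v \<omega>) * (p (x u v \<omega>) * r (y u v \<omega>)))"
proof -
  obtain C where C: "C \<ge> 0" "\<And>p q r. meas p \<Longrightarrow> meas q \<Longrightarrow> meas r \<Longrightarrow>
    collI (\<lambda>u v \<omega>. p (x u v \<omega>) * q (y u v \<omega>) * r v * ennreal (e u v \<omega>)) \<le> ennreal C * (enn_L2 p * enn_L2 q * enn_L2 r)"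
    using form3D[OF form] by blast
  show ?thesis
    unfolding bil_bound_def
  proof (intro conjI allI impI exI)
    fix p r :: vfun assume [measurable]: "meas p" "meas r"
    show "coll_meas (\<lambda>u v \<omega>. ennreal (k u v \<omega>) * (p (x u v \<omega>) * r (y u v \<omega>)))"
      by measurable
  next
    fix p r g :: vfun
    assume [measurable]: "meas p" "meas r" "meas g"
    have "collI (\<lambda>u v \<omega>. ennreal (k u v \<omega>) * (p (x u v \<omega>) * r (y u v \<omega>)) * g v)
      \<le> ennreal (K * A) * collI (\<lambda>u v \<omega>. p (x u v \<omega>) * r (y u v \<omega>) * wmul g v * ennreal (e u v \<omega>))"
    proof (rule collI_kernel_le)
      fix u v \<omega> :: vec3 assume "norm \<omega> = 1"
      then have "ennreal (k u v \<omega>) \<le> ennreal (K * A) * (ennreal (\<beta> v) * ennreal (e u v \<omega>))"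
        by (intro weight_kernel_le k3 K e)
      from mult_right_mono[OF this, of "p (x u v \<omega>) * r (y u v \<omega>) * g v"]
      show "ennreal (k u v \<omega>) * (p (x u v \<omega>) * r (y u v \<omega>)) * g v
        \<le> ennreal (K * A) * (p (x u v \<omega>) * r (y u v \<omega>) * wmul g v * ennreal (e u v \<omega>))"
        by (simp add: wmul_def mult_ac)
    qed measurable
    also have "\<dots> \<le> ennreal (K * A) * (ennreal C * (enn_L2 p * enn_L2 r * enn_L2 (wmul g)))"
      by (intro mult_left_mono C) auto
    finally show "collI (\<lambda>u v \<omega>. ennreal (k u v \<omega>) * (p (x u v \<omega>) * r (y u v \<omega>)) * g v)
        \<le> ennreal (K * A * C) * (enn_L2 p * enn_L2 r * enn_L2 (wmul g))"
      using K A_pos C by (simp add: ennreal_mult mult.assoc)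
  next
    fix p r g :: vfun
    assume [measurable]: "meas p" "meas r" "meas g"
    have "collI (\<lambda>u v \<omega>. ennreal (k u v \<omega>) * (p (x u v \<omega>) * r (y u v \<omega>)) * g v)
      \<le> ennreal (K * A) * collI (\<lambda>u v \<omega>. p (x u v \<omega>) * hmul r (y u v \<omega>) * hmul g v * ennreal (e u v \<omega>)
          + hmul p (x u v \<omega>) * r (y u v \<omega>) * hmul g v * ennreal (e u v \<omega>))"
    proof (rule collI_kernel_le)
      fix u v \<omega> :: vec3 assume \<omega>: "norm \<omega> = 1"
      let ?x = "x u v \<omega>" and ?y = "y u v \<omega>" and ?e = "e u v \<omega>"
      have "k u v \<omega> \<le> K * (sqrt (1 + norm v) * (sqrt (1 + norm ?x) + sqrt (1 + norm ?y)) * ?e)"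
        by (rule k1[OF \<omega>])
      also have "\<dots> \<le> K * ((sqrt A * sqrt (\<beta> v)) * (sqrt A * sqrt (\<beta> ?x) + sqrt A * sqrt (\<beta> ?y)) * ?e)"
        by (intro mult_left_mono mult_right_mono mult_mono add_mono sqrt_weight_ge e K) (use A_pos in auto)
      also have "\<dots> = (K * (sqrt A * sqrt A)) * (sqrt (\<beta> v) * sqrt (\<beta> ?y) * ?e + sqrt (\<beta> v) * sqrt (\<beta> ?x) * ?e)"
        by (simp only: distrib_left distrib_right mult_ac add_ac)
      finally have "ennreal (k u v \<omega>) \<le> ennreal ((K * A) * (sqrt (\<beta> v) * sqrt (\<beta> ?y) * ?e + sqrt (\<beta> v) * sqrt (\<beta> ?x) * ?e))"
        using A_pos by (intro ennreal_leI) simp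
      also have "\<dots> = ennreal (K * A) * (ennreal (sqrt (\<beta> v)) * ennreal (sqrt (\<beta> ?y)) * ennreal ?e + ennreal (sqrt (\<beta> v)) * ennreal (sqrt (\<beta> ?x)) * ennreal ?e)"
        using A_pos K e by (simp add: ennreal_mult ennreal_plus)
      finally have "ennreal (k u v \<omega>) * (p ?x * r ?y * g v) \<le> \<dots> * (p ?x * r ?y * g v)"
        by (rule mult_right_mono) simp
      then show "ennreal (k u v \<omega>) * (p ?x * r ?y) * g v
        \<le> ennreal (K * A) * (p ?x * hmul r ?y * hmul g v * ennreal ?e + hmul p ?x * r ?y * hmul g v * ennreal ?e)"
        by (simp add: hmul_def distrib_left distrib_right mult_ac)
    qed measurable
    also have "\<dots> \<le> ennreal (K * A) * (ennreal C * (enn_L2 (hmul g) * (enn_L2 p * enn_L2 (hmul r) + enn_L2 (hmul p) * enn_L2 r)))"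
    proof (rule mult_left_mono)
      have "collI (\<lambda>u v \<omega>. p (x u v \<omega>) * hmul r (y u v \<omega>) * hmul g v * ennreal (e u v \<omega>)
          + hmul p (x u v \<omega>) * r (y u v \<omega>) * hmul g v * ennreal (e u v \<omega>))
        = collI (\<lambda>u v \<omega>. p (x u v \<omega>) * hmul r (y u v \<omega>) * hmul g v * ennreal (e u v \<omega>))
        + collI (\<lambda>u v \<omega>. hmul p (x u v \<omega>) * r (y u v \<omega>) * hmul g v * ennreal (e u v \<omega>))"
        by (rule collI_add) measurable
      also have "\<dots> \<le> ennreal C * (enn_L2 p * enn_L2 (hmul r) * enn_L2 (hmul g)) + ennreal C * (enn_L2 (hmul p) * enn_L2 r * enn_L2 (hmul g))"
        by (intro add_mono C) measurable
      also have "\<dots> = ennreal C * (enn_L2 (hmul g) * (enn_L2 p * enn_L2 (hmul r) + enn_L2 (hmul p) * enn_L2 r))"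
        by (simp add: distrib_left mult_ac)
      finally show "collI (\<lambda>u v \<omega>. p (x u v \<omega>) * hmul r (y u v \<omega>) * hmul g v * ennreal (e u v \<omega>)
          + hmul p (x u v \<omega>) * r (y u v \<omega>) * hmul g v * ennreal (e u v \<omega>))
          \<le> ennreal C * (enn_L2 (hmul g) * (enn_L2 p * enn_L2 (hmul r) + enn_L2 (hmul p) * enn_L2 r))" .
    qed simp
    finally show "collI (\<lambda>u v \<omega>. ennreal (k u v \<omega>) * (p (x u v \<omega>) * r (y u v \<omega>)) * g v)
        \<le> ennreal (K * A * C) * (enn_L2 (hmul g) * (enn_L2 p * enn_L2 (hmul r) + enn_L2 (hmul p) * enn_L2 r))"
      using K A_pos C by (simp add: ennreal_mult mult.assoc)
  qed
qed

text \<open>A kernel without growth satisfies both weighted hypotheses, because all brackets are at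
  least 1 and can be inserted.\<close>

lemma bil_boundI_unweighted:
  fixes k e :: "vec3 \<Rightarrow> vec3 \<Rightarrow> vec3 \<Rightarrow> real" and x y :: "vec3 \<Rightarrow> vec3 \<Rightarrow> vec3 \<Rightarrow> vec3"
  assumes meas: "(\<lambda>(u, v, \<omega>). k u v \<omega>) \<in> borel_measurable (borel \<Otimes>\<^sub>M borel \<Otimes>\<^sub>M borel)"
      "(\<lambda>(u, v, \<omega>). e u v \<omega>) \<in> borel_measurable (borel \<Otimes>\<^sub>M borel \<Otimes>\<^sub>M borel)"
      "(\<lambda>(u, v, \<omega>). x u v \<omega>) \<in> borel_measurable (borel \<Otimes>\<^sub>M borel \<Otimes>\<^sub>M borel)"
      "(\<lambda>(u, v, \<omega>). y u v \<omega>) \<in> borel_measurable (borel \<Otimes>\<^sub>M borel \<Otimes>\<^sub>M borel)"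
    and form: "form3 (\<lambda>a b c u v \<omega>. a (x u v \<omega>) * b (y u v \<omega>) * c v * ennreal (e u v \<omega>))"
    and e: "\<And>u v \<omega>. 0 \<le> e u v \<omega>" and K: "0 \<le> K"
    and k: "\<And>u v \<omega>. norm \<omega> = 1 \<Longrightarrow> k u v \<omega> \<le> K * e u v \<omega>"
  shows "bil_bound (\<lambda>p r u v \<omega>. ennreal (k u v \<omega>) * (p (x u v \<omega>) * r (y u v \<omega>)))"
proof (rule bil_boundI_weighted[OF meas form e K])
  fix u v \<omega> :: vec3 assume \<omega>: "norm \<omega> = 1"
  have "1 * e u v \<omega> \<le> (1 + norm v) * e u v \<omega>"
    by (intro mult_right_mono e) auto
  then show "k u v \<omega> \<le> K * ((1 + norm v) * e u v \<omega>)"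
    using k[OF \<omega>, of u v] K by (elim order_trans) (intro mult_left_mono, auto)
  have "1 * 1 \<le> sqrt (1 + norm v) * (sqrt (1 + norm (x u v \<omega>)) + sqrt (1 + norm (y u v \<omega>)))"
    by (intro mult_mono) (auto intro: add_increasing2)
  from mult_right_mono[OF this e[of u v \<omega>]]
  show "k u v \<omega> \<le> K * (sqrt (1 + norm v) * (sqrt (1 + norm (x u v \<omega>)) + sqrt (1 + norm (y u v \<omega>))) * e u v \<omega>)"
    using k[OF \<omega>, of u v] K by (elim order_trans) (intro mult_left_mono, auto)
qed

text \<open>When p and g sit at the same velocity v, the weight can be distributed between them at
  will; \<open>q1\<close> and \<open>q2\<close> record the chosen distribution.\<close>

lemma collI_v_kernel_le:
  fixes k e :: "vec3 \<Rightarrow> vec3 \<Rightarrow> vec3 \<Rightarrow> real" and z :: ckernel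
  assumes [measurable]: "(\<lambda>(u, v, \<omega>). e u v \<omega>) \<in> borel_measurable (borel \<Otimes>\<^sub>M borel \<Otimes>\<^sub>M borel)"
      "coll_meas z" "meas q1" "meas q2"
    and e: "\<And>u v \<omega>. 0 \<le> e u v \<omega>" and K: "0 \<le> K"
    and k: "\<And>u v \<omega>. norm \<omega> = 1 \<Longrightarrow> k u v \<omega> \<le> K * ((1 + norm v) * e u v \<omega>)"
    and q: "\<And>v. p v * g v * ennreal (\<beta> v) = q1 v * q2 v"
  shows "collI (\<lambda>u v \<omega>. ennreal (k u v \<omega>) * (p v * z u v \<omega>) * g v)
    \<le> ennreal (K * A) * collI (\<lambda>u v \<omega>. z u v \<omega> * q1 v * q2 v * ennreal (e u v \<omega>))"
proof (rule collI_kernel_le)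
  fix u v \<omega> :: vec3 assume "norm \<omega> = 1"
  then have "ennreal (k u v \<omega>) \<le> ennreal (K * A) * (ennreal (\<beta> v) * ennreal (e u v \<omega>))"
    by (intro weight_kernel_le k K e)
  from mult_right_mono[OF this, of "p v * z u v \<omega> * g v"]
  have "ennreal (k u v \<omega>) * (p v * z u v \<omega>) * g v
    \<le> ennreal (K * A) * (z u v \<omega> * (p v * g v * ennreal (\<beta> v)) * ennreal (e u v \<omega>))"
    by (simp add: mult_ac)
  then show "ennreal (k u v \<omega>) * (p v * z u v \<omega>) * g v
    \<le> ennreal (K * A) * (z u v \<omega> * q1 v * q2 v * ennreal (e u v \<omega>))"
    unfolding q by (simp add: mult.assoc)
qed measurable

text \<open>One kernel inequality serves both bounds: the weight at v is given to g entirely, or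
  split into square roots between p and g, which share the velocity.\<close>

lemma bil_boundI_v:
  fixes k e :: "vec3 \<Rightarrow> vec3 \<Rightarrow> vec3 \<Rightarrow> real" and x :: "vec3 \<Rightarrow> vec3 \<Rightarrow> vec3 \<Rightarrow> vec3"
  assumes [measurable]: "(\<lambda>(u, v, \<omega>). k u v \<omega>) \<in> borel_measurable (borel \<Otimes>\<^sub>M borel \<Otimes>\<^sub>M borel)"
      "(\<lambda>(u, v, \<omega>). e u v \<omega>) \<in> borel_measurable (borel \<Otimes>\<^sub>M borel \<Otimes>\<^sub>M borel)"
      "(\<lambda>(u, v, \<omega>). x u v \<omega>) \<in> borel_measurable (borel \<Otimes>\<^sub>M borel \<Otimes>\<^sub>M borel)"
    and form: "form3 (\<lambda>a b c u v \<omega>. a (x u v \<omega>) * b v * c v * ennreal (e u v \<omega>))"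
    and e: "\<And>u v \<omega>. 0 \<le> e u v \<omega>" and K: "0 \<le> K"
    and k: "\<And>u v \<omega>. norm \<omega> = 1 \<Longrightarrow> k u v \<omega> \<le> K * ((1 + norm v) * e u v \<omega>)"
  shows "bil_bound (\<lambda>p r u v \<omega>. ennreal (k u v \<omega>) * (p v * r (x u v \<omega>)))"
proof -
  obtain C where C: "C \<ge> 0" "\<And>p q r. meas p \<Longrightarrow> meas q \<Longrightarrow> meas r \<Longrightarrow>
    collI (\<lambda>u v \<omega>. p (x u v \<omega>) * q v * r v * ennreal (e u v \<omega>)) \<le> ennreal C * (enn_L2 p * enn_L2 q * enn_L2 r)"
    using form3D[OF form] by blast
  have main: "collI (\<lambda>u v \<omega>. ennreal (k u v \<omega>) * (p v * r (x u v \<omega>)) * g v) \<le> ennreal (K * A * C) * (enn_L2 r * enn_L2 q1 * enn_L2 q2)"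
    if [measurable]: "meas p" "meas r" "meas g"
        "meas q1" "meas q2"
      and q: "\<And>v. p v * g v * ennreal (\<beta> v) = q1 v * q2 v" for p r g q1 q2
  proof -
    have "collI (\<lambda>u v \<omega>. ennreal (k u v \<omega>) * (p v * r (x u v \<omega>)) * g v)
      \<le> ennreal (K * A) * collI (\<lambda>u v \<omega>. r (x u v \<omega>) * q1 v * q2 v * ennreal (e u v \<omega>))"
      by (rule collI_v_kernel_le[OF _ _ _ _ e K k q]) measurable
    also have "\<dots> \<le> ennreal (K * A) * (ennreal C * (enn_L2 r * enn_L2 q1 * enn_L2 q2))"
      by (intro mult_left_mono C) auto
    finally show ?thesis
      using K A_pos C by (simp add: ennreal_mult mult.assoc)
  qed
  show ?thesis
    unfolding bil_bound_def
  proof (intro conjI allI impI exI)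
    fix p r :: vfun assume [measurable]: "meas p" "meas r"
    show "coll_meas (\<lambda>u v \<omega>. ennreal (k u v \<omega>) * (p v * r (x u v \<omega>)))"
      by measurable
  next
    fix p r g :: vfun
    assume [measurable]: "meas p" "meas r" "meas g"
    show "collI (\<lambda>u v \<omega>. ennreal (k u v \<omega>) * (p v * r (x u v \<omega>)) * g v)
        \<le> ennreal (K * A * C) * (enn_L2 p * enn_L2 r * enn_L2 (wmul g))"
      using main[of p r g p "wmul g"] by (simp add: wmul_def mult_ac)
  next
    fix p r g :: vfun
    assume [measurable]: "meas p" "meas r" "meas g"
    have "collI (\<lambda>u v \<omega>. ennreal (k u v \<omega>) * (p v * r (x u v \<omega>)) * g v)
        \<le> ennreal (K * A * C) * (enn_L2 r * enn_L2 (hmul p) * enn_L2 (hmul g))"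
      by (rule main) (auto simp: hmul_hmul)
    also have "\<dots> \<le> ennreal (K * A * C) * (enn_L2 (hmul g) * (enn_L2 p * enn_L2 (hmul r) + enn_L2 (hmul p) * enn_L2 r))"
      by (intro mult_left_mono) (auto simp: distrib_left mult_ac add_increasing)
    finally show "collI (\<lambda>u v \<omega>. ennreal (k u v \<omega>) * (p v * r (x u v \<omega>)) * g v)
        \<le> ennreal (K * A * C) * (enn_L2 (hmul g) * (enn_L2 p * enn_L2 (hmul r) + enn_L2 (hmul p) * enn_L2 r))" .
  qed
qed

end

text \<open>Dominating kernels for the collision operators: \<open>KB\<close> for those with two perturbations in the quadratic
  slots (\<open>Q1\<close> and \<open>Q2 F1 F2 \<mu>\<close>), \<open>KM\<close> for \<open>Q2\<close> with \<open>\<mu>\<close> in a quadratic slot, and \<open>KT1\<close>, \<open>KT2\<close>, \<open>KT3\<close> for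
  the cubic one, split according to whether the third argument sits at \<open>u\<close>, at \<open>v\<close>, or at one of \<open>u', v'\<close>.\<close>

definition KB :: "vfun \<Rightarrow> vfun \<Rightarrow> ckernel" where
  "KB p q u v \<omega> =
      ennreal (\<bar>\<omega> \<bullet> (v - u)\<bar> * gs u) * (p (post_u u v \<omega>) * q (post_v u v \<omega>))
    + ennreal (\<bar>\<omega> \<bullet> (v - u)\<bar> * gs u) * (q (post_u u v \<omega>) * p (post_v u v \<omega>))
    + ennreal (\<bar>\<omega> \<bullet> (v - u)\<bar> * gs u) * (q v * p u)
    + ennreal (\<bar>\<omega> \<bullet> (v - u)\<bar> * gs u) * (p v * q u)"

definition KM :: "vfun \<Rightarrow> vfun \<Rightarrow> ckernel" where
  "KM p r u v \<omega> =
      ennreal (\<bar>\<omega> \<bullet> (v - u)\<bar> * ((gs u)\<^sup>2 * gs (post_v u v \<omega>))) * (p (post_u u v \<omega>) * r u)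
    + ennreal (\<bar>\<omega> \<bullet> (v - u)\<bar> * (gs u * gs v * gs (post_v u v \<omega>))) * (p (post_u u v \<omega>) * r v)
    + ennreal (\<bar>\<omega> \<bullet> (v - u)\<bar> * ((gs u)\<^sup>2 * gs (post_u u v \<omega>))) * (p (post_v u v \<omega>) * r u)
    + ennreal (\<bar>\<omega> \<bullet> (v - u)\<bar> * (gs u * gs v * gs (post_u u v \<omega>))) * (p (post_v u v \<omega>) * r v)
    + ennreal (\<bar>\<omega> \<bullet> (v - u)\<bar> * (gs u * gs v * gs (post_u u v \<omega>))) * (r (post_u u v \<omega>) * p u)
    + ennreal (\<bar>\<omega> \<bullet> (v - u)\<bar> * (gs u * gs v * gs (post_v u v \<omega>))) * (r (post_v u v \<omega>) * p u)
    + ennreal (\<bar>\<omega> \<bullet> (v - u)\<bar> * ((gs u)\<^sup>2 * gs (post_u u v \<omega>))) * (p v * r (post_u u v \<omega>))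
    + ennreal (\<bar>\<omega> \<bullet> (v - u)\<bar> * ((gs u)\<^sup>2 * gs (post_v u v \<omega>))) * (p v * r (post_v u v \<omega>))"

definition KT1 :: "vfun \<Rightarrow> vfun \<Rightarrow> vfun \<Rightarrow> ckernel" where
  "KT1 p q r u v \<omega> = ennreal (\<bar>\<omega> \<bullet> (v - u)\<bar> * (gs u)\<^sup>2) * (p (post_u u v \<omega>) * q (post_v u v \<omega>) * r u)"

definition KT2 :: "vfun \<Rightarrow> vfun \<Rightarrow> vfun \<Rightarrow> ckernel" where
  "KT2 p q r u v \<omega> = ennreal (\<bar>\<omega> \<bullet> (v - u)\<bar> * (gs u * gs v)) * (p (post_u u v \<omega>) * q (post_v u v \<omega>) * r v)"

definition KT3 :: "vfun \<Rightarrow> vfun \<Rightarrow> vfun \<Rightarrow> ckernel" where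
  "KT3 p q r u v \<omega> =
      ennreal (\<bar>\<omega> \<bullet> (v - u)\<bar> * (gs u * gs (post_u u v \<omega>))) * (q v * (p u * r (post_u u v \<omega>)))
    + ennreal (\<bar>\<omega> \<bullet> (v - u)\<bar> * (gs u * gs (post_v u v \<omega>))) * (q v * (p u * r (post_v u v \<omega>)))"

section \<open>Bounds for the individual collision kernels\<close>

lemma coll_meas_KT:
  assumes [measurable]: "meas p" "meas q" "meas r"
  shows "coll_meas (KT1 p q r)" "coll_meas (KT2 p q r)" "coll_meas (KT3 p q r)"
  unfolding KT1_def KT2_def KT3_def by measurable

lemma KT1_bound:
  "\<exists>C. \<forall>p q r g. meas p \<longrightarrow> meas q \<longrightarrow> meas r \<longrightarrow> meas g \<longrightarrow>
    collI (\<lambda>u v \<omega>. KT1 p q r u v \<omega> * g v) \<le> ennreal C * (enn_L2 p * enn_L2 q * enn_L2 r * enn_L2 g)"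
proof -
  obtain C where C: "\<forall>p q r h. meas p \<longrightarrow> meas q \<longrightarrow> meas r \<longrightarrow> meas h \<longrightarrow>
    collI (\<lambda>u v \<omega>. p (post_u u v \<omega>) * q (post_v u v \<omega>) * r u * h v * ennreal (\<bar>\<omega> \<bullet> (v - u)\<bar> * exp (- 1 * (norm u)\<^sup>2)))
      \<le> ennreal C * (enn_L2 p * enn_L2 q * enn_L2 r * enn_L2 h)"
    using form_quad_bound[OF zero_less_one] ..
  have "(gs u)\<^sup>2 = exp (- 1 * (norm u)\<^sup>2)" for u
    by (simp add: gs_def sq_exp)
  then show ?thesis
    using C by (intro exI[of _ C]) (simp add: KT1_def mult_ac)
qed

context velocity_weight
begin

lemma bil_bound_gain:
  "bil_bound (\<lambda>p q u v \<omega>. ennreal (\<bar>\<omega> \<bullet> (v - u)\<bar> * gs u) * (p (post_u u v \<omega>) * q (post_v u v \<omega>)))"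
  proof (rule bil_boundI_weighted[OF _ _ _ _ form3_gain, of _ "exp 1"])
    fix u v \<omega> :: vec3 assume \<omega>: "norm \<omega> = 1"
    show "\<bar>\<omega> \<bullet> (v - u)\<bar> * gs u \<le> exp 1 * ((1 + norm v) * gb (norm u))"
      by (rule kernel_gauss[OF \<omega>])
    show "\<bar>\<omega> \<bullet> (v - u)\<bar> * gs u \<le> exp 1 * (sqrt (1 + norm v) * (sqrt (1 + norm (post_u u v \<omega>)) + sqrt (1 + norm (post_v u v \<omega>))) * gb (norm u))"
      by (rule kernel_gauss_sqrt[OF \<omega>])
  qed (measurable, auto?)

lemma bil_bound_loss:
  "bil_bound (\<lambda>p q u v \<omega>. ennreal (\<bar>\<omega> \<bullet> (v - u)\<bar> * gs u) * (p v * q u))"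
  proof (rule bil_boundI_v[OF _ _ _ form3_loss, of _ "exp 1"])
    fix u v \<omega> :: vec3 assume \<omega>: "norm \<omega> = 1"
    show "\<bar>\<omega> \<bullet> (v - u)\<bar> * gs u \<le> exp 1 * ((1 + norm v) * gb (norm u))"
      by (rule kernel_gauss[OF \<omega>])
  qed (measurable, auto?)

lemma bil_bound_KB: "bil_bound KB"
proof -
  note * = bil_bound_add[OF bil_bound_add[OF bil_bound_add[OF bil_bound_gain
    bil_bound_swap[OF bil_bound_gain]] bil_bound_swap[OF bil_bound_loss]] bil_bound_loss]
  show ?thesis
    by (rule back_subst[of bil_bound, OF *]) (intro ext, simp only: KB_def)
qed

lemma sqrt_sum_mono: "0 \<le> a \<Longrightarrow> 0 \<le> e \<Longrightarrow> 0 \<le> K \<Longrightarrow> k \<le> K * (a * sqrt (1 + norm x) * e) \<Longrightarrow>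
   k \<le> K * (a * (sqrt (1 + norm x) + sqrt (1 + norm y)) * (e::real))"
  by (elim order_trans) (intro mult_left_mono mult_right_mono, auto)

text \<open>The half weight that is not on g lies on the function at the outgoing velocity. The
  square root at u is only added, by \<open>sqrt_sum_mono\<close>, to reach the shape that the
  general rule expects.\<close>

lemma bil_bound_exchange:
  "bil_bound (\<lambda>p r u v \<omega>. ennreal (\<bar>\<omega> \<bullet> (v - u)\<bar> * ((gs u)\<^sup>2 * gs (post_v u v \<omega>))) * (p (post_u u v \<omega>) * r u))"
  "bil_bound (\<lambda>p r u v \<omega>. ennreal (\<bar>\<omega> \<bullet> (v - u)\<bar> * ((gs u)\<^sup>2 * gs (post_u u v \<omega>))) * (p (post_v u v \<omega>) * r u))"
proof -
  have le: "k \<le> exp 2 * x" if "k \<le> exp 1 * x" "0 \<le> x" for k x :: real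
    using that mult_right_mono[of "exp 1" "exp 2" x] by simp
  show "bil_bound (\<lambda>p r u v \<omega>. ennreal (\<bar>\<omega> \<bullet> (v - u)\<bar> * ((gs u)\<^sup>2 * gs (post_v u v \<omega>))) * (p (post_u u v \<omega>) * r u))"
  proof (rule bil_boundI_weighted[OF _ _ _ _ form3_gauss_u, of _ "exp 2"])
    fix u v \<omega> :: vec3 assume \<omega>: "norm \<omega> = 1"
    show "\<bar>\<omega> \<bullet> (v - u)\<bar> * ((gs u)\<^sup>2 * gs (post_v u v \<omega>)) \<le> exp 2 * ((1 + norm v) * gb (norm (post_v u v \<omega>)))"
      by (rule le[OF kernel_exchange[OF \<omega>]]) simp
    show "\<bar>\<omega> \<bullet> (v - u)\<bar> * ((gs u)\<^sup>2 * gs (post_v u v \<omega>))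
      \<le> exp 2 * (sqrt (1 + norm v) * (sqrt (1 + norm (post_u u v \<omega>)) + sqrt (1 + norm u)) * gb (norm (post_v u v \<omega>)))"
      by (rule sqrt_sum_mono[OF _ _ _ kernel_exchange_sqrt(1)[OF \<omega>]]) simp_all
  qed (measurable, auto?)
  show "bil_bound (\<lambda>p r u v \<omega>. ennreal (\<bar>\<omega> \<bullet> (v - u)\<bar> * ((gs u)\<^sup>2 * gs (post_u u v \<omega>))) * (p (post_v u v \<omega>) * r u))"
  proof (rule bil_boundI_weighted[OF _ _ _ _ form3_gauss_v, of _ "exp 2"])
    fix u v \<omega> :: vec3 assume \<omega>: "norm \<omega> = 1"
    show "\<bar>\<omega> \<bullet> (v - u)\<bar> * ((gs u)\<^sup>2 * gs (post_u u v \<omega>)) \<le> exp 2 * ((1 + norm v) * gb (norm (post_u u v \<omega>)))"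
      by (rule le[OF kernel_exchange[OF \<omega>]]) simp
    show "\<bar>\<omega> \<bullet> (v - u)\<bar> * ((gs u)\<^sup>2 * gs (post_u u v \<omega>))
      \<le> exp 2 * (sqrt (1 + norm v) * (sqrt (1 + norm (post_v u v \<omega>)) + sqrt (1 + norm u)) * gb (norm (post_u u v \<omega>)))"
      by (rule sqrt_sum_mono[OF _ _ _ kernel_exchange_sqrt(2)[OF \<omega>]]) simp_all
  qed (measurable, auto?)
qed

lemma gs_drop: "0 \<le> w \<Longrightarrow> w * (gs u * gs v) \<le> c \<Longrightarrow> w * (gs u * gs v * gs x) \<le> c"
  using mult_left_mono[of "gs u * gs v * gs x" "gs u * gs v" w] by (simp add: mult_left_le)

lemma gs_drop_square: "0 \<le> w \<Longrightarrow> w * (gs u * gs x) \<le> c \<Longrightarrow> w * ((gs u)\<^sup>2 * gs x) \<le> c"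
  using gs_drop[of w u x c u] by (simp add: power2_eq_square mult_ac)

text \<open>The positions of the two functions select the form: an outgoing velocity and u lead to
  the Gaussian forms, u' and v to the transversal form, v' and v to the parallel one. Where
  \<open>gs u * gs v\<close> occurs it absorbs all growth; the terms with the square of
  \<open>gs u\<close> pay with 1 + |v|.\<close>

lemma bil_bound_KM: "bil_bound KM"
proof -
  have B4: "bil_bound (\<lambda>p r u v \<omega>. ennreal (\<bar>\<omega> \<bullet> (v - u)\<bar> * (gs u * gs v * gs (post_v u v \<omega>))) * (p (post_u u v \<omega>) * r v))"
  proof (rule bil_boundI_unweighted[OF _ _ _ _ form3_transversal, of _ "exp 6"])
    fix u v \<omega> :: vec3 assume \<omega>: "norm \<omega> = 1"
    show "\<bar>\<omega> \<bullet> (v - u)\<bar> * (gs u * gs v * gs (post_v u v \<omega>)) \<le> exp 6 * (gb (\<omega> \<bullet> (v - u)) / (1 + norm (v - u)))"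
      by (rule gs_drop[OF _ kernel_transversal_gauss[OF \<omega>]]) simp
  qed (measurable, auto?)
  have B6: "bil_bound (\<lambda>p r u v \<omega>. ennreal (\<bar>\<omega> \<bullet> (v - u)\<bar> * (gs u * gs v * gs (post_u u v \<omega>))) * (p (post_v u v \<omega>) * r v))"
  proof (rule bil_boundI_unweighted[OF _ _ _ _ form3_parallel, of _ "exp 6"])
    fix u v \<omega> :: vec3 assume \<omega>: "norm \<omega> = 1"
    show "\<bar>\<omega> \<bullet> (v - u)\<bar> * (gs u * gs v * gs (post_u u v \<omega>)) \<le> exp 6 * (\<bar>\<omega> \<bullet> (v - u)\<bar> / (1 + norm (v - u)) * gb (norm (perp \<omega> (v - u))))"
      by (rule gs_drop[OF _ kernel_parallel_gauss[OF \<omega>]]) simp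
  qed (measurable, auto?)
  have B7: "bil_bound (\<lambda>r p u v \<omega>. ennreal (\<bar>\<omega> \<bullet> (v - u)\<bar> * (gs u * gs v * gs (post_u u v \<omega>))) * (r (post_u u v \<omega>) * p u))"
  proof (rule bil_boundI_unweighted[OF _ _ _ _ form3_gauss_u, of _ "exp 2"])
    fix u v \<omega> :: vec3 assume \<omega>: "norm \<omega> = 1"
    show "\<bar>\<omega> \<bullet> (v - u)\<bar> * (gs u * gs v * gs (post_u u v \<omega>)) \<le> exp 2 * (gb (norm (post_v u v \<omega>)))"
      by (rule gs_drop[OF _ kernel_all_gauss[OF \<omega>]]) simp_all
  qed (measurable, auto?)
  have B8: "bil_bound (\<lambda>r p u v \<omega>. ennreal (\<bar>\<omega> \<bullet> (v - u)\<bar> * (gs u * gs v * gs (post_v u v \<omega>))) * (r (post_v u v \<omega>) * p u))"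
  proof (rule bil_boundI_unweighted[OF _ _ _ _ form3_gauss_v, of _ "exp 2"])
    fix u v \<omega> :: vec3 assume \<omega>: "norm \<omega> = 1"
    show "\<bar>\<omega> \<bullet> (v - u)\<bar> * (gs u * gs v * gs (post_v u v \<omega>)) \<le> exp 2 * (gb (norm (post_u u v \<omega>)))"
      by (rule gs_drop[OF _ kernel_all_gauss[OF \<omega>]]) simp_all
  qed (measurable, auto?)
  have B9: "bil_bound (\<lambda>p r u v \<omega>. ennreal (\<bar>\<omega> \<bullet> (v - u)\<bar> * ((gs u)\<^sup>2 * gs (post_u u v \<omega>))) * (p v * r (post_u u v \<omega>)))"
  proof (rule bil_boundI_v[OF _ _ _ form3_transversal, of _ "exp 5"])
    fix u v \<omega> :: vec3 assume \<omega>: "norm \<omega> = 1"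
    show "\<bar>\<omega> \<bullet> (v - u)\<bar> * ((gs u)\<^sup>2 * gs (post_u u v \<omega>)) \<le> exp 5 * ((1 + norm v) * (gb (\<omega> \<bullet> (v - u)) / (1 + norm (v - u))))"
      by (rule gs_drop_square[OF _ kernel_transversal[OF \<omega>]]) simp
  qed (measurable, auto?)
  have B10: "bil_bound (\<lambda>p r u v \<omega>. ennreal (\<bar>\<omega> \<bullet> (v - u)\<bar> * ((gs u)\<^sup>2 * gs (post_v u v \<omega>))) * (p v * r (post_v u v \<omega>)))"
  proof (rule bil_boundI_v[OF _ _ _ form3_parallel, of _ "exp 1"])
    fix u v \<omega> :: vec3 assume \<omega>: "norm \<omega> = 1"
    show "\<bar>\<omega> \<bullet> (v - u)\<bar> * ((gs u)\<^sup>2 * gs (post_v u v \<omega>)) \<le> exp 1 * ((1 + norm v) * (\<bar>\<omega> \<bullet> (v - u)\<bar> / (1 + norm (v - u)) * gb (norm (perp \<omega> (v - u)))))"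
      by (rule gs_drop_square[OF _ kernel_parallel[OF \<omega>]]) simp
  qed (measurable, auto?)
  note * = bil_bound_add[OF bil_bound_add[OF bil_bound_add[OF bil_bound_add[OF
    bil_bound_add[OF bil_bound_add[OF bil_bound_add[OF bil_bound_exchange(1) B4] bil_bound_exchange(2)]
    B6] bil_bound_swap[OF B7]] bil_bound_swap[OF B8]] B9] B10]
  show ?thesis
    by (rule back_subst[of bil_bound, OF *]) (intro ext, simp only: KM_def)
qed

text \<open>The factors r and g share the velocity v and enter as one function, while
  \<open>gs u * gs v\<close> absorbs |\<omega> \<bullet> (v - u)| completely, so that no weight
  appears.\<close>

lemma KT2_bound:
  "\<exists>C. \<forall>p q r g. meas p \<longrightarrow> meas q \<longrightarrow> meas r \<longrightarrow> meas g \<longrightarrow>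
    collI (\<lambda>u v \<omega>. KT2 p q r u v \<omega> * g v) \<le> ennreal C * (enn_L2 p * enn_L2 q * enn_L2 (\<lambda>v. r v * g v))"
proof -
  obtain C where C: "C \<ge> 0" "\<And>p q r. meas p \<Longrightarrow> meas q \<Longrightarrow> meas r \<Longrightarrow>
    collI (\<lambda>u v \<omega>. p (post_u u v \<omega>) * q (post_v u v \<omega>) * r v * ennreal (gb (norm u))) \<le> ennreal C * (enn_L2 p * enn_L2 q * enn_L2 r)"
    by (rule form3D[OF form3_gain]) (rule that)
  have "collI (\<lambda>u v \<omega>. KT2 p q r u v \<omega> * g v) \<le> ennreal (exp 2 * C) * (enn_L2 p * enn_L2 q * enn_L2 (\<lambda>v. r v * g v))"
    if [measurable]: "meas p" "meas q" "meas r" "meas g" for p q r g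
  proof -
    have "collI (\<lambda>u v \<omega>. KT2 p q r u v \<omega> * g v)
      \<le> ennreal (exp 2) * collI (\<lambda>u v \<omega>. p (post_u u v \<omega>) * q (post_v u v \<omega>) * (r v * g v) * ennreal (gb (norm u)))"
    proof (rule collI_kernel_le)
      fix u v \<omega> :: vec3 assume \<omega>: "norm \<omega> = 1"
      have "gb (norm u) * gb (norm u) \<le> 1 * gb (norm u)" by (intro mult_right_mono) auto
      then have "exp 2 * (gb (norm u) * gb (norm u)) \<le> exp 2 * gb (norm u)" by simp
      then have "\<bar>\<omega> \<bullet> (v - u)\<bar> * (gs u * gs v) \<le> exp 2 * gb (norm u)"
        using kernel_pair_gauss[OF \<omega>, of v u] by (rule order_trans[rotated])
      then have "ennreal (\<bar>\<omega> \<bullet> (v - u)\<bar> * (gs u * gs v)) \<le> ennreal (exp 2) * ennreal (gb (norm u))"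
        by (simp add: ennreal_mult[symmetric] ennreal_leI)
      from mult_right_mono[OF this, of "p (post_u u v \<omega>) * q (post_v u v \<omega>) * (r v * g v)"]
      show "KT2 p q r u v \<omega> * g v \<le> ennreal (exp 2) * (p (post_u u v \<omega>) * q (post_v u v \<omega>) * (r v * g v) * ennreal (gb (norm u)))"
        by (simp add: KT2_def mult_ac)
    qed measurable
    also have "\<dots> \<le> ennreal (exp 2) * (ennreal C * (enn_L2 p * enn_L2 q * enn_L2 (\<lambda>v. r v * g v)))"
      by (intro mult_left_mono C) auto
    finally show ?thesis using C by (simp add: ennreal_mult mult.assoc)
  qed
  then show ?thesis by blast
qed

text \<open>Suprema remove both functions at outgoing velocities. Of the two Gaussians at u one is
  the kernel of the loss form and the other takes the place of its function at u, with L2 norm sqrt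
  G.\<close>

lemma KT2_bound_sup:
  "\<exists>C. \<forall>p q r g P Q. meas r \<longrightarrow> meas g \<longrightarrow> (\<forall>v. p v \<le> P) \<longrightarrow> (\<forall>v. q v \<le> Q) \<longrightarrow>
    collI (\<lambda>u v \<omega>. KT2 p q r u v \<omega> * g v) \<le> ennreal C * (P * Q * (enn_L2 r * enn_L2 g))"
proof -
  obtain C where C: "C \<ge> 0" "\<And>p q r. meas p \<Longrightarrow> meas q \<Longrightarrow> meas r \<Longrightarrow>
    collI (\<lambda>u v \<omega>. p u * q v * r v * ennreal (gb (norm u))) \<le> ennreal C * (enn_L2 p * enn_L2 q * enn_L2 r)"
    by (rule form3D[OF form3_loss]) (rule that)
  obtain G where G: "G \<ge> 0" "(\<integral>\<^sup>+(x::vec3). ennreal (exp (- (1 / 8) * (norm x)\<^sup>2)) \<partial>lborel) = ennreal G"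
    by (rule nn_integral_gaussian_finite[of "1 / 8"]) (simp, rule that)
  have "(ennreal (gb (norm x)))\<^sup>2 = ennreal (exp (- (1 / 8) * (norm x)\<^sup>2))" for x :: vec3
    by (simp add: gb_def ennreal_power sq_exp)
  then have N: "enn_L2 (\<lambda>u. ennreal (gb (norm u))) = ennreal (sqrt G)"
    using G by (simp add: enn_L2_def)
  have "collI (\<lambda>u v \<omega>. KT2 p q r u v \<omega> * g v) \<le> ennreal (exp 2 * (C * sqrt G)) * (P * Q * (enn_L2 r * enn_L2 g))"
    if [measurable]: "meas r" "meas g" and pq: "\<forall>v. p v \<le> P" "\<forall>v. q v \<le> Q" for p q r g P Q
  proof -
    have "collI (\<lambda>u v \<omega>. KT2 p q r u v \<omega> * g v)
      \<le> (ennreal (exp 2) * (P * Q)) * collI (\<lambda>u v \<omega>. ennreal (gb (norm u)) * r v * g v * ennreal (gb (norm u)))"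
    proof (rule collI_kernel_le)
      fix u v \<omega> :: vec3 assume \<omega>: "norm \<omega> = 1"
      have "ennreal (\<bar>\<omega> \<bullet> (v - u)\<bar> * (gs u * gs v)) \<le> ennreal (exp 2) * (ennreal (gb (norm u)) * ennreal (gb (norm u)))"
        using kernel_pair_gauss[OF \<omega>, of v u] by (simp add: ennreal_mult[symmetric] ennreal_leI)
      then have "ennreal (\<bar>\<omega> \<bullet> (v - u)\<bar> * (gs u * gs v)) * ((p (post_u u v \<omega>) * q (post_v u v \<omega>)) * (r v * g v))
        \<le> (ennreal (exp 2) * (ennreal (gb (norm u)) * ennreal (gb (norm u)))) * ((P * Q) * (r v * g v))"
        using pq by (intro mult_mono) auto
      then show "KT2 p q r u v \<omega> * g v \<le> (ennreal (exp 2) * (P * Q)) * (ennreal (gb (norm u)) * r v * g v * ennreal (gb (norm u)))"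
        by (simp add: KT2_def mult_ac)
    qed measurable
    also have "\<dots> \<le> (ennreal (exp 2) * (P * Q)) * (ennreal C * (enn_L2 (\<lambda>u. ennreal (gb (norm u))) * enn_L2 r * enn_L2 g))"
      by (intro mult_left_mono C) auto
    finally show ?thesis unfolding N using C G by (simp add: ennreal_mult mult_ac)
  qed
  then show ?thesis by blast
qed

text \<open>Once r is replaced by its supremum, nothing is left at an outgoing velocity and the loss
  form suffices. The factorization into \<open>q1\<close> and \<open>q2\<close> stays open because
  (1) wants square roots of the weight on q and g, whereas (3) wants all of it on g.\<close>

lemma KT3_bound_sup:
  "\<exists>C. \<forall>p q r g R q1 q2. meas p \<longrightarrow> meas q \<longrightarrow> meas r \<longrightarrow>
    meas g \<longrightarrow> meas q1 \<longrightarrow> meas q2 \<longrightarrow>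
    (\<forall>v. r v \<le> R) \<longrightarrow> (\<forall>v. q v * g v * ennreal (\<beta> v) = q1 v * q2 v) \<longrightarrow>
    collI (\<lambda>u v \<omega>. KT3 p q r u v \<omega> * g v) \<le> ennreal C * (R * (enn_L2 p * enn_L2 q1 * enn_L2 q2))"
proof -
  obtain C where C: "C \<ge> 0" "\<And>p q r. meas p \<Longrightarrow> meas q \<Longrightarrow> meas r \<Longrightarrow>
    collI (\<lambda>u v \<omega>. p u * q v * r v * ennreal (gb (norm u))) \<le> ennreal C * (enn_L2 p * enn_L2 q * enn_L2 r)"
    by (rule form3D[OF form3_loss]) (rule that)
  have "collI (\<lambda>u v \<omega>. KT3 p q r u v \<omega> * g v) \<le> ennreal (2 * (exp 1 * A * C)) * (R * (enn_L2 p * enn_L2 q1 * enn_L2 q2))"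
    if [measurable]: "meas p" "meas q" "meas r"
      "meas g" "meas q1" "meas q2"
    and r: "\<forall>v. r v \<le> R" and q: "\<forall>v. q v * g v * ennreal (\<beta> v) = q1 v * q2 v" for p q r g R q1 q2
  proof -
    have one: "ennreal (\<bar>\<omega> \<bullet> (v - u)\<bar> * (gs u * gs x)) * (q v * (p u * r x)) * g v
        \<le> (ennreal (exp 1 * A) * R) * (p u * q1 v * q2 v * ennreal (gb (norm u)))"
      if \<omega>: "norm \<omega> = 1" for u v \<omega> x
    proof -
      have "gs u * gs x \<le> gs u * 1" by (intro mult_left_mono) auto
      then have "\<bar>\<omega> \<bullet> (v - u)\<bar> * (gs u * gs x) \<le> \<bar>\<omega> \<bullet> (v - u)\<bar> * gs u"
        by (intro mult_left_mono) auto
      then have "ennreal (\<bar>\<omega> \<bullet> (v - u)\<bar> * (gs u * gs x)) \<le> ennreal (exp 1 * A) * (ennreal (\<beta> v) * ennreal (gb (norm u)))"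
        using kernel_gauss[OF \<omega>, of v u] by (intro weight_kernel_le) auto
      then have "ennreal (\<bar>\<omega> \<bullet> (v - u)\<bar> * (gs u * gs x)) * (r x * (p u * (q v * g v)))
        \<le> (ennreal (exp 1 * A) * (ennreal (\<beta> v) * ennreal (gb (norm u)))) * (R * (p u * (q v * g v)))"
        using r by (intro mult_mono) auto
      also have "\<dots> = (ennreal (exp 1 * A) * R) * (p u * (q v * g v * ennreal (\<beta> v)) * ennreal (gb (norm u)))"
        by (simp only: mult_ac)
      also have "q v * g v * ennreal (\<beta> v) = q1 v * q2 v"
        using q by blast
      finally show ?thesis
        by (simp only: mult_ac)
    qed
    have "collI (\<lambda>u v \<omega>. KT3 p q r u v \<omega> * g v)
      \<le> (2 * (ennreal (exp 1 * A) * R)) * collI (\<lambda>u v \<omega>. p u * q1 v * q2 v * ennreal (gb (norm u)))"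
    proof (rule collI_kernel_le)
      fix u v \<omega> :: vec3 assume \<omega>: "norm \<omega> = 1"
      show "KT3 p q r u v \<omega> * g v \<le> (2 * (ennreal (exp 1 * A) * R)) * (p u * q1 v * q2 v * ennreal (gb (norm u)))"
        using add_mono[OF one[OF \<omega>, of v u "post_u u v \<omega>"] one[OF \<omega>, of v u "post_v u v \<omega>"]]
        unfolding KT3_def distrib_right mult_2 .
    qed measurable
    also have "\<dots> \<le> (2 * (ennreal (exp 1 * A) * R)) * (ennreal C * (enn_L2 p * enn_L2 q1 * enn_L2 q2))"
      by (intro mult_left_mono C) auto
    finally show ?thesis using C A_pos by (simp add: ennreal_mult mult_ac)
  qed
  then show ?thesis by blast
qed

text \<open>Without a supremum r remains at u' or v', where the Gaussians control one component of v
  - u only: the inner form covers u', the perpendicular form v'. The factors q and g at v are merged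
  into one function.\<close>

lemma KT3_bound:
  "\<exists>C. \<forall>p q r g. meas p \<longrightarrow> meas q \<longrightarrow> meas r \<longrightarrow>
    meas g \<longrightarrow>
    collI (\<lambda>u v \<omega>. KT3 p q r u v \<omega> * g v) \<le> ennreal C * (enn_L2 p * enn_L2 r * enn_L2 (\<lambda>v. q v * wmul g v))"
proof -
  obtain C where C: "C \<ge> 0" "\<And>p q r. meas p \<Longrightarrow> meas q \<Longrightarrow> meas r \<Longrightarrow>
    collI (\<lambda>u v \<omega>. p u * q v * r (post_u u v \<omega>) * ennreal (gb (\<omega> \<bullet> (v - u)) / (1 + norm (v - u)))) \<le> ennreal C * (enn_L2 p * enn_L2 q * enn_L2 r)"
    by (rule form3D[OF form3_inner]) (rule that)
  obtain D where D: "D \<ge> 0" "\<And>p q r. meas p \<Longrightarrow> meas q \<Longrightarrow> meas r \<Longrightarrow>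
    collI (\<lambda>u v \<omega>. p u * q v * r (post_v u v \<omega>) * ennreal (gb (norm (perp \<omega> (v - u))))) \<le> ennreal D * (enn_L2 p * enn_L2 q * enn_L2 r)"
    by (rule form3D[OF form3_perp]) (rule that)
  have "collI (\<lambda>u v \<omega>. KT3 p q r u v \<omega> * g v) \<le> ennreal (exp 5 * A * C + exp 1 * A * D) * (enn_L2 p * enn_L2 r * enn_L2 (\<lambda>v. q v * wmul g v))"
    if [measurable]: "meas p" "meas q" "meas r"
      "meas g" for p q r g
  proof -
    let ?N = "enn_L2 p * enn_L2 r * enn_L2 (\<lambda>v. q v * wmul g v)"
    have "collI (\<lambda>u v \<omega>. ennreal (\<bar>\<omega> \<bullet> (v - u)\<bar> * (gs u * gs (post_u u v \<omega>))) * (q v * (p u * r (post_u u v \<omega>))) * g v)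
      \<le> ennreal (exp 5 * A) * collI (\<lambda>u v \<omega>. (p u * r (post_u u v \<omega>)) * (q v * wmul g v) * 1 * ennreal (gb (\<omega> \<bullet> (v - u)) / (1 + norm (v - u))))"
    proof (rule collI_v_kernel_le[where p = q and g = g and ?q1.0 = "\<lambda>v. q v * wmul g v" and ?q2.0 = "\<lambda>_. 1"
            and k = "\<lambda>u v \<omega>. \<bar>\<omega> \<bullet> (v - u)\<bar> * (gs u * gs (post_u u v \<omega>))"
            and e = "\<lambda>u v \<omega>. gb (\<omega> \<bullet> (v - u)) / (1 + norm (v - u))"
            and z = "\<lambda>u v \<omega>. p u * r (post_u u v \<omega>)"])
      fix u v \<omega> :: vec3 assume \<omega>: "norm \<omega> = 1"
      show "\<bar>\<omega> \<bullet> (v - u)\<bar> * (gs u * gs (post_u u v \<omega>)) \<le> exp 5 * ((1 + norm v) * (gb (\<omega> \<bullet> (v - u)) / (1 + norm (v - u))))"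
        by (rule kernel_transversal[OF \<omega>])
    qed (measurable, auto simp: wmul_def mult_ac)
    also have "\<dots> = ennreal (exp 5 * A) * collI (\<lambda>u v \<omega>. p u * (q v * wmul g v) * r (post_u u v \<omega>) * ennreal (gb (\<omega> \<bullet> (v - u)) / (1 + norm (v - u))))"
      by (simp add: mult_ac)
    also have "\<dots> \<le> ennreal (exp 5 * A) * (ennreal C * (enn_L2 p * enn_L2 (\<lambda>v. q v * wmul g v) * enn_L2 r))"
      by (intro mult_left_mono C) auto
    finally have 1: "collI (\<lambda>u v \<omega>. ennreal (\<bar>\<omega> \<bullet> (v - u)\<bar> * (gs u * gs (post_u u v \<omega>))) * (q v * (p u * r (post_u u v \<omega>))) * g v)
      \<le> ennreal (exp 5 * A * C) * ?N"
      using C A_pos by (simp add: ennreal_mult mult_ac)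
    have "collI (\<lambda>u v \<omega>. ennreal (\<bar>\<omega> \<bullet> (v - u)\<bar> * (gs u * gs (post_v u v \<omega>))) * (q v * (p u * r (post_v u v \<omega>))) * g v)
      \<le> ennreal (exp 1 * A) * collI (\<lambda>u v \<omega>. (p u * r (post_v u v \<omega>)) * (q v * wmul g v) * 1 * ennreal (gb (norm (perp \<omega> (v - u)))))"
    proof (rule collI_v_kernel_le[where p = q and g = g and ?q1.0 = "\<lambda>v. q v * wmul g v" and ?q2.0 = "\<lambda>_. 1"
            and k = "\<lambda>u v \<omega>. \<bar>\<omega> \<bullet> (v - u)\<bar> * (gs u * gs (post_v u v \<omega>))"
            and e = "\<lambda>u v \<omega>. gb (norm (perp \<omega> (v - u)))"
            and z = "\<lambda>u v \<omega>. p u * r (post_v u v \<omega>)"])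
      fix u v \<omega> :: vec3 assume \<omega>: "norm \<omega> = 1"
      show "\<bar>\<omega> \<bullet> (v - u)\<bar> * (gs u * gs (post_v u v \<omega>)) \<le> exp 1 * ((1 + norm v) * (gb (norm (perp \<omega> (v - u)))))"
        by (rule kernel_perp[OF \<omega>])
    qed (measurable, auto simp: wmul_def mult_ac)
    also have "\<dots> = ennreal (exp 1 * A) * collI (\<lambda>u v \<omega>. p u * (q v * wmul g v) * r (post_v u v \<omega>) * ennreal (gb (norm (perp \<omega> (v - u)))))"
      by (simp add: mult_ac)
    also have "\<dots> \<le> ennreal (exp 1 * A) * (ennreal D * (enn_L2 p * enn_L2 (\<lambda>v. q v * wmul g v) * enn_L2 r))"
      by (intro mult_left_mono D) auto
    finally have 2: "collI (\<lambda>u v \<omega>. ennreal (\<bar>\<omega> \<bullet> (v - u)\<bar> * (gs u * gs (post_v u v \<omega>))) * (q v * (p u * r (post_v u v \<omega>))) * g v)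
      \<le> ennreal (exp 1 * A * D) * ?N"
      using D A_pos by (simp add: ennreal_mult mult_ac)
    have "collI (\<lambda>u v \<omega>. KT3 p q r u v \<omega> * g v)
      = collI (\<lambda>u v \<omega>. ennreal (\<bar>\<omega> \<bullet> (v - u)\<bar> * (gs u * gs (post_u u v \<omega>))) * (q v * (p u * r (post_u u v \<omega>))) * g v)
      + collI (\<lambda>u v \<omega>. ennreal (\<bar>\<omega> \<bullet> (v - u)\<bar> * (gs u * gs (post_v u v \<omega>))) * (q v * (p u * r (post_v u v \<omega>))) * g v)"
      unfolding KT3_def distrib_right by (rule collI_add) measurable
    also have "\<dots> \<le> ennreal (exp 5 * A * C) * ?N + ennreal (exp 1 * A * D) * ?N"
      by (intro add_mono 1 2)
    also have "\<dots> = ennreal (exp 5 * A * C + exp 1 * A * D) * ?N"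
      using C D A_pos by (simp add: distrib_right)
    finally show ?thesis .
  qed
  then show ?thesis by blast
qed

end

section \<open>The combined kernel and a calculus of estimates\<close>

definition Ktot :: "vfun \<Rightarrow> vfun \<Rightarrow> vfun \<Rightarrow> ckernel" where
  "Ktot p q r u v \<omega> = KB p q u v \<omega> + KM p r u v \<omega> + KM q r u v \<omega>
    + KT1 p q r u v \<omega> + KT1 q p r u v \<omega> + KT2 p q r u v \<omega> + KT2 q p r u v \<omega> + KT3 p q r u v \<omega> + KT3 q p r u v \<omega>"

text \<open>The right-hand side is kept as a functional R of the four functions, with a constant
  chosen before them. Estimates of the summands of a kernel can then be weakened to a common R and
  added.\<close>

definition estimate :: "(vfun \<Rightarrow> vfun \<Rightarrow> vfun \<Rightarrow> ckernel) \<Rightarrow> (vfun \<Rightarrow> vfun \<Rightarrow> vfun \<Rightarrow> vfun \<Rightarrow> ennreal) \<Rightarrow> bool" where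
  "estimate F R \<longleftrightarrow>
    (\<forall>p q r. meas p \<longrightarrow> meas q \<longrightarrow> meas r \<longrightarrow> coll_meas (F p q r)) \<and>
    (\<exists>C. \<forall>p q r g. meas p \<longrightarrow> meas q \<longrightarrow> meas r \<longrightarrow>
      meas g \<longrightarrow> collI (\<lambda>u v \<omega>. F p q r u v \<omega> * g v) \<le> ennreal C * R p q r g)"

lemma estimate_measD:
  "estimate F R \<Longrightarrow> meas p \<Longrightarrow> meas q \<Longrightarrow> meas r \<Longrightarrow> coll_meas (F p q r)"
  unfolding estimate_def by blast

lemma estimateE:
  assumes "estimate F R"
  obtains C where "C \<ge> 0" "\<And>p q r g. meas p \<Longrightarrow> meas q \<Longrightarrow> meas r \<Longrightarrow>
      meas g \<Longrightarrow> collI (\<lambda>u v \<omega>. F p q r u v \<omega> * g v) \<le> ennreal C * R p q r g"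
proof -
  obtain C where C: "\<forall>p q r g. meas p \<longrightarrow> meas q \<longrightarrow> meas r \<longrightarrow>
      meas g \<longrightarrow> collI (\<lambda>u v \<omega>. F p q r u v \<omega> * g v) \<le> ennreal C * R p q r g"
    using assms unfolding estimate_def by blast
  show thesis
    by (rule that[of "max 0 C"]) (use C in \<open>auto simp: ennreal_max_0\<close>)
qed

lemma estimateI:
  assumes "\<And>p q r. meas p \<Longrightarrow> meas q \<Longrightarrow> meas r \<Longrightarrow> coll_meas (F p q r)"
    and "\<And>p q r g. meas p \<Longrightarrow> meas q \<Longrightarrow> meas r \<Longrightarrow>
      meas g \<Longrightarrow> collI (\<lambda>u v \<omega>. F p q r u v \<omega> * g v) \<le> ennreal C * R p q r g"
  shows "estimate F R"
  unfolding estimate_def using assms by blast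

lemma estimate_mono:
  assumes "estimate F R"
    and R: "\<And>p q r g. meas p \<Longrightarrow> meas q \<Longrightarrow> meas r \<Longrightarrow>
      meas g \<Longrightarrow> R p q r g \<le> ennreal K * R' p q r g"
  shows "estimate F R'"
proof (rule estimateE[OF assms(1)], rule estimateI)
  fix C :: real and p q r g :: vfun assume C: "C \<ge> 0" "\<And>p q r g. meas p \<Longrightarrow> meas q \<Longrightarrow> meas r \<Longrightarrow>
      meas g \<Longrightarrow> collI (\<lambda>u v \<omega>. F p q r u v \<omega> * g v) \<le> ennreal C * R p q r g"
    and m: "meas p" "meas q" "meas r" "meas g"
  have "collI (\<lambda>u v \<omega>. F p q r u v \<omega> * g v) \<le> ennreal C * R p q r g" by (rule C) fact+
  also have "\<dots> \<le> ennreal C * (ennreal K * R' p q r g)" by (intro mult_left_mono R m) auto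
  finally show "collI (\<lambda>u v \<omega>. F p q r u v \<omega> * g v) \<le> ennreal (C * K) * R' p q r g"
    using C by (simp add: ennreal_mult' mult.assoc)
qed (use estimate_measD[OF assms(1)] in auto)

lemma estimate_mono':
  assumes "estimate F R"
    and R: "\<And>p q r g. R p q r g \<le> R' p q r g"
  shows "estimate F R'"
  by (rule estimate_mono[OF assms(1), where K = 1]) (simp add: R)

lemma estimate_add:
  assumes F: "estimate F R" and G: "estimate G R"
  shows "estimate (\<lambda>p q r u v \<omega>. F p q r u v \<omega> + G p q r u v \<omega>) R"
proof (rule estimateE[OF F], rule estimateE[OF G], rule estimateI)
  fix C D :: real and p q r g :: vfun
  assume C: "\<And>p q r g. meas p \<Longrightarrow> meas q \<Longrightarrow> meas r \<Longrightarrow>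
      meas g \<Longrightarrow> collI (\<lambda>u v \<omega>. F p q r u v \<omega> * g v) \<le> ennreal C * R p q r g"
    and D: "\<And>p q r g. meas p \<Longrightarrow> meas q \<Longrightarrow> meas r \<Longrightarrow>
      meas g \<Longrightarrow> collI (\<lambda>u v \<omega>. G p q r u v \<omega> * g v) \<le> ennreal D * R p q r g"
    and m [measurable]: "meas p" "meas q" "meas r" "meas g"
  have [measurable]: "coll_meas (F p q r)" "coll_meas (G p q r)"
    using estimate_measD[OF F m(1-3)] estimate_measD[OF G m(1-3)] .
  have "collI (\<lambda>u v \<omega>. (F p q r u v \<omega> + G p q r u v \<omega>) * g v)
    = collI (\<lambda>u v \<omega>. F p q r u v \<omega> * g v) + collI (\<lambda>u v \<omega>. G p q r u v \<omega> * g v)"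
    unfolding distrib_right by (rule collI_add) measurable
  also have "\<dots> \<le> ennreal (max 0 C + max 0 D) * R p q r g"
    by (intro add_le_ennreal_const C D m)
  finally show "collI (\<lambda>u v \<omega>. (F p q r u v \<omega> + G p q r u v \<omega>) * g v) \<le> ennreal (max 0 C + max 0 D) * R p q r g" .
next
  fix p q r :: vfun assume m: "meas p" "meas q" "meas r"
  have [measurable]: "coll_meas (F p q r)" "coll_meas (G p q r)"
    using estimate_measD[OF F m] estimate_measD[OF G m] .
  show "coll_meas (\<lambda>u v \<omega>. F p q r u v \<omega> + G p q r u v \<omega>)" by measurable
qed

lemma estimate_swap:
  assumes "estimate F R"
  shows "estimate (\<lambda>p q r. F q p r) (\<lambda>p q r g. R q p r g)"
  by (rule estimateE[OF assms], rule estimateI) (use estimate_measD[OF assms] in auto)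

text \<open>Which of the two bounds is smaller depends on the functions, so the larger constant is
  used for both.\<close>

lemma estimate_min:
  assumes "estimate F (\<lambda>p q r g. S p q r g * R p q r g)" "estimate F (\<lambda>p q r g. S p q r g * R' p q r g)"
  shows "estimate F (\<lambda>p q r g. S p q r g * min (R p q r g) (R' p q r g))"
proof (rule estimateE[OF assms(1)], rule estimateE[OF assms(2)], rule estimateI)
  fix C D :: real and p q r g :: vfun
  assume C: "\<And>p q r g. meas p \<Longrightarrow> meas q \<Longrightarrow> meas r \<Longrightarrow>
      meas g \<Longrightarrow> collI (\<lambda>u v \<omega>. F p q r u v \<omega> * g v) \<le> ennreal C * (S p q r g * R p q r g)"
    and D: "\<And>p q r g. meas p \<Longrightarrow> meas q \<Longrightarrow> meas r \<Longrightarrow>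
      meas g \<Longrightarrow> collI (\<lambda>u v \<omega>. F p q r u v \<omega> * g v) \<le> ennreal D * (S p q r g * R' p q r g)"
    and m: "meas p" "meas q" "meas r" "meas g"
  have le: "ennreal C * x \<le> ennreal (max C D) * x" "ennreal D * x \<le> ennreal (max C D) * x" for x
    by (auto intro!: mult_right_mono ennreal_leI)
  show "collI (\<lambda>u v \<omega>. F p q r u v \<omega> * g v) \<le> ennreal (max C D) * (S p q r g * min (R p q r g) (R' p q r g))"
    using order_trans[OF C[OF m] le(1)] order_trans[OF D[OF m] le(2)]
    by (cases "R p q r g \<le> R' p q r g") (auto simp: min_def)
qed (use estimate_measD[OF assms(1)] in auto)

definition esup :: "vfun \<Rightarrow> ennreal" where
  "esup p = (SUP v. p v)"

lemma le_esup: "p v \<le> esup p"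
  unfolding esup_def by (rule SUP_upper) simp

lemma enn_L2_mult_le_esup:
  assumes [measurable]: "meas q"
  shows "enn_L2 (\<lambda>v. p v * q v) \<le> esup p * enn_L2 q"
proof -
  have "enn_L2 (\<lambda>v. p v * q v) \<le> enn_L2 (\<lambda>v. esup p * q v)"
    by (intro enn_L2_mono mult_right_mono le_esup) auto
  then show ?thesis by (simp add: enn_L2_cmult)
qed

text \<open>Testing against truncations of the function itself, whose norms are finite and can be cancelled.\<close>

lemma enn_L2_duality:
  assumes [measurable]: "meas F"
    and B: "\<And>h. meas h \<Longrightarrow> (\<integral>\<^sup>+v. F v * h v \<partial>lborel) \<le> B * enn_L2 h"
  shows "enn_L2 F \<le> B"
proof -
  define h where "h n v = min (F v) (of_nat n) * indicator (ball 0 (real n)) v" for n :: nat and v :: vec3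
  have [measurable]: "h n \<in> borel_measurable borel" for n
    unfolding h_def[abs_def] by measurable
  have hF: "h n v \<le> F v" for n v
    by (auto simp: h_def indicator_def)
  have h_inc: "h n v \<le> h m v" if "n \<le> m" for n m v
  proof -
    have "(of_nat n :: ennreal) \<le> of_nat m" using that by simp
    then have "min (F v) (of_nat n) \<le> min (F v) (of_nat m)" by (intro min.mono) auto
    moreover have "indicator (ball 0 (real n)) v \<le> (indicator (ball 0 (real m)) v :: ennreal)"
      using that by (auto simp: indicator_def)
    ultimately show ?thesis unfolding h_def by (intro mult_mono) auto
  qed
  have sup: "(SUP n. h n v) = F v" for v
  proof (rule antisym)
    show "(SUP n. h n v) \<le> F v" by (intro SUP_least hF)
    obtain N where N: "norm v < real N" using reals_Archimedean2 by blast
    have "(SUP n. h n v) \<ge> (SUP n. min (F v) (of_nat n))"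
    proof (rule SUP_least)
      fix n
      have "min (F v) (of_nat n) \<le> min (F v) (of_nat (max n N))"
        by (intro min.mono) auto
      also have "\<dots> = h (max n N) v"
        using N by (simp add: h_def)
      also have "\<dots> \<le> (SUP n. h n v)" by (rule SUP_upper) simp
      finally show "min (F v) (of_nat n) \<le> (SUP n. h n v)" .
    qed
    moreover have "(SUP n. min (F v) (of_nat n)) = F v"
    proof (cases "F v")
      case (real x)
      obtain n :: nat where n: "x < real n" using reals_Archimedean2 by blast
      then have "F v \<le> of_nat n" using real by (simp add: ennreal_of_nat_eq_real_of_nat ennreal_leI)
      then have "min (F v) (of_nat n) = F v" by (simp add: min_absorb1)
      then show ?thesis
        by (intro antisym SUP_least) (auto intro: SUP_upper2[of n])
    next
      case top
      then show ?thesis by (simp add: ennreal_SUP_of_nat_eq_top)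
    qed
    ultimately show "F v \<le> (SUP n. h n v)" by simp
  qed
  have hB: "(enn_L2 (h n))\<^sup>2 \<le> B\<^sup>2" for n
  proof -
    have "(\<integral>\<^sup>+v. (h n v)\<^sup>2 \<partial>lborel) \<le> (\<integral>\<^sup>+(v::vec3). (of_nat n)\<^sup>2 * indicator (ball 0 (real n)) v \<partial>lborel)"
      by (intro nn_integral_mono) (auto simp: h_def indicator_def intro!: power_mono)
    also have "\<dots> < \<infinity>"
      by (subst nn_integral_cmult_indicator) (auto simp: emeasure_ball ennreal_mult_less_top ennreal_of_nat_eq_real_of_nat ennreal_power)
    finally have fin: "(enn_L2 (h n))\<^sup>2 < top" by (simp add: enn_L2_square)
    have "(enn_L2 (h n))\<^sup>2 \<le> (\<integral>\<^sup>+v. F v * h n v \<partial>lborel)"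
      unfolding enn_L2_square[symmetric] unfolding power2_eq_square by (intro nn_integral_mono mult_right_mono hF) auto
    also have "\<dots> \<le> B * enn_L2 (h n)" by (rule B) measurable
    finally have le: "(enn_L2 (h n))\<^sup>2 \<le> B * enn_L2 (h n)" .
    have "enn_L2 (h n) \<le> B"
    proof (cases "enn_L2 (h n)")
      case (real x)
      show ?thesis
      proof (cases B)
        case (real b)
        have "x * x \<le> b * x"
          using le \<open>enn_L2 (h n) = ennreal x\<close> \<open>0 \<le> x\<close> real
          by (simp add: power2_eq_square ennreal_mult[symmetric])
        then have "x \<le> b" using \<open>0 \<le> x\<close> real by (cases "x = 0") auto
        then show ?thesis using \<open>enn_L2 (h n) = ennreal x\<close> real by (simp add: ennreal_leI)
      qed simp
    next
      case top
      then show ?thesis using fin by simp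
    qed
    then show ?thesis by (intro power_mono) auto
  qed
  have "(\<integral>\<^sup>+v. (F v)\<^sup>2 \<partial>lborel) = (\<integral>\<^sup>+v. (SUP n. (h n v)\<^sup>2) \<partial>lborel)"
  proof (intro nn_integral_cong)
    fix v
    have "(F v)\<^sup>2 = (SUP n. h n v) * (SUP m. h m v)"
      by (simp add: sup power2_eq_square)
    also have "\<dots> = (SUP m. SUP n. h n v * h m v)"
      by (simp add: SUP_mult_right_ennreal SUP_mult_left_ennreal)
    also have "\<dots> \<le> (SUP n. (h n v)\<^sup>2)"
    proof (intro SUP_least)
      fix m n
      have "h n v * h m v \<le> h (max n m) v * h (max n m) v"
        by (intro mult_mono h_inc) auto
      also have "\<dots> \<le> (SUP n. (h n v)\<^sup>2)"
        by (rule SUP_upper2[of "max n m"]) (auto simp: power2_eq_square)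
      finally show "h n v * h m v \<le> (SUP n. (h n v)\<^sup>2)" .
    qed
    finally show "(F v)\<^sup>2 = (SUP n. (h n v)\<^sup>2)"
      by (intro antisym SUP_least power_mono hF) auto
  qed
  also have "\<dots> = (SUP n. (\<integral>\<^sup>+v. (h n v)\<^sup>2 \<partial>lborel))"
    by (rule nn_integral_monotone_convergence_SUP) (auto simp: incseq_def le_fun_def intro!: power_mono h_inc)
  also have "\<dots> \<le> B\<^sup>2"
    by (intro SUP_least) (simp add: enn_L2_square hB)
  finally have "ennsqrt (\<integral>\<^sup>+v. (F v)\<^sup>2 \<partial>lborel) \<le> ennsqrt (B\<^sup>2)" by (rule ennsqrt_mono)
  then show ?thesis by (simp add: enn_L2_def ennsqrt_power2)
qed

lemma estimate_KT1: "estimate KT1 (\<lambda>p q r g. enn_L2 g * enn_L2 p * enn_L2 q * enn_L2 r)"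
  unfolding estimate_def using KT1_bound coll_meas_KT(1) by (simp add: mult_ac)

section \<open>The three bounds for the combined kernel\<close>

context velocity_weight
begin

lemma enn_L2_le_wmul:
  assumes [measurable]: "meas f"
  shows "enn_L2 f \<le> ennreal A * enn_L2 (wmul f)"
proof -
  have "f v \<le> ennreal A * wmul f v" for v
  proof -
    have "1 \<le> A * \<beta> v" using weight_ge[of v] norm_ge_zero[of v] by linarith
    then have "1 \<le> ennreal A * ennreal (\<beta> v)"
      using A_pos by (simp add: ennreal_mult[symmetric] del: ennreal_1 add: ennreal_1[symmetric])
    from mult_right_mono[OF this, of "f v"] show ?thesis
      by (simp add: wmul_def mult.assoc)
  qed
  from enn_L2_mono[of f "\<lambda>v. ennreal A * wmul f v", OF this] show ?thesis
    by (simp add: enn_L2_cmult)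
qed

abbreviation "wnorm f \<equiv> enn_L2 (hmul f)"

definition mixed :: "vfun \<Rightarrow> vfun \<Rightarrow> vfun \<Rightarrow> ennreal" where
  "mixed p q r = enn_L2 p * wnorm q + enn_L2 p * wnorm r + enn_L2 q * wnorm p + enn_L2 q * wnorm r + enn_L2 r * wnorm p + enn_L2 r * wnorm q"

definition pairs :: "vfun \<Rightarrow> vfun \<Rightarrow> vfun \<Rightarrow> ennreal" where
  "pairs p q r = enn_L2 p * enn_L2 q + enn_L2 p * enn_L2 r + enn_L2 q * enn_L2 p + enn_L2 q * enn_L2 r + enn_L2 r * enn_L2 p + enn_L2 r * enn_L2 q"

lemma estimate_bilinear1:
  assumes "bil_bound \<Phi>"
  shows "estimate (\<lambda>p q r. \<Phi> p q) (\<lambda>p q r g. wnorm g * mixed p q r)" "estimate (\<lambda>p q r. \<Phi> p r) (\<lambda>p q r g. wnorm g * mixed p q r)"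
    "estimate (\<lambda>p q r. \<Phi> q r) (\<lambda>p q r g. wnorm g * mixed p q r)"
proof -
  obtain C where C: "\<forall>p r g. meas p \<longrightarrow> meas r \<longrightarrow> meas g \<longrightarrow>
      collI (\<lambda>u v \<omega>. \<Phi> p r u v \<omega> * g v)
        \<le> ennreal C * (enn_L2 (hmul g) * (enn_L2 p * enn_L2 (hmul r) + enn_L2 (hmul p) * enn_L2 r))"
    using bil_boundD(3)[OF assms] ..
  have m: "enn_L2 p * wnorm q + wnorm p * enn_L2 q \<le> mixed p q r" "enn_L2 p * wnorm r + wnorm p * enn_L2 r \<le> mixed p q r"
    "enn_L2 q * wnorm r + wnorm q * enn_L2 r \<le> mixed p q r" for p q r
  proof -
    let ?x = "enn_L2 p * wnorm q + wnorm p * enn_L2 q" and ?y = "enn_L2 p * wnorm r + wnorm p * enn_L2 r" and ?z = "enn_L2 q * wnorm r + wnorm q * enn_L2 r"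
    have "mixed p q r = ?x + (?y + ?z)" "mixed p q r = ?y + (?x + ?z)" "mixed p q r = ?z + (?x + ?y)"
      by (simp_all only: mixed_def mult_ac add_ac)
    then show "?x \<le> mixed p q r" "?y \<le> mixed p q r" "?z \<le> mixed p q r"
      by (metis le_iff_add)+
  qed
  have *: "collI (\<lambda>u v \<omega>. \<Phi> a b u v \<omega> * g v) \<le> ennreal C * (wnorm g * mixed p q r)"
    if "meas a" "meas b" "meas g"
      "enn_L2 a * wnorm b + wnorm a * enn_L2 b \<le> mixed p q r" for a b g p q r
  proof -
    have "collI (\<lambda>u v \<omega>. \<Phi> a b u v \<omega> * g v) \<le> ennreal C * (wnorm g * (enn_L2 a * wnorm b + wnorm a * enn_L2 b))"
      using C that(1-3) by blast
    also have "\<dots> \<le> ennreal C * (wnorm g * mixed p q r)"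
      by (intro mult_left_mono that(4)) auto
    finally show ?thesis .
  qed
  show "estimate (\<lambda>p q r. \<Phi> p q) (\<lambda>p q r g. wnorm g * mixed p q r)" "estimate (\<lambda>p q r. \<Phi> p r) (\<lambda>p q r g. wnorm g * mixed p q r)"
    "estimate (\<lambda>p q r. \<Phi> q r) (\<lambda>p q r g. wnorm g * mixed p q r)"
    by (rule estimateI[where C = C], rule bil_boundD(1)[OF assms], assumption, assumption,
        rule *, assumption, assumption, assumption, rule m)+
qed

lemma estimate_bilinear3:
  assumes "bil_bound \<Phi>"
  shows "estimate (\<lambda>p q r. \<Phi> p q) (\<lambda>p q r g. enn_L2 (wmul g) * pairs p q r)" "estimate (\<lambda>p q r. \<Phi> p r) (\<lambda>p q r g. enn_L2 (wmul g) * pairs p q r)"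
    "estimate (\<lambda>p q r. \<Phi> q r) (\<lambda>p q r g. enn_L2 (wmul g) * pairs p q r)"
proof -
  obtain C where C: "\<forall>p r g. meas p \<longrightarrow> meas r \<longrightarrow> meas g \<longrightarrow>
      collI (\<lambda>u v \<omega>. \<Phi> p r u v \<omega> * g v) \<le> ennreal C * (enn_L2 p * enn_L2 r * enn_L2 (wmul g))"
    using bil_boundD(2)[OF assms] ..
  have m: "enn_L2 p * enn_L2 q \<le> pairs p q r" "enn_L2 p * enn_L2 r \<le> pairs p q r" "enn_L2 q * enn_L2 r \<le> pairs p q r" for p q r
    unfolding pairs_def by (simp_all add: add_increasing add_increasing2)
  have *: "collI (\<lambda>u v \<omega>. \<Phi> a b u v \<omega> * g v) \<le> ennreal C * (enn_L2 (wmul g) * pairs p q r)"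
    if "meas a" "meas b" "meas g"
      "enn_L2 a * enn_L2 b \<le> pairs p q r" for a b g p q r
  proof -
    have "collI (\<lambda>u v \<omega>. \<Phi> a b u v \<omega> * g v) \<le> ennreal C * (enn_L2 a * enn_L2 b * enn_L2 (wmul g))"
      using C that(1-3) by blast
    also have "\<dots> \<le> ennreal C * (pairs p q r * enn_L2 (wmul g))"
      by (intro mult_left_mono mult_right_mono that(4)) auto
    finally show ?thesis by (simp add: mult_ac)
  qed
  show "estimate (\<lambda>p q r. \<Phi> p q) (\<lambda>p q r g. enn_L2 (wmul g) * pairs p q r)" "estimate (\<lambda>p q r. \<Phi> p r) (\<lambda>p q r g. enn_L2 (wmul g) * pairs p q r)"
    "estimate (\<lambda>p q r. \<Phi> q r) (\<lambda>p q r g. enn_L2 (wmul g) * pairs p q r)"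
    by (rule estimateI[where C = C], rule bil_boundD(1)[OF assms], assumption, assumption,
        rule *, assumption, assumption, assumption, rule m)+
qed

lemma estimate_KT2: "estimate KT2 (\<lambda>p q r g. enn_L2 p * enn_L2 q * enn_L2 (\<lambda>v. r v * g v))"
  unfolding estimate_def using KT2_bound coll_meas_KT(2) by simp

lemma estimate_KT2_sup_r: "estimate KT2 (\<lambda>p q r g. enn_L2 g * (esup r * enn_L2 p * enn_L2 q))"
proof (rule estimate_mono[OF estimate_KT2, where K = 1])
  fix p q r g :: vfun assume "meas g"
  then have "enn_L2 p * enn_L2 q * enn_L2 (\<lambda>v. r v * g v) \<le> enn_L2 p * enn_L2 q * (esup r * enn_L2 g)"
    by (intro mult_left_mono enn_L2_mult_le_esup) auto
  then show "enn_L2 p * enn_L2 q * enn_L2 (\<lambda>v. r v * g v) \<le> ennreal 1 * (enn_L2 g * (esup r * enn_L2 p * enn_L2 q))"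
    by (simp add: mult_ac)
qed

lemma estimate_KT2_sup_pq: "estimate KT2 (\<lambda>p q r g. enn_L2 g * (esup p * esup q * enn_L2 r))"
proof -
  obtain C where C: "\<forall>p q r g P Q. meas r \<longrightarrow> meas g \<longrightarrow> (\<forall>v. p v \<le> P) \<longrightarrow> (\<forall>v. q v \<le> Q) \<longrightarrow>
    collI (\<lambda>u v \<omega>. KT2 p q r u v \<omega> * g v) \<le> ennreal C * (P * Q * (enn_L2 r * enn_L2 g))"
    using KT2_bound_sup ..
  show ?thesis
  proof (rule estimateI)
    fix p q r g :: vfun assume "meas r" "meas g"
    then have "collI (\<lambda>u v \<omega>. KT2 p q r u v \<omega> * g v) \<le> ennreal C * (esup p * esup q * (enn_L2 r * enn_L2 g))"
      using C le_esup by blast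
    then show "collI (\<lambda>u v \<omega>. KT2 p q r u v \<omega> * g v) \<le> ennreal C * (enn_L2 g * (esup p * esup q * enn_L2 r))"
      by (simp add: mult_ac)
  qed (rule coll_meas_KT)
qed

lemma estimate_KT3: "estimate KT3 (\<lambda>p q r g. enn_L2 p * enn_L2 r * enn_L2 (\<lambda>v. q v * wmul g v))"
  unfolding estimate_def using KT3_bound coll_meas_KT(3) by simp

text \<open>The maps x and y describe how the weight at v is shared between q and g. They are
  instantiated with square roots on both for (1), and with the identity and the full weight for
  (3).\<close>

lemma estimate_KT3_sup_r:
  assumes "\<And>q g. meas q \<Longrightarrow> meas g \<Longrightarrow>
      x q \<in> borel_measurable borel \<and> y g \<in> borel_measurable borel \<and> (\<forall>v. q v * g v * ennreal (\<beta> v) = x q v * y g v)"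
  shows "estimate KT3 (\<lambda>p q r g. enn_L2 (y g) * (esup r * enn_L2 p * enn_L2 (x q)))"
proof -
  obtain C where C: "\<forall>p q r g R q1 q2. meas p \<longrightarrow> meas q \<longrightarrow> meas r \<longrightarrow>
    meas g \<longrightarrow> meas q1 \<longrightarrow> meas q2 \<longrightarrow>
    (\<forall>v. r v \<le> R) \<longrightarrow> (\<forall>v. q v * g v * ennreal (\<beta> v) = q1 v * q2 v) \<longrightarrow>
    collI (\<lambda>u v \<omega>. KT3 p q r u v \<omega> * g v) \<le> ennreal C * (R * (enn_L2 p * enn_L2 q1 * enn_L2 q2))"
    using KT3_bound_sup ..
  show ?thesis
  proof (rule estimateI)
    fix p q r g :: vfun
    assume m: "meas p" "meas q" "meas r" "meas g"
    have "collI (\<lambda>u v \<omega>. KT3 p q r u v \<omega> * g v) \<le> ennreal C * (esup r * (enn_L2 p * enn_L2 (x q) * enn_L2 (y g)))"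
      using C m assms[OF m(2,4)] le_esup[of r] by blast
    then show "collI (\<lambda>u v \<omega>. KT3 p q r u v \<omega> * g v) \<le> ennreal C * (enn_L2 (y g) * (esup r * enn_L2 p * enn_L2 (x q)))"
      by (simp add: mult_ac)
  qed (rule coll_meas_KT)
qed

lemma estimate_KT3_sup_q: "estimate KT3 (\<lambda>p q r g. enn_L2 (wmul g) * (esup q * enn_L2 p * enn_L2 r))"
proof (rule estimate_mono[OF estimate_KT3, where K = 1])
  fix p q r g :: vfun assume [measurable]: "meas g"
  have "enn_L2 p * enn_L2 r * enn_L2 (\<lambda>v. q v * wmul g v) \<le> enn_L2 p * enn_L2 r * (esup q * enn_L2 (wmul g))"
    by (intro mult_left_mono enn_L2_mult_le_esup) auto
  then show "enn_L2 p * enn_L2 r * enn_L2 (\<lambda>v. q v * wmul g v) \<le> ennreal 1 * (enn_L2 (wmul g) * (esup q * enn_L2 p * enn_L2 r))"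
    by (simp add: mult_ac)
qed

lemma estimate_KT3_hsup_q: "estimate KT3 (\<lambda>p q r g. wnorm g * (enn_L2 p * esup (hmul q) * enn_L2 r))"
proof (rule estimate_mono[OF estimate_KT3, where K = 1])
  fix p q r g :: vfun assume [measurable]: "meas g"
  have "q v * wmul g v = hmul q v * hmul g v" for v
    unfolding hmul_hmul by (simp add: wmul_def mult_ac)
  then have "enn_L2 p * enn_L2 r * enn_L2 (\<lambda>v. q v * wmul g v) = enn_L2 p * enn_L2 r * enn_L2 (\<lambda>v. hmul q v * hmul g v)"
    by simp
  also have "\<dots> \<le> enn_L2 p * enn_L2 r * (esup (hmul q) * wnorm g)"
    by (intro mult_left_mono enn_L2_mult_le_esup) auto
  finally show "enn_L2 p * enn_L2 r * enn_L2 (\<lambda>v. q v * wmul g v) \<le> ennreal 1 * (wnorm g * (enn_L2 p * esup (hmul q) * enn_L2 r))"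
    by (simp add: mult_ac)
qed

definition bound1 :: "vfun \<Rightarrow> vfun \<Rightarrow> vfun \<Rightarrow> vfun \<Rightarrow> ennreal" where
  "bound1 p q r g = enn_L2 g * enn_L2 p * enn_L2 q * enn_L2 r + wnorm g * mixed p q r
    + wnorm g * min ((wnorm p * enn_L2 q + enn_L2 p * wnorm q) * esup r) (esup p * esup q * wnorm r)
    + wnorm g * min ((wnorm p * enn_L2 q + enn_L2 p * wnorm q) * esup r)
        ((esup (hmul p) * enn_L2 q + enn_L2 p * esup (hmul q)) * enn_L2 r)"

definition bound2 :: "vfun \<Rightarrow> vfun \<Rightarrow> vfun \<Rightarrow> vfun \<Rightarrow> ennreal" where
  "bound2 p q r g = esup (\<lambda>v. ennreal (\<beta> v ^ 3) * g v) * pairs p q r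
    + (wnorm g + esup (wmul g)) * enn_L2 p * enn_L2 q * enn_L2 r"

definition bound3 :: "vfun \<Rightarrow> vfun \<Rightarrow> vfun \<Rightarrow> ennreal" where
  "bound3 p q r = enn_L2 p * enn_L2 q * enn_L2 r + pairs p q r
    + min (esup r * enn_L2 p * enn_L2 q) (esup p * esup q * enn_L2 r)
    + min (esup r * enn_L2 p * enn_L2 q) (esup q * enn_L2 p * enn_L2 r)
    + min (esup r * enn_L2 p * enn_L2 q) (esup p * enn_L2 q * enn_L2 r)"

lemma estimate_Ktot:
  assumes "estimate (\<lambda>p q r. KB p q) R" "estimate (\<lambda>p q r. KM p r) R" "estimate (\<lambda>p q r. KM q r) R"
    "estimate KT1 R" "estimate (\<lambda>p q r. KT1 q p r) R" "estimate KT2 R" "estimate (\<lambda>p q r. KT2 q p r) R"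
    "estimate KT3 R" "estimate (\<lambda>p q r. KT3 q p r) R"
  shows "estimate Ktot R"
proof -
  note * = estimate_add[OF estimate_add[OF estimate_add[OF estimate_add[OF estimate_add[OF estimate_add[OF estimate_add[OF estimate_add[OF
    assms(1,2)] assms(3)] assms(4)] assms(5)] assms(6)] assms(7)] assms(8)] assms(9)]
  show ?thesis
    by (rule back_subst[of "\<lambda>F. estimate F R", OF *]) (intro ext, simp only: Ktot_def)
qed

lemma hmul_scale:
  assumes "meas f" "meas g"
  shows "enn_L2 f * enn_L2 g \<le> ennreal A * (wnorm f * wnorm g)"
proof -
  have "enn_L2 f * enn_L2 g \<le> (ennreal (sqrt A) * wnorm f) * (ennreal (sqrt A) * wnorm g)"
    using assms by (intro mult_mono enn_L2_le_hmul) auto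
  also have "\<dots> = (ennreal (sqrt A) * ennreal (sqrt A)) * (wnorm f * wnorm g)" by (simp only: mult_ac)
  finally show ?thesis using A_pos by (simp add: ennreal_mult[symmetric])
qed

text \<open>The quadratic kernels \<open>KB\<close> and \<open>KM\<close> produce the sum over
  pairs, \<open>KT1\<close> the product of four plain norms, \<open>KT2\<close> the first minimum
  and \<open>KT3\<close> the second. Swapping p and q leaves these terms unchanged, which settles
  the mirrored kernels.\<close>

lemma estimate_Ktot_bound1: "estimate Ktot bound1"
proof (rule estimate_Ktot)
  note * = estimate_bilinear1[OF bil_bound_KB] estimate_bilinear1[OF bil_bound_KM]
  show "estimate (\<lambda>p q r. KB p q) bound1" "estimate (\<lambda>p q r. KM p r) bound1" "estimate (\<lambda>p q r. KM q r) bound1"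
    by (rule estimate_mono', rule *, simp add: bound1_def add_increasing add_increasing2)+
  show "estimate KT1 bound1"
    by (rule estimate_mono', rule estimate_KT1, simp add: bound1_def add_increasing add_increasing2)
  show "estimate (\<lambda>p q r. KT1 q p r) bound1"
    by (rule estimate_mono', rule estimate_swap, rule estimate_KT1, simp add: bound1_def add_increasing add_increasing2 mult_ac)
  let ?R2 = "\<lambda>p q r g. wnorm g * min ((wnorm p * enn_L2 q + enn_L2 p * wnorm q) * esup r) (esup p * esup q * wnorm r)"
  let ?R3 = "\<lambda>p q r g. wnorm g * min ((wnorm p * enn_L2 q + enn_L2 p * wnorm q) * esup r)
        ((esup (hmul p) * enn_L2 q + enn_L2 p * esup (hmul q)) * enn_L2 r)"
  have KT2: "estimate KT2 ?R2"
  proof (rule estimate_min)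
    show "estimate KT2 (\<lambda>p q r g. wnorm g * ((wnorm p * enn_L2 q + enn_L2 p * wnorm q) * esup r))"
    proof (rule estimate_mono[OF estimate_KT2_sup_r, where K = A])
      fix p q r g :: vfun
      assume m: "meas p" "meas g"
      have "enn_L2 g * (esup r * enn_L2 p * enn_L2 q) = (enn_L2 g * enn_L2 p) * (enn_L2 q * esup r)"
        by (simp only: mult_ac)
      also have "\<dots> \<le> (ennreal A * (wnorm g * wnorm p)) * (enn_L2 q * esup r)"
        by (intro mult_right_mono hmul_scale m) auto
      also have "\<dots> = ennreal A * (wnorm g * ((wnorm p * enn_L2 q) * esup r))"
        by (simp only: mult_ac)
      also have "\<dots> \<le> ennreal A * (wnorm g * ((wnorm p * enn_L2 q + enn_L2 p * wnorm q) * esup r))"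
        by (intro mult_left_mono mult_right_mono) auto
      finally show "enn_L2 g * (esup r * enn_L2 p * enn_L2 q) \<le> \<dots>" .
    qed
    show "estimate KT2 (\<lambda>p q r g. wnorm g * (esup p * esup q * wnorm r))"
    proof (rule estimate_mono[OF estimate_KT2_sup_pq, where K = A])
      fix p q r g :: vfun
      assume m: "meas r" "meas g"
      have "enn_L2 g * (esup p * esup q * enn_L2 r) = (enn_L2 g * enn_L2 r) * (esup p * esup q)"
        by (simp only: mult_ac)
      also have "\<dots> \<le> (ennreal A * (wnorm g * wnorm r)) * (esup p * esup q)"
        by (intro mult_right_mono hmul_scale m) auto
      finally show "enn_L2 g * (esup p * esup q * enn_L2 r) \<le> ennreal A * (wnorm g * (esup p * esup q * wnorm r))"
        by (simp only: mult_ac)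
    qed
  qed
  then show "estimate KT2 bound1"
    by (rule estimate_mono') (simp add: bound1_def add_increasing add_increasing2)
  from estimate_swap[OF KT2] show "estimate (\<lambda>p q r. KT2 q p r) bound1"
    by (rule estimate_mono') (simp add: bound1_def add_increasing add_increasing2 mult_ac add_ac)
  have KT3: "estimate KT3 ?R3"
  proof (rule estimate_min)
    show "estimate KT3 (\<lambda>p q r g. wnorm g * ((wnorm p * enn_L2 q + enn_L2 p * wnorm q) * esup r))"
    proof (rule estimate_mono')
      show "estimate KT3 (\<lambda>p q r g. wnorm g * (esup r * enn_L2 p * wnorm q))"
        by (rule estimate_KT3_sup_r) (auto simp: hmul_hmul)
      fix p q r g :: vfun
      have "wnorm g * ((enn_L2 p * wnorm q) * esup r) \<le> wnorm g * ((wnorm p * enn_L2 q + enn_L2 p * wnorm q) * esup r)"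
        by (intro mult_left_mono mult_right_mono) auto
      then show "wnorm g * (esup r * enn_L2 p * wnorm q) \<le> wnorm g * ((wnorm p * enn_L2 q + enn_L2 p * wnorm q) * esup r)"
        by (simp add: mult_ac)
    qed
    show "estimate KT3 (\<lambda>p q r g. wnorm g * ((esup (hmul p) * enn_L2 q + enn_L2 p * esup (hmul q)) * enn_L2 r))"
      by (rule estimate_mono'[OF estimate_KT3_hsup_q]) (intro mult_left_mono mult_right_mono, auto)
  qed
  then show "estimate KT3 bound1"
    by (rule estimate_mono') (simp add: bound1_def add_increasing add_increasing2)
  from estimate_swap[OF KT3] show "estimate (\<lambda>p q r. KT3 q p r) bound1"
    by (rule estimate_mono') (simp add: bound1_def add_increasing add_increasing2 mult_ac add_ac)
qed

text \<open>Two additional powers of the weight dominate (1 + |v|)^2, whose reciprocal is square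
  integrable in three dimensions. One power for the kernel and two for passing from an L2 norm to a
  supremum make up the cube of \<nu> in (2).\<close>

lemma enn_L2_wmul_le_esup:
  "enn_L2 (wmul g) \<le> ennreal (A\<^sup>2 * sqrt (4 * pi)) * esup (\<lambda>v. ennreal (\<beta> v ^ 3) * g v)"
proof -
  let ?s = "esup (\<lambda>v. ennreal (\<beta> v ^ 3) * g v)"
  have "wmul g v \<le> (?s * ennreal (A\<^sup>2)) * ennreal (1 / (1 + norm v)\<^sup>2)" for v
  proof -
    have pos: "(1 + norm v)\<^sup>2 > 0" by (intro zero_less_power add_pos_nonneg) auto
    have "(1 + norm v)\<^sup>2 \<le> (A * \<beta> v)\<^sup>2"
      using weight_ge[of v] by (intro power_mono) auto
    then have "\<beta> v * (1 + norm v)\<^sup>2 \<le> \<beta> v * (A * \<beta> v)\<^sup>2"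
      by (intro mult_left_mono) auto
    then have "\<beta> v \<le> \<beta> v ^ 3 * A\<^sup>2 * (1 / (1 + norm v)\<^sup>2)"
      using pos by (simp add: divide_simps power2_eq_square power3_eq_cube mult_ac)
    then have "ennreal (\<beta> v) \<le> ennreal (\<beta> v ^ 3) * ennreal (A\<^sup>2) * ennreal (1 / (1 + norm v)\<^sup>2)"
      by (simp add: ennreal_mult[symmetric] ennreal_leI)
    from mult_right_mono[OF this, of "g v"]
    have "wmul g v \<le> (ennreal (\<beta> v ^ 3) * g v) * ennreal (A\<^sup>2) * ennreal (1 / (1 + norm v)\<^sup>2)"
      by (simp add: wmul_def mult_ac)
    also have "\<dots> \<le> ?s * ennreal (A\<^sup>2) * ennreal (1 / (1 + norm v)\<^sup>2)"
      by (intro mult_right_mono le_esup[of "\<lambda>v. ennreal (\<beta> v ^ 3) * g v"]) auto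
    finally show ?thesis .
  qed
  then have "enn_L2 (wmul g) \<le> enn_L2 (\<lambda>v. (?s * ennreal (A\<^sup>2)) * ennreal (1 / (1 + norm v)\<^sup>2))"
    by (rule enn_L2_mono)
  also have "\<dots> = (?s * ennreal (A\<^sup>2)) * enn_L2 (\<lambda>v. ennreal (1 / (1 + norm v)\<^sup>2))"
    by (rule enn_L2_cmult) measurable
  also have "\<dots> \<le> (?s * ennreal (A\<^sup>2)) * ennreal (sqrt (4 * pi))"
  proof (rule mult_left_mono)
    have "(\<integral>\<^sup>+(v::vec3). (ennreal (1 / (1 + norm v)\<^sup>2))\<^sup>2 \<partial>lborel) = (\<integral>\<^sup>+(v::vec3). ennreal (1 / (1 + norm v) ^ 4) \<partial>lborel)"
      by (intro nn_integral_cong) (simp add: ennreal_power power_divide power_mult[symmetric])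
    also have "\<dots> \<le> ennreal (4 * pi)" by (rule nn_integral_bracket4_bound)
    finally have "enn_L2 (\<lambda>v. ennreal (1 / (1 + norm v)\<^sup>2)) \<le> ennsqrt (ennreal (4 * pi))"
      unfolding enn_L2_def by (rule ennsqrt_mono)
    also have "\<dots> = ennreal (sqrt (4 * pi))" by (rule ennsqrt_ennreal) simp
    finally show "enn_L2 (\<lambda>v. ennreal (1 / (1 + norm v)\<^sup>2)) \<le> ennreal (sqrt (4 * pi))" .
  qed simp
  finally show ?thesis
    by (simp add: ennreal_mult mult_ac)
qed

text \<open>In \<open>KT2\<close> and \<open>KT3\<close> g shares its velocity with one of the three
  functions; the supremum falls on g, and all three functions keep their L2 norms. In
  \<open>KT1\<close> g is alone at v and enters through its L2 norm.\<close>

lemma estimate_Ktot_bound2: "estimate Ktot bound2"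
proof (rule estimate_Ktot)
  have bil: "estimate F bound2" if F: "estimate F (\<lambda>p q r g. enn_L2 (wmul g) * pairs p q r)" for F
  proof (rule estimate_mono[OF F, where K = "A\<^sup>2 * sqrt (4 * pi)"])
    fix p q r g :: vfun
    have "enn_L2 (wmul g) * pairs p q r \<le> (ennreal (A\<^sup>2 * sqrt (4 * pi)) * esup (\<lambda>v. ennreal (\<beta> v ^ 3) * g v)) * pairs p q r"
      by (intro mult_right_mono enn_L2_wmul_le_esup) auto
    also have "\<dots> = ennreal (A\<^sup>2 * sqrt (4 * pi)) * (esup (\<lambda>v. ennreal (\<beta> v ^ 3) * g v) * pairs p q r)"
      by (simp only: mult.assoc)
    also have "\<dots> \<le> ennreal (A\<^sup>2 * sqrt (4 * pi)) * bound2 p q r g"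
      unfolding bound2_def by (intro mult_left_mono) auto
    finally show "enn_L2 (wmul g) * pairs p q r \<le> \<dots>" .
  qed
  show "estimate (\<lambda>p q r. KB p q) bound2" "estimate (\<lambda>p q r. KM p r) bound2" "estimate (\<lambda>p q r. KM q r) bound2"
    by (rule bil, rule estimate_bilinear3[OF bil_bound_KB] estimate_bilinear3[OF bil_bound_KM])+
  have sym: "bound2 p q r g = bound2 q p r g" for p q r g
    by (simp add: bound2_def pairs_def mult_ac add_ac)
  have swap: "estimate (\<lambda>p q r. F q p r) bound2" if "estimate F bound2" for F
    using estimate_swap[OF that] by (rule estimate_mono') (simp add: sym)
  show KT1: "estimate KT1 bound2"
  proof (rule estimate_mono[OF estimate_KT1, where K = "sqrt A"])
    fix p q r g :: vfun assume "meas g"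
    then have "enn_L2 g * (enn_L2 p * enn_L2 q * enn_L2 r) \<le> (ennreal (sqrt A) * wnorm g) * (enn_L2 p * enn_L2 q * enn_L2 r)"
      by (intro mult_right_mono enn_L2_le_hmul) auto
    also have "\<dots> \<le> (ennreal (sqrt A) * (wnorm g + esup (wmul g))) * (enn_L2 p * enn_L2 q * enn_L2 r)"
      by (intro mult_left_mono mult_right_mono) auto
    also have "\<dots> = ennreal (sqrt A) * ((wnorm g + esup (wmul g)) * enn_L2 p * enn_L2 q * enn_L2 r)"
      by (simp only: mult.assoc)
    also have "\<dots> \<le> ennreal (sqrt A) * bound2 p q r g"
      unfolding bound2_def by (intro mult_left_mono) auto
    finally show "enn_L2 g * enn_L2 p * enn_L2 q * enn_L2 r \<le> ennreal (sqrt A) * bound2 p q r g"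
      by (simp add: mult.assoc)
  qed
  have tri: "esup (wmul g) * (enn_L2 p * enn_L2 q * enn_L2 r) \<le> bound2 p q r g" for p q r g
  proof -
    have "esup (wmul g) * (enn_L2 p * enn_L2 q * enn_L2 r) \<le> (wnorm g + esup (wmul g)) * (enn_L2 p * enn_L2 q * enn_L2 r)"
      by (intro mult_right_mono) auto
    also have "\<dots> \<le> bound2 p q r g"
      unfolding bound2_def by (simp add: mult.assoc)
    finally show ?thesis .
  qed
  show KT2: "estimate KT2 bound2"
  proof (rule estimate_mono[OF estimate_KT2, where K = A])
    fix p q r g :: vfun assume [measurable]: "meas r" "meas g"
    have "enn_L2 (\<lambda>v. r v * g v) \<le> ennreal A * enn_L2 (wmul (\<lambda>v. r v * g v))"
      by (rule enn_L2_le_wmul) measurable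
    also have "wmul (\<lambda>v. r v * g v) = (\<lambda>v. wmul g v * r v)"
      by (auto simp: wmul_def mult_ac)
    also have "enn_L2 (\<lambda>v. wmul g v * r v) \<le> esup (wmul g) * enn_L2 r"
      by (rule enn_L2_mult_le_esup) measurable
    finally have "enn_L2 p * enn_L2 q * enn_L2 (\<lambda>v. r v * g v) \<le> enn_L2 p * enn_L2 q * (ennreal A * (esup (wmul g) * enn_L2 r))"
      by (simp add: mult_left_mono)
    also have "\<dots> = ennreal A * (esup (wmul g) * (enn_L2 p * enn_L2 q * enn_L2 r))"
      by (simp only: mult_ac)
    also have "\<dots> \<le> ennreal A * bound2 p q r g"
      by (intro mult_left_mono tri) auto
    finally show "enn_L2 p * enn_L2 q * enn_L2 (\<lambda>v. r v * g v) \<le> ennreal A * bound2 p q r g" .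
  qed
  show KT3: "estimate KT3 bound2"
  proof (rule estimate_mono[OF estimate_KT3, where K = 1])
    fix p q r g :: vfun assume [measurable]: "meas q" "meas g"
    have "enn_L2 (\<lambda>v. q v * wmul g v) \<le> esup (wmul g) * enn_L2 q"
      using enn_L2_mult_le_esup[of q "wmul g"] by (simp add: mult.commute)
    then have "enn_L2 p * enn_L2 r * enn_L2 (\<lambda>v. q v * wmul g v) \<le> enn_L2 p * enn_L2 r * (esup (wmul g) * enn_L2 q)"
      by (rule mult_left_mono) simp
    also have "\<dots> = esup (wmul g) * (enn_L2 p * enn_L2 q * enn_L2 r)"
      by (simp only: mult_ac)
    also have "\<dots> \<le> bound2 p q r g" by (rule tri)
    finally show "enn_L2 p * enn_L2 r * enn_L2 (\<lambda>v. q v * wmul g v) \<le> ennreal 1 * bound2 p q r g" by simp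
  qed
  show "estimate (\<lambda>p q r. KT1 q p r) bound2" "estimate (\<lambda>p q r. KT2 q p r) bound2" "estimate (\<lambda>p q r. KT3 q p r) bound2"
    by (rule swap, fact)+
qed

text \<open>Here g is measured in a weighted L2 norm only. In \<open>KT2\<close> and
  \<open>KT3\<close> it meets another function at v, so a supremum must be taken of one or two of p,
  q, r instead; the possible choices are the entries of the minima.\<close>

lemma estimate_Ktot_bound3: "estimate Ktot (\<lambda>p q r g. enn_L2 (wmul g) * bound3 p q r)"
proof (rule estimate_Ktot)
  let ?R = "\<lambda>p q r g. enn_L2 (wmul g) * bound3 p q r"
  have le: "estimate F ?R" if F: "estimate F (\<lambda>p q r g. enn_L2 (wmul g) * S p q r)" and S: "\<And>p q r. S p q r \<le> bound3 p q r" for F S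
    by (rule estimate_mono'[OF F]) (intro mult_left_mono S, simp)
  have le': "estimate F ?R" if F: "estimate F (\<lambda>p q r g. enn_L2 g * S p q r)" and S: "\<And>p q r. S p q r \<le> bound3 p q r" for F S
  proof (rule estimate_mono[OF F, where K = A])
    fix p q r g :: vfun assume "meas g"
    then have "enn_L2 g * S p q r \<le> (ennreal A * enn_L2 (wmul g)) * bound3 p q r"
      by (intro mult_mono enn_L2_le_wmul S) auto
    then show "enn_L2 g * S p q r \<le> ennreal A * (enn_L2 (wmul g) * bound3 p q r)"
      by (simp only: mult.assoc)
  qed
  show "estimate (\<lambda>p q r. KB p q) ?R" "estimate (\<lambda>p q r. KM p r) ?R" "estimate (\<lambda>p q r. KM q r) ?R"
    by (rule le, rule estimate_bilinear3[OF bil_bound_KB] estimate_bilinear3[OF bil_bound_KM],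
        simp add: bound3_def add_increasing add_increasing2)+
  have sym: "bound3 p q r = bound3 q p r" for p q r
    by (simp add: bound3_def pairs_def mult_ac add_ac)
  have swap: "estimate (\<lambda>p q r. F q p r) ?R" if "estimate F ?R" for F
    using estimate_swap[OF that] by (rule estimate_mono') (simp add: sym)
  have KT1: "estimate KT1 (\<lambda>p q r g. enn_L2 g * (enn_L2 p * enn_L2 q * enn_L2 r))"
    using estimate_KT1 by (simp add: mult.assoc)
  show 1: "estimate KT1 ?R"
    by (rule le', rule KT1) (simp add: bound3_def add_increasing add_increasing2)
  show 2: "estimate KT2 ?R"
    by (rule le', rule estimate_min[OF estimate_KT2_sup_r estimate_KT2_sup_pq]) (simp add: bound3_def add_increasing add_increasing2)
  have KT3: "estimate KT3 (\<lambda>p q r g. enn_L2 (wmul g) * (esup r * enn_L2 p * enn_L2 q))"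
    by (rule estimate_KT3_sup_r[where x = "\<lambda>q. q" and y = wmul]) (auto simp: wmul_def mult_ac)
  show 3: "estimate KT3 ?R"
    by (rule le, rule estimate_min[OF KT3 estimate_KT3_sup_q]) (simp add: bound3_def add_increasing add_increasing2)
  show "estimate (\<lambda>p q r. KT1 q p r) ?R" "estimate (\<lambda>p q r. KT2 q p r) ?R" "estimate (\<lambda>p q r. KT3 q p r) ?R"
    by (rule swap, fact)+
qed

end

section \<open>Pointwise bounds of the collision operators\<close>

definition KT :: "vfun \<Rightarrow> vfun \<Rightarrow> vfun \<Rightarrow> ckernel" where
  "KT p q r u v \<omega> = KT1 p q r u v \<omega> + KT1 q p r u v \<omega> + KT2 p q r u v \<omega> + KT2 q p r u v \<omega>
    + KT3 p q r u v \<omega> + KT3 q p r u v \<omega>"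

lemma KT_commute: "KT p q r u v \<omega> = KT q p r u v \<omega>"
  by (simp add: KT_def add_ac)

text \<open>As an argument, \<open>mu\<close> behaves like \<open>sqrt MM\<close> times
  \<open>gs\<close>. The operator with \<open>mu\<close> in a quadratic slot is therefore the cubic
  one with a Gaussian as function, and its eight terms are those of \<open>KM\<close>.\<close>

lemma KT_gs_middle: "KT p (\<lambda>x. ennreal (gs x)) r u v \<omega> = KM p r u v \<omega>"
  unfolding KT_def KM_def KT1_def KT2_def KT3_def
  by (simp add: ennreal_mult power2_eq_square mult_ac add_ac)

text \<open>With the Gaussian in the third slot the surplus Gaussians are bounded by 1, and the
  eight cubic terms collapse in pairs onto the four terms of \<open>KB\<close>; hence the factor
  2.\<close>

lemma KT_gs_right: "KT p q (\<lambda>x. ennreal (gs x)) u v \<omega> \<le> 2 * KB p q u v \<omega>"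
proof -
  let ?w = "\<bar>\<omega> \<bullet> (v - u)\<bar>"
  have le: "ennreal (?w * (gs u * gs a)) * (X * ennreal (gs b)) \<le> ennreal (?w * gs u) * X" for a b X
  proof -
    have "?w * (gs u * gs a) * gs b \<le> ?w * gs u"
      using mult_left_mono[of "gs a * gs b" 1 "?w * gs u"] by (simp add: mult_ac mult_le_one)
    then have "ennreal (?w * (gs u * gs a)) * ennreal (gs b) \<le> ennreal (?w * gs u)"
      by (simp add: ennreal_mult[symmetric] ennreal_leI)
    from mult_right_mono[OF this, of X] show ?thesis by (simp add: mult_ac)
  qed
  have "KT p q (\<lambda>x. ennreal (gs x)) u v \<omega>
    \<le> (ennreal (?w * gs u) * (p (post_u u v \<omega>) * q (post_v u v \<omega>)) + ennreal (?w * gs u) * (q (post_u u v \<omega>) * p (post_v u v \<omega>)))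
    + (ennreal (?w * gs u) * (p (post_u u v \<omega>) * q (post_v u v \<omega>)) + ennreal (?w * gs u) * (q (post_u u v \<omega>) * p (post_v u v \<omega>)))
    + (ennreal (?w * gs u) * (q v * p u) + ennreal (?w * gs u) * (q v * p u))
    + (ennreal (?w * gs u) * (p v * q u) + ennreal (?w * gs u) * (p v * q u))"
    unfolding KT_def KT1_def KT2_def KT3_def power2_eq_square add.assoc mult.assoc[of "q v", symmetric] mult.assoc[of "p v", symmetric]
    by (intro add_mono le)
  also have "\<dots> = 2 * KB p q u v \<omega>"
    unfolding KB_def by (simp only: mult_2 add_ac)
  finally show ?thesis .
qed

lemma K_le_Ktot:
  "KB p q u v \<omega> \<le> Ktot p q r u v \<omega>" "KM p r u v \<omega> \<le> Ktot p q r u v \<omega>" "KM q r u v \<omega> \<le> Ktot p q r u v \<omega>"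
  "KT p q r u v \<omega> \<le> Ktot p q r u v \<omega>"
proof -
  have eq: "Ktot p q r u v \<omega> = KB p q u v \<omega> + KM p r u v \<omega> + KM q r u v \<omega> + KT p q r u v \<omega>"
    unfolding Ktot_def KT_def by (simp only: add_ac)
  show "KB p q u v \<omega> \<le> Ktot p q r u v \<omega>" "KM p r u v \<omega> \<le> Ktot p q r u v \<omega>" "KM q r u v \<omega> \<le> Ktot p q r u v \<omega>"
    "KT p q r u v \<omega> \<le> Ktot p q r u v \<omega>"
    unfolding eq by (simp_all add: add_increasing add_increasing2)
qed

text \<open>Two-sided comparison of the equilibrium with Gaussians, for both signs of \<theta> at
  once. The square of K in the bounds of \<open>MM\<close> makes K the constant for its square
  root.\<close>

locale equilibrium_bounds =
  fixes \<theta> \<rho> K :: real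
  assumes theta: "\<bar>\<theta>\<bar> = 1" and K_ge: "K \<ge> 1" and rho_pos: "\<rho> > 0"
    and mu_le: "mu \<theta> \<rho> x \<le> K * (gs x)\<^sup>2" and mu_ge: "(gs x)\<^sup>2 \<le> K * mu \<theta> \<rho> x"
    and MM_le: "MM \<theta> \<rho> x \<le> K\<^sup>2 * (gs x)\<^sup>2" and MM_ge: "(gs x)\<^sup>2 \<le> K\<^sup>2 * MM \<theta> \<rho> x"

text \<open>With E = exp |x|^2 \<ge> 1 = |\<theta>| the denominator D = \<rho> E - \<theta> lies
  between (\<rho> - 1) E and (\<rho> + 1) E, and \<rho> > 1 keeps the lower bound positive. Then
  \<open>mu\<close> is 1 / D, \<open>MM\<close> is \<rho> E / D^2, and the square of
  \<open>gs\<close> is 1 / E.\<close>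

lemma equilibrium_bounds_exists:
  assumes "\<theta> \<in> {-1, 1}" "\<rho> > 1"
  obtains K where "equilibrium_bounds \<theta> \<rho> K"
proof -
  \<comment> \<open>The summand 1 / (\<rho> - 1) bounds \<open>mu\<close> from above, \<rho> + 1
    serves both lower bounds, and sqrt \<rho> / (\<rho> - 1) bounds the square root of
    \<open>MM\<close>; the 1 ensures K \<ge> 1.\<close>
  define K where "K = 1 + 1 / (\<rho> - 1) + (\<rho> + 1) + sqrt \<rho> / (\<rho> - 1)"
  have K: "1 \<le> K" "1 / (\<rho> - 1) \<le> K" "\<rho> + 1 \<le> K" "sqrt \<rho> / (\<rho> - 1) \<le> K"
    using assms by (auto simp: K_def)
  have K2: "\<rho> / (\<rho> - 1)\<^sup>2 \<le> K\<^sup>2" "(\<rho> + 1)\<^sup>2 \<le> K\<^sup>2"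
  proof -
    have "(sqrt \<rho> / (\<rho> - 1))\<^sup>2 \<le> K\<^sup>2" using K assms by (intro power_mono) auto
    then show "\<rho> / (\<rho> - 1)\<^sup>2 \<le> K\<^sup>2" using assms by (simp add: power_divide)
    show "(\<rho> + 1)\<^sup>2 \<le> K\<^sup>2" using K assms by (intro power_mono) auto
  qed
  have main: "mu \<theta> \<rho> x \<le> K * (gs x)\<^sup>2 \<and> (gs x)\<^sup>2 \<le> K * mu \<theta> \<rho> x \<and> MM \<theta> \<rho> x \<le> K\<^sup>2 * (gs x)\<^sup>2 \<and> (gs x)\<^sup>2 \<le> K\<^sup>2 * MM \<theta> \<rho> x" for x
  proof -
    define E where "E = exp ((norm x)\<^sup>2)"
    define D where "D = \<rho> * E - \<theta>"
    have E: "E \<ge> 1" by (simp add: E_def)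
    have gsE: "(gs x)\<^sup>2 = 1 / E"
      by (simp add: gs_def E_def sq_exp exp_minus field_simps)
    have muD: "mu \<theta> \<rho> x = 1 / D" by (simp add: mu_def D_def E_def)
    have \<theta>: "\<theta> \<le> E" "- E \<le> \<theta>" using assms E by auto
    have D1: "(\<rho> - 1) * E \<le> D" "D \<le> (\<rho> + 1) * E"
      using \<theta> by (auto simp: D_def algebra_simps)
    have D0: "(\<rho> - 1) * E > 0" using E assms by simp
    have Dpos: "D > 0" using D0 D1 by linarith
    have MMD: "MM \<theta> \<rho> x = \<rho> * E / D\<^sup>2"
    proof -
      have "MM \<theta> \<rho> x = (D + \<theta>) / D\<^sup>2"
        using Dpos by (simp add: MM_def muD field_simps power2_eq_square)
      then show ?thesis by (simp add: D_def)
    qed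
    have "mu \<theta> \<rho> x \<le> 1 / ((\<rho> - 1) * E)"
      unfolding muD using D0 D1 by (intro divide_left_mono) (auto intro!: mult_pos_pos Dpos)
    also have "\<dots> = 1 / (\<rho> - 1) * (gs x)\<^sup>2" by (simp add: gsE)
    also have "\<dots> \<le> K * (gs x)\<^sup>2" using K by (intro mult_right_mono) auto
    finally have a: "mu \<theta> \<rho> x \<le> K * (gs x)\<^sup>2" .
    have "(gs x)\<^sup>2 \<le> (\<rho> + 1) * mu \<theta> \<rho> x"
      unfolding gsE muD using D1 Dpos E by (simp add: field_simps)
    also have "\<dots> \<le> K * mu \<theta> \<rho> x" using K Dpos by (intro mult_right_mono) (auto simp: muD)
    finally have b: "(gs x)\<^sup>2 \<le> K * mu \<theta> \<rho> x" .
    have "MM \<theta> \<rho> x \<le> \<rho> * E / ((\<rho> - 1) * E)\<^sup>2"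
      unfolding MMD using D0 D1 E assms Dpos
      by (intro divide_left_mono power_mono) (auto intro!: mult_pos_pos)
    also have "\<dots> = \<rho> / (\<rho> - 1)\<^sup>2 * (gs x)\<^sup>2"
      unfolding gsE using E by (simp add: power_mult_distrib power2_eq_square)
    also have "\<dots> \<le> K\<^sup>2 * (gs x)\<^sup>2" by (intro mult_right_mono K2) auto
    finally have c: "MM \<theta> \<rho> x \<le> K\<^sup>2 * (gs x)\<^sup>2" .
    have "D\<^sup>2 \<le> ((\<rho> + 1) * E)\<^sup>2" using D1 Dpos by (intro power_mono) auto
    then have "(gs x)\<^sup>2 \<le> (\<rho> + 1)\<^sup>2 * (E / D\<^sup>2)"
      unfolding gsE using Dpos E by (simp add: field_simps power2_eq_square)
    also have "\<dots> \<le> (\<rho> + 1)\<^sup>2 * (\<rho> * E / D\<^sup>2)"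
      using E assms Dpos by (intro mult_left_mono divide_right_mono) auto
    also have "\<dots> \<le> K\<^sup>2 * MM \<theta> \<rho> x"
      unfolding MMD using E assms by (intro mult_right_mono K2) auto
    finally have d: "(gs x)\<^sup>2 \<le> K\<^sup>2 * MM \<theta> \<rho> x" .
    show ?thesis using a b c d by blast
  qed
  have "equilibrium_bounds \<theta> \<rho> K"
    by standard (use assms K main in auto)
  then show thesis by (rule that)
qed

context equilibrium_bounds
begin

abbreviation "sM x \<equiv> sqrt (MM \<theta> \<rho> x)"

lemma mu_pos: "mu \<theta> \<rho> x > 0"
proof -
  have "0 < (gs x)\<^sup>2" by (intro zero_less_power gs_pos)
  then have "0 < K * mu \<theta> \<rho> x" using mu_ge[of x] by linarith
  then show ?thesis using K_ge by (simp add: zero_less_mult_iff)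
qed

lemma MM_pos: "MM \<theta> \<rho> x > 0"
proof -
  have "0 < (gs x)\<^sup>2" by (intro zero_less_power gs_pos)
  then have "0 < K\<^sup>2 * MM \<theta> \<rho> x" using MM_ge[of x] by linarith
  then show ?thesis using K_ge by (simp add: zero_less_mult_iff)
qed

lemma sM_bounds: "0 < sM x" "sM x \<le> K * gs x" "1 / sM x \<le> K / gs x"
proof -
  show pos: "0 < sM x" using MM_pos by simp
  have "sM x \<le> sqrt (K\<^sup>2 * (gs x)\<^sup>2)" by (intro real_sqrt_le_mono MM_le)
  then show "sM x \<le> K * gs x" using K_ge by (simp add: real_sqrt_mult)
  have "sqrt ((gs x)\<^sup>2) \<le> sqrt (K\<^sup>2 * MM \<theta> \<rho> x)" by (intro real_sqrt_le_mono MM_ge)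
  then have "gs x \<le> K * sM x" using K_ge by (simp add: real_sqrt_mult)
  then show "1 / sM x \<le> K / gs x" using pos by (simp add: field_simps)
qed

text \<open>f is the profile of F relative to the Gaussian: |f| for \<open>sqrtM_times\<close>, and
  \<open>gs\<close> itself for \<open>mu\<close>. One pointwise estimate then covers every choice of
  arguments of \<open>Q1\<close> and \<open>Q2\<close>.\<close>

definition dominated :: "(vec3 \<Rightarrow> real) \<Rightarrow> (vec3 \<Rightarrow> real) \<Rightarrow> bool" where
  "dominated F f \<longleftrightarrow> (\<forall>x. 0 \<le> f x \<and> \<bar>F x\<bar> \<le> K * (gs x * f x))"

lemma dominated_sqrtM_times: "dominated (sqrtM_times \<theta> \<rho> f) (\<lambda>x. \<bar>f x\<bar>)"
  unfolding dominated_def sqrtM_times_def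
proof (intro allI conjI)
  fix x
  have "\<bar>sM x * f x\<bar> = sM x * \<bar>f x\<bar>" using sM_bounds(1)[of x] by (simp add: abs_mult)
  also have "\<dots> \<le> K * gs x * \<bar>f x\<bar>" by (intro mult_right_mono sM_bounds) auto
  finally show "\<bar>sM x * f x\<bar> \<le> K * (gs x * \<bar>f x\<bar>)" by (simp add: mult_ac)
qed simp

lemma dominated_mu: "dominated (mu \<theta> \<rho>) gs"
  unfolding dominated_def
proof (intro allI conjI)
  fix x show "\<bar>mu \<theta> \<rho> x\<bar> \<le> K * (gs x * gs x)"
    using mu_le[of x] mu_pos[of x] by (simp add: power2_eq_square)
qed simp

text \<open>The hypothesis \<open>e\<close> holds for the pair (u, v) and, by energy conservation,
  for (u', v'). Either way the product of the two Gaussians divided by that of v is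
  \<open>gs u\<close>, with one factor K from each function and one from
  \<open>1 / sM\<close>.\<close>

lemma dominated_product2:
  assumes "dominated F f" "dominated G g" and e: "gs x * gs y = gs u * gs v"
  shows "\<bar>F x * G y\<bar> / sM v \<le> K ^ 3 * (gs u * (f x * g y))"
proof -
  have "\<bar>F x * G y\<bar> * (1 / sM v) \<le> ((K * (gs x * f x)) * (K * (gs y * g y))) * (K / gs v)"
    unfolding abs_mult using assms K_ge sM_bounds[of v]
    by (intro mult_mono) (auto simp: dominated_def)
  also have "\<dots> = K ^ 3 * ((gs x * gs y) / gs v * (f x * g y))"
    by (simp add: power3_eq_cube mult_ac)
  also have "(gs x * gs y) / gs v = gs u"
    unfolding e using less_imp_neq[OF gs_pos(1)[of v]] by simp
  finally show ?thesis by simp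
qed

lemma dominated_product3:
  assumes "dominated F f" "dominated G g" "dominated H h" and e: "gs x * gs y = gs u * gs v"
  shows "\<bar>F x * G y * H z\<bar> / sM v \<le> K ^ 4 * (gs u * gs z * (f x * g y * h z))"
proof -
  have fg: "0 \<le> f x" "0 \<le> g y" using assms by (auto simp: dominated_def)
  have "\<bar>F x * G y * H z\<bar> / sM v = (\<bar>F x * G y\<bar> / sM v) * \<bar>H z\<bar>" by (simp add: abs_mult)
  also have "\<dots> \<le> (K ^ 3 * (gs u * (f x * g y))) * (K * (gs z * h z))"
    using assms(3) fg K_ge
    by (intro mult_mono dominated_product2[OF assms(1,2) e]) (auto simp: dominated_def)
  also have "\<dots> = K ^ 4 * (gs u * gs z * (f x * g y * h z))"
    by (simp add: power4_eq_xxxx power3_eq_cube mult_ac)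
  finally show ?thesis .
qed

lemma Q1_pointwise:
  assumes dom: "dominated F f" "dominated G g" and \<omega>: "norm \<omega> = 1"
  shows "ennreal (\<bar>Q1_integrand F G v (u, \<omega>)\<bar> / sM v)
    \<le> ennreal (K ^ 3) * KB (\<lambda>x. ennreal (f x)) (\<lambda>x. ennreal (g x)) u v \<omega>"
proof -
  let ?w = "\<bar>\<omega> \<bullet> (v - u)\<bar>" and ?u = "post_u u v \<omega>" and ?v = "post_v u v \<omega>"
  have f: "0 \<le> f x" "0 \<le> g x" for x using dom by (auto simp: dominated_def)
  have e: "gs ?u * gs ?v = gs u * gs v" by (rule gs_energy[OF \<omega>])
  have "\<bar>Q1_integrand F G v (u, \<omega>)\<bar> / sM v
    = ?w * (\<bar>F ?u * G ?v + G ?u * F ?v - F u * G v - G u * F v\<bar> / sM v)"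
    by (simp add: Q1_integrand_def Let_def abs_mult)
  also have "\<dots> \<le> ?w * (\<bar>F ?u * G ?v\<bar> / sM v + \<bar>G ?u * F ?v\<bar> / sM v + \<bar>F u * G v\<bar> / sM v + \<bar>G u * F v\<bar> / sM v)"
    unfolding add_divide_distrib[symmetric] using sM_bounds(1)[of v]
    by (intro mult_left_mono divide_right_mono) auto
  also have "\<dots> \<le> ?w * (K ^ 3 * (gs u * (f ?u * g ?v)) + K ^ 3 * (gs u * (g ?u * f ?v))
      + K ^ 3 * (gs u * (f u * g v)) + K ^ 3 * (gs u * (g u * f v)))"
    by (intro mult_left_mono add_mono dominated_product2 dom e) auto
  also have "\<dots> = K ^ 3 * (?w * gs u * (f ?u * g ?v) + ?w * gs u * (g ?u * f ?v)
      + ?w * gs u * (g v * f u) + ?w * gs u * (f v * g u))"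
    by (simp add: algebra_simps)
  finally have "ennreal (\<bar>Q1_integrand F G v (u, \<omega>)\<bar> / sM v) \<le> ennreal \<dots>"
    by (rule ennreal_leI)
  also have "\<dots> = ennreal (K ^ 3) * KB (\<lambda>x. ennreal (f x)) (\<lambda>x. ennreal (g x)) u v \<omega>"
    using K_ge f by (simp add: KB_def ennreal_mult ennreal_plus)
  finally show ?thesis .
qed

lemma abs_sum8_le:
  fixes a b c d p q r s :: real
  shows "\<bar>a + b + c + d - p - q - r - s\<bar> \<le> \<bar>a\<bar> + \<bar>b\<bar> + \<bar>c\<bar> + \<bar>d\<bar> + \<bar>p\<bar> + \<bar>q\<bar> + \<bar>r\<bar> + \<bar>s\<bar>"
  by ((rule order_trans[OF abs_triangle_ineq4], rule add_right_mono)+,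
      (rule order_trans[OF abs_triangle_ineq], rule add_right_mono)+, rule order_refl)

text \<open>Expanding the integrand gives eight products. In each of them the quadratic arguments
  occupy (u, v) or (u', v'), so division by \<open>sM v\<close> leaves \<open>gs u\<close> together
  with the Gaussian at the velocity of the third argument.\<close>

lemma Q2_pointwise:
  assumes dom: "dominated F f" "dominated G g" "dominated H h" and \<omega>: "norm \<omega> = 1"
  shows "ennreal (\<bar>Q2_integrand F G H v (u, \<omega>)\<bar> / sM v)
    \<le> ennreal (K ^ 4) * KT (\<lambda>x. ennreal (f x)) (\<lambda>x. ennreal (g x)) (\<lambda>x. ennreal (h x)) u v \<omega>"
proof -
  let ?w = "\<bar>\<omega> \<bullet> (v - u)\<bar>" and ?u = "post_u u v \<omega>" and ?v = "post_v u v \<omega>"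
  have f: "0 \<le> f x" "0 \<le> g x" "0 \<le> h x" for x using dom by (auto simp: dominated_def)
  have e: "gs ?u * gs ?v = gs u * gs v" by (rule gs_energy[OF \<omega>])
  have "\<bar>Q2_integrand F G H v (u, \<omega>)\<bar> / sM v
    = ?w * (\<bar>F ?u * G ?v * H u + F ?u * G ?v * H v + G ?u * F ?v * H u + G ?u * F ?v * H v
      - F u * G v * H ?u - F u * G v * H ?v - G u * F v * H ?u - G u * F v * H ?v\<bar> / sM v)"
  proof -
    have "F ?u * G ?v * H u + F ?u * G ?v * H v + G ?u * F ?v * H u + G ?u * F ?v * H v
      - F u * G v * H ?u - F u * G v * H ?v - G u * F v * H ?u - G u * F v * H ?v
      = (F ?u * G ?v + G ?u * F ?v) * (H u + H v) - (F u * G v + G u * F v) * (H ?u + H ?v)"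
      by (simp only: distrib_left distrib_right diff_diff_eq add.assoc)
    then show ?thesis
      by (simp add: Q2_integrand_def Let_def abs_mult)
  qed
  also have "\<dots> \<le> ?w * (\<bar>F ?u * G ?v * H u\<bar> / sM v + \<bar>F ?u * G ?v * H v\<bar> / sM v
      + \<bar>G ?u * F ?v * H u\<bar> / sM v + \<bar>G ?u * F ?v * H v\<bar> / sM v
      + \<bar>F u * G v * H ?u\<bar> / sM v + \<bar>F u * G v * H ?v\<bar> / sM v
      + \<bar>G u * F v * H ?u\<bar> / sM v + \<bar>G u * F v * H ?v\<bar> / sM v)"
    unfolding add_divide_distrib[symmetric] using sM_bounds(1)[of v]
    by (intro mult_left_mono divide_right_mono abs_sum8_le) auto
  also have "\<dots> \<le> ?w * (K ^ 4 * (gs u * gs u * (f ?u * g ?v * h u)) + K ^ 4 * (gs u * gs v * (f ?u * g ?v * h v))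
      + K ^ 4 * (gs u * gs u * (g ?u * f ?v * h u)) + K ^ 4 * (gs u * gs v * (g ?u * f ?v * h v))
      + K ^ 4 * (gs u * gs ?u * (f u * g v * h ?u)) + K ^ 4 * (gs u * gs ?v * (f u * g v * h ?v))
      + K ^ 4 * (gs u * gs ?u * (g u * f v * h ?u)) + K ^ 4 * (gs u * gs ?v * (g u * f v * h ?v)))"
    by (intro mult_left_mono add_mono dominated_product3 dom e) auto
  also have "\<dots> = K ^ 4 * (?w * (gs u)\<^sup>2 * (f ?u * g ?v * h u) + ?w * (gs u)\<^sup>2 * (g ?u * f ?v * h u)
      + ?w * (gs u * gs v) * (f ?u * g ?v * h v) + ?w * (gs u * gs v) * (g ?u * f ?v * h v)
      + (?w * (gs u * gs ?u) * (g v * (f u * h ?u)) + ?w * (gs u * gs ?v) * (g v * (f u * h ?v)))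
      + (?w * (gs u * gs ?u) * (f v * (g u * h ?u)) + ?w * (gs u * gs ?v) * (f v * (g u * h ?v))))"
    by (simp add: algebra_simps power2_eq_square)
  finally have "ennreal (\<bar>Q2_integrand F G H v (u, \<omega>)\<bar> / sM v) \<le> ennreal \<dots>"
    by (rule ennreal_leI)
  also have "\<dots> = ennreal (K ^ 4) * KT (\<lambda>x. ennreal (f x)) (\<lambda>x. ennreal (g x)) (\<lambda>x. ennreal (h x)) u v \<omega>"
    using K_ge f by (simp add: KT_def KT1_def KT2_def KT3_def ennreal_mult ennreal_plus)
  finally show ?thesis .
qed

end

section \<open>Measurability of the collision operators\<close>

lemma nn_integral_lborel_sphere:
  assumes [measurable]: "f \<in> borel_measurable (lborel \<Otimes>\<^sub>M sphere_measure)"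
  shows "(\<integral>\<^sup>+x. f x \<partial>(lborel \<Otimes>\<^sub>M sphere_measure)) = (\<integral>\<^sup>+u. (\<integral>\<^sup>+\<omega>. f (u, \<omega>) \<partial>sphere_measure) \<partial>lborel)"
  by (rule sphere.nn_integral_fst[symmetric]) measurable

lemma measurable_mu [measurable]: "mu \<theta> \<rho> \<in> borel_measurable borel"
  unfolding mu_def[abs_def] by measurable

lemma measurable_MM [measurable]: "MM \<theta> \<rho> \<in> borel_measurable borel"
  unfolding MM_def[abs_def] by measurable

lemma measurable_sqrtM_times [measurable]:
  "meas f \<Longrightarrow> sqrtM_times \<theta> \<rho> f \<in> borel_measurable borel"
  unfolding sqrtM_times_def[abs_def] by measurable

lemma measurable_Q1_integrand [measurable]:
  assumes [measurable]: "meas F" "meas G"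
    "f \<in> borel_measurable M" "g \<in> borel_measurable M" "h \<in> borel_measurable M"
  shows "(\<lambda>x. Q1_integrand F G (f x) (g x, h x)) \<in> borel_measurable M"
  unfolding Q1_integrand_def Let_def split by measurable

lemma measurable_Q2_integrand [measurable]:
  assumes [measurable]: "meas F" "meas G" "meas H"
    "f \<in> borel_measurable M" "g \<in> borel_measurable M" "h \<in> borel_measurable M"
  shows "(\<lambda>x. Q2_integrand F G H (f x) (g x, h x)) \<in> borel_measurable M"
  unfolding Q2_integrand_def Let_def split by measurable

lemma measurable_Q_integrand_pair [measurable]:
  assumes [measurable]: "meas F" "meas G" "meas H"
  shows "Q1_integrand F G v \<in> borel_measurable (lborel \<Otimes>\<^sub>M sphere_measure)"
    "Q2_integrand F G H v \<in> borel_measurable (lborel \<Otimes>\<^sub>M sphere_measure)"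
proof -
  have "(\<lambda>x. Q1_integrand F G v (fst x, snd x)) \<in> borel_measurable (lborel \<Otimes>\<^sub>M sphere_measure)"
    "(\<lambda>x. Q2_integrand F G H v (fst x, snd x)) \<in> borel_measurable (lborel \<Otimes>\<^sub>M sphere_measure)"
    by measurable
  then show "Q1_integrand F G v \<in> borel_measurable (lborel \<Otimes>\<^sub>M sphere_measure)"
    "Q2_integrand F G H v \<in> borel_measurable (lborel \<Otimes>\<^sub>M sphere_measure)"
    by simp_all
qed

lemma measurable_lborel_sphere_integral:
  fixes f :: "vec3 \<Rightarrow> vec3 \<times> vec3 \<Rightarrow> real"
  assumes [measurable]: "(\<lambda>(v, x). f v x) \<in> borel_measurable (borel \<Otimes>\<^sub>M (lborel \<Otimes>\<^sub>M sphere_measure))"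
  shows "(\<lambda>v. \<integral>x. f v x \<partial>(lborel \<Otimes>\<^sub>M sphere_measure)) \<in> borel_measurable borel"
proof -
  interpret P: pair_sigma_finite "lborel :: vec3 measure" sphere_measure ..
  have S: "sigma_finite_measure (lborel \<Otimes>\<^sub>M sphere_measure :: (vec3 \<times> vec3) measure)"
    by (rule sigma_finite_pair_measure) unfold_locales
  show ?thesis
    by (rule sigma_finite_measure.borel_measurable_lebesgue_integral[OF S]) measurable
qed

lemma measurable_Q1 [measurable]:
  assumes [measurable]: "meas F" "meas G"
  shows "Q1 F G \<in> borel_measurable borel"
proof -
  have "(\<lambda>y. Q1_integrand F G (fst y) (fst (snd y), snd (snd y))) \<in> borel_measurable (borel \<Otimes>\<^sub>M (lborel \<Otimes>\<^sub>M sphere_measure))"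
    by measurable
  then have "(\<lambda>(v, x). Q1_integrand F G v x) \<in> borel_measurable (borel \<Otimes>\<^sub>M (lborel \<Otimes>\<^sub>M sphere_measure))"
    by (simp add: split_beta')
  from measurable_lborel_sphere_integral[OF this] show ?thesis
    unfolding Q1_def[abs_def] by measurable
qed

lemma measurable_Q2 [measurable]:
  assumes [measurable]: "meas F" "meas G" "meas H"
  shows "Q2 F G H \<in> borel_measurable borel"
proof -
  have "(\<lambda>y. Q2_integrand F G H (fst y) (fst (snd y), snd (snd y))) \<in> borel_measurable (borel \<Otimes>\<^sub>M (lborel \<Otimes>\<^sub>M sphere_measure))"
    by measurable
  then have "(\<lambda>(v, x). Q2_integrand F G H v x) \<in> borel_measurable (borel \<Otimes>\<^sub>M (lborel \<Otimes>\<^sub>M sphere_measure))"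
    by (simp add: split_beta')
  from measurable_lborel_sphere_integral[OF this] show ?thesis
    unfolding Q2_def[abs_def] by measurable
qed

lemma measurable_coll_Gamma [measurable]:
  assumes [measurable]: "meas f1" "meas f2" "meas f3"
  shows "coll_Gamma \<theta> \<rho> f1 f2 f3 \<in> borel_measurable borel"
  unfolding coll_Gamma_def[abs_def] Let_def by measurable

section \<open>The collision frequency\<close>

text \<open>Let e be the direction of X. The ball of radius 1/4 about e / 2 lies in the unit ball,
  and its points satisfy x \<bullet> e \<ge> 1/4; in the cone measure this ball alone gives a fixed
  multiple of |X|.\<close>

lemma sphere_abs_inner_ge:
  obtains c where "c > 0" "\<And>X. ennreal (c * norm X) \<le> (\<integral>\<^sup>+\<omega>. ennreal \<bar>\<omega> \<bullet> X\<bar> \<partial>sphere_measure)"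
proof -
  define V where "V = measure lborel (ball (0::vec3) (1 / 4))"
  have ball: "emeasure lborel (ball (x::vec3) (1 / 4)) = ennreal V" for x
    unfolding V_def by (simp add: emeasure_ball content_ball)
  have V: "V > 0" unfolding V_def by (rule content_ball_pos) simp
  have "ennreal (3 / 4 * V * norm X) \<le> (\<integral>\<^sup>+\<omega>. ennreal \<bar>\<omega> \<bullet> X\<bar> \<partial>sphere_measure)" for X :: vec3
  proof (cases "X = 0")
    case False
    define e where "e = sgn X"
    have e: "norm e = 1" "X = norm X *\<^sub>R e" using False by (auto simp: e_def norm_sgn sgn_div_norm)
    have "ennreal (3 / 4 * V * norm X) = (\<integral>\<^sup>+x. ennreal (3 * (norm X / 4)) * indicator (ball ((1 / 2) *\<^sub>R e) (1 / 4)) x \<partial>lborel)"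
      using V by (subst nn_integral_cmult_indicator) (auto simp: ball ennreal_mult[symmetric] mult_ac)
    also have "\<dots> \<le> (\<integral>\<^sup>+x. 3 * indicator (ball 0 1) x * ennreal \<bar>sgn x \<bullet> X\<bar> \<partial>lborel)"
    proof (rule nn_integral_mono)
      fix x :: vec3
      show "ennreal (3 * (norm X / 4)) * indicator (ball ((1 / 2) *\<^sub>R e) (1 / 4)) x \<le> 3 * indicator (ball 0 1) x * ennreal \<bar>sgn x \<bullet> X\<bar>"
      proof (cases "x \<in> ball ((1 / 2) *\<^sub>R e) (1 / 4)")
        case True
        define y where "y = x - (1 / 2) *\<^sub>R e"
        have y: "norm y < 1 / 4" using True by (simp add: y_def dist_norm norm_minus_commute)
        have x: "x = (1 / 2) *\<^sub>R e + y" by (simp add: y_def)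
        have nx: "norm x < 1" using norm_triangle_ineq[of "(1 / 2) *\<^sub>R e" y] y e by (simp add: x)
        have "\<bar>y \<bullet> e\<bar> \<le> 1 / 4" using Cauchy_Schwarz_ineq2[of y e] y e by simp
        then have xe: "1 / 4 \<le> x \<bullet> e" using e by (simp add: x inner_add_left norm_eq_1)
        then have x0: "x \<noteq> 0" by auto
        have "norm X / 4 \<le> norm X * (x \<bullet> e)" using mult_left_mono[OF xe, of "norm X"] by simp
        also have "\<dots> = x \<bullet> X" by (subst (2) e(2)) simp
        also have "\<dots> = norm x * (sgn x \<bullet> X)" using x0 by (simp add: sgn_div_norm)
        also have "\<dots> \<le> norm x * \<bar>sgn x \<bullet> X\<bar>" by (intro mult_left_mono) auto
        also have "\<dots> \<le> 1 * \<bar>sgn x \<bullet> X\<bar>" using nx by (intro mult_right_mono) auto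
        finally have "ennreal (3 * (norm X / 4)) \<le> ennreal (3 * \<bar>sgn x \<bullet> X\<bar>)"
          by (intro ennreal_leI) simp
        then show ?thesis using True nx by (simp add: ennreal_mult)
      qed simp
    qed
    also have "\<dots> = (\<integral>\<^sup>+\<omega>. ennreal \<bar>\<omega> \<bullet> X\<bar> \<partial>sphere_measure)"
      by (rule nn_integral_sphere_measure[symmetric]) measurable
    finally show ?thesis .
  qed simp
  then show thesis using that[of "3 / 4 * V"] V by simp
qed

text \<open>It suffices to integrate over u in a ball of radius 1/2 about -2 e, with e the direction
  of v. There |v - u| \<ge> |v| + 3/2, even for v = 0, while |u| \<le> 3 keeps the Gaussian above
  exp (-9).\<close>

lemma collision_frequency_ge:
  obtains c where "c > 0"
    "\<And>v. ennreal (c * (1 + norm v)) \<le> (\<integral>\<^sup>+u. (\<integral>\<^sup>+\<omega>. ennreal (\<bar>\<omega> \<bullet> (v - u)\<bar> * (gs u)\<^sup>2) \<partial>sphere_measure) \<partial>lborel)"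
proof -
  obtain c0 where c0: "c0 > 0" "\<And>X. ennreal (c0 * norm X) \<le> (\<integral>\<^sup>+\<omega>. ennreal \<bar>\<omega> \<bullet> X\<bar> \<partial>sphere_measure)"
    using sphere_abs_inner_ge by blast
  define V where "V = measure lborel (ball (0::vec3) (1 / 2))"
  have ball: "emeasure lborel (ball (x::vec3) (1 / 2)) = ennreal V" for x
    unfolding V_def by (simp add: emeasure_ball content_ball)
  have V: "V > 0" unfolding V_def by (rule content_ball_pos) simp
  let ?c = "c0 * exp (- 9) * V"
  have "ennreal (?c * (1 + norm v)) \<le> (\<integral>\<^sup>+u. (\<integral>\<^sup>+\<omega>. ennreal (\<bar>\<omega> \<bullet> (v - u)\<bar> * (gs u)\<^sup>2) \<partial>sphere_measure) \<partial>lborel)" for v :: vec3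
  proof -
    \<comment> \<open>For v = 0 any unit vector serves as direction.\<close>
    obtain e where e: "norm e = 1" "v = norm v *\<^sub>R e"
    proof (cases "v = 0")
      case True
      then show ?thesis using that[of "axis 1 1"] by (simp add: norm_axis_1)
    next
      case False
      then show ?thesis using that[of "sgn v"] by (simp add: norm_sgn sgn_div_norm)
    qed
    have "ennreal (?c * (1 + norm v)) = (\<integral>\<^sup>+u. ennreal (c0 * (1 + norm v) * exp (- 9)) * indicator (ball (- 2 *\<^sub>R e) (1 / 2)) u \<partial>lborel)"
      using V c0 by (subst nn_integral_cmult_indicator) (auto simp: ball ennreal_mult[symmetric] mult_ac)
    also have "\<dots> \<le> (\<integral>\<^sup>+u. (\<integral>\<^sup>+\<omega>. ennreal (\<bar>\<omega> \<bullet> (v - u)\<bar> * (gs u)\<^sup>2) \<partial>sphere_measure) \<partial>lborel)"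
    proof (rule nn_integral_mono)
      fix u :: vec3
      show "ennreal (c0 * (1 + norm v) * exp (- 9)) * indicator (ball (- 2 *\<^sub>R e) (1 / 2)) u
        \<le> (\<integral>\<^sup>+\<omega>. ennreal (\<bar>\<omega> \<bullet> (v - u)\<bar> * (gs u)\<^sup>2) \<partial>sphere_measure)"
      proof (cases "u \<in> ball (- 2 *\<^sub>R e) (1 / 2)")
        case True
        define y where "y = u + 2 *\<^sub>R e"
        have y: "norm y < 1 / 2" using True by (simp add: y_def dist_norm norm_minus_commute add.commute)
        have u: "u = y - 2 *\<^sub>R e" by (simp add: y_def)
        have "norm u \<le> 3" using norm_triangle_ineq4[of y "2 *\<^sub>R e"] y e by (simp add: u)
        then have "(norm u)\<^sup>2 \<le> 3\<^sup>2" by (intro power_mono) auto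
        then have gsu: "exp (- 9) \<le> (gs u)\<^sup>2" by (simp add: gs_def sq_exp)
        have "norm v + 2 = norm ((norm v + 2) *\<^sub>R e)" using e(1) by simp
        also have "(norm v + 2) *\<^sub>R e = norm v *\<^sub>R e + 2 *\<^sub>R e"
          by (rule scaleR_add_left)
        also have "norm v *\<^sub>R e + 2 *\<^sub>R e = (v - u) + y" using e(2) by (simp add: u)
        also have "norm ((v - u) + y) \<le> norm (v - u) + norm y" by (rule norm_triangle_ineq)
        finally have vu: "1 + norm v \<le> norm (v - u)" using y by simp
        have "ennreal (c0 * (1 + norm v) * exp (- 9)) \<le> ennreal (c0 * norm (v - u) * (gs u)\<^sup>2)"
          using vu gsu c0 by (intro ennreal_leI mult_mono) auto
        also have "\<dots> = ennreal (c0 * norm (v - u)) * ennreal ((gs u)\<^sup>2)"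
          using c0 by (simp add: ennreal_mult)
        also have "\<dots> \<le> (\<integral>\<^sup>+\<omega>. ennreal \<bar>\<omega> \<bullet> (v - u)\<bar> \<partial>sphere_measure) * ennreal ((gs u)\<^sup>2)"
          by (intro mult_right_mono c0) auto
        also have "\<dots> = (\<integral>\<^sup>+\<omega>. ennreal (\<bar>\<omega> \<bullet> (v - u)\<bar> * (gs u)\<^sup>2) \<partial>sphere_measure)"
          by (subst nn_integral_multc[symmetric]) (auto simp: ennreal_mult)
        finally show ?thesis using True by simp
      qed simp
    qed
    finally show ?thesis .
  qed
  then show thesis using that[of ?c] c0 V by simp
qed

text \<open>Finiteness guarantees that the Bochner integral \<open>nu\<close> is a genuine integral
  and not the default value 0, for which a lower bound would fail.\<close>

lemma collision_frequency_finite: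
  "(\<integral>\<^sup>+u. (\<integral>\<^sup>+\<omega>. ennreal (\<bar>\<omega> \<bullet> (v - u)\<bar> * (gs u)\<^sup>2) \<partial>sphere_measure) \<partial>lborel) < \<infinity>"
proof -
  obtain G where G: "G \<ge> 0" "(\<integral>\<^sup>+(x::vec3). ennreal (exp (- (1 / 16) * (norm x)\<^sup>2)) \<partial>lborel) = ennreal G"
    by (rule nn_integral_gaussian_finite[of "1 / 16"]) (simp, rule that)
  have "(\<integral>\<^sup>+u. (\<integral>\<^sup>+\<omega>. ennreal (\<bar>\<omega> \<bullet> (v - u)\<bar> * (gs u)\<^sup>2) \<partial>sphere_measure) \<partial>lborel)
    \<le> (\<integral>\<^sup>+(u::vec3). (\<integral>\<^sup>+(\<omega>::vec3). ennreal (exp 1 * (1 + norm v)) * ennreal (gb (norm u)) \<partial>sphere_measure) \<partial>lborel)"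
  proof (rule nn_integral_mono, rule nn_integral_sphere_measure_mono)
    fix u \<omega> :: vec3 assume \<omega>: "norm \<omega> = 1"
    have "\<bar>\<omega> \<bullet> (v - u)\<bar> * (gs u)\<^sup>2 \<le> \<bar>\<omega> \<bullet> (v - u)\<bar> * gs u"
      by (intro mult_left_mono) (auto simp: power2_eq_square mult_left_le)
    also have "\<dots> \<le> exp 1 * (1 + norm v) * gb (norm u)"
      using kernel_gauss[OF \<omega>, of v u] by (simp add: mult.assoc)
    finally show "ennreal (\<bar>\<omega> \<bullet> (v - u)\<bar> * (gs u)\<^sup>2) \<le> ennreal (exp 1 * (1 + norm v)) * ennreal (gb (norm u))"
      by (simp add: ennreal_mult[symmetric] ennreal_leI)
  qed
  also have "\<dots> = (\<integral>\<^sup>+(u::vec3). ennreal (exp 1 * (1 + norm v) * (4 * pi)) * ennreal (gb (norm u)) \<partial>lborel)"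
    by (simp add: emeasure_sphere_measure_UNIV ennreal_mult mult_ac)
  also have "\<dots> = ennreal (exp 1 * (1 + norm v) * (4 * pi)) * ennreal G"
    unfolding G(2)[symmetric] gb_def by (rule nn_integral_cmult) measurable
  also have "\<dots> < \<infinity>" by (simp add: ennreal_mult_less_top)
  finally show ?thesis .
qed

context equilibrium_bounds
begin

definition nu_integrand :: "vec3 \<Rightarrow> vec3 \<times> vec3 \<Rightarrow> real" where
  "nu_integrand v = (\<lambda>(u, \<omega>).
     \<bar>\<omega> \<bullet> (v - u)\<bar> * mu \<theta> \<rho> u * mu \<theta> \<rho> v
       * mu \<theta> \<rho> (post_u u v \<omega>) * mu \<theta> \<rho> (post_v u v \<omega>)
       * \<rho>\<^sup>2 * exp ((norm u)\<^sup>2 + (norm v)\<^sup>2) * inverse (MM \<theta> \<rho> v))"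

text \<open>Put a = \<open>gs\<close> squared. By energy conservation the four factors
  \<open>mu\<close> are comparable to (a u)^2 (a v)^2, the exponential is 1 / (a u a v) and the
  inverse of \<open>MM\<close> is comparable to 1 / a v; what remains is a u. Four constants K and
  one K^2 make K^6.\<close>

lemma nu_integrand_bounds:
  assumes \<omega>: "norm \<omega> = 1"
  shows "\<rho>\<^sup>2 / K ^ 6 * (\<bar>\<omega> \<bullet> (v - u)\<bar> * (gs u)\<^sup>2) \<le> nu_integrand v (u, \<omega>)"
    and "nu_integrand v (u, \<omega>) \<le> \<rho>\<^sup>2 * K ^ 6 * (\<bar>\<omega> \<bullet> (v - u)\<bar> * (gs u)\<^sup>2)"
proof -
  let ?w = "\<bar>\<omega> \<bullet> (v - u)\<bar>" and ?m = "mu \<theta> \<rho>"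
  have K: "K > 0" using K_ge by simp
  define a where "a x = (gs x)\<^sup>2" for x
  have a: "a x > 0" for x unfolding a_def by (intro zero_less_power gs_pos)
  have m: "?m x \<le> K * a x" "a x / K \<le> ?m x" for x
    using mu_le[of x] mu_ge[of x] K by (auto simp: a_def field_simps)
  have M: "inverse (MM \<theta> \<rho> v) \<le> K\<^sup>2 / a v" "1 / (K\<^sup>2 * a v) \<le> inverse (MM \<theta> \<rho> v)"
    using MM_le[of v] MM_ge[of v] MM_pos[of v] K a[of v] by (auto simp: a_def field_simps)
  have X: "exp ((norm u)\<^sup>2 + (norm v)\<^sup>2) = 1 / (a u * a v)"
    by (simp add: a_def gs_def sq_exp exp_add exp_minus field_simps)
  have e: "a (post_u u v \<omega>) * a (post_v u v \<omega>) = a u * a v"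
    using gs_energy[OF \<omega>, of u v] by (simp add: a_def power_mult_distrib[symmetric])
  have J: "nu_integrand v (u, \<omega>) = (?w * \<rho>\<^sup>2 / (a u * a v)) * ((?m u * ?m v) * (?m (post_u u v \<omega>) * ?m (post_v u v \<omega>)) * inverse (MM \<theta> \<rho> v))"
    unfolding nu_integrand_def split X by (simp add: mult_ac)
  have pos: "0 \<le> ?w * \<rho>\<^sup>2 / (a u * a v)" using a[of u] a[of v] by simp
  have "nu_integrand v (u, \<omega>) \<le> (?w * \<rho>\<^sup>2 / (a u * a v)) *
      (((K * a u) * (K * a v)) * ((K * a (post_u u v \<omega>)) * (K * a (post_v u v \<omega>))) * (K\<^sup>2 / a v))"
    unfolding J using K a MM_pos[of v] by (intro mult_left_mono mult_mono m M pos) (auto intro!: less_imp_le[OF mu_pos] less_imp_le[OF a] mult_nonneg_nonneg)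
  also have "\<dots> = (?w * \<rho>\<^sup>2 / (a u * a v)) * (K ^ 6 * (a u * a v) * (a (post_u u v \<omega>) * a (post_v u v \<omega>)) / a v)"
    by (simp add: eval_nat_numeral mult_ac)
  also have "\<dots> = \<rho>\<^sup>2 * K ^ 6 * (?w * a u)"
    unfolding e using less_imp_neq[OF a[of u]] less_imp_neq[OF a[of v]] by (simp add: field_simps)
  finally show "nu_integrand v (u, \<omega>) \<le> \<rho>\<^sup>2 * K ^ 6 * (?w * (gs u)\<^sup>2)" by (simp add: a_def)
  have "\<rho>\<^sup>2 / K ^ 6 * (?w * a u) = (?w * \<rho>\<^sup>2 / (a u * a v)) * ((a u * a v) * (a u * a v) / a v / K ^ 6)"
    using less_imp_neq[OF a[of u]] less_imp_neq[OF a[of v]] by (simp add: field_simps)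
  also have "\<dots> = (?w * \<rho>\<^sup>2 / (a u * a v)) * ((a u * a v) * (a (post_u u v \<omega>) * a (post_v u v \<omega>)) / a v / K ^ 6)"
    unfolding e ..
  also have "\<dots> = (?w * \<rho>\<^sup>2 / (a u * a v)) *
      (((a u / K) * (a v / K)) * ((a (post_u u v \<omega>) / K) * (a (post_v u v \<omega>) / K)) * (1 / (K\<^sup>2 * a v)))"
    by (simp add: eval_nat_numeral mult_ac)
  also have "\<dots> \<le> nu_integrand v (u, \<omega>)"
    unfolding J using K a MM_pos[of v] by (intro mult_left_mono mult_mono m M pos) (auto intro!: less_imp_le[OF mu_pos] less_imp_le[OF a] mult_nonneg_nonneg divide_nonneg_nonneg)
  finally show "\<rho>\<^sup>2 / K ^ 6 * (?w * (gs u)\<^sup>2) \<le> nu_integrand v (u, \<omega>)" by (simp add: a_def)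
qed

lemma measurable_nu_integrand:
  "(\<lambda>(v, x). nu_integrand v x) \<in> borel_measurable (borel \<Otimes>\<^sub>M (lborel \<Otimes>\<^sub>M sphere_measure))"
  unfolding nu_integrand_def by measurable

lemma nu_eq: "nu \<theta> \<rho> v = (\<integral>x. nu_integrand v x \<partial>(lborel \<Otimes>\<^sub>M sphere_measure))"
  by (simp add: nu_def nu_integrand_def)

lemma measurable_nu [measurable]: "nu \<theta> \<rho> \<in> borel_measurable borel"
  unfolding nu_eq[abs_def] by (rule measurable_lborel_sphere_integral[OF measurable_nu_integrand])

text \<open>Nonnegativity almost everywhere and finiteness identify \<open>nu\<close> with the
  iterated integral in [0, \<infinity>], to which the linear lower bound applies.\<close>

lemma nu_weight: obtains A where "velocity_weight (nu \<theta> \<rho>) A"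
proof -
  obtain c where c: "c > 0"
    "\<And>v. ennreal (c * (1 + norm v)) \<le> (\<integral>\<^sup>+u. (\<integral>\<^sup>+\<omega>. ennreal (\<bar>\<omega> \<bullet> (v - u)\<bar> * (gs u)\<^sup>2) \<partial>sphere_measure) \<partial>lborel)"
    using collision_frequency_ge by blast
  have K: "K > 0" using K_ge by simp
  let ?k = "\<rho>\<^sup>2 / K ^ 6"
  have k: "?k > 0" using K rho_pos by simp
  have ge: "?k * (c * (1 + norm v)) \<le> nu \<theta> \<rho> v" for v
  proof -
    let ?P = "lborel \<Otimes>\<^sub>M sphere_measure :: (vec3 \<times> vec3) measure"
    have [measurable]: "nu_integrand v \<in> borel_measurable ?P"
      unfolding nu_integrand_def by measurable
    have unit: "AE x in ?P. norm (snd x) = 1"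
    proof -
      interpret pair_sigma_finite "lborel :: vec3 measure" sphere_measure ..
      have "{x \<in> space ?P. norm (snd x) = 1} \<in> sets ?P" by measurable
      moreover have "AE u in (lborel :: vec3 measure). AE \<omega> in sphere_measure. norm (snd (u, \<omega>)) = 1"
        using AE_sphere_measure_norm by simp
      ultimately show ?thesis by (rule AE_pair_measure)
    qed
    have nonneg: "AE x in ?P. 0 \<le> nu_integrand v x"
      using unit
    proof eventually_elim
      fix x :: "vec3 \<times> vec3" assume "norm (snd x) = 1"
      from nu_integrand_bounds(1)[OF this, of v "fst x"] K rho_pos
      show "0 \<le> nu_integrand v x"
        by (intro order_trans[OF _ nu_integrand_bounds(1)[OF \<open>norm (snd x) = 1\<close>, of v "fst x", simplified]]) auto
    qed
    have int: "(\<integral>\<^sup>+x. ennreal (nu_integrand v x) \<partial>?P) = (\<integral>\<^sup>+u. (\<integral>\<^sup>+\<omega>. ennreal (nu_integrand v (u, \<omega>)) \<partial>sphere_measure) \<partial>lborel)"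
      by (rule nn_integral_lborel_sphere) measurable
    also have "\<dots> \<le> (\<integral>\<^sup>+u. (\<integral>\<^sup>+\<omega>. ennreal (\<rho>\<^sup>2 * K ^ 6) * ennreal (\<bar>\<omega> \<bullet> (v - u)\<bar> * (gs u)\<^sup>2) \<partial>sphere_measure) \<partial>lborel)"
      using nu_integrand_bounds(2)[of _ v] K
      by (intro nn_integral_mono nn_integral_sphere_measure_mono) (auto simp: ennreal_mult[symmetric] intro!: ennreal_leI)
    also have "\<dots> = ennreal (\<rho>\<^sup>2 * K ^ 6) * (\<integral>\<^sup>+u. (\<integral>\<^sup>+\<omega>. ennreal (\<bar>\<omega> \<bullet> (v - u)\<bar> * (gs u)\<^sup>2) \<partial>sphere_measure) \<partial>lborel)"
      by (simp add: nn_integral_cmult)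
    also have "\<dots> < \<infinity>"
      using collision_frequency_finite by (simp add: ennreal_mult_less_top)
    finally have fin: "(\<integral>\<^sup>+x. ennreal (nu_integrand v x) \<partial>?P) < \<infinity>" .
    have integrable: "integrable ?P (nu_integrand v)"
      by (rule integrableI_nonneg[OF _ nonneg fin]) measurable
    have "ennreal (?k * (c * (1 + norm v))) = ennreal ?k * ennreal (c * (1 + norm v))"
      by (rule ennreal_mult) (use k c in auto)
    also have "\<dots> \<le> ennreal ?k * (\<integral>\<^sup>+u. (\<integral>\<^sup>+\<omega>. ennreal (\<bar>\<omega> \<bullet> (v - u)\<bar> * (gs u)\<^sup>2) \<partial>sphere_measure) \<partial>lborel)"
      by (intro mult_left_mono c) auto
    also have "\<dots> = (\<integral>\<^sup>+u. (\<integral>\<^sup>+\<omega>. ennreal ?k * ennreal (\<bar>\<omega> \<bullet> (v - u)\<bar> * (gs u)\<^sup>2) \<partial>sphere_measure) \<partial>lborel)"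
      by (simp add: nn_integral_cmult)
    also have "\<dots> \<le> (\<integral>\<^sup>+u. (\<integral>\<^sup>+\<omega>. ennreal (nu_integrand v (u, \<omega>)) \<partial>sphere_measure) \<partial>lborel)"
      using nu_integrand_bounds(1)[of _ v] K
      by (intro nn_integral_mono nn_integral_sphere_measure_mono) (auto simp: ennreal_mult[symmetric] intro!: ennreal_leI)
    also have "\<dots> = ennreal (nu \<theta> \<rho> v)"
      unfolding int[symmetric] nu_eq by (rule nn_integral_eq_integral[OF integrable nonneg])
    finally show ?thesis
      using integral_nonneg_AE[OF nonneg] by (simp add: nu_eq)
  qed
  have "velocity_weight (nu \<theta> \<rho>) (1 / (?k * c))"
  proof
    show "1 / (?k * c) > 0" by (intro divide_pos_pos mult_pos_pos k c(1)) simp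
    fix v :: vec3
    have "1 + norm v = 1 / (?k * c) * (?k * (c * (1 + norm v)))" using k c rho_pos K by simp
    also have "\<dots> \<le> 1 / (?k * c) * nu \<theta> \<rho> v"
      using k c by (intro mult_left_mono ge) auto
    finally show "1 + norm v \<le> 1 / (?k * c) * nu \<theta> \<rho> v" .
  qed measurable
  then show thesis by (rule that)
qed

text \<open>The second conclusion does not presuppose convergence: if its right-hand side is
  infinite it is trivial, and otherwise the integrand is integrable and its integral is bounded by
  that of its absolute value.\<close>

lemma collision_integral_controlled:
  fixes I :: "vec3 \<times> vec3 \<Rightarrow> real"
  assumes [measurable]: "I \<in> borel_measurable (lborel \<Otimes>\<^sub>M sphere_measure)"
      "(\<lambda>(u, \<omega>). k u \<omega>) \<in> borel_measurable (borel \<Otimes>\<^sub>M borel)"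
    and I: "\<And>u \<omega>. norm \<omega> = 1 \<Longrightarrow> ennreal (\<bar>I (u, \<omega>)\<bar> / sM v) \<le> ennreal c * k u \<omega>"
  defines "S \<equiv> \<integral>\<^sup>+u. (\<integral>\<^sup>+\<omega>. k u \<omega> \<partial>sphere_measure) \<partial>lborel"
  shows "S < \<infinity> \<Longrightarrow> integrable (lborel \<Otimes>\<^sub>M sphere_measure) I"
    and "ennreal \<bar>1 / sM v * (1 / 2 * integral\<^sup>L (lborel \<Otimes>\<^sub>M sphere_measure) I)\<bar> \<le> ennreal c * S"
proof -
  let ?P = "lborel \<Otimes>\<^sub>M sphere_measure :: (vec3 \<times> vec3) measure"
  have pos: "sM v > 0" by (rule sM_bounds)
  have "(\<integral>\<^sup>+x. ennreal (\<bar>I x\<bar> / sM v) \<partial>?P) = (\<integral>\<^sup>+u. (\<integral>\<^sup>+\<omega>. ennreal (\<bar>I (u, \<omega>)\<bar> / sM v) \<partial>sphere_measure) \<partial>lborel)"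
    by (rule nn_integral_lborel_sphere) measurable
  also have "\<dots> \<le> (\<integral>\<^sup>+u. (\<integral>\<^sup>+\<omega>. ennreal c * k u \<omega> \<partial>sphere_measure) \<partial>lborel)"
    by (intro nn_integral_mono nn_integral_sphere_measure_mono I)
  also have "\<dots> = ennreal c * S"
    unfolding S_def by (simp add: nn_integral_cmult)
  finally have le: "(\<integral>\<^sup>+x. ennreal (\<bar>I x\<bar> / sM v) \<partial>?P) \<le> ennreal c * S" .
  have I_eq: "(\<integral>\<^sup>+x. ennreal \<bar>I x\<bar> \<partial>?P) = ennreal (sM v) * (\<integral>\<^sup>+x. ennreal (\<bar>I x\<bar> / sM v) \<partial>?P)"
    using pos by (subst nn_integral_cmult[symmetric]) (auto simp: ennreal_mult[symmetric] intro!: nn_integral_cong)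
  have fin: "integrable ?P I" if "ennreal c * S < \<infinity>"
  proof (rule integrableI_bounded)
    have "(\<integral>\<^sup>+x. ennreal \<bar>I x\<bar> \<partial>?P) \<le> ennreal (sM v) * (ennreal c * S)"
      unfolding I_eq by (intro mult_left_mono le) auto
    also have "\<dots> < \<infinity>" using that by (simp add: ennreal_mult_less_top)
    finally show "(\<integral>\<^sup>+x. ennreal (norm (I x)) \<partial>?P) < \<infinity>" by simp
  qed measurable
  show "integrable ?P I" if "S < \<infinity>"
    using that by (intro fin) (simp add: ennreal_mult_less_top)
  show "ennreal \<bar>1 / sM v * (1 / 2 * integral\<^sup>L ?P I)\<bar> \<le> ennreal c * S"
  \<comment> \<open>The case distinction is on the product, since c may be nonpositive while S is
    infinite; the product is then 0 and the integrand is still integrable.\<close>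
  proof (cases "ennreal c * S < \<infinity>")
    case True
    have "ennreal \<bar>integral\<^sup>L ?P I\<bar> \<le> (\<integral>\<^sup>+x. ennreal \<bar>I x\<bar> \<partial>?P)"
      using integral_norm_bound_ennreal[OF fin[OF True]] by simp
    also have "\<dots> \<le> ennreal (sM v) * (ennreal c * S)"
      unfolding I_eq by (intro mult_left_mono le) auto
    finally have "ennreal (1 / sM v) * ennreal \<bar>integral\<^sup>L ?P I\<bar> \<le> ennreal (1 / sM v) * (ennreal (sM v) * (ennreal c * S))"
      by (rule mult_left_mono) simp
    also have "\<dots> = ennreal c * S"
      using pos by (simp add: mult.assoc[symmetric] ennreal_mult[symmetric])
    finally have *: "ennreal (1 / sM v) * ennreal \<bar>integral\<^sup>L ?P I\<bar> \<le> ennreal c * S" .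
    have "\<bar>1 / sM v * (1 / 2 * integral\<^sup>L ?P I)\<bar> = 1 / sM v * (1 / 2 * \<bar>integral\<^sup>L ?P I\<bar>)"
      using pos by (simp add: abs_mult)
    also have "\<dots> \<le> 1 / sM v * \<bar>integral\<^sup>L ?P I\<bar>"
      using pos by (intro mult_left_mono) auto
    finally have "ennreal \<bar>1 / sM v * (1 / 2 * integral\<^sup>L ?P I)\<bar> \<le> ennreal (1 / sM v * \<bar>integral\<^sup>L ?P I\<bar>)"
      by (rule ennreal_leI)
    also have "\<dots> = ennreal (1 / sM v) * ennreal \<bar>integral\<^sup>L ?P I\<bar>"
      using pos by (intro ennreal_mult) auto
    finally show ?thesis using * by (rule order_trans)
  qed (simp add: less_top[symmetric])
qed

end

section \<open>The nonlinear operator\<close>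

abbreviation eabs :: "(vec3 \<Rightarrow> real) \<Rightarrow> vfun" where
  "eabs f \<equiv> \<lambda>v. ennreal \<bar>f v\<bar>"

definition Kint :: "(vec3 \<Rightarrow> real) \<Rightarrow> (vec3 \<Rightarrow> real) \<Rightarrow> (vec3 \<Rightarrow> real) \<Rightarrow> vfun" where
  "Kint f1 f2 f3 v = (\<integral>\<^sup>+u. (\<integral>\<^sup>+\<omega>. Ktot (eabs f1) (eabs f2) (eabs f3) u v \<omega> \<partial>sphere_measure) \<partial>lborel)"

lemma coll_meas_Ktot:
  assumes [measurable]: "meas p" "meas q" "meas r"
  shows "coll_meas (Ktot p q r)"
  unfolding Ktot_def KB_def KM_def KT1_def KT2_def KT3_def by measurable

lemma measurable_Kint [measurable]:
  assumes [measurable]: "meas f1" "meas f2" "meas f3"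
  shows "Kint f1 f2 f3 \<in> borel_measurable borel"
proof -
  have [measurable]: "coll_meas (Ktot (eabs f1) (eabs f2) (eabs f3))"
    by (rule coll_meas_Ktot) measurable
  show ?thesis unfolding Kint_def[abs_def] by measurable
qed

lemma collI_Ktot_eq:
  assumes [measurable]: "meas f1" "meas f2" "meas f3" "meas g"
  shows "collI (\<lambda>u v \<omega>. Ktot (eabs f1) (eabs f2) (eabs f3) u v \<omega> * g v) = (\<integral>\<^sup>+v. Kint f1 f2 f3 v * g v \<partial>lborel)"
proof -
  have [measurable]: "coll_meas (Ktot (eabs f1) (eabs f2) (eabs f3))"
    by (rule coll_meas_Ktot) measurable
  show ?thesis
    unfolding collI_def Kint_def by (simp add: nn_integral_multc)
qed

context equilibrium_bounds
begin

text \<open>Each of the five collision integrals is at most 2 K^4 times \<open>Kint\<close>. The 2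
  stems from \<open>KT_gs_right\<close> and is used uniformly, and K \<ge> 1 makes K^3 small enough
  for the quadratic operator. Five such terms make 10 K^4.\<close>

lemma collision_operators_controlled:
  assumes [measurable]: "meas f1" "meas f2" "meas f3"
  shows "Kint f1 f2 f3 v < \<infinity> \<Longrightarrow> coll_Gamma_converges \<theta> \<rho> f1 f2 f3 v"
    and "ennreal \<bar>coll_Gamma \<theta> \<rho> f1 f2 f3 v\<bar> \<le> ennreal (10 * K ^ 4) * Kint f1 f2 f3 v"
proof -
  let ?F = "sqrtM_times \<theta> \<rho>" and ?m = "mu \<theta> \<rho>"
  let ?k = "\<lambda>u \<omega>. Ktot (eabs f1) (eabs f2) (eabs f3) u v \<omega>"
  have [measurable]: "coll_meas (Ktot (eabs f1) (eabs f2) (eabs f3))"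
    by (rule coll_meas_Ktot) measurable
  have K34: "K ^ 3 \<le> 2 * K ^ 4" "K ^ 4 \<le> 2 * K ^ 4"
    using power_increasing[of 3 4 K] K_ge zero_le_power[of K 4] by linarith+
  have le: "ennreal C * x \<le> ennreal (2 * K ^ 4) * y" if "C \<le> 2 * K ^ 4" "x \<le> y" for C x y
    using that by (intro mult_mono ennreal_leI) auto
  have Q1: "ennreal (\<bar>Q1_integrand (?F f1) (?F f2) v (u, \<omega>)\<bar> / sM v) \<le> ennreal (2 * K ^ 4) * ?k u \<omega>"
    if "norm \<omega> = 1" for u \<omega>
    by (rule order_trans[OF Q1_pointwise[OF dominated_sqrtM_times dominated_sqrtM_times that] le[OF K34(1) K_le_Ktot(1)]])
  have Q2: "ennreal (\<bar>Q2_integrand F G H v (u, \<omega>)\<bar> / sM v) \<le> ennreal (2 * K ^ 4) * ?k u \<omega>"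
    if "dominated F f" "dominated G g" "dominated H h" "norm \<omega> = 1"
      and k: "KT (\<lambda>x. ennreal (f x)) (\<lambda>x. ennreal (g x)) (\<lambda>x. ennreal (h x)) u v \<omega> \<le> 2 * ?k u \<omega>" for F G H f g h u \<omega>
  proof -
    have "ennreal (\<bar>Q2_integrand F G H v (u, \<omega>)\<bar> / sM v)
      \<le> ennreal (K ^ 4) * KT (\<lambda>x. ennreal (f x)) (\<lambda>x. ennreal (g x)) (\<lambda>x. ennreal (h x)) u v \<omega>"
      by (rule Q2_pointwise[OF that(1-4)])
    also have "\<dots> \<le> ennreal (K ^ 4) * (2 * ?k u \<omega>)"
      by (intro mult_left_mono k) auto
    also have "\<dots> = ennreal (2 * K ^ 4) * ?k u \<omega>"
      using K_ge by (simp add: ennreal_mult mult_ac)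
    finally show ?thesis .
  qed
  have double: "x \<le> 2 * y" if "x \<le> y" for x y :: ennreal
    using add_mono[OF that zero_le[of y]] by (simp add: mult_2)
  have dM: "dominated (?F f1) (\<lambda>x. \<bar>f1 x\<bar>)" "dominated (?F f2) (\<lambda>x. \<bar>f2 x\<bar>)" "dominated (?F f3) (\<lambda>x. \<bar>f3 x\<bar>)"
    by (rule dominated_sqrtM_times)+
  have Q2a: "ennreal (\<bar>Q2_integrand (?F f1) (?F f2) ?m v (u, \<omega>)\<bar> / sM v) \<le> ennreal (2 * K ^ 4) * ?k u \<omega>"
    if "norm \<omega> = 1" for u \<omega>
    by (rule Q2[OF dM(1,2) dominated_mu that], rule order_trans[OF KT_gs_right], rule mult_left_mono[OF K_le_Ktot(1)]) simp
  have Q2b: "ennreal (\<bar>Q2_integrand (?F f1) ?m (?F f3) v (u, \<omega>)\<bar> / sM v) \<le> ennreal (2 * K ^ 4) * ?k u \<omega>"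
    if "norm \<omega> = 1" for u \<omega>
    by (rule Q2[OF dM(1) dominated_mu dM(3) that], rule double, unfold KT_gs_middle, rule K_le_Ktot(2))
  have Q2c: "ennreal (\<bar>Q2_integrand ?m (?F f2) (?F f3) v (u, \<omega>)\<bar> / sM v) \<le> ennreal (2 * K ^ 4) * ?k u \<omega>"
    if "norm \<omega> = 1" for u \<omega>
    by (rule Q2[OF dominated_mu dM(2,3) that], rule double, subst KT_commute, unfold KT_gs_middle, rule K_le_Ktot(3))
  have Q2d: "ennreal (\<bar>Q2_integrand (?F f1) (?F f2) (?F f3) v (u, \<omega>)\<bar> / sM v) \<le> ennreal (2 * K ^ 4) * ?k u \<omega>"
    if "norm \<omega> = 1" for u \<omega>
    by (rule Q2[OF dM that], rule double, rule K_le_Ktot(4))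
  have km: "(\<lambda>(u, \<omega>). ?k u \<omega>) \<in> borel_measurable (borel \<Otimes>\<^sub>M borel)" by measurable
  have m: "?F f1 \<in> borel_measurable borel" "?F f2 \<in> borel_measurable borel" "?F f3 \<in> borel_measurable borel" "?m \<in> borel_measurable borel"
    by measurable
  note ctrl1 = collision_integral_controlled[OF measurable_Q_integrand_pair(1)[OF m(1,2,2)] km Q1, folded Kint_def]
  note ctrl2 = collision_integral_controlled[OF measurable_Q_integrand_pair(2)[OF m(1,2,4)] km Q2a, folded Kint_def]
  note ctrl3 = collision_integral_controlled[OF measurable_Q_integrand_pair(2)[OF m(1,4,3)] km Q2b, folded Kint_def]
  note ctrl4 = collision_integral_controlled[OF measurable_Q_integrand_pair(2)[OF m(4,2,3)] km Q2c, folded Kint_def]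
  note ctrl5 = collision_integral_controlled[OF measurable_Q_integrand_pair(2)[OF m(1,2,3)] km Q2d, folded Kint_def]
  show "coll_Gamma_converges \<theta> \<rho> f1 f2 f3 v" if "Kint f1 f2 f3 v < \<infinity>"
    unfolding coll_Gamma_converges_def Let_def
    by (intro conjI ctrl1(1) ctrl2(1) ctrl3(1) ctrl4(1) ctrl5(1) that)
  let ?w = "1 / sM v"
  let ?c = "ennreal (2 * K ^ 4) * Kint f1 f2 f3 v"
  have "\<bar>coll_Gamma \<theta> \<rho> f1 f2 f3 v\<bar> \<le> \<bar>?w * Q1 (?F f1) (?F f2) v\<bar> + \<bar>?w * Q2 (?F f1) (?F f2) ?m v\<bar>
      + \<bar>?w * Q2 (?F f1) ?m (?F f3) v\<bar> + \<bar>?w * Q2 ?m (?F f2) (?F f3) v\<bar> + \<bar>?w * Q2 (?F f1) (?F f2) (?F f3) v\<bar>"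
    unfolding coll_Gamma_def Let_def mult.assoc
    by ((rule order_trans[OF abs_triangle_ineq], rule add_mono)+) (simp_all add: abs_mult theta)
  then have "ennreal \<bar>coll_Gamma \<theta> \<rho> f1 f2 f3 v\<bar> \<le> ennreal \<bar>?w * Q1 (?F f1) (?F f2) v\<bar> + ennreal \<bar>?w * Q2 (?F f1) (?F f2) ?m v\<bar>
      + ennreal \<bar>?w * Q2 (?F f1) ?m (?F f3) v\<bar> + ennreal \<bar>?w * Q2 ?m (?F f2) (?F f3) v\<bar> + ennreal \<bar>?w * Q2 (?F f1) (?F f2) (?F f3) v\<bar>"
    by (simp add: ennreal_plus[symmetric] ennreal_leI del: ennreal_plus)
  also have "\<dots> \<le> ?c + ?c + ?c + ?c + ?c"
    unfolding Q1_def Q2_def by (intro add_mono ctrl1(2) ctrl2(2) ctrl3(2) ctrl4(2) ctrl5(2))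
  also have "\<dots> = 5 * ?c"
  proof -
    have "(5 :: ennreal) = 1 + 1 + 1 + 1 + 1" by simp
    then show ?thesis by (simp only: distrib_right mult_1)
  qed
  also have "\<dots> = ennreal (10 * K ^ 4) * Kint f1 f2 f3 v"
  proof -
    have "5 * ennreal (2 * K ^ 4) = ennreal (5 * (2 * K ^ 4))"
      using K_ge by (subst (2) ennreal_mult) simp_all
    then show ?thesis by (simp add: mult.assoc[symmetric])
  qed
  finally show "ennreal \<bar>coll_Gamma \<theta> \<rho> f1 f2 f3 v\<bar> \<le> ennreal (10 * K ^ 4) * Kint f1 f2 f3 v" .
qed

text \<open>In [0, \<infinity>] the product with \<open>eabs g v\<close> = 0 is 0 even if
  \<open>Kint\<close> is infinite, so convergence is obtained exactly on the set where g does not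
  vanish.\<close>

lemma AE_converges:
  assumes [measurable]: "meas f1" "meas f2" "meas f3"
    and fin: "AE v in lborel. Kint f1 f2 f3 v * eabs g v < \<infinity>"
  shows "AE v in lborel. g v \<noteq> 0 \<longrightarrow> coll_Gamma_converges \<theta> \<rho> f1 f2 f3 v"
  using fin
proof eventually_elim
  fix v assume "Kint f1 f2 f3 v * eabs g v < \<infinity>"
  then have "Kint f1 f2 f3 v < \<infinity>" if "g v \<noteq> 0"
    using that by (auto simp: ennreal_mult_less_top)
  then show "g v \<noteq> 0 \<longrightarrow> coll_Gamma_converges \<theta> \<rho> f1 f2 f3 v"
    using collision_operators_controlled(1)[of f1 f2 f3 v] by simp
qed

text \<open>If the dominating integral is finite, it yields both convergence almost everywhere where
  g is nonzero and integrability of the product, which rules out the value \<infinity> reserved for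
  divergence. If it is infinite, nothing is claimed; the constant 10 K^4 is positive, so the
  right-hand side stays infinite.\<close>

lemma abs_integral_Gamma_le:
  assumes [measurable]: "meas f1" "meas f2" "meas f3" "meas g"
  shows "abs_integral_Gamma \<theta> \<rho> f1 f2 f3 g
    \<le> ennreal (10 * K ^ 4) * collI (\<lambda>u v \<omega>. Ktot (eabs f1) (eabs f2) (eabs f3) u v \<omega> * eabs g v)"
proof -
  let ?c = "ennreal (10 * K ^ 4)" and ?S = "Kint f1 f2 f3" and ?G = "coll_Gamma \<theta> \<rho> f1 f2 f3"
  have c: "0 < 10 * K ^ 4" using K_ge by simp
  have eq: "collI (\<lambda>u v \<omega>. Ktot (eabs f1) (eabs f2) (eabs f3) u v \<omega> * eabs g v) = (\<integral>\<^sup>+v. ?S v * eabs g v \<partial>lborel)"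
    by (rule collI_Ktot_eq) measurable
  show ?thesis
  proof (cases "(\<integral>\<^sup>+v. ?S v * eabs g v \<partial>lborel) < \<infinity>")
    case True
    have AE: "AE v in lborel. ?S v * eabs g v < \<infinity>"
      using nn_integral_PInf_AE[of "\<lambda>v. ?S v * eabs g v" lborel] True by (auto simp: less_top)
    have "(\<integral>\<^sup>+v. ennreal \<bar>?G v * g v\<bar> \<partial>lborel) \<le> (\<integral>\<^sup>+v. ?c * (?S v * eabs g v) \<partial>lborel)"
    proof (rule nn_integral_mono)
      fix v
      have "ennreal \<bar>?G v * g v\<bar> = ennreal \<bar>?G v\<bar> * eabs g v" by (simp add: abs_mult ennreal_mult)
      also have "\<dots> \<le> (?c * ?S v) * eabs g v"
        by (intro mult_right_mono collision_operators_controlled) auto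
      finally show "ennreal \<bar>?G v * g v\<bar> \<le> ?c * (?S v * eabs g v)" by (simp add: mult.assoc)
    qed
    also have "\<dots> = ?c * (\<integral>\<^sup>+v. ?S v * eabs g v \<partial>lborel)" by (rule nn_integral_cmult) measurable
    finally have le: "(\<integral>\<^sup>+v. ennreal \<bar>?G v * g v\<bar> \<partial>lborel) \<le> ?c * (\<integral>\<^sup>+v. ?S v * eabs g v \<partial>lborel)" .
    also have "\<dots> < \<infinity>" using True by (simp add: ennreal_mult_less_top)
    finally have int: "integrable lborel (\<lambda>v. ?G v * g v)"
      by (intro integrableI_bounded) auto
    have "ennreal \<bar>\<integral>v. ?G v * g v \<partial>lborel\<bar> \<le> (\<integral>\<^sup>+v. ennreal \<bar>?G v * g v\<bar> \<partial>lborel)"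
      using integral_norm_bound_ennreal[OF int] by simp
    then show ?thesis
      unfolding abs_integral_Gamma_def eq using AE_converges[OF assms(1-3) AE] int le by (auto intro: order_trans)
  next
    case False
    then have "?c * (\<integral>\<^sup>+v. ?S v * eabs g v \<partial>lborel) = \<infinity>"
      using c by (simp add: less_top[symmetric] ennreal_mult_top)
    then show ?thesis unfolding eq by simp
  qed
qed

lemma L2norm_Gamma_le:
  assumes [measurable]: "meas f1" "meas f2" "meas f3" "meas g"
  shows "L2norm_Gamma \<theta> \<rho> f1 f2 f3 g \<le> ennreal (10 * K ^ 4) * enn_L2 (\<lambda>v. Kint f1 f2 f3 v * eabs g v)"
proof -
  let ?c = "ennreal (10 * K ^ 4)" and ?S = "Kint f1 f2 f3" and ?G = "coll_Gamma \<theta> \<rho> f1 f2 f3"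
  have c: "0 < 10 * K ^ 4" using K_ge by simp
  show ?thesis
  proof (cases "(\<integral>\<^sup>+v. (?S v * eabs g v)\<^sup>2 \<partial>lborel) < \<infinity>")
    case True
    have "AE v in lborel. (?S v * eabs g v)\<^sup>2 < \<infinity>"
      using nn_integral_PInf_AE[of "\<lambda>v. (?S v * eabs g v)\<^sup>2" lborel] True by (auto simp: less_top)
    then have AE: "AE v in lborel. ?S v * eabs g v < \<infinity>"
      by eventually_elim (auto simp: power2_eq_square ennreal_mult_less_top less_top[symmetric] ennreal_mult_eq_top_iff)
    have "L2norm (\<lambda>v. ?G v * g v) = enn_L2 (\<lambda>v. ennreal \<bar>?G v * g v\<bar>)"
      by (simp add: L2norm_def enn_L2_def ennreal_power)
    also have "\<dots> \<le> enn_L2 (\<lambda>v. ?c * (?S v * eabs g v))"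
    proof (rule enn_L2_mono)
      fix v
      have "ennreal \<bar>?G v * g v\<bar> = ennreal \<bar>?G v\<bar> * eabs g v" by (simp add: abs_mult ennreal_mult)
      also have "\<dots> \<le> (?c * ?S v) * eabs g v"
        by (intro mult_right_mono collision_operators_controlled) auto
      finally show "ennreal \<bar>?G v * g v\<bar> \<le> ?c * (?S v * eabs g v)" by (simp add: mult.assoc)
    qed
    also have "\<dots> = ?c * enn_L2 (\<lambda>v. ?S v * eabs g v)" by (rule enn_L2_cmult) measurable
    finally show ?thesis
      unfolding L2norm_Gamma_def using AE_converges[OF assms(1-3) AE] by simp
  next
    case False
    then have "enn_L2 (\<lambda>v. ?S v * eabs g v) = \<infinity>"
      by (simp add: enn_L2_def less_top[symmetric])
    then show ?thesis using c by (simp add: ennreal_mult_top)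
  qed
qed

end

lemma smooth_imp_measurable: "smooth f \<Longrightarrow> meas f"
proof -
  assume "smooth f"
  then have "Ck 0 f" unfolding smooth_def by blast
  then show ?thesis by (simp add: borel_measurable_continuous_onI)
qed

lemma measurable_eabs: "meas f \<Longrightarrow> eabs f \<in> borel_measurable borel"
  by measurable

lemma L2norm_eq: "L2norm f = enn_L2 (eabs f)"
  by (simp add: L2norm_def enn_L2_def ennreal_power)

lemma supnorm_eq: "supnorm f = esup (eabs f)"
  by (simp add: supnorm_def esup_def)

lemma sum_distinct_pairs:
  "(\<Sum>(a, b)\<in>distinct_pairs. h a b) = h 1 2 + h 1 3 + h 2 1 + h 2 3 + h 3 1 + (h 3 2 :: ennreal)"
proof -
  have eq: "distinct_pairs = {(1, 2), (1, 3), (2, 1), (2, 3), (3, 1), (3, 2)}"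
    by (auto simp: distinct_pairs_def)
  show ?thesis unfolding eq by (simp add: add_ac)
qed

section \<open>Translation of the norms and the dual estimate\<close>

context velocity_weight
begin

lemma supnorm_sqrt_weight: "supnorm (\<lambda>v. sqrt (\<beta> v) * f v) = esup (hmul (eabs f))"
  by (simp add: supnorm_def esup_def hmul_def abs_mult ennreal_mult)

lemma supnorm_weight: "supnorm (\<lambda>v. \<beta> v * g v) = esup (wmul (eabs g))"
  by (simp add: supnorm_def esup_def wmul_def abs_mult ennreal_mult)

lemma supnorm_weight_cubed: "supnorm (\<lambda>v. \<beta> v ^ 3 * g v) = esup (\<lambda>v. ennreal (\<beta> v ^ 3) * eabs g v)"
  by (simp add: supnorm_def esup_def abs_mult ennreal_mult)

lemma enn_L2_hmul: "wnorm (eabs f) = ennsqrt (\<integral>\<^sup>+v. ennreal (\<beta> v * \<bar>f v\<bar>\<^sup>2) \<partial>lborel)"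
  by (simp add: enn_L2_def hmul_def ennreal_mult[symmetric] ennreal_power power_mult_distrib)

text \<open>Testing \<open>Kint\<close> divided by \<beta> against h amounts to the third estimate
  with h / \<beta> in place of g, and the weight restores h. Duality then bounds the L2 norm of the
  quotient, and the factor \<beta> |g| is taken out by its supremum.\<close>

lemma Kint_L2_bound:
  obtains C where "C \<ge> 0"
    "\<And>f1 f2 f3 g. meas f1 \<Longrightarrow> meas f2 \<Longrightarrow> meas f3 \<Longrightarrow>
      meas g \<Longrightarrow>
      enn_L2 (\<lambda>v. Kint f1 f2 f3 v * eabs g v) \<le> ennreal C * (esup (wmul (eabs g)) * bound3 (eabs f1) (eabs f2) (eabs f3))"
proof -
  obtain C where C: "C \<ge> 0" "\<And>p q r g. meas p \<Longrightarrow> meas q \<Longrightarrow> meas r \<Longrightarrow>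
      meas g \<Longrightarrow> collI (\<lambda>u v \<omega>. Ktot p q r u v \<omega> * g v) \<le> ennreal C * (enn_L2 (wmul g) * bound3 p q r)"
    by (rule estimateE[OF estimate_Ktot_bound3]) (rule that)
  show thesis
  proof (rule that[OF C(1)])
    fix f1 f2 f3 g :: "vec3 \<Rightarrow> real"
    assume [measurable]: "meas f1" "meas f2" "meas f3" "meas g"
    let ?B = "ennreal C * bound3 (eabs f1) (eabs f2) (eabs f3)" and ?S = "Kint f1 f2 f3"
    let ?i = "\<lambda>v. ennreal (1 / \<beta> v)"
    have inv: "ennreal (\<beta> v) * ?i v = 1" for v
      using weight_pos[of v] by (simp add: ennreal_mult[symmetric])
    have "enn_L2 (\<lambda>v. ?S v * ?i v) \<le> ?B"
    proof (rule enn_L2_duality)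
      fix h :: vfun assume [measurable]: "meas h"
      have "(\<integral>\<^sup>+v. ?S v * ?i v * h v \<partial>lborel) = collI (\<lambda>u v \<omega>. Ktot (eabs f1) (eabs f2) (eabs f3) u v \<omega> * (?i v * h v))"
        by (subst collI_Ktot_eq) (measurable, simp add: mult.assoc)
      also have "\<dots> \<le> ennreal C * (enn_L2 (wmul (\<lambda>v. ?i v * h v)) * bound3 (eabs f1) (eabs f2) (eabs f3))"
        by (rule C) measurable
      also have "wmul (\<lambda>v. ?i v * h v) = h"
        using inv by (auto simp: wmul_def mult.assoc[symmetric])
      finally show "(\<integral>\<^sup>+v. ?S v * ?i v * h v \<partial>lborel) \<le> ?B * enn_L2 h"
        by (simp add: mult_ac)
    qed measurable
    moreover have "enn_L2 (\<lambda>v. ?S v * eabs g v) \<le> esup (wmul (eabs g)) * enn_L2 (\<lambda>v. ?S v * ?i v)"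
    proof -
      have "?S v * eabs g v = wmul (eabs g) v * (?S v * ?i v)" for v
      proof -
        have "wmul (eabs g) v * (?S v * ?i v) = (ennreal (\<beta> v) * ?i v) * (?S v * eabs g v)"
          unfolding wmul_def by (simp only: mult_ac)
        then show ?thesis by (simp add: inv)
      qed
      then show ?thesis
        using enn_L2_mult_le_esup[of "\<lambda>v. ?S v * ?i v" "wmul (eabs g)"] by simp
    qed
    ultimately have "enn_L2 (\<lambda>v. ?S v * eabs g v) \<le> esup (wmul (eabs g)) * ?B"
      by (meson mult_left_mono order_trans zero_le)
    then show "enn_L2 (\<lambda>v. ?S v * eabs g v) \<le> ennreal C * (esup (wmul (eabs g)) * bound3 (eabs f1) (eabs f2) (eabs f3))"
      by (simp add: mult_ac)
  qed
qed

end

theorem lemma3p15: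
  fixes \<theta> \<rho> :: real
  assumes "\<theta> \<in> {-1, 1}" and "\<rho> > 1"
  shows "\<exists>C::real. C > 0 \<and> (\<forall>(f :: nat \<Rightarrow> vec3 \<Rightarrow> real) (g :: vec3 \<Rightarrow> real).
    (\<forall>a\<in>{1, 2, 3}. smooth (f a)) \<and> smooth g \<longrightarrow>
    abs_integral_Gamma \<theta> \<rho> (f 1) (f 2) (f 3) g \<le> ennreal C *
      (L2norm g * L2norm (f 1) * L2norm (f 2) * L2norm (f 3)
       + Lnunorm \<theta> \<rho> g * (\<Sum>(a, b)\<in>distinct_pairs. L2norm (f a) * Lnunorm \<theta> \<rho> (f b))
       + Lnunorm \<theta> \<rho> g * min
           ((Lnunorm \<theta> \<rho> (f 1) * L2norm (f 2) + L2norm (f 1) * Lnunorm \<theta> \<rho> (f 2)) * supnorm (f 3))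
           (supnorm (f 1) * supnorm (f 2) * Lnunorm \<theta> \<rho> (f 3))
       + Lnunorm \<theta> \<rho> g * min
           ((Lnunorm \<theta> \<rho> (f 1) * L2norm (f 2) + L2norm (f 1) * Lnunorm \<theta> \<rho> (f 2)) * supnorm (f 3))
           ((supnorm (\<lambda>v. sqrt (nu \<theta> \<rho> v) * f 1 v) * L2norm (f 2)
             + L2norm (f 1) * supnorm (\<lambda>v. sqrt (nu \<theta> \<rho> v) * f 2 v)) * L2norm (f 3))
       + Lnunorm \<theta> \<rho> g * min
           (Lnunorm \<theta> \<rho> (f 1) * supnorm (f 3))
           (supnorm (\<lambda>v. sqrt (nu \<theta> \<rho> v) * f 1 v) * L2norm (f 3))
       + Lnunorm \<theta> \<rho> g * min
           (Lnunorm \<theta> \<rho> (f 2) * supnorm (f 3))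
           (supnorm (\<lambda>v. sqrt (nu \<theta> \<rho> v) * f 2 v) * L2norm (f 3)))
    \<and>
    abs_integral_Gamma \<theta> \<rho> (f 1) (f 2) (f 3) g \<le> ennreal C *
      (supnorm (\<lambda>v. nu \<theta> \<rho> v ^ 3 * g v) * (\<Sum>(a, b)\<in>distinct_pairs. L2norm (f a) * L2norm (f b))
       + (Lnunorm \<theta> \<rho> g + supnorm (\<lambda>v. nu \<theta> \<rho> v * g v))
           * L2norm (f 1) * L2norm (f 2) * L2norm (f 3))
    \<and>
    L2norm_Gamma \<theta> \<rho> (f 1) (f 2) (f 3) g \<le> ennreal C *
      (supnorm (\<lambda>v. nu \<theta> \<rho> v * g v) *
        (L2norm (f 1) * L2norm (f 2) * L2norm (f 3)
         + (\<Sum>(a, b)\<in>distinct_pairs. L2norm (f a) * L2norm (f b))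
         + min (supnorm (f 3) * L2norm (f 1) * L2norm (f 2))
               (supnorm (f 1) * supnorm (f 2) * L2norm (f 3))
         + min (supnorm (f 3) * L2norm (f 1) * L2norm (f 2))
               (supnorm (f 2) * L2norm (f 1) * L2norm (f 3))
         + min (supnorm (f 3) * L2norm (f 1) * L2norm (f 2))
               (supnorm (f 1) * L2norm (f 2) * L2norm (f 3)))))"
proof -
  obtain K where K: "equilibrium_bounds \<theta> \<rho> K"
    using equilibrium_bounds_exists[OF assms] .
  interpret equilibrium_bounds \<theta> \<rho> K by (rule K)
  obtain A where A: "velocity_weight (nu \<theta> \<rho>) A"
    by (rule nu_weight)
  interpret velocity_weight "nu \<theta> \<rho>" A by (rule A)
  obtain C1 where C1: "C1 \<ge> 0" "\<And>p q r g. meas p \<Longrightarrow> meas q \<Longrightarrow> meas r \<Longrightarrow>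
      meas g \<Longrightarrow> collI (\<lambda>u v \<omega>. Ktot p q r u v \<omega> * g v) \<le> ennreal C1 * bound1 p q r g"
    by (rule estimateE[OF estimate_Ktot_bound1]) (rule that)
  obtain C2 where C2: "C2 \<ge> 0" "\<And>p q r g. meas p \<Longrightarrow> meas q \<Longrightarrow> meas r \<Longrightarrow>
      meas g \<Longrightarrow> collI (\<lambda>u v \<omega>. Ktot p q r u v \<omega> * g v) \<le> ennreal C2 * bound2 p q r g"
    by (rule estimateE[OF estimate_Ktot_bound2]) (rule that)
  obtain C3 where C3: "C3 \<ge> 0" "\<And>f1 f2 f3 g. meas f1 \<Longrightarrow> meas f2 \<Longrightarrow> meas f3 \<Longrightarrow>
      meas g \<Longrightarrow>
      enn_L2 (\<lambda>v. Kint f1 f2 f3 v * eabs g v) \<le> ennreal C3 * (esup (wmul (eabs g)) * bound3 (eabs f1) (eabs f2) (eabs f3))"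
    by (rule Kint_L2_bound) (rule that)
  \<comment> \<open>The factor 10 K^4 is the constant of pointwise domination; the summand 1 keeps C
    positive if \<open>C1\<close>, \<open>C2\<close> and \<open>C3\<close> all vanish.\<close>
  define C where "C = 10 * K ^ 4 * (1 + C1 + C2 + C3)"
  have C_pos: "C > 0" using K_ge C1 C2 C3 by (auto simp: C_def intro!: mult_pos_pos)
  have C_ge: "x \<le> ennreal C * z" if "x \<le> ennreal (10 * K ^ 4) * y" "y \<le> ennreal c * z" "c \<in> {C1, C2, C3}" for x y z c
  proof -
    have c: "0 \<le> c" "c \<le> 1 + C1 + C2 + C3" using that(3) C1(1) C2(1) C3(1) by auto
    have "x \<le> ennreal (10 * K ^ 4) * (ennreal c * z)"
      using that(1) by (rule order_trans) (intro mult_left_mono that(2), simp)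
    also have "\<dots> = ennreal (10 * K ^ 4 * c) * z"
      using K_ge c by (simp add: ennreal_mult mult.assoc)
    also have "\<dots> \<le> ennreal C * z"
      unfolding C_def using K_ge c by (intro mult_right_mono ennreal_leI mult_left_mono) auto
    finally show ?thesis .
  qed
  have Lnu: "Lnunorm \<theta> \<rho> h = wnorm (eabs h)" for h
    unfolding Lnunorm_def enn_L2_hmul ..
  note norms = L2norm_eq supnorm_eq[of "f a" for f :: "nat \<Rightarrow> vec3 \<Rightarrow> real" and a] Lnu
    supnorm_sqrt_weight supnorm_weight supnorm_weight_cubed sum_distinct_pairs
  show ?thesis
  proof (intro exI[of _ C] conjI allI impI C_pos, goal_cases)
    case (1 f g)
    then have m [measurable]: "f 1 \<in> borel_measurable borel" "f 2 \<in> borel_measurable borel" "f 3 \<in> borel_measurable borel" "meas g"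
      by (auto intro: smooth_imp_measurable)
    let ?b = "bound1 (eabs (f 1)) (eabs (f 2)) (eabs (f 3)) (eabs g)"
    have "abs_integral_Gamma \<theta> \<rho> (f 1) (f 2) (f 3) g \<le> ennreal C * ?b"
      by (rule C_ge[OF abs_integral_Gamma_le[OF m] C1(2)[OF m[THEN measurable_eabs]]]) simp
    \<comment> \<open>The last two minima of (1) enter as nonnegative summands added to
      \<open>bound1\<close>.\<close>
    also have "\<dots> \<le> ennreal C * (?b + (Lnunorm \<theta> \<rho> g * min
           (Lnunorm \<theta> \<rho> (f 1) * supnorm (f 3))
           (supnorm (\<lambda>v. sqrt (nu \<theta> \<rho> v) * f 1 v) * L2norm (f 3))
       + Lnunorm \<theta> \<rho> g * min
           (Lnunorm \<theta> \<rho> (f 2) * supnorm (f 3))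
           (supnorm (\<lambda>v. sqrt (nu \<theta> \<rho> v) * f 2 v) * L2norm (f 3))))"
      by (intro mult_left_mono) auto
    finally show ?case
      unfolding bound1_def mixed_def norms by (simp only: add.assoc)
  next
    case (2 f g)
    then have m [measurable]: "f 1 \<in> borel_measurable borel" "f 2 \<in> borel_measurable borel" "f 3 \<in> borel_measurable borel" "meas g"
      by (auto intro: smooth_imp_measurable)
    have "abs_integral_Gamma \<theta> \<rho> (f 1) (f 2) (f 3) g \<le> ennreal C * bound2 (eabs (f 1)) (eabs (f 2)) (eabs (f 3)) (eabs g)"
      by (rule C_ge[OF abs_integral_Gamma_le[OF m] C2(2)[OF m[THEN measurable_eabs]]]) simp
    then show ?case
      unfolding bound2_def pairs_def norms .
  next
    case (3 f g)
    then have m [measurable]: "f 1 \<in> borel_measurable borel" "f 2 \<in> borel_measurable borel" "f 3 \<in> borel_measurable borel" "meas g"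
      by (auto intro: smooth_imp_measurable)
    have "L2norm_Gamma \<theta> \<rho> (f 1) (f 2) (f 3) g
      \<le> ennreal C * (esup (wmul (eabs g)) * bound3 (eabs (f 1)) (eabs (f 2)) (eabs (f 3)))"
      by (rule C_ge[OF L2norm_Gamma_le[OF m] C3(2)[OF m]]) simp
    then show ?case
      unfolding bound3_def pairs_def norms .
  qed
qed

end
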